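(* Let $m,n\ge2$, $m\ne n$, $l\ge1$, and let $t,c,\lambda,\beta\in\mathbb{C}$ with $c=\lambda$ and $\beta+t=\frac{(m-n)\lambda}{2}$. For a right $\mathbb{H}_{t,c}(S_l)$-module $M$, an action of the affine super Yangian $Y^{(0)}_{\lambda,\beta}(\widehat{\mathfrak{sl}}(m|n))$ on $M\otimes_{\mathbb{C}[S_l]}\mathbb{C}(m|n)^{\otimes l}$ is defined by the following formulas, for $1\le i\le m+n-1$: $$H_{i,0}(\mathbf{m}\otimes\mathbf{v})=\mathbf{m}\otimes((-1)^{|i|}E_{i,i}-(-1)^{|i+1|}E_{i+1,i+1})\mathbf{v},$$ $$X^+_{i,0}(\mathbf{m}\otimes\mathbf{v})=\mathbf{m}\otimes E_{i,i+1}\mathbf{v},\qquad X^-_{i,0}(\mathbf{m}\otimes\mathbf{v})=(-1)^{|i|}\mathbf{m}\otimes E_{i+1,i}\mathbf{v},$$ $$J(h_i)(\mathbf{m}\otimes\mathbf{v})=\sum_{k=1}^l\mathbf{m}\,\mathfrak{y}_k\otimes((-1)^{|i|}E^{(k)}_{i,i}-(-1)^{|i+1|}E^{(k)}_{i+1,i+1})\mathbf{v},$$ $$J(x_i^+)(\mathbf{m}\otimes\mathbf{v})=\sum_{k=1}^l\mathbf{m}\,\mathfrak{y}_k\otimes E^{(k)}_{i,i+1}\mathbf{v},\qquad J(x_i^-)(\mathbf{m}\otimes\mathbf{v})=(-1)^{|i|}\sum_{k=1}^l\mathbf{m}\,\mathfrak{y}_k\otimes E^{(k)}_{i+1,i}\mathbf{v},$$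 together with $$X^+_{0,0}(\mathbf{m}\otimes\mathbf{v})=\sum_{r=1}^l\mathbf{m}\,\mathsf{x}_r\otimes E^{(r)}_{m+n,1}\mathbf{v},\qquad X^-_{0,0}(\mathbf{m}\otimes\mathbf{v})=-\sum_{r=1}^l\mathbf{m}\,\mathsf{x}_r^{-1}\otimes E^{(r)}_{1,m+n}\mathbf{v}.$$
   Context: Parity: $|i|=0$ for $1\le i\le m$, $|i|=1$ for $m+1\le i\le m+n$, and $|0|:=|m+n|=1$; indices of generators are taken modulo $m+n$. $\mathbb{C}(m|n)=\bigoplus_{i=1}^{m+n}\mathbb{C}e_i$, $e_i$ of parity $|i|$; $E_{i,j}$ matrix units of parity $|i|+|j|$. $[\cdot,\cdot]$ is the supercommutator, $\{x,y\}=xy+yx$. On $\mathbb{C}(m|n)^{\otimes l}$: $E_{a,b}^{(k)}(v_1\otimes\cdots\otimes v_l)=(-1)^{(|a|+|b|)\sum_{j<k}|v_j|}v_1\otimes\cdots\otimes E_{a,b}v_k\otimes\cdots\otimes v_l$, $E_{a,b}$ acts by $\sum_kE^{(k)}_{a,b}$, and $S_l$ acts on the left by $\sigma_{i,i+1}(v_1\otimes\cdots\otimes v_l)=(-1)^{|v_i||v_{i+1}|}v_1\otimes\cdots\otimes v_{i+1}\otimes v_i\otimes\cdots\otimes v_l$. $\sigma_{i,j}$ is the transposition of $i,j$; $M$ is regarded as purely even. For $0\le i,j\le m+n-1$ let $a_{i,i}=(-1)^{|i|}+(-1)^{|i+1|}$, $a_{i,i+1}=-(-1)^{|i+1|}$,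 $a_{i,i-1}=-(-1)^{|i|}$, $a_{0,m+n-1}=a_{m+n-1,0}=-(-1)^{|m+n|}=1$, and $a_{i,j}=0$ otherwise. $Y^{(0)}_{\lambda,\beta}(\widehat{\mathfrak{sl}}(m|n))$ is the associative superalgebra generated by $X^\pm_{i,r},H_{i,r}$ ($0\le i\le m+n-1$, $r=0,1$), where $X^\pm_{0,r},X^\pm_{m,r}$ are odd and all other generators are even, with relations (where $\widetilde H_{i,1}=H_{i,1}-\frac\lambda2H_{i,0}^2$, and "generic" means $(i,j)\ne(0,m+n-1),(m+n-1,0)$): $[H_{i,r},H_{j,s}]=0$; $[X^+_{i,0},X^-_{j,0}]=\delta_{i,j}H_{i,0}$; $[X^+_{i,1},X^-_{j,0}]=\delta_{i,j}H_{i,1}=[X^+_{i,0},X^-_{j,1}]$; $[H_{i,0},X^\pm_{j,r}]=\pm a_{i,j}X^\pm_{j,r}$; $[\widetilde H_{i,1},X^\pm_{j,0}]=\pm a_{i,j}X^\pm_{j,1}$ for generic $(i,j)$; $[\widetilde H_{0,1},X^\pm_{m+n-1,0}]=\pm a_{0,m+n-1}(X^\pm_{m+n-1,1}-\beta X^\pm_{m+n-1,0})$; $[\widetilde H_{m+n-1,1},X^\pm_{0,0}]=\pm a_{m+n-1,0}(X^\pm_{0,1}+\beta X^\pm_{0,0})$; $[X^\pm_{i,1},X^\pm_{j,0}]-[X^\pm_{i,0},X^\pm_{j,1}]=\pm a_{i,j}\frac\lambda2\{X^\pm_{i,0},X^\pm_{j,0}\}$ for generic $(i,j)$; $[X^\pm_{0,1},X^\pm_{m+n-1,0}]-[X^\pm_{0,0},X^\pm_{m+n-1,1}]=\pm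 a_{0,m+n-1}\frac\lambda2\{X^\pm_{0,0},X^\pm_{m+n-1,0}\}-\beta[X^\pm_{0,0},X^\pm_{m+n-1,0}]$; $(\mathrm{ad}X^\pm_{i,0})^{1+|a_{i,j}|}(X^\pm_{j,0})=0$ for $i\ne j$ (absolute value of $a_{i,j}$); and for $i=0,m$: $[X^\pm_{i,0},X^\pm_{i,0}]=0$ and $[[X^\pm_{i-1,0},X^\pm_{i,0}],[X^\pm_{i,0},X^\pm_{i+1,0}]]=0$. Elements $E_{a,b}$ ($a\ne b$) of $\mathfrak{sl}_{m|n}$ are viewed in this algebra via $E_{i,i+1}\mapsto X^+_{i,0}$, $(-1)^{|i|}E_{i+1,i}\mapsto X^-_{i,0}$, $(-1)^{|i|}E_{i,i}-(-1)^{|i+1|}E_{i+1,i+1}\mapsto H_{i,0}$ ($1\le i\le m+n-1$). For $1\le i\le m+n-1$ put $i^{(0)}=\sum_{j=i+2}^{m+n}(-1)^{|j|}$ and $$\vartheta_i=-\tfrac{(i-1)^{(0)}}{2}H_{i,0}+\tfrac{(-1)^{|i|}}{2}\sum_{k\ne i}(-1)^{|k|}\mathrm{sign}(k-i)E_{i,k}E_{k,i}-\tfrac{(-1)^{|i+1|}}{2}\sum_{k\ne i+1}(-1)^{|k|}\mathrm{sign}(k-i-1)E_{i+1,k}E_{k,i+1},$$ $$\varpi_i^+=-\tfrac{i^{(0)}}{2}X^+_{i,0}+\tfrac12\sum_{k\ne i,i+1}(-1)^{|k|}\mathrm{sign}(k-i)E_{i,k}E_{k,i+1}-\tfrac12H_{i,0}X^+_{i,0},$$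 $$\varpi_i^-=-\tfrac{i^{(0)}}{2}X^-_{i,0}+\tfrac{(-1)^{|i|}}{2}\sum_{k\ne i,i+1}(-1)^{|k|}\mathrm{sign}(k-i)E_{i+1,k}E_{k,i}-\tfrac12X^-_{i,0}H_{i,0}$$ (sums over $1\le k\le m+n$), $J(h_i)=\widetilde H_{i,1}+\lambda\vartheta_i$, $J(x_i^\pm)=X^\pm_{i,1}+\lambda\varpi_i^\pm$. Prescribing the action of the elements in the claim prescribes that of all generators: $H_{i,1},X_{i,1}^\pm$ ($i\ge1$) are recovered from $J(h_i),J(x_i^\pm)$, and $H_{0,0}=[X^+_{0,0},X^-_{0,0}]$, $\pm a_{1,0}X^\pm_{0,1}=[\widetilde H_{1,1},X^\pm_{0,0}]$, $H_{0,1}=[X^+_{0,1},X^-_{0,0}]$. For $t,c\in\mathbb{C}$, the rational Cherednik algebra $\mathsf{H}_{t,c}(S_l)$ is generated by $\mathbb{C}[S_l]$, commuting $\mathsf{x}_1,\dots,\mathsf{x}_l$ and commuting $\mathsf{y}_1,\dots,\mathsf{y}_l$ with $\sigma\mathsf{x}_i\sigma^{-1}=\mathsf{x}_{\sigma(i)}$, $\sigma\mathsf{y}_i\sigma^{-1}=\mathsf{y}_{\sigma(i)}$, $[\mathsf{y}_j,\mathsf{x}_i]=-c\sigma_{i,j}$ for $i\ne j$, $[\mathsf{y}_i,\mathsf{x}_i]=t+c\sum_{k\ne i}\sigma_{k,i}$. The degenerate double affine Hecke algebra $\mathbb{H}_{t,c}(S_l)$ is its localization at $\mathsf{x}_1\cdots\mathsf{x}_l$.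 Put $\mathcal{U}_i=\frac t2+\mathsf{x}_i\mathsf{y}_i+c\sum_{j<i}\sigma_{i,j}$ and $\mathfrak{y}_i=\mathcal{U}_i+\frac c2\sum_{j\ne i}\mathrm{sign}(j-i)\sigma_{i,j}$. *)

theory Defs
  imports
    Complex_Main
    "HOL-Combinatorics.Permutations"
    "HOL-Library.Poly_Mapping"
    "HOL-Algebra.Module"
    "HOL-Algebra.QuotRing"
begin

section \<open>Complex vector spaces, quotients and presented algebras\<close>

text \<open>
  Complex vector spaces are modules in the sense of HOL-Algebra over the field \<^term>\<open>complex_ring\<close>.
  Associative complex algebras use the same record type, with all of its fields; the fields
  \<^const>\<open>mult\<close> and \<^const>\<open>one\<close> are left unspecified for plain vector spaces.
\<close>

definition complex_ring :: "complex ring" where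
  "complex_ring = \<lparr>carrier = UNIV, mult = (*), one = 1, zero = 0, add = (+)\<rparr>"

definition cscale :: "complex \<Rightarrow> ('b \<Rightarrow>\<^sub>0 complex) \<Rightarrow> ('b \<Rightarrow>\<^sub>0 complex)"  (infixr \<open>*\<^sub>c\<close> 75) where
  "z *\<^sub>c p = Poly_Mapping.map ((*) z) p"

definition free_space :: "'b set \<Rightarrow> (complex, 'b \<Rightarrow>\<^sub>0 complex) module" where
  "free_space B = \<lparr>carrier = {p. Poly_Mapping.keys p \<subseteq> B}, mult = undefined, one = undefined,
     zero = 0, add = (+), smult = cscale\<rparr>"

definition lin_ext :: "('b \<Rightarrow> ('d \<Rightarrow>\<^sub>0 complex)) \<Rightarrow> ('b \<Rightarrow>\<^sub>0 complex) \<Rightarrow> ('d \<Rightarrow>\<^sub>0 complex)" where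
  "lin_ext f p = (\<Sum>b\<in>Poly_Mapping.keys p. Poly_Mapping.lookup p b *\<^sub>c f b)"

definition lspan :: "(complex, 'b) module \<Rightarrow> 'b set \<Rightarrow> 'b set" where
  "lspan V S = \<Inter>{W. submodule W complex_ring V \<and> S \<subseteq> W}"

definition coset_smult :: "(complex, 'b) module \<Rightarrow> 'b set \<Rightarrow> complex \<Rightarrow> 'b set \<Rightarrow> 'b set" where
  "coset_smult V W z C = (\<Union>x\<in>C. W +>\<^bsub>V\<^esub> (z \<odot>\<^bsub>V\<^esub> x))"

definition quotient_space :: "(complex, 'b) module \<Rightarrow> 'b set \<Rightarrow> (complex, 'b set) module" where
  "quotient_space V W = \<lparr>carrier = a_rcosets\<^bsub>V\<^esub> W, mult = undefined, one = undefined,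
     zero = W, add = set_add V, smult = coset_smult V W\<rparr>"

text \<open>
  The free unital associative algebra on generators of type \<open>'g\<close> consists of the finitely supported
  functions on words, with convolution as product (the library instance for \<open>\<Rightarrow>\<^sub>0\<close>). Words are
  wrapped in a datatype since the product requires the concatenation monoid as a type class instance.
\<close>

datatype 'g word = Word (letters: "'g list")

instantiation word :: (type) monoid_add
begin
definition zero_word :: "'a word" where "zero_word = Word []"
definition plus_word :: "'a word \<Rightarrow> 'a word \<Rightarrow> 'a word" where
  "plus_word u v = Word (letters u @ letters v)"
instance
  by standard (simp_all add: zero_word_def plus_word_def)
end

type_synonym 'g falg = "'g word \<Rightarrow>\<^sub>0 complex"

definition gen :: "'g \<Rightarrow> 'g falg" where
  "gen g = Poly_Mapping.single (Word [g]) 1"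

definition free_algebra :: "'g set \<Rightarrow> (complex, 'g falg) module" where
  "free_algebra G = \<lparr>carrier = {p. \<forall>w\<in>Poly_Mapping.keys p. set (letters w) \<subseteq> G},
     mult = (*), one = 1, zero = 0, add = (+), smult = cscale\<rparr>"

text \<open>
  Relations are pairs (left-hand side, right-hand side); \<open>Idl\<close> is the generated two-sided ideal.
\<close>

definition relation_ideal :: "'g set \<Rightarrow> ('g falg \<times> 'g falg) set \<Rightarrow> 'g falg set" where
  "relation_ideal G R = Idl\<^bsub>free_algebra G\<^esub> {a - b | a b. (a, b) \<in> R}"

definition presented_class :: "'g set \<Rightarrow> ('g falg \<times> 'g falg) set \<Rightarrow> 'g falg \<Rightarrow> 'g falg set" where
  "presented_class G R a = relation_ideal G R +>\<^bsub>free_algebra G\<^esub> a"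

definition presented_algebra ::
  "'g set \<Rightarrow> ('g falg \<times> 'g falg) set \<Rightarrow> (complex, 'g falg set) module" where
  "presented_algebra G R = (let Q = free_algebra G Quot relation_ideal G R in
     \<lparr>carrier = carrier Q, mult = mult Q, one = one Q, zero = zero Q, add = add Q,
      smult = coset_smult (free_algebra G) (relation_ideal G R)\<rparr>)"

locale left_alg_module = Module.module complex_ring V
  for A :: "(complex, 'a) module" and V :: "(complex, 'v) module" and act :: "'a \<Rightarrow> 'v \<Rightarrow> 'v" +
  assumes act_closed: "\<lbrakk>a \<in> carrier A; v \<in> carrier V\<rbrakk> \<Longrightarrow> act a v \<in> carrier V"
    and act_add_right: "\<lbrakk>a \<in> carrier A; v \<in> carrier V; w \<in> carrier V\<rbrakk> \<Longrightarrow>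
          act a (v \<oplus>\<^bsub>V\<^esub> w) = act a v \<oplus>\<^bsub>V\<^esub> act a w"
    and act_add_left: "\<lbrakk>a \<in> carrier A; b \<in> carrier A; v \<in> carrier V\<rbrakk> \<Longrightarrow>
          act (a \<oplus>\<^bsub>A\<^esub> b) v = act a v \<oplus>\<^bsub>V\<^esub> act b v"
    and act_smult: "\<lbrakk>a \<in> carrier A; v \<in> carrier V\<rbrakk> \<Longrightarrow>
          act (z \<odot>\<^bsub>A\<^esub> a) v = z \<odot>\<^bsub>V\<^esub> act a v"
    and act_mult: "\<lbrakk>a \<in> carrier A; b \<in> carrier A; v \<in> carrier V\<rbrakk> \<Longrightarrow>
          act (a \<otimes>\<^bsub>A\<^esub> b) v = act a (act b v)"
    and act_one: "v \<in> carrier V \<Longrightarrow> act \<one>\<^bsub>A\<^esub> v = v"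

locale right_alg_module = Module.module complex_ring M
  for A :: "(complex, 'a) module" and M :: "(complex, 'm) module" and act :: "'m \<Rightarrow> 'a \<Rightarrow> 'm" +
  assumes act_closed: "\<lbrakk>a \<in> carrier A; v \<in> carrier M\<rbrakk> \<Longrightarrow> act v a \<in> carrier M"
    and act_add_left: "\<lbrakk>a \<in> carrier A; v \<in> carrier M; w \<in> carrier M\<rbrakk> \<Longrightarrow>
          act (v \<oplus>\<^bsub>M\<^esub> w) a = act v a \<oplus>\<^bsub>M\<^esub> act w a"
    and act_add_right: "\<lbrakk>a \<in> carrier A; b \<in> carrier A; v \<in> carrier M\<rbrakk> \<Longrightarrow>
          act v (a \<oplus>\<^bsub>A\<^esub> b) = act v a \<oplus>\<^bsub>M\<^esub> act v b"
    and act_smult: "\<lbrakk>a \<in> carrier A; v \<in> carrier M\<rbrakk> \<Longrightarrow>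
          act v (z \<odot>\<^bsub>A\<^esub> a) = z \<odot>\<^bsub>M\<^esub> act v a"
    and act_mult: "\<lbrakk>a \<in> carrier A; b \<in> carrier A; v \<in> carrier M\<rbrakk> \<Longrightarrow>
          act v (a \<otimes>\<^bsub>A\<^esub> b) = act (act v a) b"
    and act_one: "v \<in> carrier M \<Longrightarrow> act v \<one>\<^bsub>A\<^esub> = v"

text \<open>
  A module over a superalgebra is a superspace on which the action respects parities.
  \<open>Ap p\<close> and \<open>Vp p\<close> are the homogeneous parts of parity \<open>p \<in> {0, 1}\<close>.
\<close>

locale left_supermodule = left_alg_module A V act
  for A :: "(complex, 'a) module" and Ap :: "nat \<Rightarrow> 'a set"
    and V :: "(complex, 'v) module" and Vp :: "nat \<Rightarrow> 'v set" and act :: "'a \<Rightarrow> 'v \<Rightarrow> 'v" +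
  assumes part_submodule: "p < 2 \<Longrightarrow> submodule (Vp p) complex_ring V"
    and part_decomp: "v \<in> carrier V \<Longrightarrow> \<exists>v0\<in>Vp 0. \<exists>v1\<in>Vp 1. v = v0 \<oplus>\<^bsub>V\<^esub> v1"
    and part_disjoint: "Vp 0 \<inter> Vp 1 = {\<zero>\<^bsub>V\<^esub>}"
    and act_parity: "\<lbrakk>p < 2; q < 2; a \<in> Ap p; v \<in> Vp q\<rbrakk> \<Longrightarrow> act a v \<in> Vp ((p + q) mod 2)"


section \<open>Free superalgebras\<close>

definition word_parity :: "('g \<Rightarrow> nat) \<Rightarrow> 'g word \<Rightarrow> nat" where
  "word_parity par w = (\<Sum>g\<leftarrow>letters w. par g) mod 2"

definition hom_part :: "('g \<Rightarrow> nat) \<Rightarrow> nat \<Rightarrow> 'g falg \<Rightarrow> 'g falg" where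
  "hom_part par p a = (\<Sum>w | w \<in> Poly_Mapping.keys a \<and> word_parity par w = p.
     Poly_Mapping.single w (Poly_Mapping.lookup a w))"

text \<open>
  The supercommutator \<open>xy - (-1)\<^bsup>|x||y|\<^esup> yx\<close> of homogeneous elements, extended bilinearly.
\<close>

definition scomm :: "('g \<Rightarrow> nat) \<Rightarrow> 'g falg \<Rightarrow> 'g falg \<Rightarrow> 'g falg" where
  "scomm par x y = (\<Sum>p<2. \<Sum>q<2. hom_part par p x * hom_part par q y
     - (-1) ^ (p * q) * (hom_part par q y * hom_part par p x))"

definition presented_part ::
  "'g set \<Rightarrow> ('g falg \<times> 'g falg) set \<Rightarrow> ('g \<Rightarrow> nat) \<Rightarrow> nat \<Rightarrow> 'g falg set set" where
  "presented_part G R par p = presented_class G R `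
     {a \<in> carrier (free_algebra G). \<forall>w\<in>Poly_Mapping.keys a. word_parity par w = p}"


section \<open>The superspace $\mathbb{C}(m|n)^{\otimes l}$\<close>

definition parity :: "nat \<Rightarrow> nat \<Rightarrow> nat" where
  "parity m i = (if 1 \<le> i \<and> i \<le> m then 0 else 1)"

definition psign :: "nat \<Rightarrow> nat \<Rightarrow> complex" where
  "psign m i = (-1) ^ parity m i"

text \<open>
  A basis vector $e_{w(1)} \otimes \cdots \otimes e_{w(l)}$ is encoded by the
  function \<open>w : {1..l} \<rightarrow> {1..m+n}\<close>.
\<close>

definition multi_indices :: "nat \<Rightarrow> nat \<Rightarrow> (nat \<Rightarrow> nat) set" where
  "multi_indices N l = ({1..l} \<rightarrow>\<^sub>E {1..N})"

type_synonym tpow = "(nat \<Rightarrow> nat) \<Rightarrow>\<^sub>0 complex"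

definition tensor_power :: "nat \<Rightarrow> nat \<Rightarrow> nat \<Rightarrow> (complex, tpow) module" where
  "tensor_power m n l = free_space (multi_indices (m + n) l)"

definition tensor_power_part :: "nat \<Rightarrow> nat \<Rightarrow> nat \<Rightarrow> nat \<Rightarrow> tpow set" where
  "tensor_power_part m n l p =
     {v \<in> carrier (tensor_power m n l).
        \<forall>w\<in>Poly_Mapping.keys v. (\<Sum>i=1..l. parity m (w i)) mod 2 = p}"

definition E_at :: "nat \<Rightarrow> nat \<Rightarrow> nat \<Rightarrow> nat \<Rightarrow> tpow \<Rightarrow> tpow" where
  "E_at m k a b = lin_ext (\<lambda>w. if w k = b
     then (-1) ^ ((parity m a + parity m b) * (\<Sum>j=1..<k. parity m (w j)))
            *\<^sub>c Poly_Mapping.single (w(k := a)) 1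
     else 0)"

definition E_tot :: "nat \<Rightarrow> nat \<Rightarrow> nat \<Rightarrow> nat \<Rightarrow> tpow \<Rightarrow> tpow" where
  "E_tot m l a b v = (\<Sum>k=1..l. E_at m k a b v)"

text \<open>
  The permutation \<open>\<sigma>\<close> moves the \<open>i\<close>-th tensor factor to position \<open>\<sigma>(i)\<close>; a sign $(-1)^{|v_i||v_j|}$
  arises for every pair of factors whose order is reversed.
\<close>

definition perm_act :: "nat \<Rightarrow> nat \<Rightarrow> (nat \<Rightarrow> nat) \<Rightarrow> tpow \<Rightarrow> tpow" where
  "perm_act m l \<sigma> = lin_ext (\<lambda>w.
     (\<Prod>(i, j)\<in>{(i, j). 1 \<le> i \<and> i < j \<and> j \<le> l \<and> \<sigma> j < \<sigma> i}. (-1) ^ (parity m (w i) * parity m (w j)))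
       *\<^sub>c Poly_Mapping.single (w \<circ> Hilbert_Choice.inv \<sigma>) 1)"

lemma perm_act_adjacent:
  assumes "1 \<le> i" "i < l"
  shows "perm_act m l (Transposition.transpose i (Suc i)) (Poly_Mapping.single w 1)
    = (-1) ^ (parity m (w i) * parity m (w (Suc i)))
        *\<^sub>c Poly_Mapping.single (w(i := w (Suc i), Suc i := w i)) 1"
proof -
  let ?s = "Transposition.transpose i (Suc i)"
  have inversions: "{(p, q). 1 \<le> p \<and> p < q \<and> q \<le> l \<and> ?s q < ?s p} = {(i, Suc i)}"
    using assms by (auto simp: Transposition.transpose_def split: if_splits)
  have "w \<circ> Hilbert_Choice.inv ?s = w(i := w (Suc i), Suc i := w i)"
    by (auto simp: fun_eq_iff Transposition.transpose_def)
  moreover have "1 *\<^sub>c p = p" for p :: tpow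
    by (rule poly_mapping_eqI) (simp add: cscale_def Poly_Mapping.map.rep_eq when_def)
  ultimately show ?thesis
    by (simp only: perm_act_def lin_ext_def inversions keys_single lookup_single) simp
qed


section \<open>The degenerate double affine Hecke algebra\<close>

text \<open>\<open>XInv\<close> stands for $(\mathsf{x}_1 \cdots \mathsf{x}_l)^{-1}$.\<close>

datatype cgen = Sig "nat \<Rightarrow> nat" | Xc nat | Yc nat | XInv

definition cherednik_gens :: "nat \<Rightarrow> cgen set" where
  "cherednik_gens l = Sig ` {\<sigma>. \<sigma> permutes {1..l}} \<union> Xc ` {1..l} \<union> Yc ` {1..l}"

abbreviation transp :: "nat \<Rightarrow> nat \<Rightarrow> cgen falg" where
  "transp i j \<equiv> gen (Sig (Transposition.transpose i j))"

inductive_set cherednik_rels :: "nat \<Rightarrow> complex \<Rightarrow> complex \<Rightarrow> (cgen falg \<times> cgen falg) set"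
  for l :: nat and t c :: complex where
  Sig_one: "(gen (Sig id), 1) \<in> cherednik_rels l t c"
| Sig_mult: "\<lbrakk>\<sigma> permutes {1..l}; \<tau> permutes {1..l}\<rbrakk> \<Longrightarrow>
    (gen (Sig \<sigma>) * gen (Sig \<tau>), gen (Sig (\<sigma> \<circ> \<tau>))) \<in> cherednik_rels l t c"
| x_comm: "\<lbrakk>i \<in> {1..l}; j \<in> {1..l}\<rbrakk> \<Longrightarrow>
    (gen (Xc i) * gen (Xc j), gen (Xc j) * gen (Xc i)) \<in> cherednik_rels l t c"
| y_comm: "\<lbrakk>i \<in> {1..l}; j \<in> {1..l}\<rbrakk> \<Longrightarrow>
    (gen (Yc i) * gen (Yc j), gen (Yc j) * gen (Yc i)) \<in> cherednik_rels l t c"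
| Sig_x: "\<lbrakk>\<sigma> permutes {1..l}; i \<in> {1..l}\<rbrakk> \<Longrightarrow>
    (gen (Sig \<sigma>) * gen (Xc i) * gen (Sig (Hilbert_Choice.inv \<sigma>)), gen (Xc (\<sigma> i))) \<in> cherednik_rels l t c"
| Sig_y: "\<lbrakk>\<sigma> permutes {1..l}; i \<in> {1..l}\<rbrakk> \<Longrightarrow>
    (gen (Sig \<sigma>) * gen (Yc i) * gen (Sig (Hilbert_Choice.inv \<sigma>)), gen (Yc (\<sigma> i))) \<in> cherednik_rels l t c"
| y_x: "\<lbrakk>i \<in> {1..l}; j \<in> {1..l}; i \<noteq> j\<rbrakk> \<Longrightarrow>
    (gen (Yc j) * gen (Xc i) - gen (Xc i) * gen (Yc j), (- c) *\<^sub>c transp i j) \<in> cherednik_rels l t c"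
| y_x_diag: "i \<in> {1..l} \<Longrightarrow>
    (gen (Yc i) * gen (Xc i) - gen (Xc i) * gen (Yc i),
     t *\<^sub>c 1 + c *\<^sub>c (\<Sum>k\<in>{1..l} - {i}. transp k i)) \<in> cherednik_rels l t c"

text \<open>
  Localization at $\mathsf{x}_1 \cdots \mathsf{x}_l$ is the universal adjunction of a two-sided
  inverse of this element.
\<close>

definition xprod :: "nat \<Rightarrow> cgen falg" where
  "xprod l = prod_list (map (\<lambda>i. gen (Xc i)) [1..<Suc l])"

definition daha_gens :: "nat \<Rightarrow> cgen set" where
  "daha_gens l = insert XInv (cherednik_gens l)"

definition daha_rels :: "nat \<Rightarrow> complex \<Rightarrow> complex \<Rightarrow> (cgen falg \<times> cgen falg) set" where
  "daha_rels l t c = cherednik_rels l t c \<union> {(xprod l * gen XInv, 1), (gen XInv * xprod l, 1)}"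

definition daha :: "nat \<Rightarrow> complex \<Rightarrow> complex \<Rightarrow> (complex, cgen falg set) module" where
  "daha l t c = presented_algebra (daha_gens l) (daha_rels l t c)"

definition daha_class :: "nat \<Rightarrow> complex \<Rightarrow> complex \<Rightarrow> cgen falg \<Rightarrow> cgen falg set" where
  "daha_class l t c = presented_class (daha_gens l) (daha_rels l t c)"

definition x_inv :: "nat \<Rightarrow> nat \<Rightarrow> cgen falg" where
  "x_inv l r = prod_list (map (\<lambda>i. gen (Xc i)) (filter (\<lambda>i. i \<noteq> r) [1..<Suc l])) * gen XInv"

definition U_elt :: "complex \<Rightarrow> complex \<Rightarrow> nat \<Rightarrow> cgen falg" where
  "U_elt t c i = (t / 2) *\<^sub>c 1 + gen (Xc i) * gen (Yc i) + c *\<^sub>c (\<Sum>j=1..<i. transp i j)"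

definition y_elt :: "nat \<Rightarrow> complex \<Rightarrow> complex \<Rightarrow> nat \<Rightarrow> cgen falg" where
  "y_elt l t c i = U_elt t c i
     + (c / 2) *\<^sub>c (\<Sum>j\<in>{1..l} - {i}. sgn (of_nat j - of_nat i) *\<^sub>c transp i j)"


section \<open>The affine super Yangian\<close>

datatype pm = Plus | Minus

fun pm_val :: "pm \<Rightarrow> complex" where
  "pm_val Plus = 1"
| "pm_val Minus = -1"

datatype ygen = Xy pm nat nat | Hy nat nat

context
  fixes m n :: nat and lam beta :: complex
begin

definition cartan :: "nat \<Rightarrow> nat \<Rightarrow> int" where
  "cartan i j =
     (if i = j then (-1) ^ parity m i + (-1) ^ parity m (i + 1)
      else if j = i + 1 then - ((-1) ^ parity m (i + 1))
      else if i = j + 1 then - ((-1) ^ parity m i)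
      else if (i, j) \<in> {(0, m + n - 1), (m + n - 1, 0)} then - ((-1) ^ parity m (m + n))
      else 0)"

definition yangian_gens :: "ygen set" where
  "yangian_gens = {Xy \<epsilon> i r | \<epsilon> i r. i < m + n \<and> r < 2} \<union> {Hy i r | i r. i < m + n \<and> r < 2}"

fun ygen_parity :: "ygen \<Rightarrow> nat" where
  "ygen_parity (Xy \<epsilon> i r) = (if i = 0 \<or> i = m then 1 else 0)"
| "ygen_parity (Hy i r) = 0"

abbreviation gX :: "pm \<Rightarrow> nat \<Rightarrow> nat \<Rightarrow> ygen falg" where "gX \<epsilon> i r \<equiv> gen (Xy \<epsilon> i r)"
abbreviation gH :: "nat \<Rightarrow> nat \<Rightarrow> ygen falg" where "gH i r \<equiv> gen (Hy i r)"

abbreviation bracket :: "ygen falg \<Rightarrow> ygen falg \<Rightarrow> ygen falg"  (\<open>[_, _]\<^sub>s\<close>) where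
  "[x, y]\<^sub>s \<equiv> scomm ygen_parity x y"

abbreviation anticomm :: "ygen falg \<Rightarrow> ygen falg \<Rightarrow> ygen falg" where
  "anticomm x y \<equiv> x * y + y * x"

abbreviation cartan_c :: "nat \<Rightarrow> nat \<Rightarrow> complex" where
  "cartan_c i j \<equiv> of_int (cartan i j)"

definition H_tilde :: "nat \<Rightarrow> ygen falg" where
  "H_tilde i = gH i 1 - (lam / 2) *\<^sub>c (gH i 0 * gH i 0)"

definition generic :: "nat \<Rightarrow> nat \<Rightarrow> bool" where
  "generic i j \<longleftrightarrow> (i, j) \<noteq> (0, m + n - 1) \<and> (i, j) \<noteq> (m + n - 1, 0)"

text \<open>
  The predecessor and successor of a node \<open>i < m + n\<close> of the affine diagram are
  \<open>(i + (m + n - 1)) mod (m + n)\<close> and \<open>(i + 1) mod (m + n)\<close>.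
\<close>

inductive_set yangian_rels :: "(ygen falg \<times> ygen falg) set" where
  HH: "\<lbrakk>i < m + n; j < m + n; r < 2; s < 2\<rbrakk> \<Longrightarrow> ([gH i r, gH j s]\<^sub>s, 0) \<in> yangian_rels"
| XX_00: "\<lbrakk>i < m + n; j < m + n\<rbrakk> \<Longrightarrow>
    ([gX Plus i 0, gX Minus j 0]\<^sub>s, if i = j then gH i 0 else 0) \<in> yangian_rels"
| XX_10: "\<lbrakk>i < m + n; j < m + n\<rbrakk> \<Longrightarrow>
    ([gX Plus i 1, gX Minus j 0]\<^sub>s, if i = j then gH i 1 else 0) \<in> yangian_rels"
| XX_01: "\<lbrakk>i < m + n; j < m + n\<rbrakk> \<Longrightarrow>
    ([gX Plus i 0, gX Minus j 1]\<^sub>s, if i = j then gH i 1 else 0) \<in> yangian_rels"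
| H0X: "\<lbrakk>i < m + n; j < m + n; r < 2\<rbrakk> \<Longrightarrow>
    ([gH i 0, gX \<epsilon> j r]\<^sub>s, (pm_val \<epsilon> * cartan_c i j) *\<^sub>c gX \<epsilon> j r) \<in> yangian_rels"
| H1X: "\<lbrakk>i < m + n; j < m + n; generic i j\<rbrakk> \<Longrightarrow>
    ([H_tilde i, gX \<epsilon> j 0]\<^sub>s, (pm_val \<epsilon> * cartan_c i j) *\<^sub>c gX \<epsilon> j 1) \<in> yangian_rels"
| H1X_first:
    "([H_tilde 0, gX \<epsilon> (m + n - 1) 0]\<^sub>s,
      (pm_val \<epsilon> * cartan_c 0 (m + n - 1)) *\<^sub>c (gX \<epsilon> (m + n - 1) 1 - beta *\<^sub>c gX \<epsilon> (m + n - 1) 0))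
     \<in> yangian_rels"
| H1X_last:
    "([H_tilde (m + n - 1), gX \<epsilon> 0 0]\<^sub>s,
      (pm_val \<epsilon> * cartan_c (m + n - 1) 0) *\<^sub>c (gX \<epsilon> 0 1 + beta *\<^sub>c gX \<epsilon> 0 0)) \<in> yangian_rels"
| XX: "\<lbrakk>i < m + n; j < m + n; generic i j\<rbrakk> \<Longrightarrow>
    ([gX \<epsilon> i 1, gX \<epsilon> j 0]\<^sub>s - [gX \<epsilon> i 0, gX \<epsilon> j 1]\<^sub>s,
     (pm_val \<epsilon> * cartan_c i j * lam / 2) *\<^sub>c anticomm (gX \<epsilon> i 0) (gX \<epsilon> j 0)) \<in> yangian_rels"
| XX_first:
    "([gX \<epsilon> 0 1, gX \<epsilon> (m + n - 1) 0]\<^sub>s - [gX \<epsilon> 0 0, gX \<epsilon> (m + n - 1) 1]\<^sub>s,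
      (pm_val \<epsilon> * cartan_c 0 (m + n - 1) * lam / 2) *\<^sub>c anticomm (gX \<epsilon> 0 0) (gX \<epsilon> (m + n - 1) 0)
        - beta *\<^sub>c [gX \<epsilon> 0 0, gX \<epsilon> (m + n - 1) 0]\<^sub>s) \<in> yangian_rels"
| Serre: "\<lbrakk>i < m + n; j < m + n; i \<noteq> j\<rbrakk> \<Longrightarrow>
    (((\<lambda>z. [gX \<epsilon> i 0, z]\<^sub>s) ^^ (1 + nat \<bar>cartan i j\<bar>)) (gX \<epsilon> j 0), 0) \<in> yangian_rels"
| odd_square: "i \<in> {0, m} \<Longrightarrow> ([gX \<epsilon> i 0, gX \<epsilon> i 0]\<^sub>s, 0) \<in> yangian_rels"
| odd_Serre: "i \<in> {0, m} \<Longrightarrow>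
    ([[gX \<epsilon> ((i + (m + n - 1)) mod (m + n)) 0, gX \<epsilon> i 0]\<^sub>s,
      [gX \<epsilon> i 0, gX \<epsilon> ((i + 1) mod (m + n)) 0]\<^sub>s]\<^sub>s, 0) \<in> yangian_rels"

definition yangian :: "(complex, ygen falg set) module" where
  "yangian = presented_algebra yangian_gens yangian_rels"

definition yangian_part :: "nat \<Rightarrow> ygen falg set set" where
  "yangian_part = presented_part yangian_gens yangian_rels ygen_parity"

definition yangian_class :: "ygen falg \<Rightarrow> ygen falg set" where
  "yangian_class = presented_class yangian_gens yangian_rels"

text \<open>
  Representatives of the matrix units \<open>E\<^bsub>a,b\<^esub>\<close>, \<open>a \<noteq> b\<close>, of \<open>sl(m|n)\<close>. Those next to the diagonal
  are prescribed, and $E_{a,b} = [E_{a,c}, E_{c,b}]$ for distinct \<open>a, b, c\<close> determines the others: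
  \<open>E_up d a\<close> represents $E_{a,a+1+d}$, \<open>E_down d b\<close> represents $E_{b+1+d,b}$.
\<close>

primrec E_up :: "nat \<Rightarrow> nat \<Rightarrow> ygen falg" where
  "E_up 0 i = gX Plus i 0"
| "E_up (Suc d) i = [gX Plus i 0, E_up d (i + 1)]\<^sub>s"

primrec E_down :: "nat \<Rightarrow> nat \<Rightarrow> ygen falg" where
  "E_down 0 i = psign m i *\<^sub>c gX Minus i 0"
| "E_down (Suc d) i = [E_down d (i + 1), psign m i *\<^sub>c gX Minus i 0]\<^sub>s"

definition E_unit :: "nat \<Rightarrow> nat \<Rightarrow> ygen falg" where
  "E_unit p q = (if p < q then E_up (q - p - 1) p else if q < p then E_down (p - q - 1) q else undefined)"

definition paren0 :: "nat \<Rightarrow> complex" where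
  "paren0 i = (\<Sum>j=i+2..m+n. psign m j)"

abbreviation sgn_diff :: "nat \<Rightarrow> nat \<Rightarrow> complex" where
  "sgn_diff k i \<equiv> sgn (of_nat k - of_nat i)"

definition vartheta :: "nat \<Rightarrow> ygen falg" where
  "vartheta i = (- paren0 (i - 1) / 2) *\<^sub>c gH i 0
     + (psign m i / 2) *\<^sub>c
         (\<Sum>k\<in>{1..m+n} - {i}. (psign m k * sgn_diff k i) *\<^sub>c (E_unit i k * E_unit k i))
     - (psign m (i + 1) / 2) *\<^sub>c
         (\<Sum>k\<in>{1..m+n} - {i + 1}. (psign m k * sgn_diff k (i + 1)) *\<^sub>c (E_unit (i + 1) k * E_unit k (i + 1)))"

definition varpi_plus :: "nat \<Rightarrow> ygen falg" where
  "varpi_plus i = (- paren0 i / 2) *\<^sub>c gX Plus i 0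
     + (1 / 2) *\<^sub>c (\<Sum>k\<in>{1..m+n} - {i, i + 1}. (psign m k * sgn_diff k i) *\<^sub>c (E_unit i k * E_unit k (i + 1)))
     - (1 / 2) *\<^sub>c (gH i 0 * gX Plus i 0)"

definition varpi_minus :: "nat \<Rightarrow> ygen falg" where
  "varpi_minus i = (- paren0 i / 2) *\<^sub>c gX Minus i 0
     + (psign m i / 2) *\<^sub>c
         (\<Sum>k\<in>{1..m+n} - {i, i + 1}. (psign m k * sgn_diff k i) *\<^sub>c (E_unit (i + 1) k * E_unit k i))
     - (1 / 2) *\<^sub>c (gX Minus i 0 * gH i 0)"

definition J_h :: "nat \<Rightarrow> ygen falg" where
  "J_h i = H_tilde i + lam *\<^sub>c vartheta i"

definition J_x_plus :: "nat \<Rightarrow> ygen falg" where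
  "J_x_plus i = gX Plus i 1 + lam *\<^sub>c varpi_plus i"

definition J_x_minus :: "nat \<Rightarrow> ygen falg" where
  "J_x_minus i = gX Minus i 1 + lam *\<^sub>c varpi_minus i"

end


section \<open>The tensor product over the group algebra of the symmetric group\<close>

text \<open>
  $M \otimes_{\mathbb{C}[S_l]} \mathbb{C}(m|n)^{\otimes l}$ is the quotient of the vector space
  freely spanned by pairs by the relations of bilinearity and balancedness. By bilinearity,
  balancedness over the elements of $S_l$ is balancedness over $\mathbb{C}[S_l]$.
\<close>

context
  fixes m n l :: nat and t c :: complex
    and M :: "(complex, 'm) module" and ract :: "'m \<Rightarrow> cgen falg set \<Rightarrow> 'm"
begin

abbreviation mpair :: "'m \<Rightarrow> tpow \<Rightarrow> ('m \<times> tpow \<Rightarrow>\<^sub>0 complex)" where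
  "mpair x v \<equiv> Poly_Mapping.single (x, v) 1"

inductive_set tensor_rels :: "('m \<times> tpow \<Rightarrow>\<^sub>0 complex) set" where
  add_left: "\<lbrakk>x \<in> carrier M; y \<in> carrier M; v \<in> carrier (tensor_power m n l)\<rbrakk> \<Longrightarrow>
    mpair (x \<oplus>\<^bsub>M\<^esub> y) v - (mpair x v + mpair y v) \<in> tensor_rels"
| add_right: "\<lbrakk>x \<in> carrier M; v \<in> carrier (tensor_power m n l); w \<in> carrier (tensor_power m n l)\<rbrakk> \<Longrightarrow>
    mpair x (v + w) - (mpair x v + mpair x w) \<in> tensor_rels"
| scale_left: "\<lbrakk>x \<in> carrier M; v \<in> carrier (tensor_power m n l)\<rbrakk> \<Longrightarrow>
    mpair (z \<odot>\<^bsub>M\<^esub> x) v - z *\<^sub>c mpair x v \<in> tensor_rels"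
| scale_right: "\<lbrakk>x \<in> carrier M; v \<in> carrier (tensor_power m n l)\<rbrakk> \<Longrightarrow>
    mpair x (z *\<^sub>c v) - z *\<^sub>c mpair x v \<in> tensor_rels"
| balanced: "\<lbrakk>x \<in> carrier M; v \<in> carrier (tensor_power m n l); \<sigma> permutes {1..l}\<rbrakk> \<Longrightarrow>
    mpair (ract x (daha_class l t c (gen (Sig \<sigma>)))) v - mpair x (perm_act m l \<sigma> v) \<in> tensor_rels"

definition pair_space :: "(complex, 'm \<times> tpow \<Rightarrow>\<^sub>0 complex) module" where
  "pair_space = free_space (carrier M \<times> carrier (tensor_power m n l))"

definition tensor_null :: "('m \<times> tpow \<Rightarrow>\<^sub>0 complex) set" where
  "tensor_null = lspan pair_space tensor_rels"

definition tensor_space :: "(complex, ('m \<times> tpow \<Rightarrow>\<^sub>0 complex) set) module" where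
  "tensor_space = quotient_space pair_space tensor_null"

definition tensor :: "'m \<Rightarrow> tpow \<Rightarrow> ('m \<times> tpow \<Rightarrow>\<^sub>0 complex) set" where
  "tensor x v = tensor_null +>\<^bsub>pair_space\<^esub> mpair x v"

text \<open>\<open>M\<close> is purely even, so the parity of \<open>x \<otimes> v\<close> is that of \<open>v\<close>.\<close>

definition tensor_part :: "nat \<Rightarrow> ('m \<times> tpow \<Rightarrow>\<^sub>0 complex) set set" where
  "tensor_part p = (\<lambda>u. tensor_null +>\<^bsub>pair_space\<^esub> u) `
     carrier (free_space (carrier M \<times> tensor_power_part m n l p))"

end

end

theory Submission
  imports Defs
begin

text \<open>
  The elements $\mathsf{z}_p = \mathsf{x}_p \mathsf{y}_p$ of the Cherednik algebra satisfy the relations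
  $[\mathsf{z}_p, \mathsf{z}_q] = c(\mathsf{z}_p - \mathsf{z}_q)\sigma_{p,q}$ of the degenerate affine Hecke
  algebra. Hence the operators $E_{a,b}[g] = \sum_p \mathbf{m} g_p \otimes E_{a,b}^{(p)} \mathbf{v}$ with
  $g_p$ a power of $\mathsf{x}_p$ generate an action of the loop algebra of $gl(m|n)$, and
  $E_{a,b}[\mathsf{z}]$ satisfies quadratic relations with them. Corrected by quadratic expressions in
  $gl(m|n)$, the diagonal $E_{a,a}[\mathsf{z}]$ become commuting Gelfand-Tsetlin elements $D_a$; each
  $\widetilde H_{i,1}$ acts by a difference of two neighbouring $D_a$, and $X^\pm_{i,1}$ by the commutator
  of $D_a$ with $X^\pm_{i,0}$, so that the defining relations follow from commutators with the $D_a$. The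
  condition on $\beta + t$ closes the affine node, where $m - n$ enters as the supertrace of the identity.
  Uniqueness holds since all generators are obtained by commutators from the prescribed ones.
\<close>

section \<open>Complex vector spaces and algebras as type classes\<close>

text \<open>The spaces of the statement live on carriers and in quotients, while the calculation
  consists of long operator identities. So each carrier-based space is embedded in one type,
  operators form an algebra class, and the relations are proved in the abstract locale
  \<open>gl_core\<close>, which assumes only identities between the E[x^k] and E[z]. A right action
  becomes an anti-homomorphism into operators, so products of Cherednik elements appear reversed. A
  sum of \<sigma>_{k,p} over k different from p turns, on the tensor side, into the sum of (-1)^|a|
  E_{i,a} E_{a,j} minus (m - n) E_{i,j}; this is how quadratic corrections and the supertrace meet.
  The two ends N = m + n and 1 of the chain of D_a see the affine root vectors with a discrepancy om
  = t + 2 beta, and the assumed condition says exactly lam (m - n) = t + om. The scalars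
  \<open>kc\<close> by which X_{i,1} is shifted are dictated by J(x_i) at finite nodes and by beta
  at node 0. The D_a are even, hence act as derivations on every supercommutator. Since m, n >= 2,
  the odd nodes 0 and m are not adjacent, so brackets of neighbouring generators are ordinary
  commutators.\<close>

class cvector = ab_group_add +
  fixes scaleC :: "complex \<Rightarrow> 'a \<Rightarrow> 'a"  (infixr \<open>*\<^sub>v\<close> 75)
  assumes scaleC_add_right: "z *\<^sub>v (a + b) = z *\<^sub>v a + z *\<^sub>v b"
    and scaleC_add_left: "(z + w) *\<^sub>v a = z *\<^sub>v a + w *\<^sub>v a"
    and scaleC_scaleC: "z *\<^sub>v w *\<^sub>v a = (z * w) *\<^sub>v a"
    and scaleC_one: "1 *\<^sub>v a = a"
begin

lemma scaleC_zero_left [simp]: "0 *\<^sub>v a = 0"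
  using scaleC_add_left[of 0 0 a] by simp

lemma scaleC_zero_right [simp]: "z *\<^sub>v 0 = 0"
  using scaleC_add_right[of z 0 0] by simp

lemma scaleC_minus_left: "(- z) *\<^sub>v a = - (z *\<^sub>v a)"
  using scaleC_add_left[of z "- z" a] by (simp add: eq_neg_iff_add_eq_0 add_commute)

lemma scaleC_minus_right: "z *\<^sub>v (- a) = - (z *\<^sub>v a)"
  using scaleC_add_right[of z a "- a"] by (simp add: eq_neg_iff_add_eq_0 add_commute)

lemma scaleC_diff_right: "z *\<^sub>v (a - b) = z *\<^sub>v a - z *\<^sub>v b"
  using scaleC_add_right[of z a "- b"] by (simp add: scaleC_minus_right)

lemma scaleC_diff_left: "(z - w) *\<^sub>v a = z *\<^sub>v a - w *\<^sub>v a"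
  using scaleC_add_left[of z "- w" a] by (simp add: scaleC_minus_left)

lemma scaleC_sum_right: "z *\<^sub>v sum f A = (\<Sum>x\<in>A. z *\<^sub>v f x)"
  by (induction A rule: infinite_finite_induct) (simp_all add: scaleC_add_right)

lemma scaleC_sum_left: "sum f A *\<^sub>v a = (\<Sum>x\<in>A. f x *\<^sub>v a)"
  by (induction A rule: infinite_finite_induct) (simp_all add: scaleC_add_left)

end

class calgebra = cvector + ring + monoid_mult +
  assumes mult_scaleC_left: "(z *\<^sub>v a) * b = z *\<^sub>v (a * b)"
    and mult_scaleC_right: "a * (z *\<^sub>v b) = z *\<^sub>v (a * b)"

lemmas scaleC_simps = scaleC_add_right scaleC_diff_right scaleC_minus_right scaleC_minus_left
  scaleC_scaleC scaleC_one mult_scaleC_left mult_scaleC_right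

definition cm :: "'a::calgebra \<Rightarrow> 'a \<Rightarrow> 'a" where
  "cm x y = x * y - y * x"

text \<open>The supercommutator with its sign as a parameter: for homogeneous arguments
  \<open>z\<close> is (-1)^(|x||y|). This avoids carrying a grading on the abstract algebra;
  brackets with an even element are \<open>cm\<close>.\<close>

definition sb :: "complex \<Rightarrow> 'a::calgebra \<Rightarrow> 'a \<Rightarrow> 'a" where
  "sb z x y = x * y - z *\<^sub>v (y * x)"

lemma sb_one: "sb 1 x y = cm x y"
  by (simp add: sb_def cm_def scaleC_one)

lemma cm_bilinear:
  "cm (x + x') y = cm x y + cm x' y" "cm x (y + y') = cm x y + cm x y'"
  "cm (x - x') y = cm x y - cm x' y" "cm x (y - y') = cm x y - cm x y'"
  "cm (z *\<^sub>v x) y = z *\<^sub>v cm x y" "cm x (z *\<^sub>v y) = z *\<^sub>v cm x y"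
  "cm (- x) y = - cm x y" "cm x (- y) = - cm x y" "cm 0 y = 0" "cm x 0 = 0"
  by (simp_all add: cm_def algebra_simps scaleC_simps)

lemma sb_bilinear:
  "sb w (x + x') y = sb w x y + sb w x' y" "sb w x (y + y') = sb w x y + sb w x y'"
  "sb w (x - x') y = sb w x y - sb w x' y" "sb w x (y - y') = sb w x y - sb w x y'"
  "sb w (z *\<^sub>v x) y = z *\<^sub>v sb w x y" "sb w x (z *\<^sub>v y) = z *\<^sub>v sb w x y"
  "sb w (- x) y = - sb w x y" "sb w x (- y) = - sb w x y" "sb w 0 y = 0" "sb w x 0 = 0"
  by (simp_all add: sb_def algebra_simps scaleC_simps)

lemma cm_sum: "cm (sum f A) y = (\<Sum>x\<in>A. cm (f x) y)" "cm y (sum f A) = (\<Sum>x\<in>A. cm y (f x))"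
  by (simp_all add: cm_def sum_distrib_left sum_distrib_right sum_subtractf)

lemma sb_sum: "sb z (sum f A) y = (\<Sum>x\<in>A. sb z (f x) y)" "sb z y (sum f A) = (\<Sum>x\<in>A. sb z y (f x))"
  by (simp_all add: sb_def sum_distrib_left sum_distrib_right sum_subtractf scaleC_sum_right)

lemma cm_mult: "cm x (y * z) = cm x y * z + y * cm x z" "cm (x * y) z = x * cm y z + cm x z * y"
  by (simp_all add: cm_def algebra_simps)

text \<open>The derivation property holds for any fixed sign \<open>w\<close>. It allows commutators
  with the even D_a to be applied to known brackets in order to produce new ones.\<close>

lemma cm_sb: "cm x (sb w y z) = sb w (cm x y) z + sb w y (cm x z)"
  by (simp add: sb_def cm_bilinear cm_mult algebra_simps scaleC_simps)

text \<open>Super Leibniz rule: moving \<open>z\<close> past \<open>x * y\<close> collects the sign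
  \<open>w1\<close> from \<open>y\<close> and \<open>w2\<close> from \<open>x\<close>.\<close>

lemma sb_mult_left: "w = w1 * w2 \<Longrightarrow> sb w (x * y) z = x * sb w1 y z + w1 *\<^sub>v (sb w2 x z * y)"
  by (simp add: sb_def algebra_simps scaleC_simps)

lemma cm_swap: "cm x y = - cm y x"
  by (simp add: cm_def)

lemma sb_swap: "z * z = 1 \<Longrightarrow> sb z x y = - (z *\<^sub>v sb z y x)"
  by (simp add: sb_def algebra_simps scaleC_simps)

lemma cm_self [simp]: "cm x x = 0"
  by (simp add: cm_def)

lemma cm_jacobi: "cm x (cm y z) = cm (cm x y) z + cm y (cm x z)"
  by (simp add: cm_def algebra_simps)

text \<open>Linear endomorphisms form a type so that composition is the product of a
  \<open>calgebra\<close>, and operator identities become ring identities.\<close>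

typedef (overloaded) 'v lin =
  "{f :: 'v::cvector \<Rightarrow> 'v. (\<forall>u v. f (u + v) = f u + f v) \<and> (\<forall>z v. f (z *\<^sub>v v) = z *\<^sub>v f v)}"
  morphisms app Lin
  by (rule exI[of _ id]) simp

setup_lifting type_definition_lin

instantiation lin :: (cvector) calgebra
begin
lift_definition zero_lin :: "'a lin" is "\<lambda>_. 0" by simp
lift_definition one_lin :: "'a lin" is "\<lambda>v. v" by simp
lift_definition plus_lin :: "'a lin \<Rightarrow> 'a lin \<Rightarrow> 'a lin" is "\<lambda>f g v. f v + g v"
  by (simp add: scaleC_add_right algebra_simps)
lift_definition minus_lin :: "'a lin \<Rightarrow> 'a lin \<Rightarrow> 'a lin" is "\<lambda>f g v. f v - g v"
  by (simp add: scaleC_diff_right algebra_simps)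
lift_definition uminus_lin :: "'a lin \<Rightarrow> 'a lin" is "\<lambda>f v. - f v"
  by (simp add: scaleC_minus_right)
lift_definition times_lin :: "'a lin \<Rightarrow> 'a lin \<Rightarrow> 'a lin" is "\<lambda>f g v. f (g v)" by simp
lift_definition scaleC_lin :: "complex \<Rightarrow> 'a lin \<Rightarrow> 'a lin" is "\<lambda>z f v. z *\<^sub>v f v"
  by (simp add: scaleC_add_right scaleC_scaleC mult.commute)
instance
  by standard (transfer; simp add: algebra_simps scaleC_add_right scaleC_add_left scaleC_scaleC
      scaleC_one fun_eq_iff)+
end

lemma app_add: "app f (u + v) = app f u + app f v"
  and app_scale: "app f (z *\<^sub>v v) = z *\<^sub>v app f v"
  by (transfer, simp)+

lemma app_zero [simp]: "app f 0 = 0"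
  using app_scale[of f 0 0] by simp

lemma app_minus: "app f (- v) = - app f v"
  using app_scale[of f "-1" v] by (simp add: scaleC_minus_left scaleC_one)

lemma app_sum: "app f (sum g A) = (\<Sum>x\<in>A. app f (g x))"
  by (induction A rule: infinite_finite_induct) (simp_all add: app_add)

lemma app_simps:
  "app (f + g) v = app f v + app g v" "app (f - g) v = app f v - app g v"
  "app (- f) v = - app f v" "app (f * g) v = app f (app g v)" "app (z *\<^sub>v f) v = z *\<^sub>v app f v"
  "app 0 v = 0" "app 1 v = v"
  by (transfer; simp)+

lemma app_sum_left: "app (sum F A) v = (\<Sum>x\<in>A. app (F x) v)"
  by (induction A rule: infinite_finite_induct) (simp_all add: app_simps)

lemma lin_eqI: "(\<And>v. app f v = app g v) \<Longrightarrow> f = g"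
  by (transfer) auto

section \<open>Embedding carrier-based vector spaces into a type\<close>

text \<open>
  The product of all complex vector spaces whose carrier is a set of elements of \<open>'v\<close> is a vector
  space on a whole type; it contains each of these spaces as a factor, so that the sums and operators
  of a carrier-based space can be handled in type classes.
\<close>

abbreviation (input) cmod :: "(complex, 'v) module \<Rightarrow> bool" where
  "cmod V \<equiv> Module.module complex_ring V"

typedef 'v vfam = "{F :: (complex, 'v) module \<Rightarrow> 'v.
    \<forall>V. if cmod V then F V \<in> carrier V else F V = undefined}"
  morphisms fam_at VFam
proof -
  have "\<exists>x. if cmod V then x \<in> carrier V else x = undefined" for V :: "(complex, 'v) module"
  proof (cases "cmod V")
    case True
    then interpret Module.module complex_ring V .
    show ?thesis using M.zero_closed True by auto
  qed simp
  then have "\<forall>V :: (complex, 'v) module. \<exists>x. if cmod V then x \<in> carrier V else x = undefined"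
    by blast
  from choice[OF this] show ?thesis by blast
qed

setup_lifting type_definition_vfam

lemma complex_ring_simps [simp]:
  "carrier complex_ring = UNIV" "add complex_ring = (+)" "mult complex_ring = (*)"
  "one complex_ring = 1" "zero complex_ring = 0"
  by (simp_all add: complex_ring_def)

lemma cring_complex_ring: "cring complex_ring"
proof (rule cringI)
  show "abelian_group complex_ring"
    by (rule abelian_groupI)
      (auto simp: add.assoc add.commute intro: exI[of _ "- x" for x])
  show "Group.comm_monoid complex_ring"
    by (rule comm_monoidI) auto
qed (auto simp: algebra_simps)

instantiation vfam :: (type) cvector
begin
lift_definition zero_vfam :: "'a vfam" is "\<lambda>V. if cmod V then \<zero>\<^bsub>V\<^esub> else undefined"
  by (auto simp: Module.module_def abelian_group_def abelian_monoid.zero_closed)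
lift_definition plus_vfam :: "'a vfam \<Rightarrow> 'a vfam \<Rightarrow> 'a vfam"
  is "\<lambda>F G V. if cmod V then F V \<oplus>\<^bsub>V\<^esub> G V else undefined"
  by (auto simp: Module.module_def abelian_group_def abelian_monoid.a_closed)
lift_definition minus_vfam :: "'a vfam \<Rightarrow> 'a vfam \<Rightarrow> 'a vfam"
  is "\<lambda>F G V. if cmod V then F V \<ominus>\<^bsub>V\<^esub> G V else undefined"
  by (auto simp: Module.module_def abelian_group.minus_closed)
lift_definition uminus_vfam :: "'a vfam \<Rightarrow> 'a vfam"
  is "\<lambda>F V. if cmod V then \<ominus>\<^bsub>V\<^esub> F V else undefined"
  by (auto simp: Module.module_def abelian_group.a_inv_closed)
lift_definition scaleC_vfam :: "complex \<Rightarrow> 'a vfam \<Rightarrow> 'a vfam"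
  is "\<lambda>z F V. if cmod V then z \<odot>\<^bsub>V\<^esub> F V else undefined"
  by (auto simp: Module.module.smult_closed)
instance
proof
  fix a b c :: "'a vfam" and z w
  note [simp] = abelian_monoid.a_assoc abelian_monoid.l_zero abelian_group.l_neg
    Module.module.smult_r_distr
  have ag: "abelian_group V" "abelian_monoid V" if "cmod V" for V :: "(complex, 'a) module"
    using that by (auto simp: Module.module_def abelian_group_def)
  show "a + b + c = a + (b + c)" "0 + a = a" "- a + a = 0" "z *\<^sub>v (a + b) = z *\<^sub>v a + z *\<^sub>v b"
    by (transfer, auto simp: ag fun_eq_iff split: if_splits)+
  show "a + b = b + a" 
    by (transfer, auto simp: fun_eq_iff intro!: abelian_monoid.a_comm ag)
  show "a - b = a + - b"
    by (transfer, auto simp: fun_eq_iff a_minus_def)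
  show "(z + w) *\<^sub>v a = z *\<^sub>v a + w *\<^sub>v a" "z *\<^sub>v w *\<^sub>v a = (z * w) *\<^sub>v a" "1 *\<^sub>v a = a"
    by (transfer, auto simp: fun_eq_iff Module.module.smult_l_distr[of complex_ring, simplified]
        Module.module.smult_assoc1[of complex_ring, simplified]
        Module.module.smult_one[of complex_ring, simplified] split: if_splits)+
qed
end

text \<open>Inclusion of the factor \<open>V\<close> into the product, zero in all other factors;
  the projection \<open>fam_at _ V\<close> is a left inverse on the carrier. Arguments outside the
  carrier are sent to zero, since the value must lie in the type in any case.\<close>

lift_definition emb :: "(complex, 'v) module \<Rightarrow> 'v \<Rightarrow> 'v vfam"
  is "\<lambda>V x W. if cmod W then (if W = V \<and> x \<in> carrier V then x else \<zero>\<^bsub>W\<^esub>) else undefined"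
  by (auto simp: Module.module_def abelian_group_def abelian_monoid.zero_closed)

lemma comp_closed: "cmod V \<Longrightarrow> fam_at F V \<in> carrier V"
  by (transfer) (metis (full_types))

lemma comp_emb [simp]: "cmod V \<Longrightarrow> x \<in> carrier V \<Longrightarrow> fam_at (emb V x) V = x"
  by (transfer) auto

lemma comp_simps:
  assumes "cmod V"
  shows "fam_at (F + G) V = fam_at F V \<oplus>\<^bsub>V\<^esub> fam_at G V" "fam_at (z *\<^sub>v F) V = z \<odot>\<^bsub>V\<^esub> fam_at F V"
    "fam_at 0 V = \<zero>\<^bsub>V\<^esub>" "fam_at (- F) V = \<ominus>\<^bsub>V\<^esub> fam_at F V"
  using assms by (transfer, simp)+

lemma vfam_eqI: "(\<And>V. cmod V \<Longrightarrow> fam_at F V = fam_at G V) \<Longrightarrow> F = G"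
  by (transfer) (metis (full_types) ext)

lemma comp_emb_other: "cmod W \<Longrightarrow> W \<noteq> V \<Longrightarrow> fam_at (emb V x) W = \<zero>\<^bsub>W\<^esub>"
  by (transfer) auto

lemma emb_add:
  assumes "cmod V" "x \<in> carrier V" "y \<in> carrier V"
  shows "emb V (x \<oplus>\<^bsub>V\<^esub> y) = emb V x + emb V y"
proof (rule vfam_eqI)
  fix W :: "(complex, 'a) module" assume W: "cmod W"
  interpret W: Module.module complex_ring W by fact
  interpret V: Module.module complex_ring V by fact
  show "fam_at (emb V (x \<oplus>\<^bsub>V\<^esub> y)) W = fam_at (emb V x + emb V y) W"
    using assms W by (cases "W = V") (auto simp: comp_simps comp_emb_other)
qed

lemma emb_scale:
  assumes "cmod V" "x \<in> carrier V"
  shows "emb V (z \<odot>\<^bsub>V\<^esub> x) = z *\<^sub>v emb V x"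
proof (rule vfam_eqI)
  fix W :: "(complex, 'a) module" assume W: "cmod W"
  interpret W: Module.module complex_ring W by fact
  interpret V: Module.module complex_ring V by fact
  show "fam_at (emb V (z \<odot>\<^bsub>V\<^esub> x)) W = fam_at (z *\<^sub>v emb V x) W"
    using assms W by (cases "W = V") (auto simp: comp_simps comp_emb_other)
qed

lemma emb_zero: "cmod V \<Longrightarrow> emb V \<zero>\<^bsub>V\<^esub> = 0"
  by (metis emb_scale scaleC_zero_left Module.module.smult_l_null complex_ring_simps(5)
      Module.module_def abelian_group.axioms(1) abelian_monoid.zero_closed)

lemma emb_minus: "cmod V \<Longrightarrow> x \<in> carrier V \<Longrightarrow> emb V (\<ominus>\<^bsub>V\<^esub> x) = - emb V x"
  by (metis add.inverse_unique emb_add emb_zero Module.module_def abelian_group.a_inv_closed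
      abelian_group.r_neg)

lemma emb_inj: "cmod V \<Longrightarrow> x \<in> carrier V \<Longrightarrow> y \<in> carrier V \<Longrightarrow> emb V x = emb V y \<Longrightarrow> x = y"
  by (metis comp_emb)

lemma emb_finsum:
  assumes "cmod V" "finite A" "\<And>a. a \<in> A \<Longrightarrow> f a \<in> carrier V"
  shows "emb V (finsum V f A) = (\<Sum>a\<in>A. emb V (f a))"
proof -
  interpret Module.module complex_ring V by fact
  show ?thesis using assms(2,3)
    by (induction A) (auto simp: assms(1) emb_zero Pi_def emb_add)
qed

section \<open>Linear extension from a basis\<close>

instantiation complex :: cvector
begin
definition scaleC_complex :: "complex \<Rightarrow> complex \<Rightarrow> complex" where "scaleC_complex = (*)"
instance by standard (simp_all add: scaleC_complex_def algebra_simps)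
end

instantiation poly_mapping :: (type, cvector) cvector
begin
lift_definition scaleC_poly_mapping :: "complex \<Rightarrow> ('a \<Rightarrow>\<^sub>0 'b) \<Rightarrow> ('a \<Rightarrow>\<^sub>0 'b)"
  is "\<lambda>z f k. z *\<^sub>v f k"
  by (erule finite_subset[rotated]) auto
instance
  by standard (transfer, simp add: fun_eq_iff scaleC_add_right scaleC_add_left scaleC_scaleC scaleC_one)+
end

lemma lookup_scaleC: "Poly_Mapping.lookup (z *\<^sub>v p) k = z *\<^sub>v Poly_Mapping.lookup p k"
  by transfer simp

lemma lookup_scaleC_complex [simp]:
  "Poly_Mapping.lookup (z *\<^sub>v p) k = z * Poly_Mapping.lookup p k"
  by (simp add: lookup_scaleC scaleC_complex_def)

lemma cscale_eq: "z *\<^sub>c p = z *\<^sub>v p"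
  by (rule poly_mapping_eqI) (simp add: cscale_def Poly_Mapping.map.rep_eq when_def)

text \<open>The same formula as \<open>lin_ext\<close>, but with values in an arbitrary vector space
  of the class. It serves for operators on the tensor power, for maps out of the space of pairs, and
  for homomorphisms out of free algebras.\<close>

definition lext :: "('b \<Rightarrow> 'v::cvector) \<Rightarrow> ('b \<Rightarrow>\<^sub>0 complex) \<Rightarrow> 'v" where
  "lext f p = (\<Sum>b\<in>Poly_Mapping.keys p. Poly_Mapping.lookup p b *\<^sub>v f b)"

lemma lin_ext_eq: "lin_ext f = lext f"
  by (simp add: fun_eq_iff lin_ext_def lext_def cscale_eq)

text \<open>Coefficients vanish off the support, so the sums for p, q and p + q can be taken over
  one common finite set; additivity rests on this.\<close>

lemma lext_superset:
  "finite A \<Longrightarrow> Poly_Mapping.keys p \<subseteq> A \<Longrightarrow> lext f p = (\<Sum>b\<in>A. Poly_Mapping.lookup p b *\<^sub>v f b)"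
  unfolding lext_def by (rule sum.mono_neutral_left) (auto simp: in_keys_iff)

lemma lext_add: "lext f (p + q) = lext f p + lext f q"
  using keys_add[of p q]
  by (subst (1 2 3) lext_superset[of "Poly_Mapping.keys p \<union> Poly_Mapping.keys q"])
    (auto simp: lookup_add scaleC_add_left sum.distrib)

lemma lext_scale: "lext f (z *\<^sub>v p) = z *\<^sub>v lext f p"
  by (subst (1 2) lext_superset[of "Poly_Mapping.keys p"])
    (auto simp: scaleC_sum_right scaleC_scaleC in_keys_iff)

lemma lext_single: "lext f (Poly_Mapping.single b z) = z *\<^sub>v f b"
  by (cases "z = 0") (simp_all add: lext_def)

lemma lext_zero [simp]: "lext f 0 = 0"
  by (simp add: lext_def)

lemma lext_minus: "lext f (- p) = - lext f p"
  by (metis lext_scale scaleC_minus_left scaleC_one)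

lemma lext_diff: "lext f (p - q) = lext f p - lext f q"
  using lext_add[of f p "- q"] by (simp add: lext_minus)

lemma lext_sum: "lext f (sum g A) = (\<Sum>x\<in>A. lext f (g x))"
  by (induction A rule: infinite_finite_induct) (simp_all add: lext_add)

lemma poly_mapping_sum_basis:
  "(p :: 'b \<Rightarrow>\<^sub>0 complex)
     = (\<Sum>b\<in>Poly_Mapping.keys p. Poly_Mapping.lookup p b *\<^sub>v Poly_Mapping.single b 1)"
  by (rule poly_mapping_eqI)
    (auto simp: lookup_sum lookup_single when_def in_keys_iff sum.If_cases if_distrib[of "(*) _"] cong: if_cong)

lemma keys_scaleC: "Poly_Mapping.keys (z *\<^sub>v (p :: 'b \<Rightarrow>\<^sub>0 complex)) \<subseteq> Poly_Mapping.keys p"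
  by (auto simp: in_keys_iff)

lemma keys_sum_subset:
  "(\<And>x. x \<in> A \<Longrightarrow> Poly_Mapping.keys (f x) \<subseteq> B) \<Longrightarrow> Poly_Mapping.keys (sum f A) \<subseteq> B"
proof (induction A rule: infinite_finite_induct)
  case (insert x A)
  then show ?case using keys_add[of "f x" "sum f A"] by auto
qed auto

lemma keys_lext:
  "(\<And>b. b \<in> Poly_Mapping.keys p \<Longrightarrow> Poly_Mapping.keys (f b) \<subseteq> B) \<Longrightarrow>
   Poly_Mapping.keys (lext f p :: 'd \<Rightarrow>\<^sub>0 complex) \<subseteq> B"
  unfolding lext_def by (rule keys_sum_subset) (meson keys_scaleC order_trans)

lemma lin_basis_eqI:
  fixes f g :: "('b \<Rightarrow>\<^sub>0 complex) lin"
  assumes "\<And>b. app f (Poly_Mapping.single b 1) = app g (Poly_Mapping.single b 1)"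
  shows "f = g"
proof (rule lin_eqI)
  fix v
  show "app f v = app g v"
    by (subst (1 2) poly_mapping_sum_basis) (simp add: app_sum app_scale assms)
qed

section \<open>The matrix units and the symmetric group on the tensor power\<close>

text \<open>The exponent of the Koszul sign picked up by an odd operator on its way to position
  \<open>k\<close>. It stays a natural number; only its residue modulo 2 matters.\<close>

definition par_before :: "nat \<Rightarrow> (nat \<Rightarrow> nat) \<Rightarrow> nat \<Rightarrow> nat" where
  "par_before m w k = (\<Sum>j=1..<k. parity m (w j))"

definition EV :: "nat \<Rightarrow> nat \<Rightarrow> nat \<Rightarrow> nat \<Rightarrow> tpow lin" where
  "EV m k a b = Lin (E_at m k a b)"

lemma app_Lin_lext: "app (Lin (lext f)) = lext f"
  by (rule Lin_inverse) (simp add: lext_add lext_scale)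

lemma app_EV: "app (EV m k a b) = E_at m k a b"
  by (simp add: EV_def E_at_def lin_ext_eq app_Lin_lext)

lemma EV_single: "app (EV m k a b) (Poly_Mapping.single w 1) =
  (if w k = b then (-1) ^ ((parity m a + parity m b) * par_before m w k) *\<^sub>v
     Poly_Mapping.single (w(k := a)) 1 else 0)"
  by (simp add: app_EV E_at_def lin_ext_eq lext_single scaleC_one cscale_eq par_before_def)

definition inversions :: "nat \<Rightarrow> (nat \<Rightarrow> nat) \<Rightarrow> (nat \<times> nat) set" where
  "inversions l \<sigma> = {(i, j). 1 \<le> i \<and> i < j \<and> j \<le> l \<and> \<sigma> j < \<sigma> i}"

definition perm_sign :: "nat \<Rightarrow> nat \<Rightarrow> (nat \<Rightarrow> nat) \<Rightarrow> (nat \<Rightarrow> nat) \<Rightarrow> complex" where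
  "perm_sign m l \<sigma> w = (\<Prod>(i, j)\<in>inversions l \<sigma>. (-1) ^ (parity m (w i) * parity m (w j)))"

definition PV :: "nat \<Rightarrow> nat \<Rightarrow> (nat \<Rightarrow> nat) \<Rightarrow> tpow lin" where
  "PV m l \<sigma> = Lin (perm_act m l \<sigma>)"

lemma app_PV: "app (PV m l \<sigma>) = perm_act m l \<sigma>"
  by (simp add: PV_def perm_act_def lin_ext_eq app_Lin_lext)

lemma PV_single: "app (PV m l \<sigma>) (Poly_Mapping.single w 1) =
  perm_sign m l \<sigma> w *\<^sub>v Poly_Mapping.single (w \<circ> Hilbert_Choice.inv \<sigma>) 1"
  by (simp add: app_PV perm_act_def lin_ext_eq lext_single scaleC_one cscale_eq perm_sign_def
      inversions_def)

text \<open>The sign (-1)^(|E_{a,b}| |E_{c,d}|) of exchanging two matrix units.\<close>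

definition eps :: "nat \<Rightarrow> nat \<Rightarrow> nat \<Rightarrow> nat \<Rightarrow> nat \<Rightarrow> complex" where
  "eps m a b c d = (-1) ^ ((parity m a + parity m b) * (parity m c + parity m d))"

lemma parity_cases: "parity m a = 0 \<or> parity m a = 1"
  by (simp add: parity_def)

text \<open>All comparisons of Koszul signs reduce to this: the exponents need to agree only modulo
  2.\<close>

lemma neg_one_power_eqI: "even (x + y) \<Longrightarrow> (-1 :: complex) ^ x = (-1) ^ y"
  by (cases "even x") (auto simp: minus_one_power_iff)

lemma EV_mult_same: "EV m p a b * EV m p c d = (if b = c then EV m p a d else 0)"
proof (rule lin_basis_eqI)
  fix w
  have [simp]: "par_before m (w(p := c)) p = par_before m w p" for w c
    by (simp add: par_before_def)
  show "app (EV m p a b * EV m p c d) (Poly_Mapping.single w 1) =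
    app (if b = c then EV m p a d else 0) (Poly_Mapping.single w 1)"
  proof (cases "b = c \<and> w p = d")
    case True
    define P where "P = par_before m w p"
    have "(-1 :: complex) ^ ((parity m c + parity m d) * P + (parity m a + parity m b) * P)
      = (-1) ^ ((parity m a + parity m d) * P)"
      using True by (intro neg_one_power_eqI) auto
    then show ?thesis
      using True by (simp add: app_simps EV_single app_scale scaleC_scaleC P_def[symmetric] power_add
          mult_ac)
  qed (auto simp: app_simps EV_single app_scale)
qed

lemma par_before_upd:
  assumes "1 \<le> p"
  shows "q \<le> p \<Longrightarrow> par_before m (w(p := a)) q = par_before m w q"
    and "p < q \<Longrightarrow> par_before m w q =
      par_before m w p + parity m (w p) + (\<Sum>j\<in>{p<..<q}. parity m (w j))"
    and "p < q \<Longrightarrow> (\<Sum>j\<in>{p<..<q}. parity m ((w(p := a)) j)) = (\<Sum>j\<in>{p<..<q}. parity m (w j))"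
    and "p < q \<Longrightarrow> (\<Sum>j\<in>{p<..<q}. parity m ((w(q := a)) j)) = (\<Sum>j\<in>{p<..<q}. parity m (w j))"
proof -
  show "q \<le> p \<Longrightarrow> par_before m (w(p := a)) q = par_before m w q"
    by (auto simp: par_before_def intro!: sum.cong)
  show "p < q \<Longrightarrow> par_before m w q =
      par_before m w p + parity m (w p) + (\<Sum>j\<in>{p<..<q}. parity m (w j))"
  proof -
    assume "p < q"
    then have "{1..<q} = insert p {1..<p} \<union> {p<..<q}" using assms by auto
    then have "par_before m w q = (\<Sum>j\<in>insert p {1..<p}. parity m (w j)) + (\<Sum>j\<in>{p<..<q}. parity m (w j))"
      unfolding par_before_def using \<open>p < q\<close> by (subst sum.union_disjoint[symmetric]) auto
    then show ?thesis
      by (simp add: par_before_def)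
  qed
qed (auto intro!: sum.cong)

text \<open>The operator at \<open>p\<close> is unaffected by what happens at the later position
  \<open>q\<close>, whereas the one at \<open>q\<close> passes a factor whose parity has changed by
  |a| + |b|. This single change accounts for \<open>eps\<close>.\<close>

lemma EV_comm_less:
  assumes "1 \<le> p" "p < q"
  shows "EV m p a b * EV m q c d = eps m a b c d *\<^sub>v (EV m q c d * EV m p a b)"
proof (rule lin_basis_eqI)
  fix w
  define P Q where "P = par_before m w p" and "Q = (\<Sum>j\<in>{p<..<q}. parity m (w j))"
  have 1: "par_before m w q = P + parity m (w p) + Q"
    using par_before_upd(2)[OF assms(1), of q] assms(2) by (simp add: P_def Q_def)
  have 2: "par_before m (w(p := a)) q = P + parity m a + Q"
    using par_before_upd(2)[OF assms(1), of q "m" "w(p := a)"] assms(2) 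
      par_before_upd(1)[OF assms(1), of p m w a]
      par_before_upd(3)[OF assms(1), of q m w a]
    by (simp add: P_def Q_def)
  have 3: "par_before m (w(q := c)) p = P"
    using par_before_upd(1)[of q p m w c] assms by (simp add: P_def)
  have 4: "w(p := a, q := c) = w(q := c, p := a)"
    using assms by (auto simp: fun_eq_iff)
  show "app (EV m p a b * EV m q c d) (Poly_Mapping.single w 1) =
    app (eps m a b c d *\<^sub>v (EV m q c d * EV m p a b)) (Poly_Mapping.single w 1)"
  proof (cases "w p = b \<and> w q = d")
    case True
    have "(-1 :: complex) ^ ((parity m c + parity m d) * (P + parity m b + Q)
        + (parity m a + parity m b) * P)
      = (-1) ^ ((parity m a + parity m b) * (parity m c + parity m d)
        + (parity m a + parity m b) * P + (parity m c + parity m d) * (P + parity m a + Q))"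
      by (rule neg_one_power_eqI) auto
    then show ?thesis
      using True assms by (simp add: app_simps EV_single app_scale scaleC_scaleC 1 2 3 4 eps_def
          P_def[symmetric] power_add mult_ac)
  qed (use assms in \<open>auto simp: app_simps EV_single app_scale\<close>)
qed

lemma eps_sq [simp]: "eps m a b c d * eps m a b c d = 1"
  by (simp add: eps_def flip: power_add)

lemma eps_sym: "eps m a b c d = eps m c d a b"
  by (simp add: eps_def mult.commute)

lemma EV_comm:
  assumes "1 \<le> p" "1 \<le> q" "p \<noteq> q"
  shows "EV m p a b * EV m q c d = eps m a b c d *\<^sub>v (EV m q c d * EV m p a b)"
proof (cases "p < q")
  case False
  then have "EV m q c d * EV m p a b = eps m c d a b *\<^sub>v (EV m p a b * EV m q c d)"
    using assms by (intro EV_comm_less) auto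
  then show ?thesis
    by (simp add: scaleC_scaleC eps_sym[of m a b] scaleC_one)
qed (use assms EV_comm_less in auto)

text \<open>Bookkeeping of Koszul signs. The unit at \<open>p\<close> passes the odd factors before
  \<open>p\<close> (\<open>S1\<close>). Changing the factor at \<open>p\<close> alters the sign of
  the permutation once for each odd factor in an inversion with \<open>p\<close>: later factors that
  overtake it (\<open>S2\<close>) and earlier ones that fall behind (\<open>S3\<close>). Afterwards
  the factors in front of \<sigma>(p) have parity \<open>S4\<close> = S1 - S3 + S2, so both sides
  agree modulo 2.\<close>

lemma PV_EV:
  assumes "\<sigma> permutes {1..l}" "p \<in> {1..l}"
  shows "PV m l \<sigma> * EV m p a b = EV m (\<sigma> p) a b * PV m l \<sigma>"
proof (rule lin_basis_eqI)
  fix w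
  define x where "x i = parity m (w i)" for i :: nat
  define d where "d = parity m a + parity m b"
  define S1 where "S1 = (\<Sum>i\<in>{1..l}. if i < p then x i else 0)"
  define S2 where "S2 = (\<Sum>i\<in>{1..l}. if p < i \<and> \<sigma> i < \<sigma> p then x i else 0)"
  define S3 where "S3 = (\<Sum>i\<in>{1..l}. if i < p \<and> \<sigma> p < \<sigma> i then x i else 0)"
  define S4 where "S4 = (\<Sum>i\<in>{1..l}. if \<sigma> i < \<sigma> p then x i else 0)"
  note inj = permutes_inj[OF assms(1)]
  have sum_eq: "S1 + S2 + S3 = S4 + 2 * S3"
  proof -
    have "S1 + S2 + S3 = (\<Sum>i\<in>{1..l}. (if i < p then x i else 0)
        + (if p < i \<and> \<sigma> i < \<sigma> p then x i else 0) + (if i < p \<and> \<sigma> p < \<sigma> i then x i else 0))"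
      by (simp add: S1_def S2_def S3_def sum.distrib)
    also have "\<dots> = (\<Sum>i\<in>{1..l}. (if \<sigma> i < \<sigma> p then x i else 0)
        + 2 * (if i < p \<and> \<sigma> p < \<sigma> i then x i else 0))"
      using inj by (intro sum.cong refl) (auto dest: injD simp: not_less_iff_gr_or_eq)
    also have "\<dots> = S4 + 2 * S3"
      by (simp add: S4_def S3_def sum.distrib sum_distrib_left)
    finally show ?thesis .
  qed
  have before: "par_before m w p = S1"
  proof -
    have "S1 = (\<Sum>i\<in>{1..<p}. x i)"
      unfolding S1_def using assms(2) by (subst sum.inter_filter[symmetric]) (auto intro!: sum.cong)
    then show ?thesis by (simp add: par_before_def x_def)
  qed
  have before': "par_before m (w \<circ> Hilbert_Choice.inv \<sigma>) (\<sigma> p) = S4"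
  proof -
    have \<sigma>p: "\<sigma> p \<in> {1..l}" using permutes_in_image[OF assms(1)] assms(2) by blast
    have "S4 = (\<Sum>i\<in>{1..l}. if i < \<sigma> p then x (Hilbert_Choice.inv \<sigma> i) else 0)"
      unfolding S4_def
      using sum.reindex_bij_betw[OF permutes_imp_bij[OF assms(1)],
          of "\<lambda>i. if i < \<sigma> p then x (Hilbert_Choice.inv \<sigma> i) else 0"]
      by (simp add: inv_f_f[OF inj] cong: if_cong)
    also have "\<dots> = (\<Sum>i\<in>{1..<\<sigma> p}. x (Hilbert_Choice.inv \<sigma> i))"
      using \<sigma>p by (subst sum.inter_filter[symmetric]) (auto intro!: sum.cong)
    finally show ?thesis by (simp add: par_before_def x_def)
  qed
  have sign: "perm_sign m l \<sigma> (w(p := a)) = perm_sign m l \<sigma> w * (-1) ^ (d * (S2 + S3))"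
    if "w p = b"
  proof -
    \<comment> \<open>The parity of the partner of \<open>p\<close> if \<open>p\<close> belongs to
      the pair, and 0 otherwise: modulo 2 the exponent of the pair changes by
      \<open>d * h i j\<close>.\<close>
    define h where "h i j = (if i = p then x j else 0) + (if j = p then x i else 0)" for i j
    have "perm_sign m l \<sigma> (w(p := a))
      = (\<Prod>(i, j)\<in>inversions l \<sigma>. (-1) ^ (x i * x j) * (-1) ^ (d * h i j))"
      unfolding perm_sign_def
    proof (intro prod.cong refl, clarify)
      fix i j assume "(i, j) \<in> inversions l \<sigma>"
      then have "i \<noteq> j" by (auto simp: inversions_def)
      then show "(-1 :: complex) ^ (parity m ((w(p := a)) i) * parity m ((w(p := a)) j))
        = (-1) ^ (x i * x j) * (-1) ^ (d * h i j)"
        using that parity_cases[of m a] parity_cases[of m b] parity_cases[of m "w i"]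
          parity_cases[of m "w j"]
        by (auto simp: x_def h_def d_def)
    qed
    also have "\<dots> = perm_sign m l \<sigma> w * (-1) ^ (\<Sum>(i, j)\<in>inversions l \<sigma>. d * h i j)"
      by (simp add: perm_sign_def x_def case_prod_beta prod.distrib power_sum)
    also have "(\<Sum>(i, j)\<in>inversions l \<sigma>. d * h i j) = d * (\<Sum>(i, j)\<in>inversions l \<sigma>. h i j)"
      by (simp add: sum_distrib_left case_prod_beta)
    also have "(\<Sum>(i, j)\<in>inversions l \<sigma>. h i j)
      = (\<Sum>(i, j)\<in>{1..l} \<times> {1..l}. if i < j \<and> \<sigma> j < \<sigma> i then h i j else 0)"
      unfolding case_prod_beta
      by (subst sum.inter_filter[symmetric]) (auto simp: inversions_def intro!: sum.cong)
    also have "\<dots> = (\<Sum>i\<in>{1..l}. \<Sum>j\<in>{1..l}. if i < j \<and> \<sigma> j < \<sigma> i then h i j else 0)"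
      by (simp add: sum.cartesian_product)
    also have "\<dots> = (\<Sum>i\<in>{1..l}. \<Sum>j\<in>{1..l}. (if i = p then if p < j \<and> \<sigma> j < \<sigma> p then x j else 0 else 0)
        + (if j = p then if i < p \<and> \<sigma> p < \<sigma> i then x i else 0 else 0))"
      by (intro sum.cong refl) (auto simp: h_def)
    also have "\<dots> = S2 + S3"
      using assms(2) unfolding sum.distrib
      by (subst sum.swap) (simp add: S2_def S3_def)
    finally show ?thesis .
  qed
  have upd: "w(p := a) \<circ> Hilbert_Choice.inv \<sigma> = (w \<circ> Hilbert_Choice.inv \<sigma>)(\<sigma> p := a)"
    using permutes_inverses[OF assms(1)] by (auto simp: fun_eq_iff)
  have at: "(w \<circ> Hilbert_Choice.inv \<sigma>) (\<sigma> p) = w p"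
    using permutes_inverses[OF assms(1)] by simp
  have "(-1 :: complex) ^ (d * S1) * (-1) ^ (d * (S2 + S3)) = (-1) ^ (d * S4)"
  proof -
    have "d * S1 + d * (S2 + S3) = d * S4 + 2 * (d * S3)"
      using arg_cong[OF sum_eq, of "(*) d"] by (simp add: algebra_simps)
    then show ?thesis by (simp flip: power_add) (simp add: power_add power_mult)
  qed
  then show "app (PV m l \<sigma> * EV m p a b) (Poly_Mapping.single w 1) =
    app (EV m (\<sigma> p) a b * PV m l \<sigma>) (Poly_Mapping.single w 1)"
    using at by (auto simp: app_simps EV_single PV_single app_scale scaleC_scaleC before before' sign
        upd d_def[symmetric] mult_ac)
qed

text \<open>The superpermutation of two factors is the sum over x, y of (-1)^|y| E_{x,y} in the
  first and E_{y,x} in the second. Multiplying it with E_{a,b} and E_{c,d} leaves only the term x =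
  c, y = a; the two factors of \<open>eta\<close> are (-1)^|a| and the sign of moving E_{a,c} past
  E_{a,b}.\<close>

definition eta :: "nat \<Rightarrow> nat \<Rightarrow> nat \<Rightarrow> nat \<Rightarrow> complex" where
  "eta m a b c = psign m a * (-1) ^ ((parity m a + parity m c) * (parity m a + parity m b))"

text \<open>The inversions of the transposition are (p, q) itself and, for each j strictly between,
  the pairs (p, j) and (j, q).\<close>

lemma perm_sign_transpose:
  assumes "1 \<le> p" "p < q" "q \<le> l"
  shows "perm_sign m l (Transposition.transpose p q) w
    = (-1) ^ (parity m (w p) * parity m (w q)
        + (parity m (w p) + parity m (w q)) * (\<Sum>j\<in>{p<..<q}. parity m (w j)))"
proof -
  define f :: "nat \<times> nat \<Rightarrow> complex" where "f = (\<lambda>(i, j). (-1) ^ (parity m (w i) * parity m (w j)))"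
  have inv: "inversions l (Transposition.transpose p q)
    = insert (p, q) ((\<lambda>j. (p, j)) ` {p<..<q} \<union> (\<lambda>j. (j, q)) ` {p<..<q})"
    using assms by (auto simp: inversions_def Transposition.transpose_def image_iff split: if_splits)
  have "perm_sign m l (Transposition.transpose p q) w
    = f (p, q) * (prod f ((\<lambda>j. (p, j)) ` {p<..<q}) * prod f ((\<lambda>j. (j, q)) ` {p<..<q}))"
    unfolding perm_sign_def inv f_def[symmetric]
    by (subst prod.insert, simp, force, subst prod.union_disjoint) auto
  also have "prod f ((\<lambda>j. (p, j)) ` {p<..<q}) = (-1) ^ (\<Sum>j\<in>{p<..<q}. parity m (w p) * parity m (w j))"
    by (subst prod.reindex) (auto simp: inj_on_def f_def power_sum)
  also have "prod f ((\<lambda>j. (j, q)) ` {p<..<q}) = (-1) ^ (\<Sum>j\<in>{p<..<q}. parity m (w j) * parity m (w q))"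
    by (subst prod.reindex) (auto simp: inj_on_def f_def power_sum)
  finally show ?thesis
    by (simp add: f_def sum_distrib_left sum.distrib power_add distrib_right distrib_left mult_ac)
qed

lemma PV_EV_EV_less:
  assumes "1 \<le> p" "p < q" "q \<le> l"
  shows "PV m l (Transposition.transpose p q) * (EV m p a b * EV m q c d)
    = eta m a b c *\<^sub>v (EV m p c b * EV m q a d)"
proof (rule lin_basis_eqI)
  fix w
  define P Q where "P = par_before m w p" and "Q = (\<Sum>j\<in>{p<..<q}. parity m (w j))"
  have 1: "par_before m w q = P + parity m (w p) + Q"
    using par_before_upd(2)[OF assms(1), of q] assms(2) by (simp add: P_def Q_def)
  have 2: "par_before m (w(q := c)) p = P" for c
    using par_before_upd(1)[of q p m w c] assms by (simp add: P_def)
  have 3: "w(q := c, p := a) \<circ> Transposition.transpose p q = w(q := a, p := c)"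
    using assms by (auto simp: fun_eq_iff Transposition.transpose_def)
  have 4: "(\<Sum>j\<in>{p<..<q}. parity m ((w(q := c, p := a)) j)) = Q"
    unfolding Q_def by (intro sum.cong) auto
  show "app (PV m l (Transposition.transpose p q) * (EV m p a b * EV m q c d)) (Poly_Mapping.single w 1)
    = app (eta m a b c *\<^sub>v (EV m p c b * EV m q a d)) (Poly_Mapping.single w 1)"
  proof (cases "w p = b \<and> w q = d")
    case True
    have "(-1 :: complex) ^ ((parity m c + parity m d) * (P + parity m b + Q)
        + (parity m a + parity m b) * P + (parity m a * parity m c + (parity m a + parity m c) * Q))
      = (-1) ^ (parity m a + (parity m a + parity m c) * (parity m a + parity m b)
        + (parity m a + parity m d) * (P + parity m b + Q) + (parity m c + parity m b) * P)"
      by (rule neg_one_power_eqI) auto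
    then show ?thesis
      using True assms by (simp add: app_simps EV_single app_scale scaleC_scaleC 1 2 3 4 eta_def
          psign_def PV_single perm_sign_transpose[OF assms] P_def[symmetric] Q_def[symmetric] power_add
          mult_ac)
  qed (use assms in \<open>auto simp: app_simps EV_single app_scale\<close>)
qed

lemma PV_EV_EV:
  assumes "p \<in> {1..l}" "q \<in> {1..l}" "p \<noteq> q"
  shows "PV m l (Transposition.transpose p q) * (EV m p a b * EV m q c d)
    = eta m a b c *\<^sub>v (EV m p c b * EV m q a d)"
proof (cases "p < q")
  case False
  then have "PV m l (Transposition.transpose p q) * (EV m p a b * EV m q c d)
     = eps m a b c d *\<^sub>v (PV m l (Transposition.transpose q p) * (EV m q c d * EV m p a b))"
    using assms by (subst EV_comm) (auto simp: mult_scaleC_right transpose_commute)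
  also have "\<dots> = eps m a b c d *\<^sub>v (eta m c d a *\<^sub>v (EV m q a d * EV m p c b))"
    using assms False by (subst PV_EV_EV_less) auto
  also have "\<dots> = (eps m a b c d * eta m c d a * eps m a d c b) *\<^sub>v (EV m p c b * EV m q a d)"
    using EV_comm[of q p m a d c b] assms by (simp add: scaleC_scaleC mult.assoc)
  \<comment> \<open>For q < p the matrix units are exchanged before and after applying the ordered
    case. The resulting signs are compared by running through all parities.\<close>
  also have "eps m a b c d * eta m c d a * eps m a d c b = eta m a b c"
    using parity_cases[of m a] parity_cases[of m b] parity_cases[of m c] parity_cases[of m d]
    by (auto simp: eps_def eta_def psign_def)
  finally show ?thesis .
qed (use assms PV_EV_EV_less in auto)

abbreviation TV :: "nat \<Rightarrow> nat \<Rightarrow> nat \<Rightarrow> tpow set" where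
  "TV m n l \<equiv> carrier (tensor_power m n l)"

lemma TV_iff: "v \<in> TV m n l \<longleftrightarrow> Poly_Mapping.keys v \<subseteq> multi_indices (m + n) l"
  by (simp add: tensor_power_def free_space_def)

lemma TV_zero: "0 \<in> TV m n l"
  and TV_add: "u \<in> TV m n l \<Longrightarrow> v \<in> TV m n l \<Longrightarrow> u + v \<in> TV m n l"
  and TV_scale: "v \<in> TV m n l \<Longrightarrow> z *\<^sub>v v \<in> TV m n l"
  and TV_sum: "(\<And>x. x \<in> A \<Longrightarrow> f x \<in> TV m n l) \<Longrightarrow> sum f A \<in> TV m n l"
  using keys_add[of u v] keys_scaleC[of z v] keys_sum_subset[of A f "multi_indices (m + n) l"]
  by (auto simp: TV_iff)

lemma multi_indices_upd:
  "w \<in> multi_indices N l \<Longrightarrow> p \<in> {1..l} \<Longrightarrow> a \<in> {1..N} \<Longrightarrow> w(p := a) \<in> multi_indices N l"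
  by (auto simp: multi_indices_def PiE_def extensional_def)

lemma EV_closed:
  assumes "v \<in> TV m n l" "p \<in> {1..l}" "a \<in> {1..m + n}"
  shows "app (EV m p a b) v \<in> TV m n l"
  using assms(1) unfolding TV_iff app_EV E_at_def lin_ext_eq
proof (intro keys_lext)
  fix w assume "w \<in> Poly_Mapping.keys v" "Poly_Mapping.keys v \<subseteq> multi_indices (m + n) l"
  then have "w(p := a) \<in> multi_indices (m + n) l"
    using assms by (intro multi_indices_upd) auto
  then show "Poly_Mapping.keys (if w k = b
     then (-1) ^ ((parity m a + parity m b) * (\<Sum>j=1..<p. parity m (w j)))
            *\<^sub>c Poly_Mapping.single (w(p := a)) 1
     else 0) \<subseteq> multi_indices (m + n) l" for k
    by (auto simp: cscale_eq dest!: keys_scaleC[THEN subsetD])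
qed

lemma PV_closed:
  assumes "v \<in> TV m n l" "\<sigma> permutes {1..l}"
  shows "app (PV m l \<sigma>) v \<in> TV m n l"
  using assms(1) unfolding TV_iff app_PV perm_act_def lin_ext_eq
proof (intro keys_lext)
  fix w assume "w \<in> Poly_Mapping.keys v" and sub: "Poly_Mapping.keys v \<subseteq> multi_indices (m + n) l"
  then have w: "w \<in> multi_indices (m + n) l" by auto
  have inv: "Hilbert_Choice.inv \<sigma> permutes {1..l}" using assms(2) by (rule permutes_inv)
  have "w \<circ> Hilbert_Choice.inv \<sigma> \<in> multi_indices (m + n) l"
  proof -
    have "Hilbert_Choice.inv \<sigma> i \<in> {1..l}" if "i \<in> {1..l}" for i
      using permutes_in_image[OF inv] that by blast
    moreover have "w (Hilbert_Choice.inv \<sigma> i) = undefined" if "i \<notin> {1..l}" for i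
      using permutes_not_in[OF inv that] w that by (auto simp: multi_indices_def PiE_def extensional_def)
    ultimately show ?thesis
      using w unfolding multi_indices_def by (intro PiE_I) auto
  qed
  then show "Poly_Mapping.keys
       ((\<Prod>(i, j)\<in>{(i, j). 1 \<le> i \<and> i < j \<and> j \<le> l \<and> \<sigma> j < \<sigma> i}. (- 1) ^ (parity m (w i) * parity m (w j)))
          *\<^sub>c Poly_Mapping.single (w \<circ> Hilbert_Choice.inv \<sigma>) 1) \<subseteq> multi_indices (m + n) l"
    by (auto simp: cscale_eq dest!: keys_scaleC[THEN subsetD])
qed

text \<open>Resolution of the identity at position \<open>p\<close>; it holds on the tensor power
  only, where the letter at \<open>p\<close> lies in 1..m+n. Inserting it lets a transposition act
  on a single matrix unit through \<open>PV_EV_EV\<close>.\<close>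

lemma sum_EV_diag:
  assumes "v \<in> TV m n l" "p \<in> {1..l}"
  shows "(\<Sum>a\<in>{1..m + n}. app (EV m p a a) v) = v"
proof -
  have "(\<Sum>a\<in>{1..m + n}. app (EV m p a a) (Poly_Mapping.single w 1)) = Poly_Mapping.single w 1"
    if "w \<in> multi_indices (m + n) l" for w
  proof -
    have "w p \<in> {1..m + n}" using that assms(2) by (auto simp: multi_indices_def)
    then show ?thesis
      by (simp add: EV_single scaleC_one fun_upd_idem power_mult flip: mult_2 cong: if_cong)
  qed
  then have *: "(\<Sum>a\<in>{1..m + n}. app (EV m p a a) (Poly_Mapping.single w 1)) = Poly_Mapping.single w 1"
    if "w \<in> Poly_Mapping.keys v" for w
    using that assms(1) unfolding TV_iff by blast
  have "(\<Sum>a\<in>{1..m + n}. app (EV m p a a) v)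
    = app (\<Sum>a\<in>{1..m + n}. EV m p a a) (\<Sum>w\<in>Poly_Mapping.keys v. Poly_Mapping.lookup v w *\<^sub>v Poly_Mapping.single w 1)"
    by (simp add: app_sum_left flip: poly_mapping_sum_basis)
  also have "\<dots> = (\<Sum>w\<in>Poly_Mapping.keys v. Poly_Mapping.lookup v w *\<^sub>v Poly_Mapping.single w 1)"
    unfolding app_sum by (intro sum.cong refl) (simp only: app_scale app_sum_left *)
  finally show ?thesis by (simp flip: poly_mapping_sum_basis)
qed

section \<open>Drinfeld generators from matrix units and degenerate Hecke operators\<close>

lemma psign_sq [simp]: "psign m a * psign m a = 1"
  by (simp add: psign_def flip: power_add)

lemma psign_sq_left [simp]: "psign m a * (psign m a * z) = z"
  by (simp flip: mult.assoc)

lemma eps_diag [simp]: "eps m a a c d = 1" "eps m a b c c = 1"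
  by (simp_all add: eps_def power_mult mult.commute[of "parity m a + parity m b"] flip: mult_2)

lemma eps_flip: "eps m b a c d = eps m a b c d" "eps m a b d c = eps m a b c d"
  by (simp_all add: eps_def add.commute)

lemma scaleC_half:
  "(z / 2) *\<^sub>v x + (z / 2) *\<^sub>v x = z *\<^sub>v x"
  "(z / 2) *\<^sub>v x + ((z / 2) *\<^sub>v x + y) = z *\<^sub>v x + y"
  by (simp_all flip: add.assoc scaleC_add_left)

lemma cm_prod_even: "w * w = 1 \<Longrightarrow> cm (x * y) z = x * sb w y z + w *\<^sub>v (sb w x z * y)"
  by (simp add: sb_mult_left[of 1 w w, symmetric] sb_one)

lemma sum_psign: "(\<Sum>a\<in>{1..m + n}. psign m a) = of_nat m - of_nat n"
proof -
  have "{1..m + n} = {1..m} \<union> {m + 1..m + n}" by auto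
  then have "(\<Sum>a\<in>{1..m + n}. psign m a) = (\<Sum>a\<in>{1..m}. psign m a) + (\<Sum>a\<in>{m + 1..m + n}. psign m a)"
    by (simp add: sum.union_disjoint)
  also have "(\<Sum>a\<in>{1..m}. psign m a) = (\<Sum>a\<in>{1..m}. 1)"
    by (intro sum.cong) (auto simp: psign_def parity_def)
  also have "(\<Sum>a\<in>{m + 1..m + n}. psign m a) = (\<Sum>a\<in>{m + 1..m + n}. - 1)"
    by (intro sum.cong) (auto simp: psign_def parity_def)
  finally show ?thesis by simp
qed

text \<open>The interface between the two halves of the proof. In the model, \<open>EE k a b\<close>
  is E_{a,b}[x^k], \<open>Z a b\<close> is E_{a,b}[x y], \<open>W\<close> is E_{N,1}[x y x] and
  \<open>W'\<close> is E_{1,N}[y] with N = m + n. The degree-one commutators of the diagonal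
  \<open>Z\<close> with the affine root vectors are listed separately: there z_p and x_p meet in the
  same tensor factor, which produces the t-terms and the supertrace terms.\<close>

locale gl_core =
  fixes m n :: nat and lam t beta :: complex
    and EE :: "int \<Rightarrow> nat \<Rightarrow> nat \<Rightarrow> 'a::calgebra" and Z :: "nat \<Rightarrow> nat \<Rightarrow> 'a" and W W' :: 'a
  assumes m2: "m \<ge> 2" and n2: "n \<ge> 2"
    and trace: "beta + t = (of_nat m - of_nat n) * lam / 2"
    and EE_EE: "\<lbrakk>{a, b, c, d} \<subseteq> {1..m + n}\<rbrakk> \<Longrightarrow> sb (eps m a b c d) (EE k a b) (EE j c d)
      = (if b = c then EE (k + j) a d else 0) - (if a = d then eps m a b c d *\<^sub>v EE (k + j) c b else 0)"
    and E_Z: "\<lbrakk>{a, b, c, d} \<subseteq> {1..m + n}\<rbrakk> \<Longrightarrow> sb (eps m a b c d) (EE 0 a b) (Z c d)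
      = (if b = c then Z a d else 0) - (if a = d then eps m a b c d *\<^sub>v Z c b else 0)"
    and Z_Z: "\<lbrakk>{a, b} \<subseteq> {1..m + n}; a \<noteq> b\<rbrakk> \<Longrightarrow>
      cm (Z a a) (Z b b) = (lam * psign m a) *\<^sub>v (Z b a * EE 0 a b - EE 0 b a * Z a b)"
    and Z_EE1: "\<lbrakk>{a, c, d} \<subseteq> {1..m + n}; a \<noteq> c; a \<noteq> d\<rbrakk> \<Longrightarrow>
      cm (Z a a) (EE 1 c d) = (lam * psign m a) *\<^sub>v (EE 1 c a * EE 0 a d - EE 1 c d)"
    and Z_EEm1: "\<lbrakk>{a, c, d} \<subseteq> {1..m + n}; a \<noteq> c; a \<noteq> d\<rbrakk> \<Longrightarrow>
      cm (Z a a) (EE (-1) c d) = - ((lam * psign m a) *\<^sub>v (EE 0 c a * EE (-1) a d - EE (-1) c d))"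
    and Z1_e0: "cm (Z 1 1) (EE 1 (m + n) 1)
      = - W + lam *\<^sub>v (EE 1 (m + n) 1 * EE 0 1 1 - EE 1 (m + n) 1)"
    and ZN_e0: "cm (Z (m + n) (m + n)) (EE 1 (m + n) 1)
      = W - t *\<^sub>v EE 1 (m + n) 1
        - lam *\<^sub>v ((\<Sum>a\<in>{1..m + n}. psign m a *\<^sub>v (EE 0 (m + n) a * EE 1 a 1))
                 - (of_nat m - of_nat n) *\<^sub>v EE 1 (m + n) 1)
        - lam *\<^sub>v (EE 1 (m + n) (m + n) * EE 0 (m + n) 1 - EE 1 (m + n) 1)"
    and Z1_f0: "cm (Z 1 1) (EE (-1) 1 (m + n))
      = W' - lam *\<^sub>v (EE 0 1 1 * EE (-1) 1 (m + n) - EE (-1) 1 (m + n))"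
    and ZN_f0: "cm (Z (m + n) (m + n)) (EE (-1) 1 (m + n))
      = - W' + t *\<^sub>v EE (-1) 1 (m + n)
        + lam *\<^sub>v ((\<Sum>a\<in>{1..m + n}. psign m a *\<^sub>v (EE (-1) 1 a * EE 0 a (m + n)))
                 - (of_nat m - of_nat n) *\<^sub>v EE (-1) 1 (m + n))
        + lam *\<^sub>v (EE 0 1 (m + n) * EE (-1) (m + n) (m + n) - EE (-1) 1 (m + n))"
    and W_f0: "W * EE (-1) 1 (m + n) + EE (-1) 1 (m + n) * W
      = Z (m + n) (m + n) + Z 1 1 + t *\<^sub>v EE 0 (m + n) (m + n)
        + lam *\<^sub>v ((\<Sum>a\<in>{1..m + n}. psign m a *\<^sub>v (EE 0 (m + n) a * EE 0 a (m + n)))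
                 - (of_nat m - of_nat n) *\<^sub>v EE 0 (m + n) (m + n))
        - lam *\<^sub>v (EE 0 1 1 * EE 0 (m + n) (m + n))"
begin

abbreviation "N \<equiv> m + n"
abbreviation "s \<equiv> psign m"
abbreviation "E \<equiv> EE 0"

text \<open>Chosen so that the condition on beta + t reads lam (m - n) = t + om. It measures how far
  the affine node is from looking the same from both of its ends.\<close>

definition "om = t + 2 * beta"

text \<open>Node \<open>i\<close> of the affine diagram joins the indices \<open>L i\<close> and
  \<open>i + 1\<close>, where index 0 is read as N. The loop degree \<open>kp\<close> is nonzero
  only at node 0. With these conventions all nodes are treated by the same formulas.\<close>

definition L :: "nat \<Rightarrow> nat" where "L i = (if i = 0 then N else i)"
definition kp :: "nat \<Rightarrow> int" where "kp i = (if i = 0 then 1 else 0)"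
definition e :: "nat \<Rightarrow> 'a" where "e i = EE (kp i) (L i) (i + 1)"
definition f :: "nat \<Rightarrow> 'a" where "f i = s i *\<^sub>v EE (- kp i) (i + 1) (L i)"
definition h :: "nat \<Rightarrow> 'a" where "h i = s i *\<^sub>v E (L i) (L i) - s (i + 1) *\<^sub>v E (i + 1) (i + 1)"

text \<open>The truncation k < a makes the D_a commute: the commutator of Z_aa with C_b for a < b
  cancels that of Z_aa with Z_bb. The term (lam / 2) E_aa^2 in \<open>D\<close> is what is left at
  each index when (lam / 2) h_i^2 is split off from H_{i,1}; hence the combination for the generator
  with the tilde is a difference of two D's.\<close>

definition C :: "nat \<Rightarrow> 'a" where "C a = (\<Sum>k\<in>{1..<a}. s k *\<^sub>v (E a k * E k a))"
definition D :: "nat \<Rightarrow> 'a" where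
  "D a = s a *\<^sub>v Z a a + (lam * s a) *\<^sub>v C a + (lam / 2) *\<^sub>v (E a a * E a a)"
text \<open>The off-diagonal companion of \<open>D\<close>: with truncation at \<open>a\<close> it
  arises, up to sign and a multiple of the root vector, as the commutator of D_a or D_{a+1} with a
  simple root vector.\<close>

definition Q :: "nat \<Rightarrow> nat \<Rightarrow> nat \<Rightarrow> 'a" where
  "Q j c d = Z c d + lam *\<^sub>v (\<Sum>k\<in>{1..j}. s k *\<^sub>v (E c k * E k d))"

text \<open>These become X_{i,1} of sign + and - after adding a multiple \<open>kc i\<close> of the
  root vector. The shift by \<open>om\<close> at node 0 is chosen so that the commutator with D_{L
  i} has the same form at every node; the discrepancy then appears only in the commutator with
  D_{i+1} at i = 0.\<close>

definition A :: "nat \<Rightarrow> 'a" where "A i = (if i = 0 then W + om *\<^sub>v e 0 else Q i i (i + 1))"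
definition B :: "nat \<Rightarrow> 'a" where "B i = (if i = 0 then - W' + om *\<^sub>v f 0 else s i *\<^sub>v Q i (i + 1) i)"

lemma E_cm:
  assumes "{a, c, d} \<subseteq> {1..N}"
  shows "cm (E a a) (EE k c d) = (if a = c then EE k c d else 0) - (if a = d then EE k c d else 0)"
  using EE_EE[of a a c d 0 k] assms by (auto simp: sb_one scaleC_one)

lemma E_cm_Z:
  assumes "{a, c, d} \<subseteq> {1..N}"
  shows "cm (E a a) (Z c d) = (if a = c then Z c d else 0) - (if a = d then Z c d else 0)"
  using E_Z[of a a c d] assms by (auto simp: sb_one scaleC_one)

lemma Z_cm_E:
  assumes "{a, c, d} \<subseteq> {1..N}"
  shows "cm (Z a a) (E c d) = (if a = c then Z a d else 0) - (if a = d then Z c a else 0)"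
  using E_Z[of c d a a] assms by (auto simp: cm_swap[of "Z a a"] sb_one scaleC_one)

lemma EE_swap:
  assumes "{a, b, c, d} \<subseteq> {1..N}"
  shows "EE k a b * EE j c d = eps m a b c d *\<^sub>v (EE j c d * EE k a b)
    + (if b = c then EE (k + j) a d else 0) - (if a = d then eps m a b c d *\<^sub>v EE (k + j) c b else 0)"
  using EE_EE[OF assms, of k j] by (simp add: sb_def algebra_simps)

text \<open>The product E_aj E_ja is even, so the Leibniz rule applies with one common sign. Only j
  = c or j = d contributes, and reordering each product so that the factor starting from c stands
  first converts the various Koszul signs into s a.\<close>

lemma EE_prod_cm:
  assumes "{a, j, c, d} \<subseteq> {1..N}" "a \<noteq> c" "a \<noteq> d" "a \<noteq> j" "c \<noteq> d"
  shows "s j *\<^sub>v cm (E a j * E j a) (EE k c d) =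
    (if j = c then s a *\<^sub>v (E c a * EE k a d - EE k c d) else 0)
    - (if j = d then s a *\<^sub>v (EE k c a * E a d - EE k c d) else 0)"
proof -
  let ?w = "eps m a j c d"
  have 1: "sb ?w (E j a) (EE k c d) = - (if j = d then ?w *\<^sub>v EE k c a else 0)"
    using EE_EE[of j a c d 0 k] assms by (auto simp: eps_flip)
  have 2: "sb ?w (E a j) (EE k c d) = (if j = c then EE k a d else 0)"
    using EE_EE[of a j c d 0 k] assms by auto
  have 3: "E a d * EE k c a = eps m a d c a *\<^sub>v (EE k c a * E a d) - eps m a d c a *\<^sub>v EE k c d"
    using EE_swap[of a d c a 0 k] assms by auto
  have 4: "EE k a d * E c a = eps m a d c a *\<^sub>v (E c a * EE k a d) - eps m a d c a *\<^sub>v EE k c d"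
    using EE_swap[of a d c a k 0] assms by auto
  have 5: "s d * (eps m a d c d * eps m a d c a) = s a" "s c * (eps m a c c d * eps m a d c a) = s a"
    using parity_cases[of m a] parity_cases[of m c] parity_cases[of m d]
    by (auto simp: eps_def psign_def)
  show ?thesis
    unfolding cm_prod_even[OF eps_sq, of _ _ _ m a j c d] 1 2
    using assms by (auto simp: 3 4 scaleC_simps mult.assoc 5)
qed

lemma C_EE:
  assumes "{a, c, d} \<subseteq> {1..N}" "a \<noteq> c" "a \<noteq> d" "c \<noteq> d"
  shows "cm (C a) (EE k c d) = s a *\<^sub>v ((if c < a then E c a * EE k a d - EE k c d else 0)
    - (if d < a then EE k c a * E a d - EE k c d else 0))"
proof -
  have "cm (C a) (EE k c d) = (\<Sum>j\<in>{1..<a}. s j *\<^sub>v cm (E a j * E j a) (EE k c d))"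
    by (simp add: C_def cm_sum cm_bilinear)
  also have "\<dots> = (\<Sum>j\<in>{1..<a}. (if j = c then s a *\<^sub>v (E c a * EE k a d - EE k c d) else 0)
    - (if j = d then s a *\<^sub>v (EE k c a * E a d - EE k c d) else 0))"
    using assms by (intro sum.cong refl EE_prod_cm) auto
  also have "\<dots> = s a *\<^sub>v ((if c < a then E c a * EE k a d - EE k c d else 0)
    - (if d < a then EE k c a * E a d - EE k c d else 0))"
    using assms by (simp add: sum_subtractf scaleC_diff_right)
  finally show ?thesis .
qed

lemma E_C: assumes "{a, b} \<subseteq> {1..N}" shows "cm (E b b) (C a) = 0"
proof -
  have "cm (E b b) (E a k * E k a) = 0" if "k \<in> {1..<a}" for k
    using that assms by (auto simp: cm_mult E_cm)
  then show ?thesis by (simp add: C_def cm_sum cm_bilinear)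
qed

lemma E_D: assumes "{a, b} \<subseteq> {1..N}" shows "cm (E b b) (D a) = 0"
  using assms by (auto simp: D_def cm_bilinear E_C E_cm E_cm_Z cm_mult)

lemma D_E: assumes "{a, b} \<subseteq> {1..N}" shows "cm (D a) (E b b) = 0"
  using E_D[OF assms] by (simp add: cm_swap[of "D a"])

text \<open>For c, d < b both terms of \<open>C_EE\<close> are present, and in loop degree 0 they
  coincide: C_b is invariant under gl of the indices below b.\<close>

lemma C_commute:
  assumes "{b, c, d} \<subseteq> {1..N}" "c < b" "d < b"
  shows "cm (C b) (E c d) = 0"
proof (cases "c = d")
  case True
  then show ?thesis using E_C[of b c] assms by (simp add: cm_swap[of "C b"])
next
  case False
  then show ?thesis using C_EE[of b c d 0] assms by simp
qed

text \<open>Only two contributions survive, from (Z_aa, Z_bb) and (Z_aa, C_b), and they are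
  opposite. C_a involves only indices at most a < b, so it commutes with Z_bb and, by
  \<open>C_commute\<close>, with C_b.\<close>

lemma D_commute_less:
  assumes "{a, b} \<subseteq> {1..N}" "a < b"
  shows "cm (D a) (D b) = 0"
proof -
  have ZC: "cm (Z a a) (C b) = s a *\<^sub>v (E b a * Z a b - Z b a * E a b)"
  proof -
    have "cm (Z a a) (C b) = (\<Sum>k\<in>{1..<b}. s k *\<^sub>v cm (Z a a) (E b k * E k b))"
      by (simp add: C_def cm_sum cm_bilinear)
    also have "\<dots> = (\<Sum>k\<in>{1..<b}. if k = a then s a *\<^sub>v (E b a * Z a b - Z b a * E a b) else 0)"
      using assms by (intro sum.cong refl) (auto simp: cm_mult Z_cm_E algebra_simps)
    finally show ?thesis using assms by simp
  qed
  have CZ: "cm (C a) (Z b b) = 0"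
  proof -
    have "cm (E a k * E k a) (Z b b) = 0" if "k \<in> {1..<a}" for k
      using that assms Z_cm_E[of b a k] Z_cm_E[of b k a]
      by (auto simp: cm_mult cm_swap[of _ "Z b b"])
    then show ?thesis by (simp add: C_def cm_sum cm_bilinear)
  qed
  have CC: "cm (C a) (C b) = 0"
  proof -
    have "cm (E a k * E k a) (C b) = 0" if "k \<in> {1..<a}" for k
      using that assms C_commute[of b a k] C_commute[of b k a]
      by (auto simp: cm_mult cm_swap[of _ "C b"])
    then show ?thesis by (simp add: C_def[of a] cm_sum cm_bilinear)
  qed
  have "cm (Z a a) (E b b) = 0" "cm (E a a) (Z b b) = 0" "cm (E a a) (E b b) = 0"
    "cm (C a) (E b b) = 0" "cm (E a a) (C b) = 0"
    using assms E_C[of a b] E_C[of b a]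
    by (auto simp: Z_cm_E E_cm_Z E_cm cm_swap[of "C a"])
  then show ?thesis
    using assms by (simp add: D_def cm_bilinear cm_mult ZC CZ CC Z_Z scaleC_simps mult_ac)
qed

lemma D_commute: assumes "{a, b} \<subseteq> {1..N}" shows "cm (D a) (D b) = 0"
  using D_commute_less[of a b] D_commute_less[of b a] assms
  by (cases a b rule: linorder_cases) (auto simp: cm_swap[of "D a"])

text \<open>The conditions c < a and d < a stem from the truncation in \<open>C\<close>. In loop
  degree 1 the commutator with Z_aa adds the term belonging to d for every a, and in degree -1 it
  removes the one belonging to c; this turns the linear order of the indices into the cyclic
  one.\<close>

lemma D_EE:
  assumes "{a, c, d} \<subseteq> {1..N}" "a \<noteq> c" "a \<noteq> d" "c \<noteq> d"
  shows "cm (D a) (E c d) = lam *\<^sub>v ((if c < a then E c a * E a d - E c d else 0)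
    - (if d < a then E c a * E a d - E c d else 0))"
    "cm (D a) (EE 1 c d) = lam *\<^sub>v ((if c < a then E c a * EE 1 a d - EE 1 c d else 0)
    + (if d < a then 0 else EE 1 c a * E a d - EE 1 c d))"
    "cm (D a) (EE (-1) c d) = - (lam *\<^sub>v ((if c < a then 0 else E c a * EE (-1) a d - EE (-1) c d)
    + (if d < a then EE (-1) c a * E a d - EE (-1) c d else 0)))"
  using assms 
  by (auto simp: D_def cm_bilinear cm_mult C_EE Z_EE1 Z_EEm1 Z_cm_E E_cm scaleC_simps mult_ac)

lemma L_simps [simp]: "L 0 = N" "L (Suc i) = Suc i" "0 < i \<Longrightarrow> L i = i"
  by (simp_all add: L_def)

lemma L_range [simp]: "i < N \<Longrightarrow> 1 \<le> L i" "i < N \<Longrightarrow> Suc 0 \<le> L i" "i < N \<Longrightarrow> L i \<le> N"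
  using m2 by (auto simp: L_def)

lemma psign_0N: "s 0 = -1" "s N = -1" "s 1 = 1" "s (Suc 0) = 1"
  using m2 n2 by (auto simp: psign_def parity_def)

lemma psign_L: "s (L i) = s i"
  by (simp add: L_def psign_0N)

text \<open>The two indices of a node are cyclically consecutive, so no other index lies between
  them: the terms of \<open>D_EE\<close> cancel at finite nodes and are absent at node 0.\<close>

lemma D_e_zero:
  assumes "i < N" "a \<in> {1..N}" "a \<noteq> L i" "a \<noteq> i + 1"
  shows "cm (D a) (e i) = 0" "cm (D a) (f i) = 0"
  using assms m2 n2 by (cases i; auto simp: e_def f_def kp_def cm_bilinear D_EE)+

end

lemma eps_self_sq: "eps m a b a b = psign m a * psign m b" "eps m a b b a = psign m a * psign m b"
  using parity_cases[of m a] parity_cases[of m b] by (auto simp: eps_def psign_def)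

section \<open>Commutators of the D_a with the simple root vectors at their own indices\<close>

context gl_core
begin

lemma C_left_e:
  assumes "a \<in> {1..N}" "b \<in> {1..N}" "a < b"
  shows "cm (C a) (E a b) = (\<Sum>k\<in>{1..<a}. s k *\<^sub>v (E a k * E k b))"
proof -
  have "cm (E a k * E k a) (E a b) = E a k * E k b" if "k \<in> {1..<a}" for k
    unfolding cm_prod_even[OF eps_sq, of _ _ _ m a k a b]
    using EE_EE[of k a a b 0 0] EE_EE[of a k a b 0 0] assms that by (auto simp: eps_flip)
  then show ?thesis by (simp add: C_def cm_sum cm_bilinear)
qed

lemma C_left_f:
  assumes "a \<in> {1..N}" "b \<in> {1..N}" "a < b"
  shows "cm (C a) (E b a) = - (\<Sum>k\<in>{1..<a}. s k *\<^sub>v (E b k * E k a))"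
proof -
  have "cm (E a k * E k a) (E b a) = - (E b k * E k a)" if "k \<in> {1..<a}" for k
    unfolding cm_prod_even[OF eps_sq, of _ _ _ m a k b a]
    using EE_EE[of k a b a 0 0] EE_EE[of a k b a 0 0] assms that by (auto simp: eps_flip scaleC_simps)
  then show ?thesis by (simp add: C_def cm_sum cm_bilinear sum_negf scaleC_minus_right)
qed

text \<open>Each k < b contributes through the second index b; the term k = a meets E_{a,b} at its
  first index as well, which yields the extra product with E_bb.\<close>

lemma C_right_e:
  assumes "a \<in> {1..N}" "b \<in> {1..N}" "b = a + 1"
  shows "cm (C b) (E a b) = s b *\<^sub>v (E b b * E a b) - (\<Sum>k\<in>{1..a}. s k *\<^sub>v (E a k * E k b))"
proof -
  have "s k *\<^sub>v cm (E b k * E k b) (E a b)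
    = (if k = a then s b *\<^sub>v (E b b * E a b) else 0) - s k *\<^sub>v (E a k * E k b)"
    if "k \<in> {1..<b}" for k
  proof -
    let ?w = "eps m b k a b"
    have 1: "sb ?w (E k b) (E a b) = 0"
      using EE_EE[of k b a b 0 0] assms that by (auto simp: eps_flip)
    have 2: "sb ?w (E b k) (E a b) = (if k = a then E b b else 0) - ?w *\<^sub>v E a k"
      using EE_EE[of b k a b 0 0] assms that by auto
    have 3: "s a * eps m b a a b = s b" using eps_self_sq(2)[of m b a] by (simp add: mult_ac)
    show ?thesis
      unfolding cm_prod_even[OF eps_sq, of _ _ _ m b k a b] 1 2
      by (auto simp: 3 scaleC_simps left_diff_distrib mult.assoc)
  qed
  then have "cm (C b) (E a b)
    = (\<Sum>k\<in>{1..<b}. (if k = a then s b *\<^sub>v (E b b * E a b) else 0) - s k *\<^sub>v (E a k * E k b))"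
    by (simp add: C_def cm_sum cm_bilinear)
  moreover have int: "{1..<b} = {1..a}" using assms by auto
  ultimately show ?thesis unfolding int sum_subtractf using assms by simp
qed

lemma C_right_f:
  assumes "a \<in> {1..N}" "b \<in> {1..N}" "b = a + 1"
  shows "cm (C b) (E b a) = (\<Sum>k\<in>{1..a}. s k *\<^sub>v (E b k * E k a)) - s b *\<^sub>v (E b a * E b b)"
proof -
  have "s k *\<^sub>v cm (E b k * E k b) (E b a)
    = s k *\<^sub>v (E b k * E k a) - (if k = a then s b *\<^sub>v (E b a * E b b) else 0)"
    if "k \<in> {1..<b}" for k
  proof -
    let ?w = "eps m b k b a"
    have 1: "sb ?w (E k b) (E b a) = E k a - (if k = a then ?w *\<^sub>v E b b else 0)"
      using EE_EE[of k b b a 0 0] assms that by (auto simp: eps_flip)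
    have 2: "sb ?w (E b k) (E b a) = 0"
      using EE_EE[of b k b a 0 0] assms that by auto
    have 3: "s a * eps m b a b a = s b" using eps_self_sq(1)[of m b a] by (simp add: mult_ac)
    show ?thesis
      unfolding cm_prod_even[OF eps_sq, of _ _ _ m b k b a] 1 2
      by (auto simp: 3 scaleC_simps right_diff_distrib mult.assoc)
  qed
  then have "cm (C b) (E b a)
    = (\<Sum>k\<in>{1..<b}. s k *\<^sub>v (E b k * E k a) - (if k = a then s b *\<^sub>v (E b a * E b b) else 0))"
    by (simp add: C_def cm_sum cm_bilinear)
  moreover have int: "{1..<b} = {1..a}" using assms by auto
  ultimately show ?thesis unfolding int sum_subtractf using assms by simp
qed

lemma Q_split: "1 \<le> a \<Longrightarrow> Q a c d
  = Z c d + lam *\<^sub>v (\<Sum>k\<in>{1..<a}. s k *\<^sub>v (E c k * E k d)) + (lam * s a) *\<^sub>v (E c a * E a d)"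
proof -
  assume "1 \<le> a"
  then have "{1..a} = insert a {1..<a}" by auto
  then show ?thesis by (simp add: Q_def scaleC_simps algebra_simps)
qed

text \<open>Both neighbouring indices produce the same \<open>Q\<close>, with opposite signs and
  with the same correction by lam / 2. The term k = a, absent from C_a, is supplied by (lam / 2)
  E_aa^2; on the other side C_b contains it already.\<close>

lemma D_Q:
  assumes "a \<in> {1..N}" "b \<in> {1..N}" "b = a + 1"
  shows "cm (D a) (E a b) = s a *\<^sub>v Q a a b - (lam / 2) *\<^sub>v E a b"
    and "cm (D a) (E b a) = - (s a *\<^sub>v Q a b a) + (lam / 2) *\<^sub>v E b a"
    and "cm (D b) (E a b) = - (s b *\<^sub>v Q a a b) - (lam / 2) *\<^sub>v E a b"
    and "cm (D b) (E b a) = s b *\<^sub>v Q a b a + (lam / 2) *\<^sub>v E b a"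
proof -
  have w: "cm (E a a) (E a b) = E a b" "cm (E a a) (E b a) = - E b a"
    "cm (E b b) (E a b) = - E a b" "cm (E b b) (E b a) = E b a"
    using assms by (auto simp: E_cm)
  then have w': "E a b * E a a = E a a * E a b - E a b" "E a a * E b a = E b a * E a a - E b a"
    "E a b * E b b = E b b * E a b + E a b" "E b b * E b a = E b a * E b b + E b a"
    by (simp_all add: cm_def algebra_simps)
  show "cm (D a) (E a b) = s a *\<^sub>v Q a a b - (lam / 2) *\<^sub>v E a b"
    "cm (D a) (E b a) = - (s a *\<^sub>v Q a b a) + (lam / 2) *\<^sub>v E b a"
    using assms w w'
    by (simp_all add: D_def cm_bilinear cm_mult C_left_e C_left_f Z_cm_E Q_split scaleC_simps)
      (simp_all add: algebra_simps scaleC_simps scaleC_half)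
  show "cm (D b) (E a b) = - (s b *\<^sub>v Q a a b) - (lam / 2) *\<^sub>v E a b"
    "cm (D b) (E b a) = s b *\<^sub>v Q a b a + (lam / 2) *\<^sub>v E b a"
    using assms w w'
    by (simp_all add: D_def cm_bilinear cm_mult C_right_e[of a "Suc a"] C_right_f[of a "Suc a"]
        Z_cm_E Q_def scaleC_simps)
      (simp_all add: algebra_simps scaleC_simps scaleC_half)
qed

lemma EE_cm_left:
  assumes "{a, c, d} \<subseteq> {1..N}"
  shows "cm (EE k a a) (EE j c d) = (if a = c then EE (k + j) c d else 0) - (if a = d then EE (k + j) c d else 0)"
  using EE_EE[of a a c d k j] assms by (auto simp: sb_one scaleC_one)

lemma cm_0N:
  "cm (E 1 1) (EE 1 N 1) = - EE 1 N 1" "cm (E N N) (EE 1 N 1) = EE 1 N 1"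
  "cm (E 1 1) (EE (-1) 1 N) = EE (-1) 1 N" "cm (E N N) (EE (-1) 1 N) = - EE (-1) 1 N"
  "cm (EE 1 N N) (E N 1) = EE 1 N 1" "cm (EE (-1) N N) (E 1 N) = - EE (-1) 1 N"
  using m2 n2 by (auto simp: EE_cm_left)

lemma C_N_e0: "cm (C N) (EE 1 N 1)
  = (\<Sum>k\<in>{1..<N}. s k *\<^sub>v (E N k * EE 1 k 1)) + E N 1 * EE 1 N N"
proof -
  have "s k *\<^sub>v cm (E N k * E k N) (EE 1 N 1)
    = s k *\<^sub>v (E N k * EE 1 k 1) + (if k = 1 then E N 1 * EE 1 N N else 0)"
    if "k \<in> {1..<N}" for k
  proof -
    let ?w = "eps m N k N 1"
    have 1: "sb ?w (E k N) (EE 1 N 1) = EE 1 k 1 - (if k = 1 then ?w *\<^sub>v EE 1 N N else 0)"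
      using EE_EE[of k N N 1 0 1] m2 that by (auto simp: eps_flip)
    have 2: "sb ?w (E N k) (EE 1 N 1) = 0"
      using EE_EE[of N k N 1 0 1] m2 that by auto
    have 3: "eps m N 1 N 1 = -1" "s 1 = 1" using eps_self_sq(1)[of m N 1] by (auto simp: psign_0N)
    show ?thesis
      unfolding cm_prod_even[OF eps_sq, of _ _ _ m N k N 1] 1 2 using 3
      by (auto simp: scaleC_simps right_diff_distrib)
  qed
  then have "cm (C N) (EE 1 N 1) = (\<Sum>k\<in>{1..<N}. s k *\<^sub>v (E N k * EE 1 k 1)
      + (if k = 1 then E N 1 * EE 1 N N else 0))"
    by (simp add: C_def cm_sum cm_bilinear)
  then show ?thesis using m2 by (simp add: sum.distrib)
qed

lemma C_N_f0: "cm (C N) (EE (-1) 1 N)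
  = - (\<Sum>k\<in>{1..<N}. s k *\<^sub>v (EE (-1) 1 k * E k N)) - EE (-1) N N * E 1 N"
proof -
  have "s k *\<^sub>v cm (E N k * E k N) (EE (-1) 1 N)
    = - (s k *\<^sub>v (EE (-1) 1 k * E k N)) - (if k = 1 then EE (-1) N N * E 1 N else 0)"
    if "k \<in> {1..<N}" for k
  proof -
    let ?w = "eps m N k 1 N"
    have 1: "sb ?w (E k N) (EE (-1) 1 N) = 0"
      using EE_EE[of k N 1 N 0 "-1"] m2 that by (auto simp: eps_flip)
    have 2: "sb ?w (E N k) (EE (-1) 1 N) = (if k = 1 then EE (-1) N N else 0) - ?w *\<^sub>v EE (-1) 1 k"
      using EE_EE[of N k 1 N 0 "-1"] m2 that by auto
    have 3: "eps m N 1 1 N = -1" "s 1 = 1" using eps_self_sq(2)[of m N 1] by (auto simp: psign_0N)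
    show ?thesis
      unfolding cm_prod_even[OF eps_sq, of _ _ _ m N k 1 N] 1 2 using 3
      by (auto simp: scaleC_simps left_diff_distrib)
  qed
  then have "cm (C N) (EE (-1) 1 N) = (\<Sum>k\<in>{1..<N}. - (s k *\<^sub>v (EE (-1) 1 k * E k N))
      - (if k = 1 then EE (-1) N N * E 1 N else 0))"
    by (simp add: C_def cm_sum cm_bilinear)
  then show ?thesis using m2 by (simp add: sum_subtractf sum_negf)
qed

lemma sum_N_split: "(\<Sum>k\<in>{1..N}. s k *\<^sub>v g k) = (\<Sum>k\<in>{1..<N}. s k *\<^sub>v g k) - (g N :: 'a)"
proof -
  have "{1..N} = insert N {1..<N}" using m2 by auto
  then show ?thesis by (simp add: psign_0N scaleC_simps algebra_simps)
qed

text \<open>The condition on beta + t in the form in which it meets the supertrace terms of the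
  affine node.\<close>

lemma trace_scaleC: "lam *\<^sub>v (of_nat m - of_nat n) *\<^sub>v x = t *\<^sub>v x + om *\<^sub>v (x :: 'a)"
proof -
  have "lam * (of_nat m - of_nat n) = t + om"
    using trace by (simp add: om_def field_simps)
  then show ?thesis by (simp add: scaleC_scaleC flip: scaleC_add_left)
qed

text \<open>The affine analogue of \<open>D_Q\<close>: index 1 and index N see the same
  \<open>W\<close> and \<open>W'\<close>, but index N with the additional shift \<open>om\<close>.
  C_1 is empty, while the sum in C_N is completed by the trace identity.\<close>

lemma D_0:
  "cm (D 1) (EE 1 N 1) = - W - (lam / 2) *\<^sub>v EE 1 N 1"
  "cm (D 1) (EE (-1) 1 N) = W' + (lam / 2) *\<^sub>v EE (-1) 1 N"
  "cm (D N) (EE 1 N 1) = - W - om *\<^sub>v EE 1 N 1 - (lam / 2) *\<^sub>v EE 1 N 1"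
  "cm (D N) (EE (-1) 1 N) = W' + om *\<^sub>v EE (-1) 1 N + (lam / 2) *\<^sub>v EE (-1) 1 N"
proof -
  note w = cm_0N
  have w': "EE 1 N 1 * E 1 1 = E 1 1 * EE 1 N 1 + EE 1 N 1"
    "EE 1 N 1 * E N N = E N N * EE 1 N 1 - EE 1 N 1"
    "EE (-1) 1 N * E 1 1 = E 1 1 * EE (-1) 1 N - EE (-1) 1 N"
    "E N N * EE (-1) 1 N = EE (-1) 1 N * E N N - EE (-1) 1 N"
    "EE 1 N N * E N 1 = E N 1 * EE 1 N N + EE 1 N 1"
    "EE (-1) N N * E 1 N = E 1 N * EE (-1) N N - EE (-1) 1 N"
    using w by (simp_all add: cm_def algebra_simps)
  have C1: "C 1 = 0" by (simp add: C_def)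
  show "cm (D 1) (EE 1 N 1) = - W - (lam / 2) *\<^sub>v EE 1 N 1"
    "cm (D 1) (EE (-1) 1 N) = W' + (lam / 2) *\<^sub>v EE (-1) 1 N"
    unfolding D_def cm_bilinear cm_mult C1 Z1_e0 Z1_f0 w psign_0N
    by (simp_all add: w'[unfolded One_nat_def] algebra_simps scaleC_simps scaleC_half)
  show "cm (D N) (EE 1 N 1) = - W - om *\<^sub>v EE 1 N 1 - (lam / 2) *\<^sub>v EE 1 N 1"
    "cm (D N) (EE (-1) 1 N) = W' + om *\<^sub>v EE (-1) 1 N + (lam / 2) *\<^sub>v EE (-1) 1 N"
    unfolding D_def cm_bilinear cm_mult C_N_e0 C_N_f0 ZN_e0 ZN_f0 w psign_0N sum_N_split
      scaleC_diff_right trace_scaleC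
    by (simp_all add: w'[unfolded One_nat_def] algebra_simps scaleC_simps scaleC_half)
qed

end

section \<open>Uniform formulas for all nodes, and the brackets involving A and B\<close>

context gl_core
begin

lemma e_simps: "e 0 = EE 1 N 1" "0 < i \<Longrightarrow> e i = E i (i + 1)"
  "f 0 = - EE (-1) 1 N" "0 < i \<Longrightarrow> f i = s i *\<^sub>v E (i + 1) i"
  by (simp_all add: e_def f_def kp_def psign_0N scaleC_simps)

lemma D_L_e: "i < N \<Longrightarrow> cm (D (L i)) (e i) = s i *\<^sub>v A i - (lam / 2) *\<^sub>v e i"
  by (cases "i = 0") (simp_all add: e_simps A_def B_def psign_0N scaleC_simps cm_bilinear mult_ac
      D_0(3)[unfolded One_nat_def] D_Q(1)[of i "Suc i"] algebra_simps)

lemma D_L_f: "i < N \<Longrightarrow> cm (D (L i)) (f i) = - (s i *\<^sub>v B i) + (lam / 2) *\<^sub>v f i"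
  by (cases "i = 0") (simp_all add: e_simps A_def B_def psign_0N scaleC_simps cm_bilinear mult_ac
      D_0(4)[unfolded One_nat_def] D_Q(2)[of i "Suc i"] algebra_simps)

lemma D_R_e: "i < N \<Longrightarrow> cm (D (i + 1)) (e i)
    = - (s (i + 1) *\<^sub>v A i) - (lam / 2) *\<^sub>v e i + (if i = 0 then om *\<^sub>v e 0 else 0)"
  by (cases "i = 0") (simp_all add: e_simps A_def B_def psign_0N scaleC_simps cm_bilinear mult_ac
      D_0(1)[unfolded One_nat_def] D_Q(3)[of i "Suc i"] algebra_simps)

lemma D_R_f: "i < N \<Longrightarrow> cm (D (i + 1)) (f i)
    = s (i + 1) *\<^sub>v B i + (lam / 2) *\<^sub>v f i - (if i = 0 then om *\<^sub>v f 0 else 0)"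
  by (cases "i = 0") (simp_all add: e_simps A_def B_def psign_0N scaleC_simps cm_bilinear mult_ac
      D_0(2)[unfolded One_nat_def] D_Q(4)[of i "Suc i"] algebra_simps)

definition sg :: "nat \<Rightarrow> nat \<Rightarrow> complex" where
  "sg i j = eps m (L i) (i + 1) (L j) (j + 1)"

lemma parity_L: "parity m (L i) = parity m i"
  using m2 n2 by (auto simp: parity_def L_def)

lemma sg_alt: "sg i j = (if i \<in> {0, m} \<and> j \<in> {0, m} then -1 else 1)"
  if "i < N" "j < N"
  using that m2 n2 unfolding sg_def eps_def parity_L
  by (auto simp: parity_def)

text \<open>At most one of two neighbouring nodes is odd because m, n >= 2, so the sign is 1 and
  matrix units with matching inner index compose.\<close>

lemma cm_next:
  assumes "i < N" "j = (i + 1) mod N"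
  shows "cm (e i) (e j) = EE (kp i + kp j) (L i) (j + 1)"
    and "cm (f i) (f j) = - ((s i * s (i + 1)) *\<^sub>v EE (- kp i - kp j) (j + 1) (L i))"
proof -
  have j: "L j = i + 1" "j < N"
    using assms m2 by (auto simp: L_def mod_Suc)
  have neq: "L i \<noteq> j + 1" "L i \<noteq> i + 1" "j \<noteq> i"
    using assms m2 n2 by (auto simp: L_def mod_Suc split: if_splits)
  have sj: "s j = s (i + 1)" using psign_L[of j] j by simp
  have "sg i j = 1" using assms j m2 n2 by (auto simp: sg_alt mod_Suc split: if_splits)
  then have 1: "eps m (L i) (i + 1) (i + 1) (j + 1) = 1"
    by (simp add: sg_def j)
  then show "cm (e i) (e j) = EE (kp i + kp j) (L i) (j + 1)"
    using EE_EE[of "L i" "i + 1" "i + 1" "j + 1" "kp i" "kp j"] assms(1) j neq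
    by (simp add: e_def sb_one)
  have "eps m (i + 1) (L i) (j + 1) (i + 1) = 1" using 1 eps_flip by metis
  then show "cm (f i) (f j) = - ((s i * s (i + 1)) *\<^sub>v EE (- kp i - kp j) (j + 1) (L i))"
    using EE_EE[of "i + 1" "L i" "j + 1" "i + 1" "- kp i" "- kp j"] assms(1) j neq
    by (simp add: f_def sb_one cm_bilinear scaleC_simps sj mult.commute)
qed

text \<open>The bracket of two neighbouring root vectors jumps over the index i + 1, so exactly one
  term of \<open>D_EE\<close> survives. It is already the product in the opposite order, by the
  commutator of the two root vectors. The three cases are: node 0 comes first, is absent, or comes
  last.\<close>

lemma D_cm_next:
  assumes "i < N" "j = (i + 1) mod N"
  shows "cm (D (i + 1)) (cm (e i) (e j)) = lam *\<^sub>v (e j * e i)"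
    and "cm (D (i + 1)) (cm (f i) (f j)) = lam *\<^sub>v (f i * f j)"
proof -
  have "i = 0 \<or> (1 \<le> i \<and> i + 1 < N) \<or> i + 1 = N" using assms by auto
  then show "cm (D (i + 1)) (cm (e i) (e j)) = lam *\<^sub>v (e j * e i)"
  proof (elim disjE)
    assume i: "i = 0"
    have j: "j = 1" using assms i m2 by simp
    have "EE 1 N 1 * E 1 2 - EE 1 N 2 = E 1 2 * EE 1 N 1"
      using cm_next(1)[of 0 "Suc 0"] m2 by (simp add: e_def kp_def cm_def numeral_2_eq_2 algebra_simps)
    moreover have "cm (D 1) (cm (e 0) (e 1)) = lam *\<^sub>v (EE 1 N 1 * E 1 2 - EE 1 N 2)"
      using m2 n2 by (simp add: cm_next(1)[of 0 "Suc 0"] kp_def D_EE numeral_2_eq_2)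
    ultimately show ?thesis
      by (simp add: i j e_simps numeral_2_eq_2)
  next
    assume i: "1 \<le> i \<and> i + 1 < N"
    have j: "j = i + 1" using assms i m2 by simp
    have "E i (i+1) * E (i+1) (i+2) - E i (i+2) = E (i+1) (i+2) * E i (i+1)"
      using cm_next(1)[of i j] i j by (simp add: e_def kp_def cm_def algebra_simps)
    moreover have "cm (D (i + 1)) (cm (e i) (e j)) = lam *\<^sub>v (E i (i+1) * E (i+1) (i+2) - E i (i+2))"
      using i j by (simp add: cm_next(1)[of i "Suc i"] kp_def D_EE)
    ultimately show ?thesis
      using i j by (simp add: e_simps)
  next
    assume i: "i + 1 = N"
    have j: "j = 0" and N: "0 < i" using assms i m2 by auto
    have "E i N * EE 1 N 1 - EE 1 i 1 = EE 1 N 1 * E i N"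
      using cm_next(1)[of i j] i j N by (simp add: e_def kp_def cm_def algebra_simps)
    moreover have "cm (D N) (cm (e i) (e 0)) = lam *\<^sub>v (E i N * EE 1 N 1 - EE 1 i 1)"
      using i j N m2 n2 by (simp add: cm_next(1)[of i 0] kp_def D_EE)
    ultimately show ?thesis
      using i j N by (simp add: e_simps)
  qed
  have "i = 0 \<or> (1 \<le> i \<and> i + 1 < N) \<or> i + 1 = N" using assms by auto
  then show "cm (D (i + 1)) (cm (f i) (f j)) = lam *\<^sub>v (f i * f j)"
  proof (elim disjE)
    assume i: "i = 0"
    have j: "j = 1" using assms i m2 by simp
    have s2: "s (Suc (Suc 0)) = 1" using m2 by (simp add: psign_def parity_def)
    have "E 2 1 * EE (-1) 1 N - EE (-1) 2 N = EE (-1) 1 N * E 2 1"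
      using cm_next(2)[of 0 "Suc 0"] m2 by (simp add: f_def kp_def cm_def numeral_2_eq_2 algebra_simps psign_0N scaleC_simps)
    moreover have "cm (D 1) (cm (f 0) (f 1)) = - (lam *\<^sub>v (E 2 1 * EE (-1) 1 N - EE (-1) 2 N))"
      using m2 n2 by (simp add: cm_next(2)[of 0 "Suc 0"] kp_def D_EE numeral_2_eq_2 psign_0N cm_bilinear scaleC_simps)
    ultimately show ?thesis
      by (simp add: i j e_simps numeral_2_eq_2 psign_0N scaleC_simps)
  next
    assume i: "1 \<le> i \<and> i + 1 < N"
    have j: "j = i + 1" using assms i m2 by simp
    have ss: "x = y" if "(s i * s (i + 1)) *\<^sub>v x = (s i * s (i + 1)) *\<^sub>v y" for x y :: 'a
      using arg_cong[OF that, of "\<lambda>x. (s i * s (i + 1)) *\<^sub>v x"]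
      by (simp add: scaleC_simps mult_ac)
    have "(s i * s (i + 1)) *\<^sub>v (E (i+1) i * E (i+2) (i+1) - E (i+2) (i+1) * E (i+1) i)
      = (s i * s (i + 1)) *\<^sub>v - E (i+2) i"
      using cm_next(2)[of i j] i j
      by (simp add: f_def kp_def cm_def scaleC_simps mult.commute[of "s (Suc i)"])
    from ss[OF this] have "E (i+2) (i+1) * E (i+1) i - E (i+2) i = E (i+1) i * E (i+2) (i+1)"
      by (simp add: algebra_simps)
    moreover have "cm (D (i + 1)) (cm (f i) (f j))
      = (s i * s (i + 1)) *\<^sub>v (lam *\<^sub>v (E (i+2) (i+1) * E (i+1) i - E (i+2) i))"
      using i j by (simp add: cm_next(2)[of i "Suc i"] kp_def D_EE cm_bilinear scaleC_simps)
    ultimately show ?thesis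
      using i j by (simp add: e_simps scaleC_simps mult_ac)
  next
    assume i: "i + 1 = N"
    have j: "j = 0" and N: "0 < i" using assms i m2 by auto
    have si: "s i = - 1" using i n2 by (simp add: psign_def parity_def)
    have "EE (-1) 1 N * E N i - EE (-1) 1 i = E N i * EE (-1) 1 N"
      using cm_next(2)[of i j] i j N
      by (simp add: f_def kp_def cm_def algebra_simps psign_0N si scaleC_simps)
    moreover have "cm (D N) (cm (f i) (f 0)) = lam *\<^sub>v (EE (-1) 1 N * E N i - EE (-1) 1 i)"
      using i j N m2 n2
      by (simp add: cm_next(2)[of i 0] kp_def D_EE psign_0N si scaleC_simps cm_bilinear)
    ultimately show ?thesis
      using i j N by (simp add: e_simps si scaleC_simps)
  qed
qed

text \<open>At an even node every sign is 1, and in the sum defining \<open>Q\<close> only k = i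
  fails to commute with the root vector. This gives the relation for i = j, where a_{i,i} = 2 s
  i.\<close>

lemma A_even:
  assumes "i < N" "i \<notin> {0, m}"
  shows "cm (A i) (e i) = (lam * s i) *\<^sub>v (e i * e i)"
    and "cm (B i) (f i) = - ((lam * s i) *\<^sub>v (f i * f i))"
proof -
  define b where "b = i + 1"
  have b: "{i, b} \<subseteq> {1..N}" "i \<noteq> b" using assms by (auto simp: b_def)
  have par: "parity m b = parity m i" using assms by (auto simp: b_def parity_def)
  have eps1: "eps m x y i b = 1" "eps m x y b i = 1" for x y by (simp_all add: eps_def par flip: mult_2)
  have "cm (Q i i b) (E i b) = lam *\<^sub>v (\<Sum>k\<in>{1..i}. s k *\<^sub>v cm (E i k * E k b) (E i b))"
    using E_Z[of i b i b] b by (simp add: Q_def cm_bilinear cm_sum cm_swap[of "Z i b"] eps1 sb_one)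
  also have "(\<Sum>k\<in>{1..i}. s k *\<^sub>v cm (E i k * E k b) (E i b))
    = (\<Sum>k\<in>{1..i}. if k = i then s i *\<^sub>v (E i b * E i b) else 0)"
  proof (intro sum.cong refl)
    fix k assume "k \<in> {1..i}"
    then have k: "{k, i, b} \<subseteq> {1..N}" "k \<noteq> b" using b by (auto simp: b_def)
    then have "cm (E i k) (E i b) = (if k = i then E i b else 0)" "cm (E k b) (E i b) = 0"
      using EE_EE[of i k i b 0 0] EE_EE[of k b i b 0 0] b by (auto simp: eps1 sb_one)
    then show "s k *\<^sub>v cm (E i k * E k b) (E i b) = (if k = i then s i *\<^sub>v (E i b * E i b) else 0)"
      by (simp add: cm_mult)
  qed
  finally have 1: "cm (Q i i b) (E i b) = (lam * s i) *\<^sub>v (E i b * E i b)"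
    using b by (simp add: scaleC_simps)
  have "cm (Q i b i) (E b i) = lam *\<^sub>v (\<Sum>k\<in>{1..i}. s k *\<^sub>v cm (E b k * E k i) (E b i))"
    using E_Z[of b i b i] b by (simp add: Q_def cm_bilinear cm_sum cm_swap[of "Z b i"] eps1 sb_one)
  also have "(\<Sum>k\<in>{1..i}. s k *\<^sub>v cm (E b k * E k i) (E b i))
    = (\<Sum>k\<in>{1..i}. if k = i then - (s i *\<^sub>v (E b i * E b i)) else 0)"
  proof (intro sum.cong refl)
    fix k assume "k \<in> {1..i}"
    then have k: "{k, i, b} \<subseteq> {1..N}" "k \<noteq> b" using b by (auto simp: b_def)
    then have "cm (E k i) (E b i) = - (if k = i then E b i else 0)" "cm (E b k) (E b i) = 0"
      using EE_EE[of k i b i 0 0] EE_EE[of b k b i 0 0] b by (auto simp: eps1 sb_one scaleC_one)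
    then show "s k *\<^sub>v cm (E b k * E k i) (E b i) = (if k = i then - (s i *\<^sub>v (E b i * E b i)) else 0)"
      by (simp add: cm_mult scaleC_simps)
  qed
  finally have 2: "cm (Q i b i) (E b i) = - ((lam * s i) *\<^sub>v (E b i * E b i))"
    using b by (simp add: scaleC_simps)
  show "cm (A i) (e i) = (lam * s i) *\<^sub>v (e i * e i)" "cm (B i) (f i) = - ((lam * s i) *\<^sub>v (f i * f i))"
    using 1 2 assms by (simp_all add: A_def B_def e_simps b_def cm_bilinear scaleC_simps mult_ac)
qed

text \<open>The central computation behind [X^+_{i,1}, X^-_{i,0}] = H_{i,1}. At a finite node the
  sum in \<open>Q\<close> breaks up into C_i and C_{i+1}. At node 0 the role of \<open>Q\<close> is
  played by \<open>W_f0\<close>: the trace identity leaves multiples of E_NN that cancel against the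
  shift of A_0, and only the multiple om of E_11 remains.\<close>

lemma A_f:
  assumes "i < N"
  shows "sb (sg i i) (A i) (f i)
    = D (L i) - D (i + 1) + (lam / 2) *\<^sub>v (h i * h i) - (if i = 0 then om *\<^sub>v E 1 1 else 0)"
proof (cases "i = 0")
  case True
  have e0: "EE 1 N 1 * EE (-1) 1 N + EE (-1) 1 N * EE 1 N 1 = E N N + E 1 1"
    using EE_EE[of N 1 1 N 1 "-1"] m2 eps_self_sq(2)[of m N 1] by (simp add: sb_def psign_0N scaleC_simps)
  have e00: "EE (-1) 1 N * EE 1 N 1 = E N N + E 1 1 - EE 1 N 1 * EE (-1) 1 N"
    using e0 by (simp add: algebra_simps)
  have W: "EE (-1) 1 N * W = Z N N + Z 1 1
        + lam *\<^sub>v ((\<Sum>a\<in>{1..<N}. s a *\<^sub>v (E N a * E a N)) - E N N * E N N) - om *\<^sub>v E N N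
        - lam *\<^sub>v (E 1 1 * E N N) - W * EE (-1) 1 N"
    using W_f0 unfolding sum_N_split scaleC_diff_right trace_scaleC by (simp add: algebra_simps)
  have w: "E N N * E 1 1 = E 1 1 * E N N"
    using E_cm[of N 1 1 0] m2 by (simp add: cm_def)
  have sg0: "sg 0 0 = -1" using m2 by (simp add: sg_alt)
  have C1: "C (Suc 0) = 0" by (simp add: C_def)
  show ?thesis
    unfolding True sg0 A_def sb_def f_def kp_def e_def
    using m2 
    by (simp add: psign_0N scaleC_simps algebra_simps W[unfolded One_nat_def] e00[unfolded One_nat_def] 
        D_def h_def C1 C_def[of N] w[unfolded One_nat_def] scaleC_half)
next
  case False
  define b where "b = i + 1"
  define w where "w = eps m i b b i"
  have b: "{i, b} \<subseteq> {1..N}" "i \<noteq> b" using assms False by (auto simp: b_def)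
  have w_alt: "w = s i * s b" by (simp add: w_def eps_self_sq)
  have ww: "w * w = 1" by (simp add: w_def)
  have sg: "sg i i = w" using False by (simp add: sg_def w_def b_def eps_flip)
  have Z: "sb w (Z i b) (E b i) = Z i i - w *\<^sub>v Z b b"
  proof -
    have "eps m b i i b = w" by (simp add: w_def eps_flip)
    then have *: "sb w (E b i) (Z i b) = Z b b - w *\<^sub>v Z i i"
      using E_Z[of b i i b] b by auto
    then show ?thesis
      by (simp add: sb_swap[OF ww, of "Z i b"] * scaleC_simps ww)
  qed
  have prod: "s k *\<^sub>v sb w (E i k * E k b) (E b i) = s k *\<^sub>v (E i k * E k i) - (s k * w) *\<^sub>v (E b k * E k b)
    - (if k = i then s b *\<^sub>v (E i i * E b b) else 0)" if "k \<in> {1..i}" for k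
  proof -
    have k: "{i, b, k} \<subseteq> {1..N}" "k \<noteq> b" using that b by (auto simp: b_def)
    have ws: "w = eps m k b b i * eps m i k b i"
      using parity_cases[of m i] parity_cases[of m b] parity_cases[of m k]
      by (auto simp: eps_def w_def)
    have 1: "sb (eps m k b b i) (E k b) (E b i) = E k i - (if k = i then eps m k b b i *\<^sub>v E b b else 0)"
      using EE_EE[of k b b i 0 0] k by auto
    have 2: "sb (eps m i k b i) (E i k) (E b i) = - (eps m i k b i *\<^sub>v E b k)"
      using EE_EE[of i k b i 0 0] k b by auto
    have 3: "s i * w = s b" "s i * eps m i b b i = s b" by (simp_all add: w_alt eps_self_sq)
    have 4: "eps m k b b i * eps m i k b i = w" using ws by simp
    show ?thesis
      unfolding sb_mult_left[OF ws] 1 2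
      using 3 4 by (auto simp: scaleC_simps right_diff_distrib mult.assoc)
  qed
  have "sb w (Q i i b) (E b i) = Z i i - w *\<^sub>v Z b b
    + lam *\<^sub>v (\<Sum>k\<in>{1..i}. s k *\<^sub>v sb w (E i k * E k b) (E b i))"
    by (simp add: Q_def sb_bilinear sb_sum Z)
  also have "(\<Sum>k\<in>{1..i}. s k *\<^sub>v sb w (E i k * E k b) (E b i))
    = (\<Sum>k\<in>{1..i}. s k *\<^sub>v (E i k * E k i)) - w *\<^sub>v (\<Sum>k\<in>{1..i}. s k *\<^sub>v (E b k * E k b))
      - s b *\<^sub>v (E i i * E b b)"
    using b by (simp add: prod sum_subtractf scaleC_sum_right scaleC_scaleC mult.commute)
  also have "(\<Sum>k\<in>{1..i}. s k *\<^sub>v (E b k * E k b)) = C b"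
    unfolding C_def b_def by (intro sum.cong) auto
  also have "(\<Sum>k\<in>{1..i}. s k *\<^sub>v (E i k * E k i)) = C i + s i *\<^sub>v (E i i * E i i)"
  proof -
    have "{1..i} = insert i {1..<i}" using False by auto
    then show ?thesis by (simp add: C_def add.commute)
  qed
  finally have 1: "sb w (Q i i b) (E b i) = Z i i - w *\<^sub>v Z b b
    + lam *\<^sub>v (C i + s i *\<^sub>v (E i i * E i i) - w *\<^sub>v C b - s b *\<^sub>v (E i i * E b b))" .
  have wt: "E b b * E i i = E i i * E b b"
    using E_cm[of b i i 0] b by (simp add: cm_def)
  have s3: "s i * (lam * s i) = lam" "s i * (lam * (s i * z)) = lam * z" for z
    by (simp_all add: mult.left_commute[of "s i"])
  have bS: "b = Suc i" by (simp add: b_def)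
  show ?thesis
    unfolding sg using False
    by (simp add: A_def e_simps sb_bilinear 1[unfolded w_alt bS] h_def D_def scaleC_simps w_alt
       wt[unfolded bS] algebra_simps scaleC_half bS s3)
qed

end

lemma pm_val_sq [simp]: "pm_val p * pm_val p = 1" "pm_val p * (pm_val p * z) = z"
  by (cases p; simp)+

section \<open>Cartan relations and brackets of generators of opposite sign\<close>

context gl_core
begin

fun X :: "pm \<Rightarrow> nat \<Rightarrow> 'a" where "X Plus i = e i" | "X Minus i = f i"
fun Y :: "pm \<Rightarrow> nat \<Rightarrow> 'a" where "Y Plus i = A i" | "Y Minus i = B i"

definition wt :: "nat \<Rightarrow> nat \<Rightarrow> complex" where
  "wt a j = (if a = L j then 1 else 0) - (if a = j + 1 then 1 else 0)"

text \<open>For finite i, \<open>kap i\<close> is the scalar that makes J(x_i) act through the y_k: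
  t / 2 is their constant term, and the rest balances the supertrace against i^(0). The value at
  node 0 continues the sequence around the diagram, with the jump beta required by the relations for
  the pair (m+n-1, 0).\<close>

definition kap :: "nat \<Rightarrow> complex" where "kap i = t / 2 - lam / 2 * (\<Sum>j\<in>{1..i}. s j)"
definition kc :: "nat \<Rightarrow> complex" where "kc i = (if i = 0 then kap N - beta else kap i)"
definition X1 :: "pm \<Rightarrow> nat \<Rightarrow> 'a" where "X1 p i = Y p i + kc i *\<^sub>v X p i"
text \<open>The image of the generator H_{i,1} with the tilde. The term om E_11 at node 0 is the
  remainder found in \<open>A_f\<close>.\<close>

definition Ht :: "nat \<Rightarrow> 'a" where
  "Ht i = D (L i) - D (i + 1) - (if i = 0 then om *\<^sub>v E 1 1 else 0) + kc i *\<^sub>v h i"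
definition H1 :: "nat \<Rightarrow> 'a" where "H1 i = Ht i + (lam / 2) *\<^sub>v (h i * h i)"

lemma D_L_X: "i < N \<Longrightarrow> cm (D (L i)) (X p i) = pm_val p *\<^sub>v (s i *\<^sub>v Y p i - (lam / 2) *\<^sub>v X p i)"
  by (cases p) (simp_all add: D_L_e D_L_f scaleC_simps)

lemma D_R_X: "i < N \<Longrightarrow> cm (D (i + 1)) (X p i)
  = pm_val p *\<^sub>v (- (s (i + 1) *\<^sub>v Y p i) - (lam / 2) *\<^sub>v X p i + (if i = 0 then om *\<^sub>v X p i else 0))"
  using D_R_e[of i] D_R_f[of i]
  by (cases p) (simp_all add: scaleC_simps)

lemma D_X_zero: "\<lbrakk>i < N; a \<in> {1..N}; a \<noteq> L i; a \<noteq> i + 1\<rbrakk> \<Longrightarrow> cm (D a) (X p i) = 0"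
  using D_e_zero[of i a] by (cases p) simp_all

lemma D_cm_next_X:
  assumes "i < N" "j = (i + 1) mod N"
  shows "cm (D (i + 1)) (cm (X p i) (X p j))
    = (lam / 2) *\<^sub>v (X p i * X p j + X p j * X p i) - (pm_val p * (lam / 2)) *\<^sub>v cm (X p i) (X p j)"
  using D_cm_next[OF assms]
  by (cases p) (simp_all add: cm_def algebra_simps scaleC_simps scaleC_half)

lemma Y_even: "\<lbrakk>i < N; i \<notin> {0, m}\<rbrakk> \<Longrightarrow>
    cm (Y p i) (X p i) = (pm_val p * lam * s i) *\<^sub>v (X p i * X p i)"
  using A_even[of i] by (cases p) (simp_all add: scaleC_simps)

lemma E_X: "\<lbrakk>i < N; a \<in> {1..N}\<rbrakk> \<Longrightarrow> cm (E a a) (X p i) = (pm_val p * wt a i) *\<^sub>v X p i"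
  using E_cm[of a "L i" "i + 1"] E_cm[of a "i + 1" "L i"]
  by (cases p) (auto simp: e_def f_def wt_def cm_bilinear scaleC_simps)

text \<open>Two ways to produce the level-one element from the level-zero one, by the D at either
  index of the node. Properties preserved by commutators with D thus pass from X to Y.\<close>

lemma Y_alt:
  assumes "i < N"
  shows "Y p i = (pm_val p * s i) *\<^sub>v cm (D (L i)) (X p i) + (lam / 2 * s i) *\<^sub>v X p i"
    and "Y p i = - ((pm_val p * s (i + 1)) *\<^sub>v cm (D (i + 1)) (X p i))
      + ((if i = 0 then om else 0) - lam / 2 * s (i + 1)) *\<^sub>v X p i"
  using D_L_X[OF assms, of p] D_R_X[OF assms, of p] assms
  by (cases "i = 0"; simp add: scaleC_simps scaleC_diff_left mult_ac psign_0N)+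

lemma E_Y:
  assumes "i < N" "a \<in> {1..N}"
  shows "cm (E a a) (Y p i) = (pm_val p * wt a i) *\<^sub>v Y p i"
proof -
  have "cm (E a a) (D (L i)) = 0" using assms by (intro E_D) auto
  then have "cm (E a a) (cm (D (L i)) (X p i)) = (pm_val p * wt a i) *\<^sub>v cm (D (L i)) (X p i)"
    by (simp add: cm_jacobi[of "E a a"] E_X[OF assms] cm_bilinear)
  then show ?thesis
    by (simp add: Y_alt(1)[OF assms(1)] cm_bilinear E_X[OF assms] scaleC_simps mult_ac)
qed

lemma E_X1: "\<lbrakk>i < N; a \<in> {1..N}\<rbrakk> \<Longrightarrow> cm (E a a) (X1 p i) = (pm_val p * wt a i) *\<^sub>v X1 p i"
  by (simp add: X1_def cm_bilinear E_X E_Y scaleC_simps mult_ac)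

lemma next_iff: "\<lbrakk>i < N; j < N\<rbrakk> \<Longrightarrow> j = (i + 1) mod N \<longleftrightarrow> L j = i + 1"
  by (auto simp: L_def mod_Suc)

lemma L_inj: "\<lbrakk>i < N; j < N\<rbrakk> \<Longrightarrow> L i = L j \<longleftrightarrow> i = j"
  by (auto simp: L_def)

lemma cartan_alt: "\<lbrakk>i < N; j < N\<rbrakk> \<Longrightarrow> of_int (cartan m n i j) = s i * wt (L i) j - s (i + 1) * wt (i + 1) j"
  using m2 n2 by (auto simp: cartan_def wt_def L_def psign_def parity_def split: if_splits)

lemma cartan_cases:
  assumes "i < N" "j < N"
  shows "of_int (cartan m n i j) = (if i = j then s i + s (i + 1) else if L j = i + 1 then - s j
    else if L i = j + 1 then - s i else 0)"
  using m2 n2 psign_L[of j] L_inj[OF assms] assms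
  unfolding cartan_alt[OF assms] 
  by (auto simp: wt_def L_def split: if_splits)

lemma h_X:
  assumes "i < N" "j < N"
  shows "cm (h i) (X p j) = (pm_val p * of_int (cartan m n i j)) *\<^sub>v X p j"
    and "cm (h i) (X1 p j) = (pm_val p * of_int (cartan m n i j)) *\<^sub>v X1 p j"
  using assms E_X[of j "L i" p] E_X[of j "i + 1" p] E_X1[of j "L i" p] E_X1[of j "i + 1" p]
  by (simp_all add: h_def cm_bilinear cartan_alt scaleC_simps algebra_simps scaleC_diff_left)

lemma h_commute: "\<lbrakk>i < N; j < N\<rbrakk> \<Longrightarrow> cm (h i) (h j) = 0"
  by (simp add: h_def cm_bilinear E_cm)

lemma D_h: "\<lbrakk>a \<in> {1..N}; j < N\<rbrakk> \<Longrightarrow> cm (D a) (h j) = 0"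
  by (simp add: h_def cm_bilinear D_E)

lemma E_h: "\<lbrakk>a \<in> {1..N}; j < N\<rbrakk> \<Longrightarrow> cm (E a a) (h j) = 0"
  by (simp add: h_def cm_bilinear E_cm)

lemma Ht_h: "\<lbrakk>i < N; j < N\<rbrakk> \<Longrightarrow> cm (Ht i) (h j) = 0"
  using m2 by (auto simp: Ht_def cm_bilinear D_h h_commute E_h)

lemma Ht_Ht: "\<lbrakk>i < N; j < N\<rbrakk> \<Longrightarrow> cm (Ht i) (Ht j) = 0"
  using m2 Ht_h[of i j] Ht_h[of j i]
  by (auto simp: Ht_def cm_bilinear D_commute D_E E_D E_cm cm_swap[of "h _" "D _"]
      cm_swap[of "h _" "E _ _"] D_h h_commute E_h)

lemma H_commute:
  assumes "i < N" "j < N"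
  shows "cm (h i) (h j) = 0" "cm (H1 i) (h j) = 0" "cm (h i) (H1 j) = 0" "cm (H1 i) (H1 j) = 0"
  using Ht_h[of i j] Ht_h[of j i] Ht_Ht[of i j] h_commute[of i j] assms
  by (auto simp: H1_def cm_bilinear cm_mult cm_swap[of "h _" "Ht _"])

lemma X_f:
  assumes "i < N" "j < N"
  shows "sb (sg i j) (e i) (f j) = (if i = j then h i else 0)"
proof -
  have "eps m (L i) (i + 1) (j + 1) (L j) = sg i j" by (simp add: sg_def eps_flip)
  moreover have "sg i i = s i * s (i + 1)" using eps_self_sq(1)[of m "L i" "i + 1"] by (simp add: sg_def psign_L)
  ultimately show ?thesis
    using EE_EE[of "L i" "i + 1" "j + 1" "L j" "kp i" "- kp j"] assms L_inj[OF assms]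
    by (auto simp: e_def f_def sb_bilinear h_def scaleC_simps)
qed

text \<open>Two distinct nodes share at most one index, so some index of node i is not an index of
  node j. The D at this index creates Y_i from X_i and commutes with X_j.\<close>

lemma D_choice:
  assumes "i < N" "j < N" "i \<noteq> j"
  obtains a z z' where "a \<in> {1..N}" "\<And>p. Y p i = (pm_val p * z) *\<^sub>v cm (D a) (X p i) + z' *\<^sub>v X p i"
    "\<And>p. cm (D a) (X p j) = 0"
proof (cases "L i = j + 1")
  case False
  show ?thesis
    by (rule that[of "L i" "s i" "lam / 2 * s i"])
      (use assms False L_inj[OF assms(1,2)] in \<open>auto simp: Y_alt(1)[OF assms(1)] intro!: D_X_zero\<close>)
next
  case True
  then have "i + 1 \<noteq> L j" using assms m2 n2 by (auto simp: L_def split: if_splits)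
  then show ?thesis
    by (intro that[of "i + 1" "- s (i + 1)" "(if i = 0 then om else 0) - lam / 2 * s (i + 1)"])
      (use assms in \<open>auto simp: Y_alt(2)[OF assms(1)] scaleC_simps simp del: Y.simps intro!: D_X_zero[of _ "i + 1", simplified]\<close>)
qed

lemma X1_f:
  assumes "i < N" "j < N"
  shows "sb (sg i j) (X1 Plus i) (f j) = (if i = j then H1 i else 0)"
proof (cases "i = j")
  case True
  then show ?thesis
    using assms A_f[of i] X_f[of i i] 
    by (simp add: X1_def sb_bilinear H1_def Ht_def algebra_simps)
next
  case False
  obtain a z z' where a: "\<And>p. Y p i = (pm_val p * z) *\<^sub>v cm (D a) (X p i) + z' *\<^sub>v X p i"
    "\<And>p. cm (D a) (X p j) = 0" by (rule D_choice[OF assms False]) blast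
  have "sb (sg i j) (cm (D a) (e i)) (f j) = 0"
    using cm_sb[of "D a" "sg i j" "e i" "f j"] X_f[OF assms] False a(2)[of Minus]
    by (simp add: cm_bilinear sb_bilinear)
  then show ?thesis
    using a(1)[of Plus] X_f[OF assms] False by (simp add: X1_def sb_bilinear)
qed

lemma X_f1:
  assumes "i < N" "j < N"
  shows "sb (sg i j) (e i) (X1 Minus j) = (if i = j then H1 i else 0)"
proof (cases "i = j")
  case True
  \<comment> \<open>The bracket is h_i, which commutes with D. Expanding by the derivation rule
    shows that it does not matter which of the two factors is raised to level one.\<close>
  have "0 = cm (D (L i)) (sb (sg i i) (e i) (f i))"
    using assms X_f[of i i] by (simp add: D_h)
  also have "\<dots> = s i *\<^sub>v (sb (sg i i) (A i) (f i) - sb (sg i i) (e i) (B i))"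
    using assms by (simp add: cm_sb D_L_e D_L_f sb_bilinear scaleC_simps)
  finally have "s i *\<^sub>v s i *\<^sub>v (sb (sg i i) (A i) (f i) - sb (sg i i) (e i) (B i)) = 0" by simp
  then have "sb (sg i i) (e i) (B i) = sb (sg i i) (A i) (f i)"
    by (simp add: scaleC_scaleC scaleC_one)
  then show ?thesis
    using X1_f[of i i] assms True by (simp add: X1_def sb_bilinear)
next
  case False
  then have False': "j \<noteq> i" by simp
  obtain a z z' where a: "\<And>p. Y p j = (pm_val p * z) *\<^sub>v cm (D a) (X p j) + z' *\<^sub>v X p j"
    "\<And>p. cm (D a) (X p i) = 0" by (rule D_choice[OF assms(2,1) False']) blast
  have "sb (sg i j) (e i) (cm (D a) (f j)) = 0"
    using cm_sb[of "D a" "sg i j" "e i" "f j"] X_f[OF assms] False a(2)[of Plus]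
    by (simp add: cm_bilinear sb_bilinear)
  then show ?thesis
    using a(1)[of Minus] X_f[OF assms] False by (simp add: X1_def sb_bilinear)
qed

text \<open>Here beta + t enters a second time: the full sum of signs is m - n.\<close>

lemma kap_N: "kap N = - t / 2 - beta"
proof -
  have "kap N = t / 2 - (beta + t)"
    unfolding trace kap_def sum_psign by (simp add: mult.commute)
  then show ?thesis by simp
qed

text \<open>Passing to the next node changes \<open>kc\<close> by the amount that compensates the
  terms lam / 2 in \<open>D_L_X\<close> and \<open>D_R_X\<close>. At the two steps around node 0 the
  discrepancies om and beta appear.\<close>

lemma kc_next:
  assumes "i < N" "j < N" "L j = i + 1"
  shows "kc i = kc j + lam / 2 * s j - (if i = 0 then om else 0) + (if j = 0 then beta else 0)"
proof -
  have step: "kap k = kap (k + 1) + lam / 2 * s (k + 1)" for k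
    by (simp add: kap_def algebra_simps)
  consider "i = 0" "j = 1" | "0 < i" "j = i + 1" | "0 < i" "j = 0" "i + 1 = N"
    using assms m2 by (auto simp: L_def split: if_splits)
  then show ?thesis
  proof cases
    case 1
    then show ?thesis using kap_N
      by (simp add: kc_def kap_def[of "Suc 0"] psign_0N om_def field_simps)
  next
    case 2
    then show ?thesis using step[of i] by (simp add: kc_def)
  next
    case 3
    then show ?thesis using step[of i] psign_0N by (simp add: kc_def)
  qed
qed

text \<open>Covers the generic relation and both relations with beta at once. The cases are equal
  nodes, j following i, i following j, and distant nodes. For neighbours only one of the two D's
  acts nontrivially, and \<open>kc_next\<close> replaces \<open>kc i\<close> by
  \<open>kc j\<close>.\<close>

lemma Ht_X:
  assumes "i < N" "j < N"
  shows "cm (Ht i) (X p j) = (pm_val p * of_int (cartan m n i j)) *\<^sub>v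
    (X1 p j + ((if j = 0 \<and> i = N - 1 then beta else 0) - (if i = 0 \<and> j = N - 1 then beta else 0)) *\<^sub>v X p j)"
proof -
  have N5: "4 \<le> N" using m2 n2 by simp
  have E1: "i = 0 \<Longrightarrow> cm (E 1 1) (X p j) = (pm_val p * ((if j = 1 then 1 else 0) - (if j = 0 then 1 else 0))) *\<^sub>v X p j"
    using E_X[of j 1 p] assms N5 by (auto simp: wt_def L_def)
  have Ht: "cm (Ht i) (X p j) = cm (D (L i)) (X p j) - cm (D (i + 1)) (X p j)
      - (if i = 0 then om *\<^sub>v cm (E 1 1) (X p j) else 0) + kc i *\<^sub>v cm (h i) (X p j)"
    by (simp add: Ht_def cm_bilinear)
  consider "i = j" | "i \<noteq> j" "L j = i + 1" | "i \<noteq> j" "L j \<noteq> i + 1" "L i = j + 1"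
    | "i \<noteq> j" "L j \<noteq> i + 1" "L i \<noteq> j + 1" by blast
  then show ?thesis
  proof cases
    case 1
    show ?thesis
      unfolding 1 Ht[unfolded 1] h_X(1)[OF assms(2) assms(2)] D_L_X[OF assms(2)] D_R_X[OF assms(2)]
      using assms 1 E1 N5
      by (cases "j = 0") (simp_all add: cartan_cases X1_def scaleC_simps
          scaleC_add_left scaleC_diff_left algebra_simps psign_0N)
  next
    case 2
    have 3: "cm (D (L i)) (X p j) = 0"
      using 2 assms L_inj[OF assms] N5 by (intro D_X_zero) (auto simp: L_def split: if_splits)
    have 4: "cm (D (i + 1)) (X p j) = pm_val p *\<^sub>v (s j *\<^sub>v Y p j - (lam / 2) *\<^sub>v X p j)"
      using D_L_X[of j p] 2 assms by simp
    have 5: "j = 1 \<longleftrightarrow> i = 0" "j = 0 \<longleftrightarrow> i = N - 1" "\<not> (i = 0 \<and> j = 0)" "\<not> (i = 0 \<and> j = N - 1)" "i = 0 \<Longrightarrow> s j = 1"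
      using 2 assms N5 by (auto simp: L_def psign_0N split: if_splits)
    show ?thesis
      unfolding Ht h_X(1)[OF assms] 3 4 kc_next[OF assms 2(2)]
      using 5 2 assms E1 psign_0N
      by (cases "i = 0") (auto simp: cartan_cases X1_def scaleC_simps
          scaleC_add_left scaleC_diff_left algebra_simps)
  next
    case 3
    have 4: "cm (D (i + 1)) (X p j) = 0"
      using 3 assms by (intro D_X_zero) auto
    have 5: "cm (D (L i)) (X p j) = pm_val p *\<^sub>v (- (s i *\<^sub>v Y p j) - (lam / 2) *\<^sub>v X p j + (if j = 0 then om *\<^sub>v X p j else 0))"
      using D_R_X[of j p] 3 assms psign_L[of i] by simp
    have 6: "i = 1 \<longleftrightarrow> j = 0" "i = 0 \<longleftrightarrow> j = N - 1" "\<not> (i = 0 \<and> j = 0)" "\<not> (j = 0 \<and> i = N - 1)" "j = 0 \<Longrightarrow> s i = 1" "i = 0 \<Longrightarrow> j \<noteq> 1"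
      using 3 assms N5 by (auto simp: L_def psign_0N split: if_splits)
    show ?thesis
      unfolding Ht h_X(1)[OF assms] 4 5 X1_def kc_next[OF assms(2,1) 3(3)]
      using 6 3 assms E1 psign_0N
      by (cases "j = 0"; cases "i = 0") (auto simp: cartan_cases X1_def scaleC_simps
          scaleC_add_left scaleC_diff_left algebra_simps)
  next
    case 4
    have "cm (D (L i)) (X p j) = 0" "cm (D (i + 1)) (X p j) = 0"
      using 4 assms L_inj[OF assms] by (auto intro!: D_X_zero[of _ "i + 1", simplified] D_X_zero)
    moreover have "i = 0 \<Longrightarrow> j \<noteq> 1" using 4 assms by auto
    ultimately show ?thesis
      using 4 assms E1 h_X(1)[of i j p] by (auto simp: Ht cartan_cases)
  qed
qed

end

section \<open>Relations between generators of equal sign, including the Serre relations\<close>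

context gl_core
begin

lemma sg_next: "\<lbrakk>i < N; j < N; i \<noteq> j; L j = i + 1 \<or> L i = j + 1\<rbrakk> \<Longrightarrow> sg i j = 1"
  using m2 n2 by (auto simp: sg_alt L_def split: if_splits)

lemma X_X_zero:
  assumes "i < N" "j < N" "i = j \<and> i \<in> {0, m} \<or> i \<noteq> j \<and> L j \<noteq> i + 1 \<and> L i \<noteq> j + 1"
  shows "sb (sg i j) (X p i) (X p j) = 0"
proof -
  have 1: "i + 1 \<noteq> L j" "L i \<noteq> j + 1" using assms m2 n2 by (auto simp: L_def split: if_splits)
  have "eps m (i + 1) (L i) (j + 1) (L j) = sg i j" by (simp add: sg_def eps_flip)
  then show ?thesis
    using EE_EE[of "L i" "i + 1" "L j" "j + 1" "kp i" "kp j"]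
      EE_EE[of "i + 1" "L i" "j + 1" "L j" "- kp i" "- kp j"] assms 1
    by (cases p) (auto simp: e_def f_def sb_bilinear sg_def)
qed

text \<open>The D at the index shared by both nodes is applied to [X_i, X_j]. By
  \<open>D_cm_next_X\<close> the result is an anticommutator plus a multiple of the bracket; by the
  Jacobi identity it is the difference [Y_i, X_j] - [X_i, Y_j] up to such multiples. Comparing the
  two expressions gives the relation.\<close>

lemma X1_X_next:
  assumes "i < N" "j < N" "i \<noteq> j" "L j = i + 1"
  shows "cm (X1 p i) (X p j) - cm (X p i) (X1 p j)
    = - ((pm_val p * s j * lam / 2) *\<^sub>v (X p i * X p j + X p j * X p i))
      + (if j = 0 then beta *\<^sub>v cm (X p i) (X p j) else 0)"
proof -
  define c where "c = cm (X p i) (X p j)"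
  define d where "d = cm (Y p i) (X p j) - cm (X p i) (Y p j)"
  define a where "a = (lam / 2) *\<^sub>v (X p i * X p j + X p j * X p i)"
  have nx: "j = (i + 1) mod N" using assms next_iff by blast
  have sj: "s (i + 1) = s j" using assms psign_L[of j] by simp
  have Dj: "cm (D (i + 1)) (X p j) = pm_val p *\<^sub>v (s j *\<^sub>v Y p j - (lam / 2) *\<^sub>v X p j)"
    using D_L_X[of j p] assms by simp
  have "a - (pm_val p * (lam / 2)) *\<^sub>v c = cm (D (i + 1)) (cm (X p i) (X p j))"
    using D_cm_next_X[OF assms(1) nx, of p] by (simp add: a_def c_def)
  also have "\<dots> = cm (cm (D (i + 1)) (X p i)) (X p j) + cm (X p i) (cm (D (i + 1)) (X p j))"
    by (rule cm_jacobi)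
  also have "\<dots> = pm_val p *\<^sub>v (- (s j *\<^sub>v d) - lam *\<^sub>v c + (if i = 0 then om *\<^sub>v c else 0))"
    unfolding D_R_X[OF assms(1)] Dj sj
    by (simp add: cm_bilinear d_def c_def scaleC_simps scaleC_half(1)[of lam, symmetric] algebra_simps)
  finally have "s j *\<^sub>v pm_val p *\<^sub>v (a - (pm_val p * (lam / 2)) *\<^sub>v c)
    = s j *\<^sub>v pm_val p *\<^sub>v pm_val p *\<^sub>v (- (s j *\<^sub>v d) - lam *\<^sub>v c + (if i = 0 then om *\<^sub>v c else 0))"
    by simp
  then have "(pm_val p * s j) *\<^sub>v a + (lam / 2 * s j) *\<^sub>v c - (if i = 0 then (s j * om) *\<^sub>v c else 0) = - d"
    by (cases "i = 0") (simp_all add: scaleC_simps scaleC_half(1)[of lam, symmetric] algebra_simps)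
  then have "d = - ((pm_val p * s j) *\<^sub>v a + (lam / 2 * s j) *\<^sub>v c - (if i = 0 then (s j * om) *\<^sub>v c else 0))"
    by (simp only: minus_minus)
  then have d: "d = - ((pm_val p * s j) *\<^sub>v a) - (lam / 2 * s j) *\<^sub>v c + (if i = 0 then (s j * om) *\<^sub>v c else 0)"
    by (simp only: minus_minus minus_diff_eq minus_add_distrib diff_conv_add_uminus add_ac)
  have i0: "i = 0 \<Longrightarrow> s j = 1" using assms psign_0N by (auto simp: L_def split: if_splits)
  have "cm (X1 p i) (X p j) - cm (X p i) (X1 p j) = d + (kc i - kc j) *\<^sub>v c"
    by (simp add: X1_def cm_bilinear d_def c_def scaleC_diff_left algebra_simps)
  also have "kc i - kc j = lam / 2 * s j - (if i = 0 then om else 0) + (if j = 0 then beta else 0)"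
    using kc_next[OF assms(1,2,4)] by simp
  also have "d + (lam / 2 * s j - (if i = 0 then om else 0) + (if j = 0 then beta else 0)) *\<^sub>v c
    = - ((pm_val p * s j * lam / 2) *\<^sub>v (X p i * X p j + X p j * X p i)) + (if j = 0 then beta *\<^sub>v c else 0)"
    unfolding d a_def using i0
    by (cases "i = 0") (simp_all add: scaleC_simps scaleC_add_left scaleC_diff_left algebra_simps)
  finally show ?thesis by (simp only: c_def)
qed

text \<open>For an equal odd node both sides vanish, since the bracket is symmetric and a_{i,i} = 0;
  for an equal even node \<open>Y_even\<close> applies. Neighbours reduce to
  \<open>X1_X_next\<close>, possibly with the nodes exchanged. For distant nodes each bracket
  vanishes by \<open>D_choice\<close>.\<close>

lemma X1_X:
  assumes "i < N" "j < N" "(i, j) \<noteq> (N - 1, 0)"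
  shows "sb (sg i j) (X1 p i) (X p j) - sb (sg i j) (X p i) (X1 p j)
    = (pm_val p * of_int (cartan m n i j) * lam / 2) *\<^sub>v (X p i * X p j + X p j * X p i)
      - (if i = 0 \<and> j = N - 1 then beta *\<^sub>v sb (sg i j) (X p i) (X p j) else 0)"
proof -
  consider "i = j" "i \<in> {0, m}" | "i = j" "i \<notin> {0, m}" | "i \<noteq> j" "L j = i + 1"
    | "i \<noteq> j" "L j \<noteq> i + 1" "L i = j + 1" | "i \<noteq> j" "L j \<noteq> i + 1" "L i \<noteq> j + 1" by blast
  then show ?thesis
  proof cases
    case 1
    have "sg j j = -1" using 1 assms by (simp add: sg_alt)
    moreover have "s j + s (j + 1) = 0" using 1 m2 n2 by (auto simp: psign_def parity_def)
    moreover have "\<not> (j = 0 \<and> j = N - 1)" using m2 n2 by linarith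
    ultimately show ?thesis
      using 1 assms by (auto simp: cartan_cases sb_def X1_def algebra_simps scaleC_simps)
  next
    case 2
    have sg: "sg j j = 1" using 2 assms by (simp add: sg_alt)
    have sj: "s (j + 1) = s j" using 2 by (auto simp: psign_def parity_def)
    have "cm (X1 p j) (X p j) - cm (X p j) (X1 p j) = cm (Y p j) (X p j) + cm (Y p j) (X p j)"
      by (simp add: X1_def cm_bilinear cm_swap[of "X p j"])
    also have "\<dots> = (pm_val p * lam * s j) *\<^sub>v (X p j * X p j + X p j * X p j)"
      using 2 assms by (simp add: Y_even scaleC_add_right)
    finally show ?thesis
      using 2 assms sj by (simp add: sg sb_one cartan_cases mult_ac)
  next
    case 3
    have "i = 0 \<Longrightarrow> j \<noteq> N - 1" "j \<noteq> 0" using 3 assms m2 n2 by (auto simp: L_def split: if_splits)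
    then show ?thesis
      using 3 assms X1_X_next[of i j p] sg_next[of i j]
      by (auto simp: sb_one cartan_cases scaleC_minus_left)
  next
    case 4
    have 5: "i = 0 \<Longrightarrow> j = N - 1" "i \<noteq> 0 \<Longrightarrow> j \<noteq> N - 1 \<or> i \<noteq> 0" using 4 assms m2 n2 by (auto simp: L_def split: if_splits)
    have "cm (X1 p i) (X p j) - cm (X p i) (X1 p j) = cm (X1 p j) (X p i) - cm (X p j) (X1 p i)"
      by (simp add: cm_swap[of "X1 p i"] cm_swap[of "X p i"])
    also have "\<dots> = - ((pm_val p * s i * lam / 2) *\<^sub>v (X p i * X p j + X p j * X p i))
      - (if i = 0 then beta *\<^sub>v cm (X p i) (X p j) else 0)"
      using 4 assms by (subst X1_X_next) (auto simp: add.commute cm_swap[of "X p j"] scaleC_minus_right)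
    finally show ?thesis
      using 4 5 assms sg_next[of i j]
      by (auto simp: sb_one cartan_cases scaleC_minus_left)
  next
    case 5
    have 0: "sb (sg i j) (X p i) (X p j) = 0" using 5 assms by (intro X_X_zero) auto
    obtain a z z' where a: "\<And>p. Y p i = (pm_val p * z) *\<^sub>v cm (D a) (X p i) + z' *\<^sub>v X p i"
      "\<And>p. cm (D a) (X p j) = 0" by (rule D_choice[OF assms(1,2) 5(1)]) blast
    obtain b y y' where b: "\<And>p. Y p j = (pm_val p * y) *\<^sub>v cm (D b) (X p j) + y' *\<^sub>v X p j"
      "\<And>p. cm (D b) (X p i) = 0" by (rule D_choice[OF assms(2,1) 5(1)[symmetric]]) blast
    have "sb (sg i j) (cm (D a) (X p i)) (X p j) = 0"
      using cm_sb[of "D a" "sg i j" "X p i" "X p j"] 0 a(2) by (simp add: cm_bilinear sb_bilinear)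
    moreover have "sb (sg i j) (X p i) (cm (D b) (X p j)) = 0"
      using cm_sb[of "D b" "sg i j" "X p i" "X p j"] 0 b(2) by (simp add: cm_bilinear sb_bilinear)
    ultimately show ?thesis
      using 0 5 assms by (auto simp: X1_def a(1) b(1) sb_bilinear cartan_cases)
  qed
qed

text \<open>The bracket of neighbours is a single matrix unit sharing its first or its second index
  with X_i. Two such units have no composable indices, so they supercommute.\<close>

lemma X_cm_adjacent:
  assumes "i < N" "j < N" "i \<noteq> j" "L j = i + 1 \<or> L i = j + 1"
  shows "sb (sg i i) (X p i) (cm (X p i) (X p j)) = 0"
proof -
  have zero: "sb w (EE k a b) (EE k' c d) = 0"
    if "{a, b, c, d} \<subseteq> {1..N}" "w = eps m a b c d" "b \<noteq> c" "a \<noteq> d" for w k k' a b c d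
    using EE_EE[OF that(1), of k k'] that by simp
  have nn: "i + 1 \<noteq> L i" "j + 1 \<noteq> L j" "\<not> (L j = i + 1 \<and> L i = j + 1)" "L i \<noteq> L j" 
    using assms m2 n2 L_inj[OF assms(1,2)] by (auto simp: L_def split: if_splits)
  have w: "eps m (L i) (i + 1) (L j) (j + 1) = 1" using sg_next[OF assms] by (simp add: sg_def)
  from assms(4) show ?thesis
  proof
    assume nx: "L j = i + 1"
    have c: "cm (e i) (e j) = EE (kp i + kp j) (L i) (j + 1)"
      "cm (f i) (f j) = - ((s i * s (i + 1)) *\<^sub>v EE (- kp i - kp j) (j + 1) (L i))"
      using nx next_iff[of i j] assms cm_next[of i j] by blast+
    have w': "sg i i = eps m (L i) (i + 1) (L i) (j + 1)"
      "sg i i = eps m (i + 1) (L i) (j + 1) (L i)"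
      using w parity_cases[of m "L i"] parity_cases[of m "i + 1"] parity_cases[of m "j + 1"]
      unfolding nx by (auto simp: sg_def eps_def split: if_splits)
    have "sb (sg i i) (EE (kp i) (L i) (i + 1)) (EE (kp i + kp j) (L i) (j + 1)) = 0"
      using assms nn nx by (intro zero) (auto simp: w'(1))
    moreover have "sb (sg i i) (EE (- kp i) (i + 1) (L i)) (EE (- kp i - kp j) (j + 1) (L i)) = 0"
      using assms nn nx by (intro zero) (auto simp: w'(2))
    ultimately show ?thesis
      by (cases p) (simp_all add: c, simp_all add: e_def f_def sb_bilinear)
  next
    assume nx: "L i = j + 1"
    have c: "cm (e i) (e j) = - EE (kp j + kp i) (L j) (i + 1)"
      "cm (f i) (f j) = (s j * s (j + 1)) *\<^sub>v EE (- kp j - kp i) (i + 1) (L j)"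
      using nx next_iff[of j i] assms cm_next[of j i] cm_swap[of "e i"] cm_swap[of "f i"] by simp_all
    have w': "sg i i = eps m (L i) (i + 1) (L j) (i + 1)"
      "sg i i = eps m (i + 1) (L i) (i + 1) (L j)"
      using w parity_cases[of m "L j"] parity_cases[of m "i + 1"] parity_cases[of m "j + 1"]
      unfolding nx by (auto simp: sg_def eps_def nx split: if_splits)
    have "sb (sg i i) (EE (kp i) (L i) (i + 1)) (EE (kp j + kp i) (L j) (i + 1)) = 0"
      using assms nn nx by (intro zero) (auto simp: w'(1))
    moreover have "sb (sg i i) (EE (- kp i) (i + 1) (L i)) (EE (- kp j - kp i) (i + 1) (L j)) = 0"
      using assms nn nx by (intro zero) (auto simp: w'(2))
    ultimately show ?thesis
      by (cases p) (simp_all add: c, simp_all add: e_def f_def sb_bilinear)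
  qed
qed

text \<open>Both inner brackets are matrix units, of cyclic index ranges that overlap in node i
  without sharing an end point; neither product of units can be composed.\<close>

lemma odd_Serre_X:
  assumes "i \<in> {0, m}" "ip = (i + (N - 1)) mod N" "iq = (i + 1) mod N"
  shows "sb (-1) (cm (X p ip) (X p i)) (cm (X p i) (X p iq)) = 0"
proof -
  have lt: "i < N" "ip < N" "iq < N" using assms m2 n2 by auto
  have ip: "ip = (if i = 0 then N - 1 else i - 1)"
  proof (cases "i = 0")
    case False
    then have "i + (N - 1) = (i - 1) + N" using m2 by simp
    then have "(i + (N - 1)) mod N = (i - 1) mod N" by (simp only: mod_add_self2)
    then show ?thesis using False lt assms(2) by simp
  qed (use assms lt in simp)
  have nx1: "i = (ip + 1) mod N"
    using assms(1) m2 n2 unfolding ip by auto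
  have L1: "L i = ip + 1" and L2: "L iq = i + 1"
    using nx1 assms(3) next_iff lt by blast+
  have iq: "iq = i + 1" using assms(1,3) m2 n2 by auto
  have nn: "L ip \<noteq> i + 1" "L ip \<noteq> iq + 1" "L i \<noteq> i + 1" "L i \<noteq> iq + 1"
    using assms(1) m2 n2 unfolding ip iq by (auto simp: L_def)
  have "parity m (L ip) + parity m (i + 1) = 1" "parity m (L i) + parity m (iq + 1) = 1"
    using assms(1) m2 n2 unfolding ip iq by (auto simp: L_def parity_def)
  then have par: "eps m (L ip) (i + 1) (L i) (iq + 1) = -1" "eps m (i + 1) (L ip) (iq + 1) (L i) = -1"
    by (simp_all add: eps_def add.commute)
  show ?thesis
    using EE_EE[of "L ip" "i + 1" "L i" "iq + 1" "kp ip + kp i" "kp i + kp iq"]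
      EE_EE[of "i + 1" "L ip" "iq + 1" "L i" "- kp ip - kp i" "- kp i - kp iq"] nn lt par
      cm_next[OF lt(2) nx1] cm_next[OF lt(1) assms(3)]
    by (cases p) (simp_all add: sb_bilinear)
qed

end

lemma sgn_of_nat_diff:
  "k < i \<Longrightarrow> sgn (of_nat k - of_nat i :: complex) = -1" "i < k \<Longrightarrow> sgn (of_nat k - of_nat i :: complex) = 1"
proof -
  have 1: "sgn (of_nat k - of_nat i :: complex) = 1" if "i < k" for i k
  proof -
    have eq: "(of_nat k - of_nat i :: complex) = of_nat (k - i)" using that by (simp add: of_nat_diff)
    show ?thesis unfolding eq using that by (simp add: sgn_eq norm_of_nat del: of_nat_diff)
  qed
  show "i < k \<Longrightarrow> sgn (of_nat k - of_nat i :: complex) = 1" by (rule 1)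
  show "k < i \<Longrightarrow> sgn (of_nat k - of_nat i :: complex) = -1"
    using 1[of k i] sgn_minus[of "of_nat i - of_nat k :: complex"] by simp
qed

section \<open>The elements J expressed by matrix units\<close>

context gl_core
begin

text \<open>The operator E_{a,b} weighted by the elements y_k of the formulas for J. Up to scalars
  such an element is x_k y_k plus half the sum of all transpositions moving k, and the latter
  becomes the quadratic sum minus the supertrace term.\<close>

definition JJ :: "nat \<Rightarrow> nat \<Rightarrow> 'a" where
  "JJ a b = Z a b + (t / 2) *\<^sub>v E a b
    + (lam / 2) *\<^sub>v ((\<Sum>k\<in>{1..N}. s k *\<^sub>v (E a k * E k b)) - (of_nat m - of_nat n) *\<^sub>v E a b)"

text \<open>The truncated sum in \<open>Q\<close> has coefficient lam for k < i; adding lam / 2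
  times the sum weighted by sign(k - i) gives lam / 2 for all k other than i and i + 1. The
  remaining linear terms match because m - n splits into the signs up to i, the sign at i + 1 and
  i^(0).\<close>

lemma J_x_eq:
  assumes "0 < i" "i < N"
  shows "X1 Plus i + lam *\<^sub>v ((- paren0 m n i / 2) *\<^sub>v e i
      + (1 / 2) *\<^sub>v (\<Sum>k\<in>{1..N} - {i, i + 1}. (s k * sgn (of_nat k - of_nat i)) *\<^sub>v (E i k * E k (i + 1)))
      - (1 / 2) *\<^sub>v (h i * e i)) = JJ i (i + 1)"
    and "X1 Minus i + lam *\<^sub>v ((- paren0 m n i / 2) *\<^sub>v f i
      + (s i / 2) *\<^sub>v (\<Sum>k\<in>{1..N} - {i, i + 1}. (s k * sgn (of_nat k - of_nat i)) *\<^sub>v (E (i + 1) k * E k i))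
      - (1 / 2) *\<^sub>v (f i * h i)) = s i *\<^sub>v JJ (i + 1) i"
proof -
  have sets: "{1..N} - {i, i + 1} = {1..<i} \<union> {i + 2..N}" "{1..N} = insert i (insert (i + 1) ({1..<i} \<union> {i + 2..N}))"
    "{1..i} = insert i {1..<i}"
    using assms by auto
  have split1: "(\<Sum>k\<in>{1..N} - {i, i + 1}. (s k * sgn (of_nat k - of_nat i)) *\<^sub>v g k)
    = (\<Sum>k\<in>{i + 2..N}. s k *\<^sub>v g k) - (\<Sum>k\<in>{1..<i}. s k *\<^sub>v g k)" for g :: "nat \<Rightarrow> 'a"
    unfolding sets(1) by (subst sum.union_disjoint) (auto simp: sgn_of_nat_diff scaleC_simps sum_negf)
  have split2: "(\<Sum>k\<in>{1..N}. s k *\<^sub>v g k) = s i *\<^sub>v g i + s (i + 1) *\<^sub>v g (i + 1)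
    + (\<Sum>k\<in>{1..<i}. s k *\<^sub>v g k) + (\<Sum>k\<in>{i + 2..N}. s k *\<^sub>v g k)" for g :: "nat \<Rightarrow> 'a"
    unfolding sets(2) by (subst sum.insert, simp, simp)+ (subst sum.union_disjoint, auto simp: add.assoc)
  define T :: complex where "T = of_nat m - of_nat n"
  have tr: "T = (\<Sum>k\<in>{1..i}. s k) + s (i + 1) + paren0 m n i"
  proof -
    have "{1..N} = insert (i + 1) ({1..i} \<union> {i + 2..N})" using assms by auto
    moreover have "sum s ({1..i} \<union> {i + 2..N}) = sum s {1..i} + sum s {i + 2..N}"
      by (subst sum.union_disjoint) auto
    ultimately have "(\<Sum>k\<in>{1..N}. s k) = s (i + 1) + (sum s {1..i} + sum s {i + 2..N})"
      by simp
    then show ?thesis unfolding sum_psign paren0_def T_def by simp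
  qed
  have kc: "kc i = t / 2 - lam / 2 * T + lam / 2 * s (i + 1) + lam / 2 * paren0 m n i"
    using assms unfolding tr by (simp add: kc_def kap_def algebra_simps)
  have w: "E i (i + 1) * E (i + 1) (i + 1) = E (i + 1) (i + 1) * E i (i + 1) + E i (i + 1)"
    "E (i + 1) (i + 1) * E (i + 1) i = E (i + 1) i * E (i + 1) (i + 1) + E (i + 1) i"
    using E_cm[of "i + 1" i "i + 1" 0] E_cm[of "i + 1" "i + 1" i 0] assms by (simp_all add: cm_def algebra_simps)
  have Q: "Q i a b = Z a b + lam *\<^sub>v (\<Sum>k\<in>{1..<i}. s k *\<^sub>v (E a k * E k b)) + (lam * s i) *\<^sub>v (E a i * E i b)" for a b
    using Q_split assms by simp
  show "X1 Plus i + lam *\<^sub>v ((- paren0 m n i / 2) *\<^sub>v e i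
      + (1 / 2) *\<^sub>v (\<Sum>k\<in>{1..N} - {i, i + 1}. (s k * sgn (of_nat k - of_nat i)) *\<^sub>v (E i k * E k (i + 1)))
      - (1 / 2) *\<^sub>v (h i * e i)) = JJ i (i + 1)"
    unfolding split1 JJ_def T_def[symmetric] split2 X1_def kc Y.simps X.simps A_def Q
    using assms w 
    by (simp add: e_simps h_def scaleC_simps scaleC_add_left scaleC_diff_left algebra_simps
        scaleC_half(1)[of lam, symmetric] scaleC_half(1)[of "lam * s i", symmetric])
  show "X1 Minus i + lam *\<^sub>v ((- paren0 m n i / 2) *\<^sub>v f i
      + (s i / 2) *\<^sub>v (\<Sum>k\<in>{1..N} - {i, i + 1}. (s k * sgn (of_nat k - of_nat i)) *\<^sub>v (E (i + 1) k * E k i))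
      - (1 / 2) *\<^sub>v (f i * h i)) = s i *\<^sub>v JJ (i + 1) i"
    unfolding split1 JJ_def T_def[symmetric] split2 X1_def kc Y.simps X.simps B_def Q
    using assms w 
    by (simp add: e_simps h_def scaleC_simps scaleC_add_left scaleC_diff_left algebra_simps
        scaleC_half(1)[of lam, symmetric] scaleC_half(1)[of "lam * s i", symmetric])
qed

lemma J_h_eq:
  assumes "0 < i" "i < N"
  shows "Ht i + lam *\<^sub>v ((- paren0 m n (i - 1) / 2) *\<^sub>v h i
      + (s i / 2) *\<^sub>v (\<Sum>k\<in>{1..N} - {i}. (s k * sgn (of_nat k - of_nat i)) *\<^sub>v (E i k * E k i))
      - (s (i + 1) / 2) *\<^sub>v (\<Sum>k\<in>{1..N} - {i + 1}. (s k * sgn (of_nat k - of_nat (i + 1))) *\<^sub>v (E (i + 1) k * E k (i + 1))))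
    = s i *\<^sub>v JJ i i - s (i + 1) *\<^sub>v JJ (i + 1) (i + 1)"
proof -
  define tr :: complex where "tr = of_nat m - of_nat n"
  \<comment> \<open>The same symmetrisation for a single index. The leftover multiple of s a E_aa
    has a coefficient independent of a, so in the difference of two neighbours it becomes a multiple
    of h_i, absorbed by \<open>kc i\<close>.\<close>
  have key: "D a + (lam * s a / 2) *\<^sub>v (\<Sum>k\<in>{1..N} - {a}. (s k * sgn (of_nat k - of_nat a)) *\<^sub>v (E a k * E k a))
    = s a *\<^sub>v JJ a a + (lam / 2 * tr - t / 2) *\<^sub>v s a *\<^sub>v E a a" if "a \<in> {1..N}" for a
  proof -
    have sets: "{1..N} - {a} = {1..<a} \<union> {a + 1..N}" "{1..N} = insert a ({1..<a} \<union> {a + 1..N})"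
      using that by auto
    have split1: "(\<Sum>k\<in>{1..N} - {a}. (s k * sgn (of_nat k - of_nat a)) *\<^sub>v g k)
      = (\<Sum>k\<in>{a + 1..N}. s k *\<^sub>v g k) - (\<Sum>k\<in>{1..<a}. s k *\<^sub>v g k)" for g :: "nat \<Rightarrow> 'a"
      unfolding sets(1) by (subst sum.union_disjoint) (auto simp: sgn_of_nat_diff scaleC_simps sum_negf)
    have split2: "(\<Sum>k\<in>{1..N}. s k *\<^sub>v g k) = s a *\<^sub>v g a
      + (\<Sum>k\<in>{1..<a}. s k *\<^sub>v g k) + (\<Sum>k\<in>{a + 1..N}. s k *\<^sub>v g k)" for g :: "nat \<Rightarrow> 'a"
      unfolding sets(2) by (subst sum.insert, simp, simp) (subst sum.union_disjoint, auto simp: add.assoc)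
    show ?thesis
      unfolding split1 JJ_def split2 D_def C_def tr_def[symmetric]
      by (simp add: scaleC_simps scaleC_add_left scaleC_diff_left algebra_simps
        scaleC_half(1)[of lam, symmetric] scaleC_half(1)[of "lam * s a", symmetric])
  qed
  have trs: "tr = (\<Sum>k\<in>{1..i}. s k) + paren0 m n (i - 1)"
  proof -
    have "{1..N} = {1..i} \<union> {i - 1 + 2..N}" using assms by auto
    moreover have "sum s ({1..i} \<union> {i - 1 + 2..N}) = sum s {1..i} + sum s {i - 1 + 2..N}"
      by (subst sum.union_disjoint) auto
    ultimately have "(\<Sum>k\<in>{1..N}. s k) = sum s {1..i} + sum s {i - 1 + 2..N}"
      by simp
    then show ?thesis unfolding sum_psign paren0_def tr_def by simp
  qed
  have kc: "kc i = t / 2 - lam / 2 * tr + lam / 2 * paren0 m n (i - 1)"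
    using assms unfolding trs by (simp add: kc_def kap_def algebra_simps)
  have "Ht i + lam *\<^sub>v ((- paren0 m n (i - 1) / 2) *\<^sub>v h i
      + (s i / 2) *\<^sub>v (\<Sum>k\<in>{1..N} - {i}. (s k * sgn (of_nat k - of_nat i)) *\<^sub>v (E i k * E k i))
      - (s (i + 1) / 2) *\<^sub>v (\<Sum>k\<in>{1..N} - {i + 1}. (s k * sgn (of_nat k - of_nat (i + 1))) *\<^sub>v (E (i + 1) k * E k (i + 1))))
    = (D i + (lam * s i / 2) *\<^sub>v (\<Sum>k\<in>{1..N} - {i}. (s k * sgn (of_nat k - of_nat i)) *\<^sub>v (E i k * E k i)))
      - (D (i + 1) + (lam * s (i + 1) / 2) *\<^sub>v (\<Sum>k\<in>{1..N} - {i + 1}. (s k * sgn (of_nat k - of_nat (i + 1))) *\<^sub>v (E (i + 1) k * E k (i + 1))))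
      + (t / 2 - lam / 2 * tr) *\<^sub>v h i"
    using assms unfolding Ht_def kc
    by (simp add: scaleC_simps scaleC_add_left scaleC_diff_left algebra_simps)
  also have "\<dots> = s i *\<^sub>v JJ i i - s (i + 1) *\<^sub>v JJ (i + 1) (i + 1)"
  proof -
    have "i \<in> {1..N}" "i + 1 \<in> {1..N}" using assms by auto
    then show ?thesis
      unfolding key[OF \<open>i \<in> {1..N}\<close>] key[OF \<open>i + 1 \<in> {1..N}\<close>]
      using assms by (simp add: h_def scaleC_simps scaleC_diff_left algebra_simps)
  qed
  finally show ?thesis .
qed

end

section \<open>Cosets, quotient spaces and presented algebras\<close>

text \<open>Cosets as plain sets over a type class. The quotient constructions of the definitions
  are translated to this form, where equality of cosets is membership of a difference.\<close>

definition coset :: "'a::ab_group_add set \<Rightarrow> 'a \<Rightarrow> 'a set" where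
  "coset W u = (\<lambda>w. w + u) ` W"

definition add_closed :: "'a::ab_group_add set \<Rightarrow> bool" where
  "add_closed W \<longleftrightarrow> 0 \<in> W \<and> (\<forall>u\<in>W. \<forall>v\<in>W. u - v \<in> W)"

lemma add_closedD:
  assumes "add_closed W"
  shows "0 \<in> W" "u \<in> W \<Longrightarrow> v \<in> W \<Longrightarrow> u - v \<in> W" "u \<in> W \<Longrightarrow> - u \<in> W" "u \<in> W \<Longrightarrow> v \<in> W \<Longrightarrow> u + v \<in> W"
proof -
  show 0: "0 \<in> W" and diff: "u \<in> W \<Longrightarrow> v \<in> W \<Longrightarrow> u - v \<in> W" for u v
    using assms by (auto simp: add_closed_def)
  show minus: "u \<in> W \<Longrightarrow> - u \<in> W" for u using diff[OF 0, of u] by simp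
  show "u \<in> W \<Longrightarrow> v \<in> W \<Longrightarrow> u + v \<in> W" using diff[of u "- v"] minus[of v] by simp
qed

lemma mem_coset: "v \<in> coset W u \<longleftrightarrow> v - u \<in> W"
  by (force simp: coset_def intro: image_eqI[of _ _ "v - u"])

lemma coset_self: "add_closed W \<Longrightarrow> u \<in> coset W u"
  by (simp add: mem_coset add_closedD)

lemma coset_eq_iff:
  assumes "add_closed W"
  shows "coset W u = coset W v \<longleftrightarrow> u - v \<in> W"
proof
  assume "coset W u = coset W v"
  then show "u - v \<in> W" using coset_self[OF assms, of u] by (simp add: mem_coset)
next
  assume *: "u - v \<in> W"
  have "x - u \<in> W \<longleftrightarrow> x - v \<in> W" for x
    using add_closedD(4)[OF assms, of "x - u" "u - v"] add_closedD(2)[OF assms, of "x - v" "u - v"] *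
    by auto
  then show "coset W u = coset W v" by (auto simp: mem_coset)
qed

lemma coset_zero: "coset W 0 = W"
  by (simp add: coset_def)

lemma set_add_coset:
  assumes "add_closed W"
  shows "(\<Union>x\<in>coset W u. \<Union>y\<in>coset W v. {x + y}) = coset W (u + v)"
proof (intro equalityI subsetI)
  fix x assume "x \<in> (\<Union>x\<in>coset W u. \<Union>y\<in>coset W v. {x + y})"
  then obtain a b where ab: "x = a + b" "a - u \<in> W" "b - v \<in> W" by (auto simp: mem_coset)
  then have "a + b - (u + v) = (a - u) + (b - v)" by simp
  then show "x \<in> coset W (u + v)" using ab add_closedD(4)[OF assms] by (metis mem_coset)
next
  fix x assume "x \<in> coset W (u + v)"
  then have "x - v \<in> coset W u" by (simp add: mem_coset algebra_simps)
  moreover have "v \<in> coset W v" using assms by (rule coset_self)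
  ultimately show "x \<in> (\<Union>x\<in>coset W u. \<Union>y\<in>coset W v. {x + y})"
    by (intro UN_I[of "x - v"] UN_I[of v]) auto
qed

definition FS :: "'b set \<Rightarrow> ('b \<Rightarrow>\<^sub>0 complex) set" where
  "FS B = {p. Poly_Mapping.keys p \<subseteq> B}"

lemma FS_closed: "0 \<in> FS B" "u \<in> FS B \<Longrightarrow> v \<in> FS B \<Longrightarrow> u + v \<in> FS B"
  "u \<in> FS B \<Longrightarrow> z *\<^sub>v u \<in> FS B" "u \<in> FS B \<Longrightarrow> - u \<in> FS B"
  "u \<in> FS B \<Longrightarrow> v \<in> FS B \<Longrightarrow> u - v \<in> FS B" "b \<in> B \<Longrightarrow> Poly_Mapping.single b z \<in> FS B"
  by (simp_all add: FS_def subset_iff in_keys_iff lookup_minus lookup_add lookup_single when_def)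
    (metis add.right_neutral, metis diff_zero)

lemma free_space_simps [simp]:
  "carrier (free_space B) = FS B" "add (free_space B) = (+)" "zero (free_space B) = 0"
  "smult (free_space B) = (*\<^sub>v)"
  by (auto simp: free_space_def FS_def fun_eq_iff cscale_eq)

definition lin_closed :: "'v::cvector set \<Rightarrow> bool" where
  "lin_closed W \<longleftrightarrow> 0 \<in> W \<and> (\<forall>u\<in>W. \<forall>v\<in>W. u + v \<in> W) \<and> (\<forall>z. \<forall>u\<in>W. z *\<^sub>v u \<in> W)"

lemma lin_closed_add_closed: "lin_closed W \<Longrightarrow> add_closed W"
  unfolding lin_closed_def add_closed_def
  by (metis diff_conv_add_uminus scaleC_minus_left scaleC_one)

lemma cmodI:
  assumes "abelian_group V" "\<And>z x. x \<in> carrier V \<Longrightarrow> z \<odot>\<^bsub>V\<^esub> x \<in> carrier V"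
    "\<And>z w x. x \<in> carrier V \<Longrightarrow> (z + w) \<odot>\<^bsub>V\<^esub> x = z \<odot>\<^bsub>V\<^esub> x \<oplus>\<^bsub>V\<^esub> w \<odot>\<^bsub>V\<^esub> x"
    "\<And>z x y. x \<in> carrier V \<Longrightarrow> y \<in> carrier V \<Longrightarrow> z \<odot>\<^bsub>V\<^esub> (x \<oplus>\<^bsub>V\<^esub> y) = z \<odot>\<^bsub>V\<^esub> x \<oplus>\<^bsub>V\<^esub> z \<odot>\<^bsub>V\<^esub> y"
    "\<And>z w x. x \<in> carrier V \<Longrightarrow> (z * w) \<odot>\<^bsub>V\<^esub> x = z \<odot>\<^bsub>V\<^esub> (w \<odot>\<^bsub>V\<^esub> x)"
    "\<And>x. x \<in> carrier V \<Longrightarrow> 1 \<odot>\<^bsub>V\<^esub> x = x"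
  shows "cmod V"
  using assms by (intro moduleI cring_complex_ring) auto

lemma abelian_group_FS: "abelian_group (free_space B)"
  by (rule abelian_groupI) (auto simp: FS_closed add_ac intro!: bexI[of _ "- x" for x])

lemma submodule_FS_iff:
  "submodule W complex_ring (free_space B) \<longleftrightarrow> W \<subseteq> FS B \<and> lin_closed W"
proof
  assume "submodule W complex_ring (free_space B)"
  then interpret submodule W complex_ring "free_space B" .
  show "W \<subseteq> FS B \<and> lin_closed W"
    using subset one_closed m_closed smult_closed by (auto simp: lin_closed_def)
next
  assume *: "W \<subseteq> FS B \<and> lin_closed W"
  interpret abelian_group "free_space B" by (rule abelian_group_FS)
  have inv: "inv\<^bsub>add_monoid (free_space B)\<^esub> u = - u" if "u \<in> FS B" for u
    using that unfolding a_inv_def[symmetric] by (intro add.inv_equality) (auto simp: FS_closed)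
  have "- u \<in> W" if "u \<in> W" for u
    using * that add_closedD(3)[OF lin_closed_add_closed] by blast
  then show "submodule W complex_ring (free_space B)"
    using * inv by (intro submodule.intro subgroup.intro submodule_axioms.intro) (auto simp: lin_closed_def)
qed

lemma lspan_FS: "lspan (free_space B) S = \<Inter>{W. W \<subseteq> FS B \<and> lin_closed W \<and> S \<subseteq> W}"
  by (simp add: lspan_def submodule_FS_iff conj_assoc)

lemma lspan_FS_props:
  assumes "S \<subseteq> FS B"
  shows "lspan (free_space B) S \<subseteq> FS B" "lin_closed (lspan (free_space B) S)" "S \<subseteq> lspan (free_space B) S"
proof -
  have "lin_closed (FS B)" by (auto simp: lin_closed_def FS_closed)
  then show "lspan (free_space B) S \<subseteq> FS B" using assms unfolding lspan_FS by blast
  show "lin_closed (lspan (free_space B) S)" unfolding lspan_FS lin_closed_def by blast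
  show "S \<subseteq> lspan (free_space B) S" unfolding lspan_FS by blast
qed

text \<open>The kernel of the linear extension is one of the subspaces whose intersection defines
  the span.\<close>

lemma lspan_FS_kernel:
  assumes "S \<subseteq> FS B" "\<And>s. s \<in> S \<Longrightarrow> lext g s = 0" "u \<in> lspan (free_space B) S"
  shows "lext g u = 0"
proof -
  have "lin_closed {u \<in> FS B. lext g u = 0}"
    by (auto simp: lin_closed_def FS_closed lext_add lext_scale)
  then have "lspan (free_space B) S \<subseteq> {u \<in> FS B. lext g u = 0}"
    using assms(1,2) unfolding lspan_FS by (intro Inter_lower) auto
  then show ?thesis using assms(3) by auto
qed

locale quotient_FS =
  fixes B :: "'b set" and W :: "('b \<Rightarrow>\<^sub>0 complex) set"
  assumes W_sub: "W \<subseteq> FS B" and W_lin: "lin_closed W"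
begin

abbreviation "QS \<equiv> quotient_space (free_space B) W"

lemma W_add: "add_closed W" using W_lin by (rule lin_closed_add_closed)

lemma r_coset_FS: "W +>\<^bsub>free_space B\<^esub> u = coset W u"
  by (auto simp: a_r_coset_def' coset_def)

lemma QS_carrier: "carrier QS = coset W ` FS B"
  by (auto simp: quotient_space_def A_RCOSETS_def' r_coset_FS)

lemma QS_add: "coset W u \<oplus>\<^bsub>QS\<^esub> coset W v = coset W (u + v)"
  using set_add_coset[OF W_add] by (simp add: quotient_space_def set_add_def')

lemma QS_zero: "\<zero>\<^bsub>QS\<^esub> = coset W 0"
  by (simp add: quotient_space_def coset_zero)

text \<open>\<open>coset_smult\<close> is a union over all representatives, each contributing the
  same coset.\<close>

lemma QS_smult: "z \<odot>\<^bsub>QS\<^esub> coset W u = coset W (z *\<^sub>v u)"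
proof -
  have "coset W (z *\<^sub>v x) = coset W (z *\<^sub>v u)" if "x \<in> coset W u" for x
  proof -
    have "z *\<^sub>v (x - u) \<in> W" using that W_lin unfolding mem_coset lin_closed_def by blast
    then show ?thesis unfolding coset_eq_iff[OF W_add] scaleC_diff_right .
  qed
  then show ?thesis
    unfolding quotient_space_def coset_smult_def r_coset_FS module.simps free_space_simps
    by (intro UN_constant_eq[OF coset_self[OF W_add]]) blast
qed

lemma cmod_QS: "cmod QS"
proof (rule cmodI)
  show "abelian_group QS"
  proof (rule abelian_groupI)
    fix x assume "x \<in> carrier QS"
    then obtain u where u: "x = coset W u" "u \<in> FS B" by (auto simp: QS_carrier)
    then show "\<exists>y\<in>carrier QS. y \<oplus>\<^bsub>QS\<^esub> x = \<zero>\<^bsub>QS\<^esub>"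
      by (intro bexI[of _ "coset W (- u)"]) (auto simp: QS_add QS_zero QS_carrier FS_closed)
  qed (auto simp: QS_carrier QS_add QS_zero FS_closed add_ac)
qed (auto simp: QS_carrier QS_add QS_smult FS_closed scaleC_add_left scaleC_add_right scaleC_scaleC scaleC_one)

end

section \<open>Free algebras, their homomorphisms and presentations\<close>

definition FA :: "'g set \<Rightarrow> 'g falg set" where
  "FA G = {p. \<forall>w\<in>Poly_Mapping.keys p. set (letters w) \<subseteq> G}"

lemma FA_eq_FS: "FA G = FS {w. set (letters w) \<subseteq> G}"
  by (auto simp: FA_def FS_def)

lemma falg_sum_single: "(p :: 'b \<Rightarrow>\<^sub>0 complex)
    = (\<Sum>w\<in>Poly_Mapping.keys p. Poly_Mapping.single w (Poly_Mapping.lookup p w))"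
proof -
  have "Poly_Mapping.single w (Poly_Mapping.lookup p w) = Poly_Mapping.lookup p w *\<^sub>v Poly_Mapping.single w 1" for w
    by (rule poly_mapping_eqI) (simp add: lookup_single when_def)
  then show ?thesis using poly_mapping_sum_basis[of p] by simp
qed

lemma FA_closed:
  "0 \<in> FA G" "1 \<in> FA G" "a \<in> FA G \<Longrightarrow> b \<in> FA G \<Longrightarrow> a + b \<in> FA G" "a \<in> FA G \<Longrightarrow> b \<in> FA G \<Longrightarrow> a - b \<in> FA G"
  "a \<in> FA G \<Longrightarrow> b \<in> FA G \<Longrightarrow> a * b \<in> FA G" "a \<in> FA G \<Longrightarrow> - a \<in> FA G" "a \<in> FA G \<Longrightarrow> z *\<^sub>c a \<in> FA G"
  "a \<in> FA G \<Longrightarrow> z *\<^sub>v a \<in> FA G" "g \<in> G \<Longrightarrow> gen g \<in> FA G"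
proof -
  show "a \<in> FA G \<Longrightarrow> b \<in> FA G \<Longrightarrow> a * b \<in> FA G"
    using keys_mult[of a b] by (fastforce simp: FA_def plus_word_def)
  show "1 \<in> FA G" by (auto simp: FA_def zero_word_def keys_one)
  show "g \<in> G \<Longrightarrow> gen g \<in> FA G" by (auto simp: FA_def gen_def)
qed (simp_all add: FA_eq_FS FS_closed cscale_eq)

lemma FA_sum: "(\<And>x. x \<in> A \<Longrightarrow> f x \<in> FA G) \<Longrightarrow> sum f A \<in> FA G"
  by (induction A rule: infinite_finite_induct) (auto simp: FA_closed)

lemma FA_prod_list: "(\<And>x. x \<in> set xs \<Longrightarrow> x \<in> FA G) \<Longrightarrow> prod_list xs \<in> FA G"
  by (induction xs) (auto simp: FA_closed)

lemma FA_induct [consumes 1, case_names zero add scale one mult gen]: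
  assumes "a \<in> FA G" and zero: "P 0" and add: "\<And>a b. a \<in> FA G \<Longrightarrow> b \<in> FA G \<Longrightarrow> P a \<Longrightarrow> P b \<Longrightarrow> P (a + b)"
    and scale: "\<And>z a. a \<in> FA G \<Longrightarrow> P a \<Longrightarrow> P (z *\<^sub>v a)" and one: "P 1"
    and mult: "\<And>a b. a \<in> FA G \<Longrightarrow> b \<in> FA G \<Longrightarrow> P a \<Longrightarrow> P b \<Longrightarrow> P (a * b)"
    and gen: "\<And>g. g \<in> G \<Longrightarrow> P (gen g)"
  shows "P a"
proof -
  have word: "P (Poly_Mapping.single w 1) \<and> Poly_Mapping.single w 1 \<in> FA G" if "set (letters w) \<subseteq> G" for w
  proof -
    have "P (Poly_Mapping.single (Word xs) 1) \<and> Poly_Mapping.single (Word xs) 1 \<in> FA G" if "set xs \<subseteq> G" for xs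
      using that
    proof (induction xs)
      case Nil
      have "Poly_Mapping.single (Word []) (1 :: complex) = (1 :: 'a falg)" by (simp flip: zero_word_def)
      then show ?case using one FA_closed(2) by metis
    next
      case (Cons g xs)
      have "Poly_Mapping.single (Word (g # xs)) 1 = gen g * Poly_Mapping.single (Word xs) (1 :: complex)"
        by (simp add: gen_def mult_single plus_word_def)
      then show ?case using Cons by (auto intro!: mult gen FA_closed)
    qed
    then show ?thesis using that by (cases w) auto
  qed
  have "P (\<Sum>w\<in>K. Poly_Mapping.lookup a w *\<^sub>v Poly_Mapping.single w 1)
    \<and> (\<Sum>w\<in>K. Poly_Mapping.lookup a w *\<^sub>v Poly_Mapping.single w 1) \<in> FA G"
    if "finite K" "\<And>w. w \<in> K \<Longrightarrow> set (letters w) \<subseteq> G" for K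
    using that
    by (induction K) (auto intro!: zero add scale FA_closed word[THEN conjunct1] word[THEN conjunct2])
  from this[of "Poly_Mapping.keys a"] show ?thesis
    using assms(1) by (simp add: FA_def flip: poly_mapping_sum_basis)
qed

lemma free_algebra_simps [simp]:
  "carrier (free_algebra G) = FA G" "add (free_algebra G) = (+)" "zero (free_algebra G) = 0"
  "mult (free_algebra G) = (*)" "one (free_algebra G) = 1" "smult (free_algebra G) = (*\<^sub>v)"
  by (auto simp: free_algebra_def FA_def fun_eq_iff cscale_eq)

lemma ring_free_algebra: "ring (free_algebra G)"
proof (rule ringI)
  show "abelian_group (free_algebra G)"
    by (rule abelian_groupI) (auto simp: FA_closed add_ac intro!: bexI[of _ "- x" for x])
  show "Group.monoid (free_algebra G)"
    by (rule monoidI) (auto simp: FA_closed mult.assoc)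
qed (auto simp: algebra_simps)

definition falg_hom :: "('g \<Rightarrow> 'a::calgebra) \<Rightarrow> 'g falg \<Rightarrow> 'a" where
  "falg_hom img = lext (\<lambda>w. prod_list (map img (letters w)))"

lemma falg_hom_simps:
  "falg_hom img (a + b) = falg_hom img a + falg_hom img b"
  "falg_hom img (a - b) = falg_hom img a - falg_hom img b"
  "falg_hom img (- a) = - falg_hom img a"
  "falg_hom img (z *\<^sub>v a) = z *\<^sub>v falg_hom img a"
  "falg_hom img 0 = 0" "falg_hom img 1 = 1" "falg_hom img (gen g) = img g"
  "falg_hom img (a * b) = falg_hom img a * falg_hom img b"
  "falg_hom img (\<Sum>x\<in>A. f x) = (\<Sum>x\<in>A. falg_hom img (f x))"
proof -
  let ?F = "\<lambda>w. prod_list (map img (letters w))"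
  show "falg_hom img 1 = 1"
    by (simp add: falg_hom_def lext_single scaleC_one zero_word_def flip: single_one)
  show "falg_hom img (gen g) = img g"
    by (simp add: falg_hom_def gen_def lext_single scaleC_one)
  have "falg_hom img (a * b) = falg_hom img
    ((\<Sum>w\<in>Poly_Mapping.keys a. Poly_Mapping.single w (Poly_Mapping.lookup a w))
     * (\<Sum>w\<in>Poly_Mapping.keys b. Poly_Mapping.single w (Poly_Mapping.lookup b w)))"
    by (simp flip: falg_sum_single)
  also have "\<dots> = (\<Sum>w\<in>Poly_Mapping.keys a. \<Sum>u\<in>Poly_Mapping.keys b.
      (Poly_Mapping.lookup a w * Poly_Mapping.lookup b u) *\<^sub>v (?F w * ?F u))"
    by (simp add: falg_hom_def sum_distrib_left sum_distrib_right lext_sum mult_single lext_single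
        plus_word_def) (rule sum.swap)
  also have "\<dots> = falg_hom img a * falg_hom img b"
    unfolding falg_hom_def lext_def sum_product by (simp add: scaleC_simps mult.commute)
  finally show "falg_hom img (a * b) = falg_hom img a * falg_hom img b" .
qed (simp_all add: falg_hom_def lext_add lext_diff lext_minus lext_scale lext_sum)

locale presentation =
  fixes G :: "'g set" and R :: "('g falg \<times> 'g falg) set"
  assumes rels_closed: "(a, b) \<in> R \<Longrightarrow> a - b \<in> FA G"
begin

abbreviation "I \<equiv> relation_ideal G R"
abbreviation "PA \<equiv> presented_algebra G R"
abbreviation "pc \<equiv> presented_class G R"

lemma rels_sub: "{a - b | a b. (a, b) \<in> R} \<subseteq> carrier (free_algebra G)"
  using rels_closed by auto

lemma ideal_I: "ideal I (free_algebra G)"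
  unfolding relation_ideal_def using ring.genideal_ideal[OF ring_free_algebra rels_sub] .

lemma I_mult: "i \<in> I \<Longrightarrow> a \<in> FA G \<Longrightarrow> a * i \<in> I" "i \<in> I \<Longrightarrow> a \<in> FA G \<Longrightarrow> i * a \<in> I"
  using ideal.I_l_closed[OF ideal_I] ideal.I_r_closed[OF ideal_I] by auto

text \<open>The ideal is generated in the ring sense; it is closed under scalars because z i = (z 1)
  i and z 1 lies in the free algebra.\<close>

lemma I_scale: "i \<in> I \<Longrightarrow> z *\<^sub>v i \<in> I"
proof -
  assume i: "i \<in> I"
  have "(z *\<^sub>v 1) * i = z *\<^sub>v i"
  proof -
    have "z *\<^sub>v (1 :: 'g falg) = Poly_Mapping.single 0 z"
      by (rule poly_mapping_eqI) (simp add: lookup_one lookup_single when_def)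
    moreover have "z *\<^sub>v i = Poly_Mapping.single 0 z * i"
      using mult_map_scale_conv_mult[of z i] cscale_eq[of z i] by (simp add: cscale_def)
    ultimately show ?thesis by simp
  qed
  then show ?thesis using I_mult(1)[OF i, of "z *\<^sub>v 1"] FA_closed by metis
qed

lemma I_add_closed: "add_closed I"
proof -
  have sg: "additive_subgroup I (free_algebra G)" using ideal_I by (rule ideal.axioms(1))
  have "- i \<in> I" if "i \<in> I" for i using I_scale[OF that, of "-1"] by (simp add: scaleC_minus_left scaleC_one)
  then show ?thesis
    unfolding add_closed_def diff_conv_add_uminus
    using additive_subgroup.zero_closed[OF sg] additive_subgroup.a_closed[OF sg]
    unfolding free_algebra_simps by blast
qed

lemma pc_eq: "pc a = coset I a"
  by (auto simp: presented_class_def a_r_coset_def' coset_def)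

lemma pc_rel: "(a, b) \<in> R \<Longrightarrow> pc a = pc b"
proof -
  assume "(a, b) \<in> R"
  then have "a - b \<in> I"
    unfolding relation_ideal_def using ring.genideal_self[OF ring_free_algebra rels_sub] by blast
  then show ?thesis by (simp add: pc_eq coset_eq_iff[OF I_add_closed])
qed

lemma PA_carrier: "carrier PA = pc ` FA G"
  by (auto simp: presented_algebra_def Let_def FactRing_def A_RCOSETS_def' presented_class_def)

lemma PA_simps:
  "a \<in> FA G \<Longrightarrow> b \<in> FA G \<Longrightarrow> pc a \<oplus>\<^bsub>PA\<^esub> pc b = pc (a + b)"
  "a \<in> FA G \<Longrightarrow> b \<in> FA G \<Longrightarrow> pc a \<otimes>\<^bsub>PA\<^esub> pc b = pc (a * b)"
  "a \<in> FA G \<Longrightarrow> z \<odot>\<^bsub>PA\<^esub> pc a = pc (z *\<^sub>v a)" "\<one>\<^bsub>PA\<^esub> = pc 1"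
proof -
  interpret ideal I "free_algebra G" by (rule ideal_I)
  assume a: "a \<in> FA G"
  show "pc a \<oplus>\<^bsub>PA\<^esub> pc b = pc (a + b)" if "b \<in> FA G"
    using a_rcos_sum[of a b] that a
    by (simp add: presented_algebra_def Let_def FactRing_def presented_class_def)
  show "pc a \<otimes>\<^bsub>PA\<^esub> pc b = pc (a * b)" if "b \<in> FA G"
    using rcoset_mult_add[of a b] that a
    by (simp add: presented_algebra_def Let_def FactRing_def presented_class_def)
  have eq: "pc (z *\<^sub>v x) = pc (z *\<^sub>v a)" if "x \<in> pc a" for x
  proof -
    have "z *\<^sub>v (x - a) \<in> I" using that I_scale unfolding pc_eq mem_coset by blast
    then show ?thesis unfolding pc_eq coset_eq_iff[OF I_add_closed] scaleC_diff_right .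
  qed
  have mem: "a \<in> pc a" unfolding pc_eq by (rule coset_self[OF I_add_closed])
  show "z \<odot>\<^bsub>PA\<^esub> pc a = pc (z *\<^sub>v a)"
    unfolding presented_algebra_def Let_def coset_smult_def presented_class_def[symmetric] module.simps
      free_algebra_simps
    by (rule UN_constant_eq[OF mem]) (rule ballI, erule eq)
next
  show "\<one>\<^bsub>PA\<^esub> = pc 1"
    by (simp add: presented_algebra_def Let_def FactRing_def presented_class_def)
qed

text \<open>The kernel within the free algebra is an ideal containing all differences of the
  relations, hence the ideal they generate. Homomorphisms respecting the relations therefore
  descend.\<close>

lemma falg_hom_I:
  assumes "\<And>a b. (a, b) \<in> R \<Longrightarrow> falg_hom img a = falg_hom img b" "i \<in> I"
  shows "falg_hom img i = 0"
proof -
  let ?K = "{a \<in> FA G. falg_hom img a = 0}"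
  interpret A: ring "free_algebra G" by (rule ring_free_algebra)
  have inv: "inv\<^bsub>add_monoid (free_algebra G)\<^esub> u = - u" if "u \<in> FA G" for u
    using that unfolding a_inv_def[symmetric] by (intro A.add.inv_equality) (auto simp: FA_closed)
  have "ideal ?K (free_algebra G)"
    by (intro idealI ring_free_algebra subgroup.intro) (auto simp: FA_closed falg_hom_simps inv[simplified])
  then have "I \<subseteq> ?K"
    unfolding relation_ideal_def using assms(1) rels_closed
    by (intro A.genideal_minimal) (auto simp: falg_hom_simps)
  then show ?thesis using assms(2) by auto
qed

end

section \<open>The degenerate double affine Hecke algebra acting on a right module\<close>

lemma commute_mult:
  fixes x :: "'a::semigroup_mult"
  assumes "x * a = a * x" "x * b = b * x"
  shows "x * (a * b) = a * b * x"
proof -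
  have "x * (a * b) = a * (x * b)" using assms(1) by (simp flip: mult.assoc)
  then show ?thesis using assms(2) by (simp add: mult.assoc)
qed

lemma transpose_permutes: "i \<in> {1..l} \<Longrightarrow> j \<in> {1..l} \<Longrightarrow> Transposition.transpose i j permutes {1..l}"
  by (rule permutes_swap_id)

lemma gen_Sig_FA: "\<sigma> permutes {1..l} \<Longrightarrow> gen (Sig \<sigma>) \<in> FA (daha_gens l)"
  and gen_X_FA: "i \<in> {1..l} \<Longrightarrow> gen (Xc i) \<in> FA (daha_gens l)"
  and gen_Y_FA: "i \<in> {1..l} \<Longrightarrow> gen (Yc i) \<in> FA (daha_gens l)"
  and gen_XInv_FA: "gen XInv \<in> FA (daha_gens l)"
  by (auto intro!: FA_closed simp: daha_gens_def cherednik_gens_def)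

lemmas daha_FA = gen_Sig_FA gen_X_FA gen_Y_FA gen_XInv_FA FA_closed(1-8) FA_sum

lemma xprod_FA: "xprod l \<in> FA (daha_gens l)"
  unfolding xprod_def by (intro FA_prod_list) (auto intro!: daha_FA)

lemma daha_rels_closed: "(a, b) \<in> daha_rels l t c \<Longrightarrow> a \<in> FA (daha_gens l) \<and> b \<in> FA (daha_gens l)"
  unfolding daha_rels_def
  by (auto elim!: cherednik_rels.cases intro!: daha_FA xprod_FA
      intro: permutes_id permutes_compose permutes_inv permutes_in_image[THEN iffD2] transpose_permutes
      simp: permutes_in_image simp del: One_nat_def)

interpretation daha: presentation "daha_gens l" "daha_rels l t c" for l t c
  by standard (use daha_rels_closed in \<open>blast intro: FA_closed\<close>)

locale daha_module =
  fixes l :: nat and t c :: complex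
    and M :: "(complex, 'm) module" and ract :: "'m \<Rightarrow> cgen falg set \<Rightarrow> 'm"
  assumes right: "right_alg_module (daha l t c) M ract"
begin

sublocale R: right_alg_module "daha l t c" M ract by (rule right)

lemma cmod_M: "cmod M" by (rule R.module_axioms)

abbreviation "HF \<equiv> FA (daha_gens l)"
abbreviation "dc \<equiv> daha_class l t c"

lemma dc_carrier: "h \<in> HF \<Longrightarrow> dc h \<in> carrier (daha l t c)"
  by (simp add: daha_def daha_class_def daha.PA_carrier)

text \<open>The right action, as operators: composition reverses the order of the factors.\<close>

definition RR :: "cgen falg \<Rightarrow> 'm vfam lin" where
  "RR h = Lin (\<lambda>\<xi>. emb M (ract (fam_at \<xi> M) (dc h)))"

lemma app_RR:
  assumes "h \<in> HF"
  shows "app (RR h) \<xi> = emb M (ract (fam_at \<xi> M) (dc h))"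
proof -
  note cl = comp_closed[OF cmod_M] dc_carrier[OF assms]
  have "(\<lambda>\<xi>. emb M (ract (fam_at \<xi> M) (dc h)))
    \<in> {f. (\<forall>u v. f (u + v) = f u + f v) \<and> (\<forall>z v. f (z *\<^sub>v v) = z *\<^sub>v f v)}"
  proof (clarsimp, intro conjI allI)
    fix u v :: "'m vfam" and z
    show "emb M (ract (fam_at (u + v) M) (dc h)) = emb M (ract (fam_at u M) (dc h)) + emb M (ract (fam_at v M) (dc h))"
      using cl by (simp add: comp_simps[OF cmod_M] R.act_add_left emb_add[OF cmod_M] R.act_closed)
    have one: "1 \<in> HF" by (rule FA_closed)
    \<comment> \<open>The module axioms give homogeneity only in the algebra argument. Homogeneity
      in x follows by writing z x as x acted on by z 1, and z 1 is central.\<close>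
    have "ract (z \<odot>\<^bsub>M\<^esub> x) (dc h) = z \<odot>\<^bsub>M\<^esub> ract x (dc h)" if x: "x \<in> carrier M" for x
    proof -
      have d1: "z \<odot>\<^bsub>daha l t c\<^esub> dc 1 = dc (z *\<^sub>v 1)"
        by (simp add: daha_def daha_class_def daha.PA_simps one)
      have zx: "z \<odot>\<^bsub>M\<^esub> x = ract x (dc (z *\<^sub>v 1))"
      proof -
        have "\<one>\<^bsub>daha l t c\<^esub> = dc 1" by (simp add: daha_def daha_class_def daha.PA_simps)
        then show ?thesis
          using R.act_smult[OF dc_carrier[OF one] x, of z] R.act_one[OF x] unfolding d1 by simp
      qed
      have h: "(z *\<^sub>v 1) * h = z *\<^sub>v h"
      proof -
        have "z *\<^sub>v (1 :: cgen falg) = Poly_Mapping.single 0 z"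
          by (rule poly_mapping_eqI) (simp add: lookup_one lookup_single when_def)
        moreover have "z *\<^sub>v h = Poly_Mapping.single 0 z * h"
          using mult_map_scale_conv_mult[of z h] cscale_eq[of z h] by (simp add: cscale_def)
        ultimately show ?thesis by simp
      qed
      have "ract (z \<odot>\<^bsub>M\<^esub> x) (dc h) = ract x (dc (z *\<^sub>v 1) \<otimes>\<^bsub>daha l t c\<^esub> dc h)"
        unfolding zx using x assms one by (intro R.act_mult[symmetric] dc_carrier FA_closed)
      also have "dc (z *\<^sub>v 1) \<otimes>\<^bsub>daha l t c\<^esub> dc h = z \<odot>\<^bsub>daha l t c\<^esub> dc h"
        using assms by (simp add: daha_def daha_class_def daha.PA_simps one FA_closed h)
      also have "ract x (z \<odot>\<^bsub>daha l t c\<^esub> dc h) = z \<odot>\<^bsub>M\<^esub> ract x (dc h)"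
        using x assms by (intro R.act_smult dc_carrier)
      finally show ?thesis .
    qed
    then show "emb M (ract (fam_at (z *\<^sub>v v) M) (dc h)) = z *\<^sub>v emb M (ract (fam_at v M) (dc h))"
      using cl by (simp add: comp_simps[OF cmod_M] emb_scale[OF cmod_M] R.act_closed)
  qed
  then show ?thesis by (simp add: RR_def Lin_inverse)
qed

lemma RR_simps:
  assumes "h \<in> HF" 
  shows "h' \<in> HF \<Longrightarrow> RR (h + h') = RR h + RR h'" "h' \<in> HF \<Longrightarrow> RR (h * h') = RR h' * RR h"
    "RR (z *\<^sub>v h) = z *\<^sub>v RR h"
proof -
  note cl = comp_closed[OF cmod_M] dc_carrier[OF assms]
  show "h' \<in> HF \<Longrightarrow> RR (h + h') = RR h + RR h'"
  proof (rule lin_eqI)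
    fix \<xi> assume h': "h' \<in> HF"
    have "dc (h + h') = dc h \<oplus>\<^bsub>daha l t c\<^esub> dc h'"
      using assms h' by (simp add: daha_def daha_class_def daha.PA_simps)
    then show "app (RR (h + h')) \<xi> = app (RR h + RR h') \<xi>"
      using assms h' cl dc_carrier[OF h']
      by (simp add: app_simps app_RR FA_closed R.act_add_right emb_add[OF cmod_M] R.act_closed)
  qed
  show "h' \<in> HF \<Longrightarrow> RR (h * h') = RR h' * RR h"
  proof (rule lin_eqI)
    fix \<xi> assume h': "h' \<in> HF"
    have "dc (h * h') = dc h \<otimes>\<^bsub>daha l t c\<^esub> dc h'"
      using assms h' by (simp add: daha_def daha_class_def daha.PA_simps)
    then show "app (RR (h * h')) \<xi> = app (RR h' * RR h) \<xi>"
      using assms h' cl dc_carrier[OF h']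
      by (simp add: app_simps app_RR FA_closed R.act_mult comp_emb[OF cmod_M] R.act_closed)
  qed
  show "RR (z *\<^sub>v h) = z *\<^sub>v RR h"
  proof (rule lin_eqI)
    fix \<xi>
    have "dc (z *\<^sub>v h) = z \<odot>\<^bsub>daha l t c\<^esub> dc h"
      using assms by (simp add: daha_def daha_class_def daha.PA_simps)
    then show "app (RR (z *\<^sub>v h)) \<xi> = app (z *\<^sub>v RR h) \<xi>"
      using assms cl
      by (simp add: app_simps app_RR FA_closed R.act_smult emb_scale[OF cmod_M] R.act_closed)
  qed
qed

lemma RR_zero: "RR 0 = 0"
  using RR_simps(3)[of 0 0] by (simp add: FA_closed)

lemma RR_diff: "h \<in> HF \<Longrightarrow> h' \<in> HF \<Longrightarrow> RR (h - h') = RR h - RR h'"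
  using RR_simps(1)[of h "- 1 *\<^sub>v h'"] RR_simps(3)[of h' "-1"]
  by (simp add: FA_closed scaleC_minus_left scaleC_one)

lemma RR_sum: "(\<And>x. x \<in> A \<Longrightarrow> f x \<in> HF) \<Longrightarrow> RR (\<Sum>x\<in>A. f x) = (\<Sum>x\<in>A. RR (f x))"
  by (induction A rule: infinite_finite_induct) (simp_all add: RR_zero RR_simps FA_sum)

lemma RR_rel: "(a, b) \<in> daha_rels l t c \<Longrightarrow> RR a = RR b"
  unfolding RR_def by (simp add: daha_class_def daha.pc_rel)

lemma RR_crel: "(a, b) \<in> cherednik_rels l t c \<Longrightarrow> RR a = RR b"
  by (rule RR_rel) (simp add: daha_rels_def)

text \<open>The unit of the Hecke algebra acts as the projection onto the factor M, which need not
  be the identity of the ambient product. It therefore takes the place of 1 in all identities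
  below.\<close>

definition "Pm = RR 1"
definition "XX p = RR (gen (Xc p))"
definition "YY p = RR (gen (Yc p))"
definition "SS \<sigma> = RR (gen (Sig \<sigma>))"
definition "XI = RR (gen XInv)"

abbreviation "st p q \<equiv> SS (Transposition.transpose p q)"

lemma Pm_mult: "h \<in> HF \<Longrightarrow> Pm * RR h = RR h" "h \<in> HF \<Longrightarrow> RR h * Pm = RR h"
  using RR_simps(2)[of h 1] RR_simps(2)[of 1 h] FA_closed(2)[of "daha_gens l"] by (simp_all add: Pm_def)

lemma Pm_gens:
  "p \<in> {1..l} \<Longrightarrow> Pm * XX p = XX p" "p \<in> {1..l} \<Longrightarrow> XX p * Pm = XX p"
  "p \<in> {1..l} \<Longrightarrow> Pm * YY p = YY p" "p \<in> {1..l} \<Longrightarrow> YY p * Pm = YY p"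
  "\<sigma> permutes {1..l} \<Longrightarrow> Pm * SS \<sigma> = SS \<sigma>" "\<sigma> permutes {1..l} \<Longrightarrow> SS \<sigma> * Pm = SS \<sigma>"
  "Pm * XI = XI" "XI * Pm = XI" "Pm * Pm = Pm"
  unfolding XX_def YY_def SS_def XI_def
  by (auto intro!: Pm_mult daha_FA simp del: One_nat_def) (simp add: Pm_def, intro Pm_mult[unfolded Pm_def] daha_FA)

lemma SS_mult: "\<sigma> permutes {1..l} \<Longrightarrow> \<tau> permutes {1..l} \<Longrightarrow> SS \<tau> * SS \<sigma> = SS (\<sigma> \<circ> \<tau>)"
  using RR_crel[OF cherednik_rels.Sig_mult[of \<sigma> l \<tau> t c]] by (simp add: SS_def RR_simps daha_FA)

lemma SS_id: "SS id = Pm"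
  using RR_crel[OF cherednik_rels.Sig_one[of l t c]] by (simp add: SS_def Pm_def)

lemma XX_comm: "i \<in> {1..l} \<Longrightarrow> j \<in> {1..l} \<Longrightarrow> XX i * XX j = XX j * XX i"
  using RR_crel[OF cherednik_rels.x_comm[of i l j t c]] by (simp add: XX_def RR_simps daha_FA)

lemma YY_comm: "i \<in> {1..l} \<Longrightarrow> j \<in> {1..l} \<Longrightarrow> YY i * YY j = YY j * YY i"
  using RR_crel[OF cherednik_rels.y_comm[of i l j t c]] by (simp add: YY_def RR_simps daha_FA)

lemma SS_inv: "\<sigma> permutes {1..l} \<Longrightarrow> SS \<sigma> * SS (Hilbert_Choice.inv \<sigma>) = Pm"
  using SS_mult[of "Hilbert_Choice.inv \<sigma>" \<sigma>] by (simp add: permutes_inv permutes_inv_o SS_id)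

lemma XX_SS:
  assumes "\<sigma> permutes {1..l}" "i \<in> {1..l}"
  shows "XX i * SS \<sigma> = SS \<sigma> * XX (\<sigma> i)"
proof -
  have "SS (Hilbert_Choice.inv \<sigma>) * (XX i * SS \<sigma>) = XX (\<sigma> i)"
    using RR_crel[OF cherednik_rels.Sig_x[OF assms, of t c]] assms permutes_inv[OF assms(1)]
    by (simp add: XX_def SS_def RR_simps daha_FA)
  then have "SS \<sigma> * SS (Hilbert_Choice.inv \<sigma>) * XX i * SS \<sigma> = SS \<sigma> * XX (\<sigma> i)"
    by (simp add: mult.assoc)
  then show ?thesis by (simp add: SS_inv[OF assms(1)] Pm_gens(1)[OF assms(2)])
qed

lemma YY_SS:
  assumes "\<sigma> permutes {1..l}" "i \<in> {1..l}"
  shows "YY i * SS \<sigma> = SS \<sigma> * YY (\<sigma> i)"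
proof -
  have "SS (Hilbert_Choice.inv \<sigma>) * (YY i * SS \<sigma>) = YY (\<sigma> i)"
    using RR_crel[OF cherednik_rels.Sig_y[OF assms, of t c]] assms permutes_inv[OF assms(1)]
    by (simp add: YY_def SS_def RR_simps daha_FA)
  then have "SS \<sigma> * SS (Hilbert_Choice.inv \<sigma>) * YY i * SS \<sigma> = SS \<sigma> * YY (\<sigma> i)"
    by (simp add: mult.assoc)
  then show ?thesis by (simp add: SS_inv[OF assms(1)] Pm_gens(3)[OF assms(2)])
qed

lemma XX_YY:
  assumes "i \<in> {1..l}" "j \<in> {1..l}" "i \<noteq> j"
  shows "XX i * YY j = YY j * XX i - c *\<^sub>v st i j"
proof -
  have "gen (Yc j) * gen (Xc i) \<in> HF" "gen (Xc i) * gen (Yc j) \<in> HF" "transp i j \<in> HF"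
    using assms by (auto intro!: daha_FA transpose_permutes simp del: One_nat_def)
  then have "XX i * YY j - YY j * XX i = (- c) *\<^sub>v st i j"
    using RR_crel[OF cherednik_rels.y_x[OF assms, where t = t and c = c]] assms
    by (simp add: XX_def YY_def SS_def RR_simps RR_diff daha_FA cscale_eq)
  then show ?thesis by (simp add: algebra_simps scaleC_minus_left)
qed

lemma XX_YY_diag:
  assumes "i \<in> {1..l}"
  shows "XX i * YY i = YY i * XX i + t *\<^sub>v Pm + c *\<^sub>v (\<Sum>k\<in>{1..l} - {i}. st k i)"
proof -
  have tr: "transp k i \<in> HF" if "k \<in> {1..l} - {i}" for k
    using that assms by (auto intro!: daha_FA transpose_permutes simp del: One_nat_def)
  have "gen (Yc i) * gen (Xc i) \<in> HF" "gen (Xc i) * gen (Yc i) \<in> HF" "1 \<in> HF"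
    using assms by (auto intro!: daha_FA simp del: One_nat_def)
  moreover have "(\<Sum>k\<in>{1..l} - {i}. transp k i) \<in> HF" using tr by (rule FA_sum)
  ultimately have "XX i * YY i - YY i * XX i = t *\<^sub>v Pm + c *\<^sub>v RR (\<Sum>k\<in>{1..l} - {i}. transp k i)"
    using RR_crel[OF cherednik_rels.y_x_diag[OF assms, where t = t and c = c]] assms
    by (simp add: XX_def YY_def Pm_def RR_simps RR_diff daha_FA cscale_eq)
  moreover have "RR (\<Sum>k\<in>{1..l} - {i}. transp k i) = (\<Sum>k\<in>{1..l} - {i}. st k i)"
    unfolding SS_def using tr by (rule RR_sum)
  ultimately show ?thesis by (simp add: algebra_simps)
qed

section \<open>Inverses and integral powers of the x_p\<close>

definition "Xi p = RR (x_inv l p)"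

lemma x_inv_FA: "x_inv l p \<in> HF"
  unfolding x_inv_def by (intro FA_closed(5) FA_prod_list gen_XInv_FA) (auto intro!: daha_FA)

lemma XI_prod: "XI * RR (xprod l) = Pm" "RR (xprod l) * XI = Pm"
  using RR_rel[of "xprod l * gen XInv" 1] RR_rel[of "gen XInv * xprod l" 1]
  by (auto simp: daha_rels_def XI_def Pm_def RR_simps xprod_FA daha_FA)

lemma XX_XI: "p \<in> {1..l} \<Longrightarrow> XX p * XI = XI * XX p"
proof -
  assume p: "p \<in> {1..l}"
  have comm: "XX p * RR (prod_list (map (\<lambda>i. gen (Xc i)) xs)) = RR (prod_list (map (\<lambda>i. gen (Xc i)) xs)) * XX p"
    if "set xs \<subseteq> {1..l}" for xs
    using that
  proof (induction xs)
    case Nil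
    then show ?case using Pm_gens(1,2)[OF p] by (simp add: Pm_def)
  next
    case (Cons a xs)
    have "prod_list (map (\<lambda>i. gen (Xc i)) xs) \<in> HF"
      using Cons by (intro FA_prod_list) (auto intro!: daha_FA)
    then have "RR (prod_list (map (\<lambda>i. gen (Xc i)) (a # xs))) = RR (prod_list (map (\<lambda>i. gen (Xc i)) xs)) * XX a"
      using Cons by (simp add: RR_simps daha_FA XX_def)
    moreover have "XX p * XX a = XX a * XX p" using Cons p by (intro XX_comm) auto
    moreover have "XX p * RR (prod_list (map (\<lambda>i. gen (Xc i)) xs)) = RR (prod_list (map (\<lambda>i. gen (Xc i)) xs)) * XX p"
      using Cons by simp
    ultimately show ?case by (simp only: commute_mult)
  qed
  have "XX p * RR (xprod l) = RR (xprod l) * XX p"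
    unfolding xprod_def by (rule comm) auto
  then have "XI * (XX p * RR (xprod l)) * XI = XI * (RR (xprod l) * XX p) * XI" by simp
  then have "XI * XX p * (RR (xprod l) * XI) = (XI * RR (xprod l)) * XX p * XI" by (simp only: mult.assoc)
  then have "XI * XX p * Pm = Pm * XX p * XI" by (simp only: XI_prod)
  then have "XI * (XX p * Pm) = Pm * XX p * XI" by (simp only: mult.assoc)
  then show ?thesis by (simp only: Pm_gens(1,2)[OF p])
qed

text \<open>The x_i commute with each other and with the adjoined inverse, so x_p can be split off
  from the product of all x_i.\<close>

lemma Xi_XX:
  assumes "p \<in> {1..l}"
  shows "Xi p * XX p = Pm" "XX p * Xi p = Pm"
proof -
  define r where "r xs = prod_list (map (\<lambda>i. gen (Xc i)) xs)" for xs
  have r_HF: "r xs \<in> HF" if "set xs \<subseteq> {1..l}" for xs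
    using that unfolding r_def by (intro FA_prod_list) (auto intro!: daha_FA)
  have comm: "RR (r xs) * XX p = XX p * RR (r xs)" if "set xs \<subseteq> {1..l}" for xs
    using that
  proof (induction xs)
    case Nil
    then show ?case using Pm_gens(1,2)[OF assms] by (simp add: Pm_def r_def)
  next
    case (Cons a xs)
    have "RR (r (a # xs)) = RR (r xs) * XX a"
      using Cons r_HF[of xs] by (simp add: RR_simps daha_FA XX_def r_def)
    moreover have "XX p * XX a = XX a * XX p" using Cons assms by (intro XX_comm) auto
    moreover have "RR (r xs) * XX p = XX p * RR (r xs)" using Cons by simp
    ultimately show ?case by (simp only: commute_mult)
  qed
  have split: "RR (r xs) = RR (r (filter (\<lambda>i. i \<noteq> p) xs)) * XX p"
    if "set xs \<subseteq> {1..l}" "distinct xs" "p \<in> set xs" for xs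
    using that
  proof (induction xs)
    case (Cons a xs)
    have a: "RR (r (a # ys)) = RR (r ys) * XX a" if "set ys \<subseteq> {1..l}" for ys
      using Cons.prems that r_HF[of ys] by (simp add: RR_simps daha_FA XX_def r_def)
    show ?case
    proof (cases "a = p")
      case True
      then have "filter (\<lambda>i. i \<noteq> p) xs = xs" using Cons.prems by (auto simp: filter_id_conv)
      then show ?thesis using True a[of xs] Cons.prems by simp
    next
      case False
      have sub: "set (filter (\<lambda>i. i \<noteq> p) xs) \<subseteq> {1..l}" using Cons.prems by auto
      have xa: "XX p * XX a = XX a * XX p" using Cons.prems assms by (intro XX_comm) auto
      have "RR (r (a # xs)) = RR (r (filter (\<lambda>i. i \<noteq> p) xs)) * XX p * XX a"
        using Cons False a[of xs] by simp
      also have "\<dots> = RR (r (a # filter (\<lambda>i. i \<noteq> p) xs)) * XX p"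
        using a[OF sub] xa by (simp add: mult.assoc)
      finally show ?thesis using False by simp
    qed
  qed simp
  let ?f = "filter (\<lambda>i. i \<noteq> p) [1..<Suc l]"
  have f: "set ?f \<subseteq> {1..l}" by auto
  have Xi: "Xi p = XI * RR (r ?f)"
    using r_HF[OF f] by (simp add: Xi_def x_inv_def r_def RR_simps daha_FA XI_def)
  have prod: "RR (xprod l) = RR (r ?f) * XX p"
    unfolding xprod_def r_def[symmetric] using assms by (intro split) auto
  show 1: "Xi p * XX p = Pm"
    unfolding Xi using XI_prod(1) by (simp add: prod mult.assoc)
  have "XX p * Xi p = Xi p * XX p"
    unfolding Xi by (intro commute_mult XX_XI[OF assms] comm[OF f, symmetric])
  then show "XX p * Xi p = Pm" using 1 by simp
qed

lemma Xi_Pm: "Pm * Xi p = Xi p" "Xi p * Pm = Xi p"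
  unfolding Xi_def by (rule Pm_mult[OF x_inv_FA])+

text \<open>Transfers commutation rules from x to its inverse by multiplying with inverses on both
  sides; the conditions on \<open>Pm\<close> say that A and B live on the factor M.\<close>

lemma Xi_conj:
  assumes "p \<in> {1..l}" "q \<in> {1..l}" "A * XX q = XX p * B" "Pm * A = A" "A * Pm = A" "Pm * B = B" "B * Pm = B"
  shows "Xi p * A = B * Xi q"
proof -
  have "Xi p * (A * XX q) * Xi q = Xi p * (XX p * B) * Xi q" using assms(3) by simp
  then have "Xi p * (A * (XX q * Xi q)) = (Xi p * XX p) * B * Xi q" by (simp add: mult.assoc)
  then show ?thesis using assms by (simp add: Xi_XX)
qed

lemma Xi_commute:
  assumes "p \<in> {1..l}" "q \<in> {1..l}"
  shows "Xi p * XX q = XX q * Xi p" "Xi p * Xi q = Xi q * Xi p"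
proof -
  have 1: "Xi p * XX q = XX q * Xi p" if "p \<in> {1..l}" "q \<in> {1..l}" for p q
    using that by - (rule Xi_conj, simp_all add: Pm_gens XX_comm)
  then show "Xi p * XX q = XX q * Xi p" using assms .
  show "Xi p * Xi q = Xi q * Xi p"
    using assms 1[of q p] by - (rule Xi_conj, simp_all add: Xi_Pm)
qed

lemma Xi_SS:
  assumes "\<sigma> permutes {1..l}" "p \<in> {1..l}"
  shows "Xi p * SS \<sigma> = SS \<sigma> * Xi (\<sigma> p)"
proof -
  have "\<sigma> p \<in> {1..l}" using permutes_in_image[OF assms(1)] assms(2) by blast
  then show ?thesis using assms by - (rule Xi_conj, simp_all add: Pm_gens XX_SS)
qed

text \<open>Right multiplication by x_p^k. The factor \<open>Pm\<close> matters for k = 0, where the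
  power would otherwise be the identity of the whole product.\<close>

definition pw :: "int \<Rightarrow> nat \<Rightarrow> 'm vfam lin" where
  "pw k p = (if 0 \<le> k then XX p ^ nat k * Pm else Xi p ^ nat (- k) * Pm)"

lemma pw_Pm: "pw k p * Pm = pw k p"
  by (simp add: pw_def mult.assoc Pm_gens)

lemma pw_simps: "pw 0 p = Pm" "p \<in> {1..l} \<Longrightarrow> pw 1 p = XX p" "pw (-1) p = Xi p"
  by (simp_all add: pw_def Pm_gens Xi_Pm)

lemma pw_Suc:
  assumes "p \<in> {1..l}"
  shows "pw (k + 1) p = XX p * pw k p" "pw (k - 1) p = Xi p * pw k p"
proof -
  have pos: "XX p * pw k p = pw (k + 1) p" if "k \<ge> 0" for k
    using that by (simp add: pw_def nat_add_distrib mult.assoc)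
  have neg: "Xi p * pw k p = pw (k - 1) p" if "k \<le> 0" for k
  proof (cases "k = 0")
    case False
    then have "nat (1 - k) = Suc (nat (- k))" using that by simp
    then show ?thesis using False that by (simp add: pw_def mult.assoc)
  qed (simp add: pw_def Xi_Pm Pm_gens)
  have Pm: "Pm * pw k p = pw k p" for k
  proof (cases "k \<ge> 0")
    case True
    then show ?thesis using assms by (cases "nat k") (auto simp: pw_def Pm_gens simp flip: mult.assoc)
  next
    case False
    then show ?thesis by (cases "nat (- k)") (auto simp: pw_def Pm_gens Xi_Pm simp flip: mult.assoc)
  qed
  have cancel: "XX p * (Xi p * pw k p) = pw k p" "Xi p * (XX p * pw k p) = pw k p" for k
    using Xi_XX[OF assms] Pm[of k] by (simp_all flip: mult.assoc)
  show "pw (k + 1) p = XX p * pw k p"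
    using pos[of k] neg[of "k + 1"] cancel(1)[of "k + 1"] by (cases "k \<ge> 0") auto
  show "pw (k - 1) p = Xi p * pw k p"
    using neg[of k] pos[of "k - 1"] cancel(2)[of "k - 1"] by (cases "k \<le> 0") auto
qed

lemma pw_add:
  assumes "p \<in> {1..l}"
  shows "pw k p * pw j p = pw (k + j) p"
proof -
  have Pm: "Pm * pw j p = pw j p"
    using pw_Suc(1)[OF assms, of "j - 1"] Pm_gens(1)[OF assms] by (simp flip: mult.assoc)
  show ?thesis
  proof (induction k rule: int_induct[where k = 0])
    case (step1 i)
    then show ?case using pw_Suc(1)[OF assms, of i] pw_Suc(1)[OF assms, of "i + j"]
      by (simp add: mult.assoc add_ac)
  next
    case (step2 i)
    then show ?case using pw_Suc(2)[OF assms, of i] pw_Suc(2)[OF assms, of "i + j"]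
      by (simp add: mult.assoc algebra_simps)
  qed (simp add: pw_simps Pm)
qed

lemma pw_commute:
  assumes "p \<in> {1..l}" "q \<in> {1..l}"
  shows "pw k p * pw j q = pw j q * pw k p"
proof -
  have gen: "g * pw k p = pw k p * g"
    if "g * XX p = XX p * g" "g * Xi p = Xi p * g" "g * Pm = Pm * g" for g k p
  proof -
    have "g * x ^ i = x ^ i * g" if "g * x = x * g" for i and x
      using that by (induction i) (simp_all only: power.simps mult_1_left mult_1_right commute_mult)
    then show ?thesis
      unfolding pw_def using that by (auto intro!: commute_mult)
  qed
  have "XX q * pw k p = pw k p * XX q" "Xi q * pw k p = pw k p * Xi q" "Pm * pw k p = pw k p * Pm"
    using assms by (auto intro!: gen simp: XX_comm Xi_commute Xi_Pm Pm_gens)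
  then show ?thesis by (intro gen) simp_all
qed

text \<open>The condition under which a sum of h_p tensored with E_{a,b} at position p is compatible
  with the balancing over the symmetric group.\<close>

definition equivariant :: "(nat \<Rightarrow> 'm vfam lin) \<Rightarrow> bool" where
  "equivariant h \<longleftrightarrow> (\<forall>\<sigma> p. \<sigma> permutes {1..l} \<longrightarrow> p \<in> {1..l} \<longrightarrow> h p * SS \<sigma> = SS \<sigma> * h (\<sigma> p))"

lemma equivariant_mult: "equivariant g \<Longrightarrow> equivariant h \<Longrightarrow> equivariant (\<lambda>p. g p * h p)"
proof -
  assume g: "equivariant g" and h: "equivariant h"
  have "g p * h p * SS \<sigma> = SS \<sigma> * (g (\<sigma> p) * h (\<sigma> p))" if "\<sigma> permutes {1..l}" "p \<in> {1..l}" for \<sigma> p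
  proof -
    have a: "g p * SS \<sigma> = SS \<sigma> * g (\<sigma> p)" and b: "h p * SS \<sigma> = SS \<sigma> * h (\<sigma> p)"
      using g h that unfolding equivariant_def by blast+
    have "g p * h p * SS \<sigma> = g p * SS \<sigma> * h (\<sigma> p)" by (simp only: mult.assoc b)
    then show ?thesis by (simp only: a mult.assoc)
  qed
  then show ?thesis by (simp add: equivariant_def)
qed

lemma equivariant_add: "equivariant g \<Longrightarrow> equivariant h \<Longrightarrow> equivariant (\<lambda>p. g p + h p)"
  and equivariant_scale: "equivariant h \<Longrightarrow> equivariant (\<lambda>p. z *\<^sub>v h p)"
  by (simp_all add: equivariant_def algebra_simps scaleC_simps)

lemma equivariant_gens: "equivariant XX" "equivariant YY" "equivariant Xi" "equivariant (\<lambda>p. Pm)" "equivariant (\<lambda>p. 1)"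
  unfolding equivariant_def by (auto simp: XX_SS YY_SS Xi_SS Pm_gens simp del: One_nat_def)

lemma equivariant_pw: "equivariant (pw k)"
proof -
  have "equivariant (\<lambda>p. h p ^ i)" if "equivariant h" for h i
    using that equivariant_gens(5) by (induction i) (auto intro: equivariant_mult)
  then show ?thesis
    unfolding pw_def by (cases "0 \<le> k") (auto intro!: equivariant_mult equivariant_gens)
qed

definition z :: "nat \<Rightarrow> 'm vfam lin" where "z p = YY p * XX p"

lemma equivariant_z: "equivariant z"
  unfolding z_def by (intro equivariant_mult equivariant_gens)

lemma z_Pm: "p \<in> {1..l} \<Longrightarrow> z p * Pm = z p" "p \<in> {1..l} \<Longrightarrow> Pm * z p = z p"
  by (simp_all add: z_def mult.assoc Pm_gens) (simp add: Pm_gens flip: mult.assoc)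

text \<open>Each commutator needs a single interchange of an x with a y of another index, which
  costs one transposition. The transposition is written leftmost, so that it can later be moved
  across the tensor sign. The rules for x^{-1} follow by conjugating those for x.\<close>

lemma z_commutators:
  assumes "p \<in> {1..l}" "q \<in> {1..l}" "p \<noteq> q"
  shows "z p * z q - z q * z p = st p q * (c *\<^sub>v z p - c *\<^sub>v z q)"
    and "z p * XX q - XX q * z p = st p q * (c *\<^sub>v XX p)"
    and "z p * Xi q - Xi q * z p = - (st p q * (c *\<^sub>v Xi q))"
    and "XX p * z p * Xi q - Xi q * (XX p * z p) = - (st p q * (c *\<^sub>v Pm))"
proof -
  let ?S = "st p q"
  have sym: "st q p = ?S" by (simp add: transpose_commute)
  have perm: "Transposition.transpose p q permutes {1..l}" using assms by (intro transpose_permutes)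
  have XY: "XX p * YY q = YY q * XX p - c *\<^sub>v ?S" "XX q * YY p = YY p * XX q - c *\<^sub>v ?S"
    using XX_YY[of p q] XX_YY[of q p] assms by (simp_all add: sym)
  have YS: "YY p * ?S = ?S * YY q" "YY q * ?S = ?S * YY p" "XX p * ?S = ?S * XX q" "Xi q * ?S = ?S * Xi p"
    using YY_SS[OF perm] XX_SS[OF perm] Xi_SS[OF perm] assms by simp_all
  show 1: "z p * XX q - XX q * z p = ?S * (c *\<^sub>v XX p)"
  proof -
    have "XX q * z p = (XX q * YY p) * XX p" by (simp add: z_def mult.assoc)
    also have "\<dots> = YY p * (XX q * XX p) - c *\<^sub>v (?S * XX p)" unfolding XY by (simp add: algebra_simps scaleC_simps)
    also have "XX q * XX p = XX p * XX q" using assms by (simp add: XX_comm)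
    finally show ?thesis by (simp add: z_def mult.assoc scaleC_simps)
  qed
  show "z p * z q - z q * z p = ?S * (c *\<^sub>v z p - c *\<^sub>v z q)"
  proof -
    have "z p * z q = YY p * (XX p * YY q) * XX q" by (simp add: z_def mult.assoc)
    also have "\<dots> = YY p * YY q * (XX p * XX q) - c *\<^sub>v (YY p * ?S * XX q)" unfolding XY by (simp add: algebra_simps scaleC_simps)
    finally have a: "z p * z q = YY p * YY q * (XX p * XX q) - c *\<^sub>v (?S * z q)" unfolding YS by (simp add: z_def mult.assoc)
    have "z q * z p = YY q * (XX q * YY p) * XX p" by (simp add: z_def mult.assoc)
    also have "\<dots> = YY q * YY p * (XX q * XX p) - c *\<^sub>v (YY q * ?S * XX p)" unfolding XY by (simp add: algebra_simps scaleC_simps)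
    finally have b: "z q * z p = YY q * YY p * (XX q * XX p) - c *\<^sub>v (?S * z p)" unfolding YS by (simp add: z_def mult.assoc)
    show ?thesis unfolding a b using assms by (simp add: XX_comm YY_comm algebra_simps scaleC_simps)
  qed
  show 2: "z p * Xi q - Xi q * z p = - (?S * (c *\<^sub>v Xi q))"
  proof -
    have "Xi q * (z p * XX q - XX q * z p) * Xi q = Xi q * (?S * (c *\<^sub>v XX p)) * Xi q"
      using 1 by simp
    then have "Xi q * z p * (XX q * Xi q) - (Xi q * XX q) * z p * Xi q = c *\<^sub>v ((Xi q * ?S) * XX p * Xi q)"
      by (simp add: algebra_simps scaleC_simps)
    then have "Xi q * z p - z p * Xi q = c *\<^sub>v (?S * (Xi p * XX p) * Xi q)"
      unfolding YS using assms z_Pm[of p] Xi_XX[of q] by (simp add: mult.assoc) (simp flip: mult.assoc)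
    then have "Xi q * z p - z p * Xi q = c *\<^sub>v (?S * Xi q)"
      using assms Pm_gens(6)[OF perm] by (simp add: Xi_XX)
    from arg_cong[OF this, of uminus] show ?thesis by (simp add: scaleC_simps)
  qed
  show "XX p * z p * Xi q - Xi q * (XX p * z p) = - (?S * (c *\<^sub>v Pm))"
  proof -
    have "XX p * z p * Xi q - Xi q * (XX p * z p) = XX p * (z p * Xi q - Xi q * z p)"
    proof -
      have "Xi q * (XX p * z p) = XX p * (Xi q * z p)"
        using Xi_commute(1)[of q p] assms by (simp flip: mult.assoc)
      then show ?thesis by (simp add: algebra_simps)
    qed
    also have "\<dots> = - (c *\<^sub>v ((XX p * ?S) * Xi q))" unfolding 2 by (simp add: scaleC_simps mult.assoc)
    also have "\<dots> = - (?S * (c *\<^sub>v Pm))" unfolding YS using assms by (simp add: scaleC_simps mult.assoc Xi_XX)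
    finally show ?thesis .
  qed
qed

definition sig :: "nat \<Rightarrow> 'm vfam lin" where "sig p = (\<Sum>k\<in>{1..l} - {p}. st k p)"

text \<open>With equal indices the defining commutator contributes t and the sum of all
  transpositions through p; these are the sources of the t-terms and supertrace terms at the affine
  node.\<close>

lemma z_diag:
  assumes "p \<in> {1..l}"
  shows "z p * XX p = XX p * z p - t *\<^sub>v XX p - c *\<^sub>v (sig p * XX p)"
    and "Xi p * z p = z p * Xi p - t *\<^sub>v Xi p - c *\<^sub>v (Xi p * sig p)"
    and "XX p * z p * Xi p = z p + t *\<^sub>v Pm + c *\<^sub>v sig p"
proof -
  have sPm: "sig p * Pm = sig p" "Pm * sig p = sig p"
    using assms by (auto simp: sig_def sum_distrib_left sum_distrib_right Pm_gens transpose_permutes intro!: sum.cong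
        simp del: One_nat_def)
  have "XX p * z p = (XX p * YY p) * XX p" by (simp add: z_def mult.assoc)
  also have "\<dots> = z p * XX p + t *\<^sub>v XX p + c *\<^sub>v (sig p * XX p)"
    unfolding XX_YY_diag[OF assms] sig_def[symmetric] using Pm_gens(1)[OF assms]
    by (simp add: z_def algebra_simps scaleC_simps)
  finally have 1: "XX p * z p = z p * XX p + t *\<^sub>v XX p + c *\<^sub>v (sig p * XX p)" .
  then show "z p * XX p = XX p * z p - t *\<^sub>v XX p - c *\<^sub>v (sig p * XX p)" by simp
  have "XX p * z p * Xi p = z p * (XX p * Xi p) + t *\<^sub>v (XX p * Xi p) + c *\<^sub>v (sig p * (XX p * Xi p))"
    unfolding 1 by (simp add: algebra_simps scaleC_simps)
  then show 2: "XX p * z p * Xi p = z p + t *\<^sub>v Pm + c *\<^sub>v sig p"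
    using assms by (simp add: Xi_XX z_Pm sPm)
  have "Xi p * (XX p * z p * Xi p) = Xi p * (z p + t *\<^sub>v Pm + c *\<^sub>v sig p)" using 2 by simp
  then have "(Xi p * XX p) * z p * Xi p = Xi p * z p + t *\<^sub>v Xi p + c *\<^sub>v (Xi p * sig p)"
    by (simp add: algebra_simps scaleC_simps Xi_Pm)
  then show "Xi p * z p = z p * Xi p - t *\<^sub>v Xi p - c *\<^sub>v (Xi p * sig p)"
    using assms by (simp add: Xi_XX z_Pm)
qed

text \<open>The sum over j < k has coefficient c in U_k, and the sign-weighted sum changes it to c /
  2 for every j different from k, removing the dependence on the order of the positions.\<close>

lemma RR_y_elt:
  assumes "k \<in> {1..l}"
  shows "RR (y_elt l t c k) = (t / 2) *\<^sub>v Pm + z k + (c / 2) *\<^sub>v sig k"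
proof -
  have tr: "transp k j \<in> HF" if "j \<in> {1..l}" for j
    using that assms by (intro daha_FA transpose_permutes)
  have HF: "U_elt t c k \<in> HF" "(\<Sum>j\<in>{1..l} - {k}. sgn (of_nat j - of_nat k) *\<^sub>v transp k j) \<in> HF"
    "(\<Sum>j=1..<k. transp k j) \<in> HF" "gen (Xc k) \<in> HF" "gen (Yc k) \<in> HF"
    using assms unfolding U_elt_def cscale_eq by (intro daha_FA tr; simp)+
  have U: "RR (U_elt t c k) = (t / 2) *\<^sub>v Pm + z k + c *\<^sub>v (\<Sum>j=1..<k. st k j)"
  proof -
    have "RR (\<Sum>j=1..<k. transp k j) = (\<Sum>j=1..<k. st k j)"
      unfolding SS_def using assms by (intro RR_sum tr) auto
    then show ?thesis
      using HF by (simp add: U_elt_def cscale_eq RR_simps FA_closed Pm_def z_def XX_def YY_def)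
  qed
  have sets: "{1..l} - {k} = {1..<k} \<union> {k + 1..l}" using assms by auto
  have "RR (\<Sum>j\<in>{1..l} - {k}. sgn (of_nat j - of_nat k) *\<^sub>v transp k j)
    = (\<Sum>j\<in>{1..l} - {k}. sgn (of_nat j - of_nat k) *\<^sub>v st k j)"
    unfolding SS_def by (subst RR_sum) (auto intro!: FA_closed tr sum.cong RR_simps(3) simp del: One_nat_def)
  also have "\<dots> = (\<Sum>j\<in>{k + 1..l}. st k j) - (\<Sum>j\<in>{1..<k}. st k j)"
    unfolding sets by (subst sum.union_disjoint) (auto simp: sgn_of_nat_diff scaleC_simps sum_negf)
  finally have 2: "RR (\<Sum>j\<in>{1..l} - {k}. sgn (of_nat j - of_nat k) *\<^sub>v transp k j) = \<dots>" .
  have "sig k = (\<Sum>j\<in>{1..l} - {k}. st k j)"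
    unfolding sig_def by (simp add: transpose_commute)
  also have "\<dots> = (\<Sum>j\<in>{1..<k}. st k j) + (\<Sum>j\<in>{k + 1..l}. st k j)"
    unfolding sets by (subst sum.union_disjoint) auto
  finally have 3: "sig k = (\<Sum>j\<in>{1..<k}. st k j) + (\<Sum>j\<in>{k + 1..l}. st k j)" .
  have "RR (y_elt l t c k) = RR (U_elt t c k)
    + (c / 2) *\<^sub>v RR (\<Sum>j\<in>{1..l} - {k}. sgn (of_nat j - of_nat k) *\<^sub>v transp k j)"
    unfolding y_elt_def cscale_eq using HF by (simp add: RR_simps FA_closed)
  then show ?thesis
    unfolding U 2 3 by (simp add: scaleC_simps algebra_simps scaleC_half(1)[of c, symmetric])
qed

lemma y_elt_FA: "k \<in> {1..l} \<Longrightarrow> y_elt l t c k \<in> HF"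
  unfolding y_elt_def U_elt_def cscale_eq by (intro daha_FA transpose_permutes) auto

end

section \<open>Operators on the tensor product over the symmetric group\<close>

text \<open>Off-diagonal double sums are completed to full ones, which are products of operators, at
  the price of subtracting the diagonal.\<close>

lemma sum_diag_split:
  fixes A :: "nat \<Rightarrow> 'a::ab_group_add"
  assumes "finite S"
  shows "(\<Sum>p\<in>S. \<Sum>q\<in>S. if p = q then A p else B p q)
    = (\<Sum>p\<in>S. A p) + ((\<Sum>p\<in>S. \<Sum>q\<in>S. B p q) - (\<Sum>p\<in>S. B p p))"
proof -
  have "(\<Sum>q\<in>S. if p = q then A p else B p q) = A p + ((\<Sum>q\<in>S. B p q) - B p p)" if "p \<in> S" for p
  proof -
    have "(\<Sum>q\<in>S. if p = q then A p else B p q) = (\<Sum>q\<in>S. B p q + (if p = q then A p - B p p else 0))"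
      by (intro sum.cong) auto
    then show ?thesis using that assms by (simp add: sum.distrib)
  qed
  then show ?thesis by (simp add: sum.distrib sum_subtractf)
qed

text \<open>The grading operator (-1)^|v|. Parity statements become identities for commuting with
  it, without decomposing vectors.\<close>

definition parity_op :: "nat \<Rightarrow> nat \<Rightarrow> tpow lin" where
  "parity_op m l = Lin (lext (\<lambda>w. (-1) ^ (\<Sum>i=1..l. parity m (w i)) *\<^sub>v Poly_Mapping.single w 1))"

lemma parity_op_single: "app (parity_op m l) (Poly_Mapping.single w 1)
  = (-1) ^ (\<Sum>i=1..l. parity m (w i)) *\<^sub>v Poly_Mapping.single w 1"
  by (simp add: parity_op_def app_Lin_lext lext_single scaleC_one)

lemma parity_op_PV:
  assumes "\<sigma> permutes {1..l}"
  shows "parity_op m l * PV m l \<sigma> = PV m l \<sigma> * parity_op m l"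
proof (rule lin_basis_eqI)
  fix w
  have "(\<Sum>i=1..l. parity m ((w \<circ> Hilbert_Choice.inv \<sigma>) i)) = (\<Sum>i=1..l. parity m (w i))"
    using sum.permute[OF permutes_inv[OF assms], of "\<lambda>i. parity m (w i)"] by (simp add: o_def)
  then show "app (parity_op m l * PV m l \<sigma>) (Poly_Mapping.single w 1)
    = app (PV m l \<sigma> * parity_op m l) (Poly_Mapping.single w 1)"
    by (simp add: app_simps PV_single parity_op_single app_scale scaleC_scaleC mult.commute)
qed

lemma parity_op_EV:
  assumes "p \<in> {1..l}"
  shows "parity_op m l * EV m p a b = (-1) ^ (parity m a + parity m b) *\<^sub>v (EV m p a b * parity_op m l)"
proof (rule lin_basis_eqI)
  fix w
  define r where "r = (\<Sum>i\<in>{1..l} - {p}. parity m (w i))"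
  have 1: "(\<Sum>i=1..l. parity m (w i)) = parity m (w p) + r"
    unfolding r_def using assms by (subst sum.remove[of _ p]) auto
  have 2: "(\<Sum>i=1..l. parity m ((w(p := a)) i)) = parity m a + r"
    unfolding r_def using assms by (subst sum.remove[of _ p]) (auto intro!: sum.cong)
  have "(-1 :: complex) ^ (parity m a + r) = (-1) ^ (parity m a + parity m b + (parity m b + r))"
    by (rule neg_one_power_eqI) auto
  then show "app (parity_op m l * EV m p a b) (Poly_Mapping.single w 1)
    = app ((-1) ^ (parity m a + parity m b) *\<^sub>v (EV m p a b * parity_op m l)) (Poly_Mapping.single w 1)"
    by (cases "w p = b") (simp_all only: app_simps EV_single parity_op_single app_scale scaleC_scaleC 1 2
        if_True if_False app_zero scaleC_zero_right simp_thms power_add mult_ac)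
qed

lemma parity_op_closed: "v \<in> TV m n l \<Longrightarrow> app (parity_op m l) v \<in> TV m n l"
  unfolding TV_iff parity_op_def app_Lin_lext
  by (rule keys_lext) (auto dest!: keys_scaleC[THEN subsetD])

locale drinfeld = daha_module l t c M ract
  for l :: nat and t c :: complex and M :: "(complex, 'm) module" and ract +
  fixes m n :: nat
begin

abbreviation "BB \<equiv> carrier M \<times> TV m n l"
abbreviation "TT \<equiv> tensor_space m n l t c M ract"
abbreviation "tn \<equiv> tensor_null m n l t c M ract"
abbreviation "tens \<equiv> tensor m n l t c M ract"

lemma SS_act: "\<sigma> permutes {1..l} \<Longrightarrow> x \<in> carrier M \<Longrightarrow>
    ract x (dc (gen (Sig \<sigma>))) \<in> carrier M \<and> emb M (ract x (dc (gen (Sig \<sigma>)))) = app (SS \<sigma>) (emb M x)"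
  unfolding SS_def by (simp add: app_RR gen_Sig_FA comp_emb[OF cmod_M] R.act_closed dc_carrier)

lemma rels_FS: "tensor_rels m n l t c M ract \<subseteq> FS BB"
proof
  fix r assume "r \<in> tensor_rels m n l t c M ract"
  then show "r \<in> FS BB"
  proof cases
    case (balanced x v \<sigma>)
    then show ?thesis using SS_act[of \<sigma> x] PV_closed[of v m n l \<sigma>]
      by (auto intro!: FS_closed simp: app_PV)
  qed (auto intro!: FS_closed TV_add TV_scale R.M.add.m_closed R.smult_closed simp: cscale_eq)
qed

lemma tn_eq: "tn = lspan (free_space BB) (tensor_rels m n l t c M ract)"
  by (simp add: tensor_null_def pair_space_def)

sublocale Q: quotient_FS BB tn
  unfolding tn_eq by standard (rule lspan_FS_props[OF rels_FS])+

lemma TT_eq: "TT = Q.QS"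
  by (simp add: tensor_space_def pair_space_def)

lemma cmod_T: "cmod TT"
  unfolding TT_eq by (rule Q.cmod_QS)

lemma tens_eq: "tens x v = coset tn (Poly_Mapping.single (x, v) 1)"
  by (simp add: tensor_def pair_space_def Q.r_coset_FS)

lemma tens_closed: "x \<in> carrier M \<Longrightarrow> v \<in> TV m n l \<Longrightarrow> tens x v \<in> carrier TT"
  unfolding TT_eq Q.QS_carrier tens_eq by (auto intro!: imageI FS_closed)

lemma tens_rel:
  assumes "u \<in> tensor_rels m n l t c M ract"
  shows "u \<in> tn"
  using assms lspan_FS_props(3)[OF rels_FS] tn_eq by auto

lemma coset_T:
  "u \<in> FS BB \<Longrightarrow> v \<in> FS BB \<Longrightarrow> emb TT (coset tn (u + v)) = emb TT (coset tn u) + emb TT (coset tn v)"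
  "u \<in> FS BB \<Longrightarrow> emb TT (coset tn (y *\<^sub>v u)) = y *\<^sub>v emb TT (coset tn u)"
proof -
  show "emb TT (coset tn (u + v)) = emb TT (coset tn u) + emb TT (coset tn v)" if "u \<in> FS BB" "v \<in> FS BB"
  proof -
    have "coset tn u \<in> carrier TT" "coset tn v \<in> carrier TT" using that by (auto simp: TT_eq Q.QS_carrier)
    from emb_add[OF cmod_T this] show ?thesis by (simp add: TT_eq Q.QS_add)
  qed
  show "emb TT (coset tn (y *\<^sub>v u)) = y *\<^sub>v emb TT (coset tn u)" if "u \<in> FS BB"
  proof -
    have "coset tn u \<in> carrier TT" using that by (auto simp: TT_eq Q.QS_carrier)
    from emb_scale[OF cmod_T this] show ?thesis by (simp add: TT_eq Q.QS_smult)
  qed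
qed

text \<open>The pure tensor extended to all of \<open>vfam\<close> through its component at M, so
  that operators \<open>RR\<close> can be composed in the first argument without carrier conditions
  there.\<close>

definition tau :: "'m vfam \<Rightarrow> tpow \<Rightarrow> ('m \<times> tpow \<Rightarrow>\<^sub>0 complex) set vfam" where
  "tau \<xi> v = emb TT (tens (fam_at \<xi> M) v)"

lemma tau_bilinear:
  assumes v: "v \<in> TV m n l"
  shows "tau (\<xi> + \<eta>) v = tau \<xi> v + tau \<eta> v" "tau (y *\<^sub>v \<xi>) v = y *\<^sub>v tau \<xi> v"
    "w \<in> TV m n l \<Longrightarrow> tau \<xi> (v + w) = tau \<xi> v + tau \<xi> w" "tau \<xi> (y *\<^sub>v v) = y *\<^sub>v tau \<xi> v"
    "\<sigma> permutes {1..l} \<Longrightarrow> tau (app (SS \<sigma>) \<xi>) v = tau \<xi> (app (PV m l \<sigma>) v)"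
proof -
  let ?s = "\<lambda>x v. Poly_Mapping.single (x, v) (1 :: complex)"
  have cl: "fam_at \<xi> M \<in> carrier M" for \<xi> :: "'m vfam" by (rule comp_closed[OF cmod_M])
  have eq: "emb TT (coset tn u) = emb TT (coset tn u')" if "u - u' \<in> tensor_rels m n l t c M ract" for u u'
    using tens_rel[OF that] unfolding coset_eq_iff[OF Q.W_add, symmetric] by (rule arg_cong)
  have FS: "?s (fam_at \<xi> M) v \<in> FS BB" if "v \<in> TV m n l" for \<xi> v
    using that cl by (intro FS_closed) auto
  show "tau (\<xi> + \<eta>) v = tau \<xi> v + tau \<eta> v"
    using eq[OF tensor_rels.add_left[OF cl[of \<xi>] cl[of \<eta>] v, where ract = ract and t = t and c = c]] v
    by (simp add: tau_def tens_eq comp_simps[OF cmod_M] coset_T FS)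
  show "tau (y *\<^sub>v \<xi>) v = y *\<^sub>v tau \<xi> v"
    using eq[OF tensor_rels.scale_left[OF cl[of \<xi>] v, where z = y and ract = ract and t = t and c = c]] v
    by (simp add: tau_def tens_eq comp_simps[OF cmod_M] coset_T FS cscale_eq)
  show "tau \<xi> (v + w) = tau \<xi> v + tau \<xi> w" if "w \<in> TV m n l"
    using eq[OF tensor_rels.add_right[OF cl[of \<xi>] v that, where ract = ract and t = t and c = c]] v that
    by (simp add: tau_def tens_eq coset_T FS)
  show "tau \<xi> (y *\<^sub>v v) = y *\<^sub>v tau \<xi> v"
    using eq[OF tensor_rels.scale_right[OF cl[of \<xi>] v, where z = y and ract = ract and t = t and c = c]] v
    by (simp add: tau_def tens_eq coset_T FS cscale_eq)
  show "tau (app (SS \<sigma>) \<xi>) v = tau \<xi> (app (PV m l \<sigma>) v)" if \<sigma>: "\<sigma> permutes {1..l}"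
  proof -
    have "fam_at (app (SS \<sigma>) \<xi>) M = ract (fam_at \<xi> M) (dc (gen (Sig \<sigma>)))"
      unfolding SS_def using cl \<sigma>
      by (simp add: app_RR gen_Sig_FA comp_emb[OF cmod_M] R.act_closed dc_carrier)
    then show ?thesis
      using eq[OF tensor_rels.balanced[OF cl[of \<xi>] v \<sigma>, where ract = ract and t = t and c = c]]
      by (simp add: tau_def tens_eq app_PV)
  qed
qed

lemma tau_zero: "v \<in> TV m n l \<Longrightarrow> tau 0 v = 0" "tau \<xi> 0 = 0"
  using tau_bilinear(2)[of v 0 0] tau_bilinear(4)[of 0 \<xi> 0] TV_zero by auto

lemma tau_diff: "v \<in> TV m n l \<Longrightarrow> tau (\<xi> - \<eta>) v = tau \<xi> v - tau \<eta> v"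
  using tau_bilinear(1)[of v "\<xi> - \<eta>" \<eta>] by simp

lemma tau_sum_left: "v \<in> TV m n l \<Longrightarrow> tau (\<Sum>x\<in>A. f x) v = (\<Sum>x\<in>A. tau (f x) v)"
  by (induction A rule: infinite_finite_induct) (simp_all add: tau_zero tau_bilinear)

lemma tau_sum_right: "(\<And>x. x \<in> A \<Longrightarrow> f x \<in> TV m n l) \<Longrightarrow> tau \<xi> (\<Sum>x\<in>A. f x) = (\<Sum>x\<in>A. tau \<xi> (f x))"
  by (induction A rule: infinite_finite_induct) (simp_all add: tau_zero tau_bilinear TV_sum)

lemma tau_Pm: "tau (app Pm \<xi>) v = tau \<xi> v"
proof -
  have 1: "1 \<in> HF" by (rule FA_closed)
  have "dc 1 = \<one>\<^bsub>daha l t c\<^esub>" by (simp add: daha_def daha_class_def daha.PA_simps)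
  then have "fam_at (app Pm \<xi>) M = fam_at \<xi> M"
    using comp_closed[OF cmod_M] 1 by (simp add: Pm_def app_RR R.act_one comp_emb[OF cmod_M])
  then show ?thesis by (simp add: tau_def)
qed

lemma tau_emb: "x \<in> carrier M \<Longrightarrow> tau (emb M x) v = emb TT (tens x v)"
  by (simp add: tau_def comp_emb[OF cmod_M])

text \<open>Projection onto the factor given by the tensor product. An operator \<open>F\<close>
  with \<open>F * PT = F\<close> is determined by its values on that factor.\<close>

definition "PT = Lin (\<lambda>\<omega>. emb TT (fam_at \<omega> TT))"

lemma app_PT: "app PT \<omega> = emb TT (fam_at \<omega> TT)"
  unfolding PT_def
  by (subst Lin_inverse) (auto simp: comp_simps[OF cmod_T] comp_closed[OF cmod_T] emb_add[OF cmod_T] emb_scale[OF cmod_T])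

lemma PT_tau: "v \<in> TV m n l \<Longrightarrow> app PT (tau \<xi> v) = tau \<xi> v"
  using comp_closed[OF cmod_M, of \<xi>]
  by (simp add: app_PT tau_def comp_emb[OF cmod_T] tens_closed)

lemma emb_coset: "u \<in> FS BB \<Longrightarrow> emb TT (coset tn u) = lext (\<lambda>(x, v). emb TT (tens x v)) u"
proof -
  assume u: "u \<in> FS BB"
  have "emb TT (coset tn (\<Sum>b\<in>K. Poly_Mapping.lookup u b *\<^sub>v Poly_Mapping.single b 1))
    = (\<Sum>b\<in>K. Poly_Mapping.lookup u b *\<^sub>v (case b of (x, v) \<Rightarrow> emb TT (tens x v)))
    \<and> (\<Sum>b\<in>K. Poly_Mapping.lookup u b *\<^sub>v Poly_Mapping.single b 1) \<in> FS BB"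
    if "finite K" "K \<subseteq> BB" for K
    using that
  proof (induction K)
    case empty
    show ?case using coset_T(2)[of 0 0] by (simp add: FS_closed)
  next
    case (insert b K)
    have b: "Poly_Mapping.single b 1 \<in> FS BB" using insert by (intro FS_closed) auto
    show ?case
      using insert b by (cases b) (auto simp: coset_T FS_closed tens_eq)
  qed
  from this[of "Poly_Mapping.keys u"] u show ?thesis
    by (simp add: FS_def lext_def flip: poly_mapping_sum_basis)
qed

text \<open>Every coset is a linear combination of pure tensors, so operators factoring through
  \<open>PT\<close> are compared on pure tensors only.\<close>

lemma lin_T_eqI:
  assumes "F * PT = F" "G * PT = G"
    and "\<And>\<xi> v. v \<in> TV m n l \<Longrightarrow> app F (tau \<xi> v) = app G (tau \<xi> v)"
  shows "F = G"
proof (rule lin_eqI)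
  fix \<omega>
  obtain u where u: "u \<in> FS BB" "fam_at \<omega> TT = coset tn u"
    using comp_closed[OF cmod_T, of \<omega>] by (auto simp: TT_eq Q.QS_carrier)
  have FG: "app F (emb TT (tens x v)) = app G (emb TT (tens x v))" if "x \<in> carrier M" "v \<in> TV m n l" for x v
    using assms(3)[OF that(2), of "emb M x"] by (simp only: tau_emb[OF that(1)])
  have "app F (app PT \<omega>) = app G (app PT \<omega>)"
    unfolding app_PT u(2) emb_coset[OF u(1)] lext_def app_sum app_scale
    using u(1) by (intro sum.cong refl) (auto simp: FS_def FG)
  then show "app F \<omega> = app G \<omega>"
    using assms(1,2) by (metis app_simps(4))
qed

text \<open>Universal property of the balanced tensor product. The linear extension of g kills all
  generating relations, so it depends only on the coset, and any choice of representative defines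
  the operator. The last two hypotheses say that g only sees the factor M and takes values in the
  tensor product.\<close>

lemma lift_T:
  fixes g :: "'m vfam \<Rightarrow> tpow \<Rightarrow> ('m \<times> tpow \<Rightarrow>\<^sub>0 complex) set vfam"
  assumes "\<And>\<xi> \<eta> v. v \<in> TV m n l \<Longrightarrow> g (\<xi> + \<eta>) v = g \<xi> v + g \<eta> v"
    "\<And>y \<xi> v. v \<in> TV m n l \<Longrightarrow> g (y *\<^sub>v \<xi>) v = y *\<^sub>v g \<xi> v"
    "\<And>\<xi> v w. v \<in> TV m n l \<Longrightarrow> w \<in> TV m n l \<Longrightarrow> g \<xi> (v + w) = g \<xi> v + g \<xi> w"
    "\<And>y \<xi> v. v \<in> TV m n l \<Longrightarrow> g \<xi> (y *\<^sub>v v) = y *\<^sub>v g \<xi> v"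
    "\<And>\<sigma> \<xi> v. v \<in> TV m n l \<Longrightarrow> \<sigma> permutes {1..l} \<Longrightarrow> g (app (SS \<sigma>) \<xi>) v = g \<xi> (app (PV m l \<sigma>) v)"
    "\<And>\<xi> v. v \<in> TV m n l \<Longrightarrow> g (app Pm \<xi>) v = g \<xi> v"
    "\<And>\<xi> v. v \<in> TV m n l \<Longrightarrow> app PT (g \<xi> v) = g \<xi> v"
  shows "\<exists>F. F * PT = F \<and> PT * F = F \<and> (\<forall>\<xi> v. v \<in> TV m n l \<longrightarrow> app F (tau \<xi> v) = g \<xi> v)"
proof -
  define G where "G = lext (\<lambda>(x, v). g (emb M x) v)"
  define rep where "rep \<omega> = (SOME u. u \<in> FS BB \<and> fam_at \<omega> TT = coset tn u)" for \<omega>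
  have ker: "G u = 0" if "u \<in> tn" for u
    unfolding G_def
  proof (rule lspan_FS_kernel[OF rels_FS _ that[unfolded tn_eq]])
    fix r assume "r \<in> tensor_rels m n l t c M ract"
    then show "lext (\<lambda>(x, v). g (emb M x) v) r = 0"
    proof cases
      case (balanced x v \<sigma>)
      then show ?thesis using SS_act[of \<sigma> x] assms(5)[of v \<sigma> "emb M x"]
        by (simp add: lext_diff lext_single scaleC_one app_PV)
    qed (auto simp: lext_diff lext_add lext_scale lext_single scaleC_one cscale_eq emb_add[OF cmod_M]
        emb_scale[OF cmod_M] assms(1-4))
  qed
  have rep: "rep \<omega> \<in> FS BB" "fam_at \<omega> TT = coset tn (rep \<omega>)" for \<omega>
  proof -
    have "\<exists>u. u \<in> FS BB \<and> fam_at \<omega> TT = coset tn u"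
      using comp_closed[OF cmod_T, of \<omega>] by (auto simp: TT_eq Q.QS_carrier)
    from someI_ex[OF this] show "rep \<omega> \<in> FS BB" "fam_at \<omega> TT = coset tn (rep \<omega>)" by (auto simp: rep_def)
  qed
  have Geq: "G (rep \<omega>) = G u" if "fam_at \<omega> TT = coset tn u" for \<omega> u
  proof -
    have "rep \<omega> - u \<in> tn" using that rep(2)[of \<omega>] coset_eq_iff[OF Q.W_add] by metis
    from ker[OF this] show ?thesis by (simp add: G_def lext_diff)
  qed
  define F where "F = Lin (\<lambda>\<omega>. G (rep \<omega>))"
  have F: "app F \<omega> = G (rep \<omega>)" for \<omega>
    unfolding F_def
  proof (subst Lin_inverse, clarsimp, intro conjI allI)
    fix u v y
    have "fam_at (u + v) TT = coset tn (rep u + rep v)" "fam_at (y *\<^sub>v v) TT = coset tn (y *\<^sub>v rep v)"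
      using rep(2)[of u] rep(2)[of v] by (simp_all add: comp_simps[OF cmod_T]) (simp_all add: TT_eq Q.QS_add Q.QS_smult)
    then show "G (rep (u + v)) = G (rep u) + G (rep v)" "G (rep (y *\<^sub>v v)) = y *\<^sub>v G (rep v)"
      by (simp_all add: Geq[of "u + v"] Geq[of "y *\<^sub>v v"]) (simp_all add: G_def lext_add lext_scale)
  qed simp
  have "F * PT = F"
  proof (rule lin_eqI)
    fix \<omega>
    have "fam_at (app PT \<omega>) TT = coset tn (rep \<omega>)"
      using comp_closed[OF cmod_T, of \<omega>] rep(2)[of \<omega>] by (simp add: app_PT comp_emb[OF cmod_T])
    then show "app (F * PT) \<omega> = app F \<omega>" by (simp add: app_simps F Geq)
  qed
  moreover have "app F (tau \<xi> v) = g \<xi> v" if v: "v \<in> TV m n l" for \<xi> v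
  proof -
    have x: "fam_at \<xi> M \<in> carrier M" by (rule comp_closed[OF cmod_M])
    have "fam_at (tau \<xi> v) TT = coset tn (Poly_Mapping.single (fam_at \<xi> M, v) 1)"
      using tens_closed[OF x v] by (simp add: tau_def comp_emb[OF cmod_T]) (simp add: tens_eq)
    then have "app F (tau \<xi> v) = g (emb M (fam_at \<xi> M)) v"
      unfolding F by (subst Geq) (auto simp: G_def lext_single scaleC_one)
    also have "emb M (fam_at \<xi> M) = app Pm \<xi>"
      using R.act_one[OF x] FA_closed(2)[of "daha_gens l"]
      by (simp add: Pm_def app_RR) (simp add: daha_def daha_class_def daha.PA_simps)
    finally show ?thesis using assms(6)[OF v] by simp
  qed
  moreover have "PT * F = F"
  proof (rule lin_eqI)
    fix \<omega>
    have "app PT (G u) = G u" if "u \<in> FS BB" for u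
      unfolding G_def lext_def app_sum app_scale
      using that assms(7) by (intro sum.cong refl) (auto simp: FS_def)
    then show "app (PT * F) \<omega> = app F \<omega>" using rep(1) by (simp add: app_simps F)
  qed
  ultimately show ?thesis by blast
qed

text \<open>The families h for which the operator \<open>Op\<close> below exists: balanced, and
  insensitive to the factors of the ambient product other than M.\<close>

definition good :: "(nat \<Rightarrow> 'm vfam lin) \<Rightarrow> bool" where
  "good h \<longleftrightarrow> equivariant h \<and> (\<forall>p\<in>{1..l}. h p * Pm = h p)"

text \<open>The operator E_{a,b}[h], the sum over p of h_p tensored with E_{a,b} at p. For a good
  family existence follows from \<open>lift_T\<close> and uniqueness from \<open>lin_T_eqI\<close>,
  so the choice is harmless.\<close>

definition Op :: "(nat \<Rightarrow> 'm vfam lin) \<Rightarrow> nat \<Rightarrow> nat \<Rightarrow> ('m \<times> tpow \<Rightarrow>\<^sub>0 complex) set vfam lin" where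
  "Op h a b = (SOME F. F * PT = F \<and> PT * F = F \<and> (\<forall>\<xi> v. v \<in> TV m n l \<longrightarrow>
     app F (tau \<xi> v) = (\<Sum>p\<in>{1..l}. tau (app (h p) \<xi>) (app (EV m p a b) v))))"

lemma Op:
  assumes "good h" "a \<in> {1..m + n}"
  shows Op_PT: "Op h a b * PT = Op h a b" "PT * Op h a b = Op h a b"
    and Op_tau: "v \<in> TV m n l \<Longrightarrow> app (Op h a b) (tau \<xi> v) = (\<Sum>p\<in>{1..l}. tau (app (h p) \<xi>) (app (EV m p a b) v))"
proof -
  note cl = EV_closed[OF _ _ assms(2)]
  have "\<exists>F. F * PT = F \<and> PT * F = F \<and> (\<forall>\<xi> v. v \<in> TV m n l \<longrightarrow>
     app F (tau \<xi> v) = (\<Sum>p\<in>{1..l}. tau (app (h p) \<xi>) (app (EV m p a b) v)))"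
  proof (rule lift_T)
    fix \<sigma> \<xi> v assume v: "v \<in> TV m n l" and \<sigma>: "\<sigma> permutes {1..l}"
    have "(\<Sum>p\<in>{1..l}. tau (app (h p) (app (SS \<sigma>) \<xi>)) (app (EV m p a b) v))
      = (\<Sum>p\<in>{1..l}. tau (app (h (\<sigma> p)) \<xi>) (app (EV m (\<sigma> p) a b) (app (PV m l \<sigma>) v)))"
    proof (rule sum.cong[OF refl])
      fix p assume p: "p \<in> {1..l}"
      have "app (h p) (app (SS \<sigma>) \<xi>) = app (SS \<sigma>) (app (h (\<sigma> p)) \<xi>)"
        using assms(1) \<sigma> p unfolding good_def equivariant_def by (metis app_simps(4))
      then have "tau (app (h p) (app (SS \<sigma>) \<xi>)) (app (EV m p a b) v)
        = tau (app (h (\<sigma> p)) \<xi>) (app (PV m l \<sigma>) (app (EV m p a b) v))"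
        using cl[OF v p] \<sigma> by (simp add: tau_bilinear)
      also have "app (PV m l \<sigma>) (app (EV m p a b) v) = app (EV m (\<sigma> p) a b) (app (PV m l \<sigma>) v)"
        using PV_EV[OF \<sigma> p, of m a b] by (metis app_simps(4))
      finally show "tau (app (h p) (app (SS \<sigma>) \<xi>)) (app (EV m p a b) v)
        = tau (app (h (\<sigma> p)) \<xi>) (app (EV m (\<sigma> p) a b) (app (PV m l \<sigma>) v))" .
    qed
    also have "\<dots> = (\<Sum>p\<in>{1..l}. tau (app (h p) \<xi>) (app (EV m p a b) (app (PV m l \<sigma>) v)))"
      using sum.reindex_bij_betw[OF permutes_imp_bij[OF \<sigma>], of "\<lambda>p. tau (app (h p) \<xi>) (app (EV m p a b) (app (PV m l \<sigma>) v))"] .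
    finally show "(\<Sum>p\<in>{1..l}. tau (app (h p) (app (SS \<sigma>) \<xi>)) (app (EV m p a b) v)) = \<dots>" .
  next
    fix \<xi> v assume "v \<in> TV m n l"
    show "(\<Sum>p\<in>{1..l}. tau (app (h p) (app Pm \<xi>)) (app (EV m p a b) v))
      = (\<Sum>p\<in>{1..l}. tau (app (h p) \<xi>) (app (EV m p a b) v))"
      using assms(1) unfolding good_def by (intro sum.cong refl) (metis app_simps(4))
  qed (simp_all add: app_add app_scale tau_bilinear cl sum.distrib scaleC_sum_right app_sum PT_tau del: One_nat_def)
  from someI_ex[OF this] show "Op h a b * PT = Op h a b" "PT * Op h a b = Op h a b"
    "v \<in> TV m n l \<Longrightarrow> app (Op h a b) (tau \<xi> v) = (\<Sum>p\<in>{1..l}. tau (app (h p) \<xi>) (app (EV m p a b) v))"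
    unfolding Op_def by blast+
qed

lemma good_closed:
  "good g \<Longrightarrow> good h \<Longrightarrow> good (\<lambda>p. g p * h p)" "good g \<Longrightarrow> good h \<Longrightarrow> good (\<lambda>p. g p + h p)"
  "good h \<Longrightarrow> good (\<lambda>p. y *\<^sub>v h p)" "good (\<lambda>p. Pm)" "good XX" "good Xi" "good (pw k)" "good z"
proof -
  show "good (\<lambda>p. g p * h p)" if "good g" "good h"
  proof -
    have "g p * h p * Pm = g p * h p" if "p \<in> {1..l}" for p
      using \<open>good h\<close> that unfolding good_def mult.assoc by metis
    then show ?thesis using that equivariant_mult unfolding good_def by blast
  qed
  show "good (\<lambda>p. g p + h p)" if "good g" "good h"
    using that equivariant_add[of g h] unfolding good_def distrib_right by metis
  show "good (\<lambda>p. y *\<^sub>v h p)" if "good h"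
    using that equivariant_scale[of h y] unfolding good_def mult_scaleC_left by metis
  show "good (\<lambda>p. Pm)" "good XX" "good Xi" "good (pw k)" "good z"
    using equivariant_gens equivariant_pw[of k] equivariant_z Pm_gens Xi_Pm pw_Pm z_Pm
    unfolding good_def by blast+
qed

lemma Op_cong: "(\<And>p. p \<in> {1..l} \<Longrightarrow> g p = h p) \<Longrightarrow> Op g a b = Op h a b"
proof -
  assume eq: "\<And>p. p \<in> {1..l} \<Longrightarrow> g p = h p"
  have "(\<Sum>p\<in>{1..l}. tau (app (g p) \<xi>) (app (EV m p a b) v)) = (\<Sum>p\<in>{1..l}. tau (app (h p) \<xi>) (app (EV m p a b) v))" for \<xi> v
    by (rule sum.cong[OF refl]) (simp add: eq)
  then show ?thesis unfolding Op_def by presburger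
qed

lemma Op_lin:
  assumes "good g" "good h" "a \<in> {1..m + n}"
  shows "Op (\<lambda>p. g p + h p) a b = Op g a b + Op h a b" "Op (\<lambda>p. y *\<^sub>v h p) a b = y *\<^sub>v Op h a b"
proof -
  note cl = EV_closed[OF _ _ assms(3)]
  note gs = good_closed(2)[OF assms(1,2)] good_closed(3)[OF assms(2), of y]
  note P = Op_PT(1)[OF assms(1,3)] Op_PT(1)[OF assms(2,3)] Op_PT(1)[OF gs(1) assms(3)] Op_PT(1)[OF gs(2) assms(3)]
    Op_tau[OF assms(1,3)] Op_tau[OF assms(2,3)] Op_tau[OF gs(1) assms(3)] Op_tau[OF gs(2) assms(3)]
  show "Op (\<lambda>p. g p + h p) a b = Op g a b + Op h a b"
    by (rule lin_T_eqI) (simp_all add: P distrib_right app_simps tau_bilinear cl sum.distrib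
      del: One_nat_def atLeastAtMost_iff)
  show "Op (\<lambda>p. y *\<^sub>v h p) a b = y *\<^sub>v Op h a b"
    by (rule lin_T_eqI) (simp_all add: P mult_scaleC_left app_simps tau_bilinear cl scaleC_sum_right
      del: One_nat_def atLeastAtMost_iff)
qed

lemma Op_Op_tau:
  assumes "good g" "good h" "a \<in> {1..m + n}" "i \<in> {1..m + n}" "v \<in> TV m n l"
  shows "app (Op g a b) (app (Op h i j) (tau \<xi> v))
    = (\<Sum>p\<in>{1..l}. \<Sum>q\<in>{1..l}. tau (app (g p * h q) \<xi>) (app (EV m p a b * EV m q i j) v))"
proof -
  have "app (Op g a b) (app (Op h i j) (tau \<xi> v))
    = (\<Sum>q\<in>{1..l}. \<Sum>p\<in>{1..l}. tau (app (g p) (app (h q) \<xi>)) (app (EV m p a b) (app (EV m q i j) v)))"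
    unfolding Op_tau[OF assms(2,4,5)] app_sum
    using assms by (intro sum.cong refl Op_tau[OF assms(1,3)] EV_closed)
  then show ?thesis unfolding app_simps(4) by (subst sum.swap)
qed

text \<open>The source of all commutators in \<open>gl_core\<close>. Pairs p = q give the usual
  bracket of matrix units. For p different from q, the transposition in the commutator of h_p and
  g_q is moved to the tensor power, where \<open>PV_EV_EV\<close> exchanges the row indices;
  completing to all pairs yields products of operators minus a diagonal correction. Two pairs of
  families are allowed because the commutator of z_p and z_q has two terms.\<close>

lemma Op_comm:
  assumes good: "good h" "good g" "good al" "good ga" "good al2" "good ga2"
    and idx: "a \<in> {1..m + n}" "b \<in> {1..m + n}" "i \<in> {1..m + n}" "j \<in> {1..m + n}"
    and comm: "\<And>p q. p \<in> {1..l} \<Longrightarrow> q \<in> {1..l} \<Longrightarrow> p \<noteq> q \<Longrightarrow>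
      h p * g q - g q * h p = st p q * (k *\<^sub>v (al p * ga q) + k2 *\<^sub>v (al2 p * ga2 q))"
  shows "sb (eps m a b i j) (Op h a b) (Op g i j)
    = (if b = i then Op (\<lambda>p. h p * g p) a j else 0)
      - (if a = j then eps m a b i j *\<^sub>v Op (\<lambda>p. g p * h p) i b else 0)
      + (k * eta m a b i) *\<^sub>v (Op al i b * Op ga a j - (if b = a then Op (\<lambda>p. al p * ga p) i j else 0))
      + (k2 * eta m a b i) *\<^sub>v (Op al2 i b * Op ga2 a j - (if b = a then Op (\<lambda>p. al2 p * ga2 p) i j else 0))"
    (is "_ = ?rhs")
proof (rule lin_T_eqI)
  note gd = good good_closed(1)[OF good(1,2)] good_closed(1)[OF good(2,1)] good_closed(1)[OF good(3,4)] good_closed(1)[OF good(5,6)]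
  note PT = Op_PT(1)[OF _ idx(1)] Op_PT(1)[OF _ idx(3)]
  show "sb (eps m a b i j) (Op h a b) (Op g i j) * PT = sb (eps m a b i j) (Op h a b) (Op g i j)"
    by (simp add: sb_def algebra_simps scaleC_simps PT gd)
  show "?rhs * PT = ?rhs"
    by (simp add: algebra_simps scaleC_simps PT gd)
  fix \<xi> v assume v: "v \<in> TV m n l"
  let ?e = "eps m a b i j" and ?n = "eta m a b i"
  let ?E = "EV m"
  have cl: "app (?E p x y) u \<in> TV m n l" if "u \<in> TV m n l" "p \<in> {1..l}" "x \<in> {a, i}" for p x y u
    using EV_closed[OF that(1,2), of x y] idx that(3) by auto
  define B where "B al ga p q = tau (app (al p * ga q) \<xi>) (app (?E p i b * ?E q a j) v)"
    for al ga :: "nat \<Rightarrow> 'm vfam lin" and p q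
  define A where "A p = (if b = i then tau (app (h p * g p) \<xi>) (app (?E p a j) v) else 0)
    - (if a = j then ?e *\<^sub>v tau (app (g p * h p) \<xi>) (app (?E p i b) v) else 0)" for p
  have trm: "tau (app (h p * g q) \<xi>) (app (?E p a b * ?E q i j) v)
      - ?e *\<^sub>v tau (app (g q * h p) \<xi>) (app (?E q i j * ?E p a b) v)
    = (if p = q then A p else (k * ?n) *\<^sub>v B al ga p q + (k2 * ?n) *\<^sub>v B al2 ga2 p q)"
    if p: "p \<in> {1..l}" and q: "q \<in> {1..l}" for p q
  proof (cases "p = q")
    case True
    then show ?thesis by (simp add: A_def EV_mult_same tau_zero app_simps)
  next
    case False
    let ?v = "app (?E p a b * ?E q i j) v"
    have vc: "?v \<in> TV m n l" and vc2: "app (?E q i j * ?E p a b) v \<in> TV m n l"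
      and vc3: "app (?E p i b * ?E q a j) v \<in> TV m n l"
      using v p q by (auto simp: app_simps intro!: cl)
    have perm: "Transposition.transpose p q permutes {1..l}" using p q by (rule transpose_permutes)
    have "?E p a b * ?E q i j = ?e *\<^sub>v (?E q i j * ?E p a b)" using p q False by (intro EV_comm) auto
    then have "?v = ?e *\<^sub>v app (?E q i j * ?E p a b) v" by (simp add: app_simps(5))
    then have "?e *\<^sub>v tau (app (g q * h p) \<xi>) (app (?E q i j * ?E p a b) v) = tau (app (g q * h p) \<xi>) ?v"
      using vc2 by (simp add: tau_bilinear)
    then have "tau (app (h p * g q) \<xi>) ?v - ?e *\<^sub>v tau (app (g q * h p) \<xi>) (app (?E q i j * ?E p a b) v)
      = tau (app (h p * g q - g q * h p) \<xi>) ?v"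
      using vc by (simp add: tau_diff app_simps(2))
    also have "\<dots> = tau (app (k *\<^sub>v (al p * ga q) + k2 *\<^sub>v (al2 p * ga2 q)) \<xi>) (app (PV m l (Transposition.transpose p q)) ?v)"
      unfolding comm[OF p q False] app_simps(4)[of "st p q"] by (rule tau_bilinear(5)[OF vc perm])
    also have "app (PV m l (Transposition.transpose p q)) ?v = ?n *\<^sub>v app (?E p i b * ?E q a j) v"
      using PV_EV_EV[OF p q False, of m a b i j] by (simp flip: app_simps(4,5))
    also have "tau (app (k *\<^sub>v (al p * ga q) + k2 *\<^sub>v (al2 p * ga2 q)) \<xi>) \<dots>
      = (k * ?n) *\<^sub>v B al ga p q + (k2 * ?n) *\<^sub>v B al2 ga2 p q"
      using vc3 by (simp add: tau_bilinear app_simps(1,5) B_def scaleC_simps TV_scale mult.commute)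
    finally show ?thesis using False by simp
  qed
  have "app (sb ?e (Op h a b) (Op g i j)) (tau \<xi> v)
    = (\<Sum>p\<in>{1..l}. \<Sum>q\<in>{1..l}. tau (app (h p * g q) \<xi>) (app (?E p a b * ?E q i j) v)
      - ?e *\<^sub>v tau (app (g q * h p) \<xi>) (app (?E q i j * ?E p a b) v))"
  proof -
    have "(\<Sum>p\<in>{1..l}. \<Sum>q\<in>{1..l}. tau (app (g p * h q) \<xi>) (app (?E p i j * ?E q a b) v))
      = (\<Sum>p\<in>{1..l}. \<Sum>q\<in>{1..l}. tau (app (g q * h p) \<xi>) (app (?E q i j * ?E p a b) v))"
      by (rule sum.swap)
    then show ?thesis
      unfolding sb_def app_simps(2,5) app_simps(4)[of "Op _ _ _"]
      by (simp add: Op_Op_tau good idx v sum_subtractf scaleC_sum_right del: One_nat_def atLeastAtMost_iff)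
  qed
  also have "\<dots> = (\<Sum>p\<in>{1..l}. \<Sum>q\<in>{1..l}. if p = q then A p else (k * ?n) *\<^sub>v B al ga p q + (k2 * ?n) *\<^sub>v B al2 ga2 p q)"
    by (intro sum.cong refl trm)
  also have "\<dots> = (\<Sum>p\<in>{1..l}. A p)
    + ((k * ?n) *\<^sub>v ((\<Sum>p\<in>{1..l}. \<Sum>q\<in>{1..l}. B al ga p q) - (\<Sum>p\<in>{1..l}. B al ga p p))
    + (k2 * ?n) *\<^sub>v ((\<Sum>p\<in>{1..l}. \<Sum>q\<in>{1..l}. B al2 ga2 p q) - (\<Sum>p\<in>{1..l}. B al2 ga2 p p)))"
    by (subst sum_diag_split) (simp_all add: sum.distrib scaleC_sum_right scaleC_simps algebra_simps)
  also have "\<dots> = app ?rhs (tau \<xi> v)"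
  proof -
    have 1: "(\<Sum>p\<in>{1..l}. A p) = app ((if b = i then Op (\<lambda>p. h p * g p) a j else 0)
      - (if a = j then ?e *\<^sub>v Op (\<lambda>p. g p * h p) i b else 0)) (tau \<xi> v)"
      using idx gd v by (auto simp: A_def app_simps(2,5,6) Op_tau sum_subtractf scaleC_sum_right)
    have 2: "(\<Sum>p\<in>{1..l}. \<Sum>q\<in>{1..l}. B al ga p q) - (\<Sum>p\<in>{1..l}. B al ga p p)
      = app (Op al i b * Op ga a j - (if b = a then Op (\<lambda>p. al p * ga p) i j else 0)) (tau \<xi> v)"
      if "good al" "good ga" for al ga
    proof -
      have "(\<Sum>p\<in>{1..l}. \<Sum>q\<in>{1..l}. B al ga p q) = app (Op al i b * Op ga a j) (tau \<xi> v)"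
        unfolding B_def app_simps(4)[of "Op al i b"] by (rule Op_Op_tau[symmetric]) (use that idx v in auto)
      moreover have "(\<Sum>p\<in>{1..l}. B al ga p p) = app (if b = a then Op (\<lambda>p. al p * ga p) i j else 0) (tau \<xi> v)"
        unfolding B_def EV_mult_same
        using idx good_closed(1)[OF that] v by (auto simp: Op_tau app_simps(6) tau_zero)
      ultimately show ?thesis by (simp add: app_simps(2))
    qed
    show ?thesis
      unfolding 1 2[OF good(3,4)] 2[OF good(5,6)] app_simps(1)[of _ "(k2 * ?n) *\<^sub>v _"]
        app_simps(1)[of _ "(k * ?n) *\<^sub>v _"] app_simps(5)
      by (simp add: add.assoc)
  qed
  finally show "app (sb ?e (Op h a b) (Op g i j)) (tau \<xi> v) = app ?rhs (tau \<xi> v)" .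
qed

end

lemma eta_diag: "eta m a a i = psign m a"
  by (simp add: eta_def power_mult mult.commute[of "parity m a + parity m i"] flip: mult_2)

section \<open>Sums over transpositions, and the grading operator on the tensor product\<close>

context drinfeld
begin

lemma st_SS:
  assumes "\<sigma> permutes {1..l}" "k \<in> {1..l}" "p \<in> {1..l}"
  shows "st k p * SS \<sigma> = SS \<sigma> * st (\<sigma> k) (\<sigma> p)"
proof -
  have "\<sigma> k \<in> {1..l}" "\<sigma> p \<in> {1..l}" using permutes_in_image[OF assms(1)] assms by blast+
  moreover have "\<sigma> \<circ> Transposition.transpose k p = Transposition.transpose (\<sigma> k) (\<sigma> p) \<circ> \<sigma>"
    using permutes_inj[OF assms(1)] by (auto simp: fun_eq_iff Transposition.transpose_def inj_eq)
  ultimately show ?thesis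
    using assms SS_mult[OF assms(1) transpose_permutes[OF assms(2,3)]]
      SS_mult[OF transpose_permutes assms(1), of "\<sigma> k" "\<sigma> p"] by simp
qed

text \<open>The shape shared by the sums over transpositions in \<open>z_diag\<close> and
  \<open>RR_y_elt\<close>, with the transposition leftmost, ready to be moved to the tensor
  power.\<close>

definition sig_fam :: "(nat \<Rightarrow> 'm vfam lin) \<Rightarrow> (nat \<Rightarrow> 'm vfam lin) \<Rightarrow> nat \<Rightarrow> 'm vfam lin" where
  "sig_fam al ga p = (\<Sum>k\<in>{1..l} - {p}. st k p * (al k * ga p))"

lemma good_sig_fam:
  assumes "good al" "good ga"
  shows "good (sig_fam al ga)"
  unfolding good_def equivariant_def
proof (intro conjI allI impI ballI)
  fix \<sigma> p assume \<sigma>: "\<sigma> permutes {1..l}" and p: "p \<in> {1..l}"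
  have bij: "bij_betw \<sigma> ({1..l} - {p}) ({1..l} - {\<sigma> p})"
    unfolding bij_betw_def
    using image_set_diff[OF permutes_inj[OF \<sigma>], of "{1..l}" "{p}"] permutes_image[OF \<sigma>]
      inj_on_subset[OF permutes_inj[OF \<sigma>] subset_UNIV] by simp
  have "sig_fam al ga p * SS \<sigma> = (\<Sum>k\<in>{1..l} - {p}. SS \<sigma> * (st (\<sigma> k) (\<sigma> p) * (al (\<sigma> k) * ga (\<sigma> p))))"
    unfolding sig_fam_def sum_distrib_right
  proof (rule sum.cong[OF refl])
    fix k assume "k \<in> {1..l} - {p}"
    then have k: "k \<in> {1..l}" by simp
    have a: "al k * SS \<sigma> = SS \<sigma> * al (\<sigma> k)" and g: "ga p * SS \<sigma> = SS \<sigma> * ga (\<sigma> p)"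
      using assms \<sigma> k p unfolding good_def equivariant_def by blast+
    have "st k p * (al k * ga p) * SS \<sigma> = st k p * (al k * SS \<sigma> * ga (\<sigma> p))" by (simp only: mult.assoc g)
    also have "\<dots> = (st k p * SS \<sigma>) * (al (\<sigma> k) * ga (\<sigma> p))" by (simp only: mult.assoc a)
    finally show "st k p * (al k * ga p) * SS \<sigma> = SS \<sigma> * (st (\<sigma> k) (\<sigma> p) * (al (\<sigma> k) * ga (\<sigma> p)))"
      by (simp only: st_SS[OF \<sigma> k p] mult.assoc)
  qed
  also have "\<dots> = SS \<sigma> * sig_fam al ga (\<sigma> p)"
    unfolding sig_fam_def sum_distrib_left
    using sum.reindex_bij_betw[OF bij, of "\<lambda>k. SS \<sigma> * (st k (\<sigma> p) * (al k * ga (\<sigma> p)))"] .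
  finally show "sig_fam al ga p * SS \<sigma> = SS \<sigma> * sig_fam al ga (\<sigma> p)" .
next
  fix p assume "p \<in> {1..l}"
  then have "ga p * Pm = ga p" using assms unfolding good_def by blast
  then show "sig_fam al ga p * Pm = sig_fam al ga p"
    by (simp add: sig_fam_def sum_distrib_right mult.assoc)
qed

text \<open>A resolution of the identity is inserted at position k and the transposition applied to
  both units, giving the sign (-1)^|a|. Completing the sum from k different from p to all pairs
  subtracts the diagonal, where the signs add up to the supertrace m - n.\<close>

lemma Op_sig_fam:
  assumes "good al" "good ga" "i \<in> {1..m + n}" "j \<in> {1..m + n}"
  shows "Op (sig_fam al ga) i j = (\<Sum>a\<in>{1..m + n}. psign m a *\<^sub>v (Op al i a * Op ga a j))
    - (of_nat m - of_nat n) *\<^sub>v Op (\<lambda>p. al p * ga p) i j"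
    (is "_ = ?rhs")
proof (rule lin_T_eqI)
  note gs = good_sig_fam[OF assms(1,2)] good_closed(1)[OF assms(1,2)]
  show "Op (sig_fam al ga) i j * PT = Op (sig_fam al ga) i j" by (rule Op_PT(1)[OF gs(1) assms(3)])
  show "?rhs * PT = ?rhs"
    unfolding left_diff_distrib sum_distrib_right mult_scaleC_left mult.assoc Op_PT(1)[OF gs(2) assms(3)]
    by (intro arg_cong2[of _ _ _ _ "(-)"] sum.cong refl) (simp only: Op_PT(1)[OF assms(2)])
  fix \<xi> v assume v: "v \<in> TV m n l"
  define X where "X a k p = tau (app (al k * ga p) \<xi>) (app (EV m k i a * EV m p a j) v)" for a k p
  have trm: "tau (app (sig_fam al ga p) \<xi>) (app (EV m p i j) v)
    = (\<Sum>a\<in>{1..m + n}. psign m a *\<^sub>v ((\<Sum>k\<in>{1..l}. X a k p) - X a p p))" if p: "p \<in> {1..l}" for p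
  proof -
    let ?v = "app (EV m p i j) v"
    have vc: "?v \<in> TV m n l" using v p assms(3) by (rule EV_closed)
    have one: "tau (app (st k p * (al k * ga p)) \<xi>) ?v = (\<Sum>a\<in>{1..m + n}. psign m a *\<^sub>v X a k p)"
      if "k \<in> {1..l} - {p}" for k
    proof -
      have k: "k \<in> {1..l}" "k \<noteq> p" using that by auto
      have vk: "app (EV m k i a * EV m p a j) v \<in> TV m n l" if "a \<in> {1..m + n}" for a
        unfolding app_simps(4) using v p k that assms(3) by (intro EV_closed)
      have "app (PV m l (Transposition.transpose k p)) ?v
        = app (PV m l (Transposition.transpose k p)) (\<Sum>a\<in>{1..m + n}. app (EV m k a a) ?v)"
        using sum_EV_diag[OF vc k(1)] by simp
      also have "\<dots> = (\<Sum>a\<in>{1..m + n}. app (PV m l (Transposition.transpose k p) * (EV m k a a * EV m p i j)) v)"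
        by (simp add: app_sum app_simps(4))
      also have "\<dots> = (\<Sum>a\<in>{1..m + n}. psign m a *\<^sub>v app (EV m k i a * EV m p a j) v)"
        by (simp only: PV_EV_EV[OF k(1) p k(2)] eta_diag app_simps(5))
      finally have PV: "app (PV m l (Transposition.transpose k p)) ?v = \<dots>" .
      have "tau (app (st k p * (al k * ga p)) \<xi>) ?v
        = tau (app (al k * ga p) \<xi>) (app (PV m l (Transposition.transpose k p)) ?v)"
        unfolding app_simps(4)[of "st k p"] by (rule tau_bilinear(5)[OF vc transpose_permutes[OF k(1) p]])
      also have "\<dots> = (\<Sum>a\<in>{1..m + n}. tau (app (al k * ga p) \<xi>) (psign m a *\<^sub>v app (EV m k i a * EV m p a j) v))"
        unfolding PV by (rule tau_sum_right) (intro TV_scale vk)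
      also have "\<dots> = (\<Sum>a\<in>{1..m + n}. psign m a *\<^sub>v X a k p)"
        unfolding X_def by (intro sum.cong refl tau_bilinear(4) vk)
      finally show ?thesis .
    qed
    have "tau (app (sig_fam al ga p) \<xi>) ?v = (\<Sum>k\<in>{1..l} - {p}. tau (app (st k p * (al k * ga p)) \<xi>) ?v)"
      unfolding sig_fam_def app_sum_left by (rule tau_sum_left[OF vc])
    also have "\<dots> = (\<Sum>k\<in>{1..l} - {p}. \<Sum>a\<in>{1..m + n}. psign m a *\<^sub>v X a k p)"
      by (intro sum.cong refl one)
    also have "\<dots> = (\<Sum>a\<in>{1..m + n}. psign m a *\<^sub>v (\<Sum>k\<in>{1..l} - {p}. X a k p))"
      by (subst sum.swap) (simp add: scaleC_sum_right)
    finally show ?thesis using p by (simp add: sum_diff1)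
  qed
  have "app (Op (sig_fam al ga) i j) (tau \<xi> v)
    = (\<Sum>p\<in>{1..l}. \<Sum>a\<in>{1..m + n}. psign m a *\<^sub>v ((\<Sum>k\<in>{1..l}. X a k p) - X a p p))"
    unfolding Op_tau[OF gs(1) assms(3) v] by (intro sum.cong refl trm)
  also have "\<dots> = (\<Sum>a\<in>{1..m + n}. psign m a *\<^sub>v (\<Sum>k\<in>{1..l}. \<Sum>p\<in>{1..l}. X a k p))
      - (\<Sum>a\<in>{1..m + n}. psign m a *\<^sub>v (\<Sum>p\<in>{1..l}. X a p p))"
  proof -
    have sw: "(\<Sum>p\<in>{1..l}. \<Sum>k\<in>{1..l}. X a k p) = (\<Sum>k\<in>{1..l}. \<Sum>p\<in>{1..l}. X a k p)" for a
      by (rule sum.swap)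
    show ?thesis
      by (subst sum.swap) (simp only: scaleC_sum_right[symmetric] sum_subtractf scaleC_diff_right sw)
  qed
  also have "(\<Sum>a\<in>{1..m + n}. psign m a *\<^sub>v (\<Sum>k\<in>{1..l}. \<Sum>p\<in>{1..l}. X a k p))
    = app (\<Sum>a\<in>{1..m + n}. psign m a *\<^sub>v (Op al i a * Op ga a j)) (tau \<xi> v)"
    unfolding app_sum_left app_simps(5) app_simps(4)[of "Op _ _ _"] X_def
    by (intro sum.cong refl arg_cong[of _ _ "(*\<^sub>v) _"] Op_Op_tau[symmetric] assms v)
  also have "(\<Sum>a\<in>{1..m + n}. psign m a *\<^sub>v (\<Sum>p\<in>{1..l}. X a p p))
    = app ((of_nat m - of_nat n) *\<^sub>v Op (\<lambda>p. al p * ga p) i j) (tau \<xi> v)"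
    unfolding sum_psign[symmetric] scaleC_sum_left app_sum_left app_simps(5) Op_tau[OF gs(2) assms(3) v]
      X_def EV_mult_same
    by simp
  finally show "app (Op (sig_fam al ga) i j) (tau \<xi> v) = app ?rhs (tau \<xi> v)"
    by (simp only: app_simps(2))
qed

lemma ex_parity: "\<exists>F. F * PT = F \<and> PT * F = F \<and> (\<forall>\<xi> v. v \<in> TV m n l \<longrightarrow>
    app F (tau \<xi> v) = tau \<xi> (app (parity_op m l) v))"
proof (rule lift_T)
  fix \<sigma> \<xi> v assume v: "v \<in> TV m n l" and \<sigma>: "\<sigma> permutes {1..l}"
  show "tau (app (SS \<sigma>) \<xi>) (app (parity_op m l) v) = tau \<xi> (app (parity_op m l) (app (PV m l \<sigma>) v))"
    unfolding app_simps(4)[symmetric] parity_op_PV[OF \<sigma>]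
    unfolding app_simps(4) by (rule tau_bilinear(5)[OF parity_op_closed[OF v] \<sigma>])
qed (simp_all add: app_add app_scale tau_bilinear parity_op_closed PT_tau tau_Pm)

definition "ParT = (SOME F. F * PT = F \<and> PT * F = F \<and> (\<forall>\<xi> v. v \<in> TV m n l \<longrightarrow>
    app F (tau \<xi> v) = tau \<xi> (app (parity_op m l) v)))"

lemma ParT_PT: "ParT * PT = ParT" and ParT_tau: "v \<in> TV m n l \<Longrightarrow> app ParT (tau \<xi> v) = tau \<xi> (app (parity_op m l) v)"
proof -
  have "ParT * PT = ParT \<and> PT * ParT = ParT \<and> (\<forall>\<xi> v. v \<in> TV m n l \<longrightarrow>
      app ParT (tau \<xi> v) = tau \<xi> (app (parity_op m l) v))"
    unfolding ParT_def by (rule someI_ex[OF ex_parity])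
  then show "ParT * PT = ParT" "v \<in> TV m n l \<Longrightarrow> app ParT (tau \<xi> v) = tau \<xi> (app (parity_op m l) v)"
    by blast+
qed

lemma ParT_Op:
  assumes "good h" "a \<in> {1..m + n}"
  shows "ParT * Op h a b = (-1) ^ (parity m a + parity m b) *\<^sub>v (Op h a b * ParT)"
proof (rule lin_T_eqI)
  show "ParT * Op h a b * PT = ParT * Op h a b" by (simp only: mult.assoc Op_PT(1)[OF assms])
  show "(-1) ^ (parity m a + parity m b) *\<^sub>v (Op h a b * ParT) * PT = (-1) ^ (parity m a + parity m b) *\<^sub>v (Op h a b * ParT)"
    by (simp only: mult_scaleC_left mult.assoc ParT_PT)
  fix \<xi> v assume v: "v \<in> TV m n l"
  have "app (ParT * Op h a b) (tau \<xi> v) = (\<Sum>p\<in>{1..l}. tau (app (h p) \<xi>) (app (parity_op m l * EV m p a b) v))"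
    unfolding app_simps(4) Op_tau[OF assms v] app_sum
    by (intro sum.cong refl ParT_tau EV_closed[OF v _ assms(2)])
  also have "\<dots> = (\<Sum>p\<in>{1..l}. (-1) ^ (parity m a + parity m b) *\<^sub>v tau (app (h p) \<xi>) (app (EV m p a b) (app (parity_op m l) v)))"
    using parity_op_closed[OF v]
    by (intro sum.cong refl) (simp only: parity_op_EV app_simps(4,5) tau_bilinear(4) EV_closed[OF _ _ assms(2)])
  finally show "app (ParT * Op h a b) (tau \<xi> v) = app ((-1) ^ (parity m a + parity m b) *\<^sub>v (Op h a b * ParT)) (tau \<xi> v)"
    by (simp only: app_simps(4,5) ParT_tau[OF v] Op_tau[OF assms parity_op_closed[OF v]] scaleC_sum_right)
qed

end

section \<open>The tensor product as a model of the matrix-unit relations\<close>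

locale drinfeld_affine = drinfeld l t c M ract m n
  for l t c and M :: "(complex, 'm) module" and ract m n +
  fixes beta :: complex
  assumes m2': "m \<ge> 2" and n2': "n \<ge> 2" and trace': "beta + t = (of_nat m - of_nat n) * c / 2"
begin

abbreviation "zX \<equiv> \<lambda>p. XX p * z p"
abbreviation "zXi \<equiv> \<lambda>p. z p * Xi p"

lemma idx: "1 \<in> {1..m + n}" "m + n \<in> {1..m + n}"
  using m2' by auto

lemma Op_pw: "Op (pw 1) = Op XX" "Op (pw (-1)) = Op Xi" "Op (pw 0) = Op (\<lambda>p. Pm)"
  by (intro ext Op_cong; simp add: pw_simps)+

lemma good_zX: "good zX" "good zXi" by (intro good_closed)+

lemma parN: "psign m (m + n) = -1" "psign m 1 = 1" "eps m (m + n) 1 1 (m + n) = -1" "eta m (m + n) 1 1 = 1"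
  using m2' n2' by (auto simp: psign_def parity_def eps_def eta_def)

sublocale gl_core m n c t beta "\<lambda>k. Op (pw k)" "Op z" "Op zX (m + n) 1" "Op zXi 1 (m + n)"
proof
  show "m \<ge> 2" "n \<ge> 2" "beta + t = (of_nat m - of_nat n) * c / 2" by (fact m2' n2' trace')+
  note g = good_closed(4-8)
  have red: "(\<lambda>p. z p) = z" by simp
  show "sb (eps m a b i j) (Op (pw k) a b) (Op (pw k') i j)
      = (if b = i then Op (pw (k + k')) a j else 0) - (if a = j then eps m a b i j *\<^sub>v Op (pw (k + k')) i b else 0)"
    if "{a, b, i, j} \<subseteq> {1..m + n}" for a b i j k k'
  proof -
    have "Op (\<lambda>p. pw k p * pw k' p) = Op (pw (k + k'))" "Op (\<lambda>p. pw k' p * pw k p) = Op (pw (k + k'))"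
      by (intro ext Op_cong; simp add: pw_add add.commute)+
    then show ?thesis
      using Op_comm[OF g(4)[of k] g(4)[of k'] g(1) g(1) g(1) g(1), of a b i j 0 0] that
      by (simp add: pw_commute)
  qed
  show "sb (eps m a b i j) (Op (pw 0) a b) (Op z i j)
      = (if b = i then Op z a j else 0) - (if a = j then eps m a b i j *\<^sub>v Op z i b else 0)"
    if "{a, b, i, j} \<subseteq> {1..m + n}" for a b i j
  proof -
    have "Op (\<lambda>p. Pm * z p) = Op z" "Op (\<lambda>p. z p * Pm) = Op z"
      by (intro ext Op_cong; simp add: z_Pm)+
    then show ?thesis
      unfolding Op_pw
      using Op_comm[OF g(1) g(5) g(1) g(1) g(1) g(1), of a b i j 0 0] that
      by (simp add: z_Pm)
  qed
  have Pm: "Op (\<lambda>p. Pm * z p) = Op z" "Op (\<lambda>p. z p * Pm) = Op z" "Op (\<lambda>p. Pm * Xi p) = Op Xi"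
    "Op (\<lambda>p. XX p * Pm) = Op XX" "Op (\<lambda>p. Pm * XX p) = Op XX" "Op (\<lambda>p. Xi p * Pm) = Op Xi" "Op (\<lambda>p. Pm * Pm) = Op (\<lambda>p. Pm)"
    by (intro ext Op_cong; simp add: z_Pm Xi_Pm Pm_gens)+
  show "cm (Op z a a) (Op z b b) = (c * psign m a) *\<^sub>v (Op z b a * Op (pw 0) a b - Op (pw 0) b a * Op z a b)"
    if "{a, b} \<subseteq> {1..m + n}" "a \<noteq> b" for a b
  proof -
    have "z p * z q - z q * z p = st p q * (c *\<^sub>v (z p * Pm) + (- c) *\<^sub>v (Pm * z q))"
      if "p \<in> {1..l}" "q \<in> {1..l}" "p \<noteq> q" for p q
      using z_commutators(1)[OF that] that by (simp add: z_Pm scaleC_minus_left)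
    from Op_comm[OF g(5) g(5) g(5) g(1) g(1) g(5), of a a b b c "- c", OF _ _ _ _ this] show ?thesis
      unfolding Op_pw using that
      by (simp add: sb_one eta_diag Pm scaleC_minus_left) (simp add: algebra_simps scaleC_simps)
  qed
  have zEE1: "cm (Op z a a) (Op XX i j) = (c * psign m a) *\<^sub>v (Op XX i a * Op (\<lambda>p. Pm) a j - Op XX i j)
      + ((if a = i then Op (\<lambda>p. z p * XX p) a j else 0) - (if a = j then Op zX i a else 0))"
    if "{a, i, j} \<subseteq> {1..m + n}" for a i j
  proof -
    have "z p * XX q - XX q * z p = st p q * (c *\<^sub>v (XX p * Pm) + 0 *\<^sub>v (Pm * Pm))"
      if "p \<in> {1..l}" "q \<in> {1..l}" "p \<noteq> q" for p q
      using z_commutators(2)[OF that] that by (simp add: Pm_gens)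
    from Op_comm[OF g(5) g(2) g(2) g(1) g(1) g(1), of a a i j c 0, OF _ _ _ _ this] show ?thesis
      using that by (simp add: sb_one eta_diag Pm scaleC_one)
  qed
  have zEEm1: "cm (Op z a a) (Op Xi i j) = - ((c * psign m a) *\<^sub>v (Op (\<lambda>p. Pm) i a * Op Xi a j - Op Xi i j))
      + ((if a = i then Op zXi a j else 0) - (if a = j then Op (\<lambda>p. Xi p * z p) i a else 0))"
    if "{a, i, j} \<subseteq> {1..m + n}" for a i j
  proof -
    have "z p * Xi q - Xi q * z p = st p q * ((- c) *\<^sub>v (Pm * Xi q) + 0 *\<^sub>v (Pm * Pm))"
      if "p \<in> {1..l}" "q \<in> {1..l}" "p \<noteq> q" for p q
      using z_commutators(3)[OF that] that by (simp add: Xi_Pm scaleC_simps)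
    from Op_comm[OF g(5) g(3) g(1) g(3) g(1) g(1), of a a i j "- c" 0, OF _ _ _ _ this] show ?thesis
      using that by (simp add: sb_one eta_diag Pm scaleC_one scaleC_minus_left)
  qed
  show "cm (Op z a a) (Op (pw 1) i j) = (c * psign m a) *\<^sub>v (Op (pw 1) i a * Op (pw 0) a j - Op (pw 1) i j)"
    if "{a, i, j} \<subseteq> {1..m + n}" "a \<noteq> i" "a \<noteq> j" for a i j
    unfolding Op_pw using zEE1[OF that(1)] that by simp
  show "cm (Op z a a) (Op (pw (-1)) i j) = - ((c * psign m a) *\<^sub>v (Op (pw 0) i a * Op (pw (-1)) a j - Op (pw (-1)) i j))"
    if "{a, i, j} \<subseteq> {1..m + n}" "a \<noteq> i" "a \<noteq> j" for a i j
    unfolding Op_pw using zEEm1[OF that(1)] that by simp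
  have N1: "m + n \<noteq> 1" "1 \<noteq> m + n" using m2' by auto
  show "cm (Op z 1 1) (Op (pw 1) (m + n) 1) = - Op zX (m + n) 1
      + c *\<^sub>v (Op (pw 1) (m + n) 1 * Op (pw 0) 1 1 - Op (pw 1) (m + n) 1)"
    unfolding Op_pw using zEE1[of 1 "m + n" 1] idx N1 parN by (simp del: One_nat_def)
  show "cm (Op z 1 1) (Op (pw (-1)) 1 (m + n)) = Op zXi 1 (m + n)
      - c *\<^sub>v (Op (pw 0) 1 1 * Op (pw (-1)) 1 (m + n) - Op (pw (-1)) 1 (m + n))"
    unfolding Op_pw using zEEm1[of 1 1 "m + n"] idx N1 parN by (simp del: One_nat_def)
  \<comment> \<open>The transposition sums of \<open>z_diag\<close> are brought to the form of
    \<open>Op_sig_fam\<close>. In the second, moving x_p^{-1} past the transposition turns it into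
    x_k^{-1}.\<close>
  have sf: "sig_fam (\<lambda>p. Pm) XX p = sig p * XX p" "sig_fam Xi (\<lambda>p. Pm) p = Xi p * sig p"
    "sig_fam (\<lambda>p. Pm) (\<lambda>p. Pm) p = sig p" if p: "p \<in> {1..l}" for p
  proof -
    show "sig_fam (\<lambda>p. Pm) XX p = sig p * XX p"
      by (simp only: sig_fam_def sig_def sum_distrib_right Pm_gens(1)[OF p])
    have k: "Xi p * st k p = st k p * Xi k" "st k p * Pm = st k p" if "k \<in> {1..l} - {p}" for k
    proof -
      have k: "k \<in> {1..l}" using that by simp
      have perm: "Transposition.transpose k p permutes {1..l}" using k p by (rule transpose_permutes)
      show "Xi p * st k p = st k p * Xi k" using Xi_SS[OF perm p] by simp
      show "st k p * Pm = st k p" by (rule Pm_gens(6)[OF perm])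
    qed
    show "sig_fam Xi (\<lambda>p. Pm) p = Xi p * sig p"
      unfolding sig_fam_def sig_def sum_distrib_left by (intro sum.cong refl) (simp only: k Xi_Pm)
    show "sig_fam (\<lambda>p. Pm) (\<lambda>p. Pm) p = sig p"
      unfolding sig_fam_def sig_def by (intro sum.cong refl) (simp only: k Pm_gens)
  qed
  have gs: "good (sig_fam (\<lambda>p. Pm) XX)" "good (sig_fam Xi (\<lambda>p. Pm))" "good (sig_fam (\<lambda>p. Pm) (\<lambda>p. Pm))"
    by (intro good_sig_fam g)+
  have lin3: "Op (\<lambda>p. u p + (y *\<^sub>v v p + x *\<^sub>v w p)) a b = Op u a b + (y *\<^sub>v Op v a b + x *\<^sub>v Op w a b)"
    if "good u" "good v" "good w" "a \<in> {1..m + n}" for u v w a b x y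
  proof -
    have 1: "good (\<lambda>p. y *\<^sub>v v p)" "good (\<lambda>p. x *\<^sub>v w p)" by (rule good_closed(3)[OF that(2)], rule good_closed(3)[OF that(3)])
    have 2: "good (\<lambda>p. y *\<^sub>v v p + x *\<^sub>v w p)" using 1 by (rule good_closed(2))
    show ?thesis
      unfolding Op_lin(1)[OF that(1) 2 that(4)] Op_lin(1)[OF 1 that(4)] Op_lin(2)[OF that(2,2,4)] Op_lin(2)[OF that(3,3,4)] ..
  qed
  have "Op (\<lambda>p. z p * XX p) (m + n) 1
    = Op (\<lambda>p. zX p + ((- t) *\<^sub>v XX p + (- c) *\<^sub>v sig_fam (\<lambda>p. Pm) XX p)) (m + n) 1"
    by (rule Op_cong) (simp add: z_diag(1) sf(1) scaleC_minus_left del: One_nat_def)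
  then have zx: "Op (\<lambda>p. z p * XX p) (m + n) 1 = Op zX (m + n) 1 - t *\<^sub>v Op XX (m + n) 1
    - c *\<^sub>v ((\<Sum>a\<in>{1..m + n}. psign m a *\<^sub>v (Op (\<lambda>p. Pm) (m + n) a * Op XX a 1)) - (of_nat m - of_nat n) *\<^sub>v Op XX (m + n) 1)"
    unfolding lin3[OF good_zX(1) g(2) gs(1) idx(2)] Op_sig_fam[OF g(1,2) idx(2,1)] Pm
    by (simp add: scaleC_minus_left del: One_nat_def)
  show "cm (Op z (m + n) (m + n)) (Op (pw 1) (m + n) 1)
      = Op zX (m + n) 1 - t *\<^sub>v Op (pw 1) (m + n) 1
        - c *\<^sub>v ((\<Sum>a\<in>{1..m + n}. psign m a *\<^sub>v (Op (pw 0) (m + n) a * Op (pw 1) a 1))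
                 - (of_nat m - of_nat n) *\<^sub>v Op (pw 1) (m + n) 1)
        - c *\<^sub>v (Op (pw 1) (m + n) (m + n) * Op (pw 0) (m + n) 1 - Op (pw 1) (m + n) 1)"
    unfolding Op_pw zx[symmetric] using zEE1[of "m + n" "m + n" 1] idx N1 parN
    by (simp add: scaleC_minus_left del: One_nat_def)
  have "Op (\<lambda>p. Xi p * z p) 1 (m + n)
    = Op (\<lambda>p. zXi p + ((- t) *\<^sub>v Xi p + (- c) *\<^sub>v sig_fam Xi (\<lambda>p. Pm) p)) 1 (m + n)"
    by (rule Op_cong) (simp add: z_diag(2) sf(2) scaleC_minus_left del: One_nat_def)
  then have xz: "Op (\<lambda>p. Xi p * z p) 1 (m + n) = Op zXi 1 (m + n) - t *\<^sub>v Op Xi 1 (m + n)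
    - c *\<^sub>v ((\<Sum>a\<in>{1..m + n}. psign m a *\<^sub>v (Op Xi 1 a * Op (\<lambda>p. Pm) a (m + n))) - (of_nat m - of_nat n) *\<^sub>v Op Xi 1 (m + n))"
    unfolding lin3[OF good_zX(2) g(3) gs(2) idx(1)] Op_sig_fam[OF g(3,1) idx(1,2)] Pm
    by (simp add: scaleC_minus_left del: One_nat_def)
  show "cm (Op z (m + n) (m + n)) (Op (pw (-1)) 1 (m + n))
      = - Op zXi 1 (m + n) + t *\<^sub>v Op (pw (-1)) 1 (m + n)
        + c *\<^sub>v ((\<Sum>a\<in>{1..m + n}. psign m a *\<^sub>v (Op (pw (-1)) 1 a * Op (pw 0) a (m + n)))
                 - (of_nat m - of_nat n) *\<^sub>v Op (pw (-1)) 1 (m + n))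
        + c *\<^sub>v (Op (pw 0) 1 (m + n) * Op (pw (-1)) (m + n) (m + n) - Op (pw (-1)) 1 (m + n))"
  proof -
    have "cm (Op z (m + n) (m + n)) (Op Xi 1 (m + n))
      = c *\<^sub>v (Op (\<lambda>p. Pm) 1 (m + n) * Op Xi (m + n) (m + n) - Op Xi 1 (m + n)) - Op (\<lambda>p. Xi p * z p) 1 (m + n)"
      using zEEm1[of "m + n" 1 "m + n"] idx N1 parN by (simp add: scaleC_minus_left del: One_nat_def)
    then show ?thesis unfolding Op_pw xz by (simp add: algebra_simps del: One_nat_def)
  qed
  show "Op zX (m + n) 1 * Op (pw (-1)) 1 (m + n) + Op (pw (-1)) 1 (m + n) * Op zX (m + n) 1
      = Op z (m + n) (m + n) + Op z 1 1 + t *\<^sub>v Op (pw 0) (m + n) (m + n)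
        + c *\<^sub>v ((\<Sum>a\<in>{1..m + n}. psign m a *\<^sub>v (Op (pw 0) (m + n) a * Op (pw 0) a (m + n)))
                 - (of_nat m - of_nat n) *\<^sub>v Op (pw 0) (m + n) (m + n))
        - c *\<^sub>v (Op (pw 0) 1 1 * Op (pw 0) (m + n) (m + n))"
  proof -
    have "XX p * z p * Xi q - Xi q * (XX p * z p) = st p q * ((- c) *\<^sub>v (Pm * Pm) + 0 *\<^sub>v (Pm * Pm))"
      if "p \<in> {1..l}" "q \<in> {1..l}" "p \<noteq> q" for p q
      using z_commutators(4)[OF that] by (simp add: Pm_gens scaleC_simps)
    from Op_comm[OF good_zX(1) g(3) g(1) g(1) g(1) g(1), of "m + n" 1 1 "m + n" "- c" 0, OF idx(2,1,1,2) this]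
    have 1: "Op zX (m + n) 1 * Op Xi 1 (m + n) + Op Xi 1 (m + n) * Op zX (m + n) 1
      = Op (\<lambda>p. XX p * z p * Xi p) (m + n) (m + n) + Op (\<lambda>p. Xi p * (XX p * z p)) 1 1
        - c *\<^sub>v (Op (\<lambda>p. Pm) 1 1 * Op (\<lambda>p. Pm) (m + n) (m + n))"
      using N1 parN by (simp add: sb_def scaleC_minus_left scaleC_one del: One_nat_def)
    have 2: "Op (\<lambda>p. Xi p * (XX p * z p)) 1 1 = Op z 1 1"
      by (rule Op_cong) (simp add: Xi_XX z_Pm del: One_nat_def flip: mult.assoc)
    have "Op (\<lambda>p. XX p * z p * Xi p) (m + n) (m + n)
      = Op (\<lambda>p. z p + (t *\<^sub>v Pm + c *\<^sub>v sig_fam (\<lambda>p. Pm) (\<lambda>p. Pm) p)) (m + n) (m + n)"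
      by (rule Op_cong) (simp add: z_diag(3) sf(3) add.assoc del: One_nat_def)
    also have "\<dots> = Op z (m + n) (m + n) + t *\<^sub>v Op (\<lambda>p. Pm) (m + n) (m + n)
        + c *\<^sub>v ((\<Sum>a\<in>{1..m + n}. psign m a *\<^sub>v (Op (\<lambda>p. Pm) (m + n) a * Op (\<lambda>p. Pm) a (m + n)))
                 - (of_nat m - of_nat n) *\<^sub>v Op (\<lambda>p. Pm) (m + n) (m + n))"
      unfolding lin3[OF g(5) g(1) gs(3) idx(2)] Op_sig_fam[OF g(1,1) idx(2,2)] Pm by (simp add: add.assoc)
    finally show ?thesis unfolding Op_pw 1 2 by (simp add: algebra_simps del: One_nat_def)
  qed
qed

lemma Op_y_elt:
  assumes "a \<in> {1..m + n}" "b \<in> {1..m + n}"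
  shows "Op (\<lambda>p. RR (y_elt l t c p)) a b = JJ a b"
proof -
  note g = good_closed(4-8)
  have sp: "sig_fam (\<lambda>p. Pm) (\<lambda>p. Pm) p = sig p" if p: "p \<in> {1..l}" for p
    unfolding sig_fam_def sig_def
    by (intro sum.cong refl) (use p in \<open>simp add: Pm_gens transpose_permutes del: One_nat_def\<close>)
  have gs: "good (sig_fam (\<lambda>p. Pm) (\<lambda>p. Pm))" by (intro good_sig_fam g)
  have "Op (\<lambda>p. RR (y_elt l t c p)) a b
    = Op (\<lambda>p. (z p + (t / 2) *\<^sub>v Pm) + (c / 2) *\<^sub>v sig_fam (\<lambda>p. Pm) (\<lambda>p. Pm) p) a b"
    by (rule Op_cong) (simp add: RR_y_elt sp add.commute del: One_nat_def)
  also have "\<dots> = Op z a b + (t / 2) *\<^sub>v Op (\<lambda>p. Pm) a b + (c / 2) *\<^sub>v Op (sig_fam (\<lambda>p. Pm) (\<lambda>p. Pm)) a b"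
    using Op_lin(1)[OF good_closed(2)[OF g(5) good_closed(3)[OF g(1), of "t / 2"]] good_closed(3)[OF gs, of "c / 2"] assms(1), of b]
      Op_lin(1)[OF g(5) good_closed(3)[OF g(1), of "t / 2"] assms(1), of b]
      Op_lin(2)[OF g(1,1) assms(1), of "t / 2" b] Op_lin(2)[OF gs gs assms(1), of "c / 2" b]
    by simp
  also have "\<dots> = JJ a b"
    unfolding Op_sig_fam[OF g(1,1) assms] JJ_def Op_pw
    by (simp add: Pm_gens)
  finally show ?thesis .
qed

end

section \<open>Homogeneous elements of free superalgebras\<close>

definition homog :: "('g \<Rightarrow> nat) \<Rightarrow> nat \<Rightarrow> 'g falg \<Rightarrow> bool" where
  "homog par p x \<longleftrightarrow> (\<forall>w\<in>Poly_Mapping.keys x. word_parity par w = p)"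

text \<open>Reduces the bilinearly extended supercommutator to its usual formula: all brackets to be
  evaluated have homogeneous arguments.\<close>

lemma hom_part_homog:
  assumes "homog par p x"
  shows "hom_part par q x = (if q = p then x else 0)"
proof (cases "q = p")
  case True
  have "{w. w \<in> Poly_Mapping.keys x \<and> word_parity par w = p} = Poly_Mapping.keys x"
    using assms by (auto simp: homog_def)
  then show ?thesis using True falg_sum_single[of x] by (simp add: hom_part_def)
next
  case False
  then have empty: "{w. w \<in> Poly_Mapping.keys x \<and> word_parity par w = q} = {}"
    using assms by (auto simp: homog_def)
  show ?thesis using False unfolding hom_part_def empty by simp
qed

lemma scomm_homog:
  assumes "homog par p x" "homog par q y" "p < 2" "q < 2"
  shows "scomm par x y = x * y - (-1) ^ (p * q) * (y * x)"
proof -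
  have "{..<2} = {0, Suc 0}" by auto
  moreover have "p = 0 \<or> p = Suc 0" "q = 0 \<or> q = Suc 0" using assms(3,4) by auto
  ultimately show ?thesis
    unfolding scomm_def by (elim disjE) (simp_all add: hom_part_homog[OF assms(1)] hom_part_homog[OF assms(2)])
qed

lemma homog_closed:
  "homog par p x \<Longrightarrow> homog par p y \<Longrightarrow> homog par p (x + y)" "homog par p x \<Longrightarrow> homog par p (z *\<^sub>v x)"
  "homog par p x \<Longrightarrow> homog par p (- x)" "homog par p x \<Longrightarrow> homog par p y \<Longrightarrow> homog par p (x - y)"
  "homog par p 0" "par g < 2 \<Longrightarrow> homog par (par g) (gen g)"
  using keys_add[of x y] keys_scaleC[of z x]
  by (auto simp: homog_def in_keys_iff lookup_minus gen_def word_parity_def)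

lemma homog_mult:
  assumes "homog par p x" "homog par q y"
  shows "homog par ((p + q) mod 2) (x * y)"
  unfolding homog_def
proof
  fix w assume "w \<in> Poly_Mapping.keys (x * y)"
  then obtain a b where "a \<in> Poly_Mapping.keys x" "b \<in> Poly_Mapping.keys y" "w = a + b"
    using keys_mult[of x y] by blast
  moreover have "word_parity par (a + b) = (word_parity par a + word_parity par b) mod 2"
    by (simp add: word_parity_def plus_word_def mod_add_eq)
  ultimately show "word_parity par w = (p + q) mod 2"
    using assms by (auto simp: homog_def)
qed

lemma neg_one_mult_falg: "(-1) ^ k * (x :: 'g falg) = (-1 :: complex) ^ k *\<^sub>v x"
  by (cases "even k") (simp_all add: minus_one_power_iff scaleC_one scaleC_minus_left)

lemma homog_scomm:
  assumes "homog par p x" "homog par q y" "p < 2" "q < 2"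
  shows "homog par ((p + q) mod 2) (scomm par x y)"
proof -
  have "homog par ((q + p) mod 2) (y * x)" using assms by (intro homog_mult)
  then show ?thesis
    unfolding scomm_homog[OF assms] neg_one_mult_falg
    using homog_mult[OF assms(1,2)] by (intro homog_closed) (simp_all add: add.commute)
qed

lemma falg_hom_scomm:
  assumes "homog par p x" "homog par q y" "p < 2" "q < 2"
  shows "falg_hom img (scomm par x y) = sb ((-1) ^ (p * q)) (falg_hom img x) (falg_hom img y)"
  unfolding scomm_homog[OF assms] neg_one_mult_falg by (simp add: falg_hom_simps sb_def)

lemma FA_hom_part: "x \<in> FA G \<Longrightarrow> hom_part par p x \<in> FA G"
  unfolding hom_part_def
  by (intro FA_sum) (auto simp: FA_def split: if_splits)

lemma FA_scomm: "x \<in> FA G \<Longrightarrow> y \<in> FA G \<Longrightarrow> scomm par x y \<in> FA G"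
  unfolding scomm_def neg_one_mult_falg by (intro FA_sum FA_closed FA_hom_part)

section \<open>The relations of the affine super Yangian\<close>

lemma yangian_gen_FA:
  "i < m + n \<Longrightarrow> r < 2 \<Longrightarrow> gen (Xy p i r) \<in> FA (yangian_gens m n)"
  "i < m + n \<Longrightarrow> r < 2 \<Longrightarrow> gen (Hy i r) \<in> FA (yangian_gens m n)"
  by (auto intro!: FA_closed(9) simp: yangian_gens_def)

lemma H_tilde_FA: "i < m + n \<Longrightarrow> H_tilde lam i \<in> FA (yangian_gens m n)"
  unfolding H_tilde_def by (intro FA_closed(1-8) yangian_gen_FA) auto

lemma FA_if: "x \<in> FA G \<Longrightarrow> y \<in> FA G \<Longrightarrow> (if b then x else y) \<in> FA G"
  by simp

lemma FA_funpow_scomm: "x \<in> FA G \<Longrightarrow> y \<in> FA G \<Longrightarrow> ((\<lambda>z. scomm par x z) ^^ k) y \<in> FA G"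
  by (induction k) (auto intro: FA_scomm)

lemma yangian_rels_FA:
  assumes "m \<ge> 2" "n \<ge> 2" "(a, b) \<in> yangian_rels m n lam beta"
  shows "a \<in> FA (yangian_gens m n) \<and> b \<in> FA (yangian_gens m n)"
proof -
  have N: "0 < m + n" "m + n - 1 < m + n" "m < m + n" "x mod (m + n) < m + n" for x using assms(1,2) by auto
  note rules = conjI FA_if FA_scomm FA_funpow_scomm FA_closed(1-8) H_tilde_FA yangian_gen_FA
  show ?thesis
    using assms(3)
  proof cases
    case (odd_square i)
    then have "i < m + n" using N by auto
    then show ?thesis unfolding odd_square(1,2) by (intro rules) auto
  qed (simp only:, intro rules; use N in \<open>force\<close>)+
qed

section \<open>Images of the generators, and verification of the defining relations\<close>

context drinfeld_affine
begin

definition img :: "ygen \<Rightarrow> ('m \<times> tpow \<Rightarrow>\<^sub>0 complex) set vfam lin" where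
  "img g = (case g of Xy p i r \<Rightarrow> (if r = 0 then X p i else X1 p i) | Hy i r \<Rightarrow> (if r = 0 then h i else H1 i))"

abbreviation "phi \<equiv> falg_hom img"
abbreviation "hg \<equiv> homog (ygen_parity m)"

definition np :: "nat \<Rightarrow> nat" where "np i = (if i = 0 \<or> i = m then 1 else 0)"

lemma np_less: "np i < 2" by (simp add: np_def)

lemma hg_gens: "hg (np i) (gen (Xy p i r))" "hg 0 (gen (Hy i r))"
  using homog_closed(6)[of "ygen_parity m" "Xy p i r"] homog_closed(6)[of "ygen_parity m" "Hy i r"]
  by (simp_all add: np_def split: if_splits)

lemma hg_H_tilde: "hg 0 (H_tilde c i)"
proof -
  have "hg ((0 + 0) mod 2) (gen (Hy i 0) * gen (Hy i 0))" by (intro homog_mult hg_gens)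
  then show ?thesis unfolding H_tilde_def cscale_eq by (intro homog_closed hg_gens) simp_all
qed

lemma phi_gen: "phi (gen (Xy p i 0)) = X p i" "phi (gen (Xy p i 1)) = X1 p i" "phi (gen (Xy p i (Suc 0))) = X1 p i"
  "phi (gen (Hy i 0)) = h i" "phi (gen (Hy i 1)) = H1 i" "phi (gen (Hy i (Suc 0))) = H1 i"
  by (simp_all add: falg_hom_simps img_def)

lemma phi_H_tilde: "phi (H_tilde c i) = Ht i"
  by (simp add: H_tilde_def cscale_eq falg_hom_simps img_def H1_def)

lemma np_sg: "i < N \<Longrightarrow> j < N \<Longrightarrow> (-1 :: complex) ^ (np i * np j) = sg i j"
  by (auto simp: np_def sg_alt)

lemma np_parity: "np i = (parity m (L i) + parity m (i + 1)) mod 2" if "i < N"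
  using that m2' n2' by (auto simp: np_def parity_def L_def)

lemma phi_XX: "i < N \<Longrightarrow> j < N \<Longrightarrow> phi (scomm (ygen_parity m) (gen (Xy p i r)) (gen (Xy q j r')))
  = sb (sg i j) (img (Xy p i r)) (img (Xy q j r'))"
  by (subst falg_hom_scomm[OF hg_gens(1) hg_gens(1) np_less np_less]) (simp add: np_sg falg_hom_simps)

lemma phi_even: "hg 0 x \<Longrightarrow> hg q y \<Longrightarrow> q < 2 \<Longrightarrow> phi (scomm (ygen_parity m) x y) = cm (phi x) (phi y)"
  by (subst falg_hom_scomm[of _ 0 _ q]) (auto simp: sb_one)

lemma phi_Serre:
  assumes "i < N" "j < N" "i \<noteq> j"
  shows "phi (((\<lambda>x. scomm (ygen_parity m) (gen (Xy p i 0)) x) ^^ (1 + nat \<bar>cartan m n i j\<bar>)) (gen (Xy p j 0))) = 0"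
proof -
  have hs: "hg ((np i + np j) mod 2) (scomm (ygen_parity m) (gen (Xy p i 0)) (gen (Xy p j 0)))"
    by (intro homog_scomm hg_gens np_less)
  have N5: "L j = i + 1 \<Longrightarrow> L i \<noteq> j + 1" using assms m2' n2' by (auto simp: L_def split: if_splits)
  show ?thesis
  proof (cases "L j = i + 1 \<or> L i = j + 1")
    case True
    have "s j = 1 \<or> s j = -1" "s i = 1 \<or> s i = -1" by (auto simp: psign_def parity_def)
    then have "(of_int (cartan m n i j) :: complex) = 1 \<or> (of_int (cartan m n i j) :: complex) = -1"
      unfolding cartan_cases[OF assms(1,2)] using True assms(3) N5 by auto
    then have "cartan m n i j = 1 \<or> cartan m n i j = -1"
      by (metis of_int_1 of_int_eq_iff of_int_minus)
    then have k: "nat \<bar>cartan m n i j\<bar> = 1" by auto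
    have sg1: "sg i j = 1" using sg_next[OF assms True] .
    \<comment> \<open>The outer bracket pairs X_i with an element of parity |X_i| + |X_j|. Since
      \<open>sg i j\<close> is 1, the product of the two parities is 0 and only the contribution of
      X_i with itself remains.\<close>
    have "(-1 :: complex) ^ (np i * ((np i + np j) mod 2)) = sg i i"
      using sg1 np_sg[of i j] np_sg[of i i] assms by (auto simp: np_def)
    then show ?thesis
      using X_cm_adjacent[OF assms True, of p] phi_XX[OF assms(1,2), of p 0 p 0]
      by (simp add: k falg_hom_scomm[OF hg_gens(1) hs np_less] phi_gen img_def sg1 sb_one)
  next
    case False
    then have "(of_int (cartan m n i j) :: complex) = 0"
      unfolding cartan_cases[OF assms(1,2)] using assms(3) by auto
    then have k: "nat \<bar>cartan m n i j\<bar> = 0" by simp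
    show ?thesis
      using X_X_zero[of i j p] assms False phi_XX[OF assms(1,2), of p 0 p 0]
      by (simp add: k img_def)
  qed
qed

lemma phi_odd_Serre:
  assumes "i \<in> {0, m}"
  shows "phi (scomm (ygen_parity m) (scomm (ygen_parity m) (gen (Xy p ((i + (m + n - 1)) mod (m + n)) 0)) (gen (Xy p i 0)))
      (scomm (ygen_parity m) (gen (Xy p i 0)) (gen (Xy p ((i + 1) mod (m + n)) 0)))) = 0"
proof -
  define a where "a = (i + (m + n - 1)) mod (m + n)"
  define b where "b = (i + 1) mod (m + n)"
  have lt: "i < N" "a < N" "b < N" using assms m2' n2' by (auto simp: a_def b_def)
  have Nge: "4 \<le> m + n" using m2' n2' by simp
  have a: "a = (if i = 0 then m + n - 1 else m - 1)"
  proof (cases "i = 0")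
    case False
    then have "i + (m + n - 1) = (m - 1) + (m + n)" using m2' assms by auto
    then have "a = (m - 1) mod (m + n)" unfolding a_def by (simp only: mod_add_self2)
    moreover have "m - 1 < m + n" using m2' by simp
    ultimately show ?thesis using False by simp
  qed (use Nge in \<open>simp add: a_def\<close>)
  have b: "b = i + 1" using assms m2' n2' by (auto simp: b_def)
  have nps: "np i = 1" "np a = 0" "np b = 0"
    using assms m2' n2' unfolding a b by (auto simp: np_def)
  have h1: "hg 1 (scomm (ygen_parity m) (gen (Xy p a 0)) (gen (Xy p i 0)))"
    "hg 1 (scomm (ygen_parity m) (gen (Xy p i 0)) (gen (Xy p b 0)))"
    using homog_scomm[OF hg_gens(1)[of a p 0] hg_gens(1)[of i p 0] np_less np_less]
      homog_scomm[OF hg_gens(1)[of i p 0] hg_gens(1)[of b p 0] np_less np_less] by (simp_all add: nps)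
  have "sg a i = 1" "sg i b = 1"
    using np_sg[of a i] np_sg[of i b] lt by (simp_all add: nps)
  then show ?thesis
    using odd_Serre_X[of i a b p] assms phi_XX[of a i p 0 p 0] phi_XX[of i b p 0 p 0] lt
    unfolding a_def[symmetric] b_def[symmetric]
    by (subst falg_hom_scomm[OF h1]) (simp_all add: img_def sb_one a_def b_def)
qed

lemma phi_rels:
  assumes "(a, b) \<in> yangian_rels m n c beta"
  shows "phi a = phi b"
proof -
  have N4: "4 \<le> m + n" using m2' n2' by simp
  have N0: "0 < m + n" "m + n - 1 < m + n" using m2' by auto
  show ?thesis
    using assms
  proof cases
    case (HH i j r r')
    then have "r = 0 \<or> r = 1" "r' = 0 \<or> r' = 1" by auto
    then show ?thesis
      using H_commute[of i j] HH unfolding HH(1,2)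
      by (subst phi_even[OF hg_gens(2) hg_gens(2)]) (auto simp: falg_hom_simps img_def)
  next
    case (XX_00 i j)
    then show ?thesis using X_f[of i j] unfolding XX_00(1,2)
      by (subst phi_XX) (auto simp: img_def falg_hom_simps)
  next
    case (XX_10 i j)
    then show ?thesis using X1_f[of i j] unfolding XX_10(1,2)
      by (subst phi_XX) (auto simp: img_def falg_hom_simps)
  next
    case (XX_01 i j)
    then show ?thesis using X_f1[of i j] unfolding XX_01(1,2)
      by (subst phi_XX) (auto simp: img_def falg_hom_simps)
  next
    case (H0X i j r p)
    then have "r = 0 \<or> r = 1" by auto
    then show ?thesis using h_X[of i j p] H0X unfolding H0X(1,2)
      by (subst phi_even[OF hg_gens(2) hg_gens(1) np_less]) (auto simp: img_def falg_hom_simps cscale_eq)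
  next
    case (H1X i j p)
    have g: "\<not> (j = 0 \<and> i = m + n - 1)" "\<not> (i = 0 \<and> j = m + n - 1)"
      using H1X(5) by (auto simp: generic_def)
    show ?thesis using Ht_X[of i j p] H1X g unfolding H1X(1,2)
      by (subst phi_even[OF hg_H_tilde hg_gens(1) np_less])
        (auto simp: phi_H_tilde phi_gen falg_hom_simps cscale_eq img_def simp del: One_nat_def)
  next
    case (H1X_first p)
    have "\<not> (m + n - 1 = 0 \<and> (0::nat) = m + n - 1)" using N4 by linarith
    then show ?thesis using Ht_X[of 0 "m + n - 1" p] N0 N4 unfolding H1X_first
      by (subst phi_even[OF hg_H_tilde hg_gens(1) np_less])
        (auto simp: phi_H_tilde falg_hom_simps cscale_eq img_def scaleC_simps simp del: One_nat_def)
  next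
    case (H1X_last p)
    have "\<not> (m + n - 1 = 0 \<and> (0::nat) = m + n - 1)" using N4 by linarith
    then show ?thesis using Ht_X[of "m + n - 1" 0 p] N0 N4 unfolding H1X_last
      by (subst phi_even[OF hg_H_tilde hg_gens(1) np_less])
        (auto simp: phi_H_tilde falg_hom_simps cscale_eq img_def scaleC_simps simp del: One_nat_def)
  next
    case (XX i j p)
    have g: "(i, j) \<noteq> (m + n - 1, 0)" "\<not> (i = 0 \<and> j = m + n - 1)"
      using XX(5) by (auto simp: generic_def)
    show ?thesis
      unfolding XX(1,2) falg_hom_simps(2) phi_XX[OF XX(3,4)]
      using X1_X[OF XX(3,4) g(1), of p] g(2)
      by (simp add: img_def falg_hom_simps cscale_eq del: One_nat_def)
  next
    case (XX_first p)
    have g: "(0, m + n - 1) \<noteq> (m + n - 1, 0)" using N4 by auto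
    show ?thesis
      unfolding XX_first falg_hom_simps(2) phi_XX[OF N0] cscale_eq falg_hom_simps(4)
      using X1_X[OF N0 g, of p]
      by (simp add: img_def falg_hom_simps phi_XX del: One_nat_def)
  next
    case (Serre i j p)
    then show ?thesis using phi_Serre[of i j p] by (simp add: falg_hom_simps)
  next
    case (odd_square i p)
    have "i < m + n" using odd_square m2' n2' by auto
    then show ?thesis using X_X_zero[of i i p] odd_square unfolding odd_square(1,2)
      by (subst phi_XX) (auto simp: img_def falg_hom_simps)
  next
    case (odd_Serre i p)
    then show ?thesis using phi_odd_Serre[of i p] by (simp add: falg_hom_simps)
  qed
qed

lemma np_eps: "(-1 :: complex) ^ (((x + y) mod 2) * ((u + v) mod 2)) = (-1) ^ ((x + y) * (u + v))"
  by (rule neg_one_power_eqI) (auto simp: even_mult_iff)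

lemma parity_chain: "((x + y) mod 2 + (y + w) mod 2) mod 2 = (x + w) mod (2 :: nat)"
proof -
  have "((x + y) mod 2 + (y + w) mod 2) mod 2 = ((x + w) + y * 2) mod 2"
    unfolding mod_add_eq by (rule arg_cong[of _ _ "\<lambda>a. a mod 2"]) (simp only: mult_2_right add_ac)
  then show ?thesis by (simp only: mod_mult_self1)
qed

text \<open>Homogeneity is carried along in the induction because the next bracket can be evaluated
  only with the parity of the previous one known.\<close>

lemma phi_E_up:
  "1 \<le> i \<Longrightarrow> i + 1 + d \<le> N \<Longrightarrow> phi (E_up m d i) = E i (i + 1 + d)
    \<and> hg ((parity m i + parity m (i + 1 + d)) mod 2) (E_up m d i) \<and> E_up m d i \<in> FA (yangian_gens m n)"
proof (induction d arbitrary: i)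
  case 0
  then show ?case using hg_gens(1)[of i Plus 0] np_parity[of i] by (auto simp: phi_gen e_simps intro: yangian_gen_FA)
next
  case (Suc d)
  let ?p = "(parity m i + parity m (i + 1)) mod 2" and ?q = "(parity m (i + 1) + parity m (i + 1 + 1 + d)) mod 2"
  have IH: "phi (E_up m d (i + 1)) = E (i + 1) (i + 1 + 1 + d)" "hg ?q (E_up m d (i + 1))"
    "E_up m d (i + 1) \<in> FA (yangian_gens m n)"
    using Suc.IH[of "i + 1"] Suc.prems by (auto simp: add_ac)
  have x: "hg ?p (gen (Xy Plus i 0))" using hg_gens(1)[of i Plus 0] np_parity[of i] Suc.prems by simp
  have "phi (E_up m (Suc d) i) = sb (eps m i (i + 1) (i + 1) (i + 1 + 1 + d)) (E i (i + 1)) (E (i + 1) (i + 1 + 1 + d))"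
    using Suc.prems by (simp add: falg_hom_scomm[OF x IH(2)] np_eps eps_def IH(1) phi_gen e_simps del: add_Suc_right One_nat_def)
  also have "\<dots> = E i (i + 1 + Suc d)"
    using EE_EE[of i "i + 1" "i + 1" "i + 1 + 1 + d" 0 0] Suc.prems by simp
  finally have 1: "phi (E_up m (Suc d) i) = E i (i + 1 + Suc d)" .
  have "(?p + ?q) mod 2 = (parity m i + parity m (i + 1 + 1 + d)) mod 2" by (rule parity_chain)
  then have 2: "hg ((parity m i + parity m (i + 1 + Suc d)) mod 2) (E_up m (Suc d) i)"
    using homog_scomm[OF x IH(2)] by simp
  have "E_up m (Suc d) i \<in> FA (yangian_gens m n)"
    using IH(3) Suc.prems by (auto intro!: FA_scomm yangian_gen_FA)
  then show ?case using 1 2 by blast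
qed

lemma phi_E_down:
  "1 \<le> i \<Longrightarrow> i + 1 + d \<le> N \<Longrightarrow> phi (E_down m d i) = E (i + 1 + d) i
    \<and> hg ((parity m (i + 1 + d) + parity m i) mod 2) (E_down m d i) \<and> E_down m d i \<in> FA (yangian_gens m n)"
proof (induction d arbitrary: i)
  case 0
  then show ?case using homog_closed(2)[OF hg_gens(1)[of i Minus 0], of "s i"] np_parity[of i]
    by (auto simp: phi_gen falg_hom_simps(4) cscale_eq e_simps scaleC_simps add.commute intro!: yangian_gen_FA FA_closed(8))
next
  case (Suc d)
  let ?p = "(parity m (i + 1 + 1 + d) + parity m (i + 1)) mod 2" and ?q = "(parity m (i + 1) + parity m i) mod 2"
  have IH: "phi (E_down m d (i + 1)) = E (i + 1 + 1 + d) (i + 1)" "hg ?p (E_down m d (i + 1))"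
    "E_down m d (i + 1) \<in> FA (yangian_gens m n)"
    using Suc.IH[of "i + 1"] Suc.prems by (auto simp: add_ac)
  have x: "hg ?q (s i *\<^sub>c gen (Xy Minus i 0))"
    using homog_closed(2)[OF hg_gens(1)[of i Minus 0], of "s i"] np_parity[of i] Suc.prems by (simp add: cscale_eq add.commute)
  have px: "phi (s i *\<^sub>c gen (Xy Minus i 0)) = E (i + 1) i"
    using Suc.prems by (simp add: cscale_eq falg_hom_simps(4) phi_gen e_simps scaleC_simps)
  have "phi (E_down m (Suc d) i) = sb (eps m (i + 1 + 1 + d) (i + 1) (i + 1) i) (E (i + 1 + 1 + d) (i + 1)) (E (i + 1) i)"
    by (simp add: falg_hom_scomm[OF IH(2) x] np_eps eps_def IH(1) px del: add_Suc_right One_nat_def)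
  also have "\<dots> = E (i + 1 + Suc d) i"
    using EE_EE[of "i + 1 + 1 + d" "i + 1" "i + 1" i 0 0] Suc.prems by simp
  finally have 1: "phi (E_down m (Suc d) i) = E (i + 1 + Suc d) i" .
  have "(?p + ?q) mod 2 = (parity m (i + 1 + 1 + d) + parity m i) mod 2" by (rule parity_chain)
  then have 2: "hg ((parity m (i + 1 + Suc d) + parity m i) mod 2) (E_down m (Suc d) i)"
    using homog_scomm[OF IH(2) x] by simp
  have "E_down m (Suc d) i \<in> FA (yangian_gens m n)"
    using IH(3) Suc.prems by (auto intro!: FA_scomm yangian_gen_FA FA_closed(7))
  then show ?case using 1 2 by blast
qed

lemma phi_E_unit:
  assumes "p \<in> {1..N}" "q \<in> {1..N}" "p \<noteq> q"
  shows "phi (E_unit m p q) = E p q"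
  using assms phi_E_up[of p "q - p - 1"] phi_E_down[of q "p - q - 1"] by (auto simp: E_unit_def)

lemma phi_J:
  assumes "i \<in> {1..m + n - 1}"
  shows "phi (J_h m n c i) = s i *\<^sub>v JJ i i - s (i + 1) *\<^sub>v JJ (i + 1) (i + 1)"
    and "phi (J_x_plus m n c i) = JJ i (i + 1)"
    and "phi (J_x_minus m n c i) = s i *\<^sub>v JJ (i + 1) i"
proof -
  have i: "0 < i" "i < N" using assms m2' by auto
  have ii: "i \<in> {1..N}" "i + 1 \<in> {1..N}" using i by auto
  have S: "(\<Sum>k\<in>A. w k *\<^sub>v (phi (E_unit m a k) * phi (E_unit m k b))) = (\<Sum>k\<in>A. w k *\<^sub>v (E a k * E k b))"
    if "A \<subseteq> {1..N} - {a, b}" "a \<in> {1..N}" "b \<in> {1..N}" for a b A and w :: "nat \<Rightarrow> complex"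
    using that by (intro sum.cong refl arg_cong[of _ _ "(*\<^sub>v) _"] arg_cong2[of _ _ _ _ "(*)"] phi_E_unit) auto
  have "{1..N} - {i} \<subseteq> {1..N} - {i, i}" "{1..N} - {i + 1} \<subseteq> {1..N} - {i + 1, i + 1}"
    "{1..N} - {i, i + 1} \<subseteq> {1..N} - {i, i + 1}" "{1..N} - {i, i + 1} \<subseteq> {1..N} - {i + 1, i}"
    by auto
  note S = S[OF this(1) ii(1,1)] S[OF this(2) ii(2,2)] S[OF this(3) ii] S[OF this(4) ii(2,1)]
  show "phi (J_h m n c i) = s i *\<^sub>v JJ i i - s (i + 1) *\<^sub>v JJ (i + 1) (i + 1)"
    unfolding J_h_eq[OF i, symmetric] J_h_def vartheta_def cscale_eq falg_hom_simps phi_H_tilde S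
    by (simp add: img_def del: One_nat_def)
  show "phi (J_x_plus m n c i) = JJ i (i + 1)"
    unfolding J_x_eq(1)[OF i, symmetric] J_x_plus_def varpi_plus_def cscale_eq falg_hom_simps S
    by (simp add: img_def del: One_nat_def)
  show "phi (J_x_minus m n c i) = s i *\<^sub>v JJ (i + 1) i"
    unfolding J_x_eq(2)[OF i, symmetric] J_x_minus_def varpi_minus_def cscale_eq falg_hom_simps S
    by (simp add: img_def del: One_nat_def)
qed

end

section \<open>The action of the affine super Yangian\<close>

lemma lext_lext: "lext g (lext f p) = lext (\<lambda>b. lext g (f b)) p"
  by (simp add: lext_def[of f] lext_sum lext_scale) (simp add: lext_def)

lemma lext_cong: "(\<And>b. b \<in> Poly_Mapping.keys p \<Longrightarrow> f b = g b) \<Longrightarrow> lext f p = lext g p"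
  unfolding lext_def by (rule sum.cong) auto

lemma lext_add_fun: "lext f p + lext g p = lext (\<lambda>b. f b + g b) p"
  by (simp add: lext_def sum.distrib scaleC_add_right)

lemma lext_const: "lext (\<lambda>w. Poly_Mapping.single w 1) p = p"
  unfolding lext_def by (rule poly_mapping_sum_basis[symmetric])

definition tensor_proj :: "nat \<Rightarrow> nat \<Rightarrow> nat \<Rightarrow> tpow \<Rightarrow> tpow" where
  "tensor_proj m l q = lext (\<lambda>w. if (\<Sum>i=1..l. parity m (w i)) mod 2 = q then Poly_Mapping.single w 1 else 0)"

lemma tensor_proj_part: "v \<in> TV m n l \<Longrightarrow> tensor_proj m l q v \<in> tensor_power_part m n l q"
proof -
  assume v: "v \<in> TV m n l"
  have "Poly_Mapping.keys (tensor_proj m l q v)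
    \<subseteq> {w \<in> Poly_Mapping.keys v. (\<Sum>i=1..l. parity m (w i)) mod 2 = q}"
    unfolding tensor_proj_def by (rule keys_lext) auto
  then show ?thesis using v unfolding tensor_power_part_def TV_iff by auto
qed

lemma tensor_proj_sum: "tensor_proj m l 0 v + tensor_proj m l 1 v = v"
proof -
  have "lext (\<lambda>w. if (\<Sum>i=1..l. parity m (w i)) mod 2 = 0 then Poly_Mapping.single w 1 else 0) v
    + lext (\<lambda>w. if (\<Sum>i=1..l. parity m (w i)) mod 2 = 1 then Poly_Mapping.single w 1 else 0) v
    = lext (\<lambda>w. Poly_Mapping.single w (1 :: complex)) v"
    unfolding lext_def sum.distrib[symmetric] scaleC_add_right[symmetric]
    by (intro sum.cong refl arg_cong[of _ _ "(*\<^sub>v) _"]) auto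
  then show ?thesis unfolding tensor_proj_def lext_const .
qed

lemma parity_op_part:
  assumes "v \<in> tensor_power_part m n l q"
  shows "app (parity_op m l) v = (-1) ^ q *\<^sub>v v"
proof -
  have "(-1 :: complex) ^ (\<Sum>i=1..l. parity m (w i)) = (-1) ^ q" if "w \<in> Poly_Mapping.keys v" for w
  proof (rule neg_one_power_eqI)
    have "(\<Sum>i=1..l. parity m (w i)) mod 2 = q" using assms that by (auto simp: tensor_power_part_def)
    then show "even ((\<Sum>i=1..l. parity m (w i)) + q)" by (metis even_add even_mod_2_iff)
  qed
  then have "lext (\<lambda>w. (-1) ^ (\<Sum>i=1..l. parity m (w i)) *\<^sub>v Poly_Mapping.single w 1) v
    = lext (\<lambda>w. (-1) ^ q *\<^sub>v Poly_Mapping.single w (1 :: complex)) v"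
    by (intro lext_cong) simp
  also have "\<dots> = (-1) ^ q *\<^sub>v lext (\<lambda>w. Poly_Mapping.single w 1) v"
    unfolding lext_def scaleC_sum_right by (intro sum.cong refl) (simp add: scaleC_scaleC mult.commute)
  finally show ?thesis unfolding lext_const parity_op_def app_Lin_lext .
qed

section \<open>Parity of the operators, and the induced action on the quotient\<close>

context drinfeld_affine
begin

abbreviation "YG \<equiv> yangian_gens m n"

text \<open>A representative of the weights y_p that is visibly balanced; agreement on 1..l is all
  that \<open>Op\<close> depends on.\<close>

lemma y_family:
  obtains g where "good g" "\<And>p. p \<in> {1..l} \<Longrightarrow> RR (y_elt l t c p) = g p"
proof
  note g = good_closed(4-8)
  have sp: "sig_fam (\<lambda>p. Pm) (\<lambda>p. Pm) p = sig p" if p: "p \<in> {1..l}" for p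
    unfolding sig_fam_def sig_def
    by (intro sum.cong refl) (use p in \<open>simp add: Pm_gens transpose_permutes del: One_nat_def\<close>)
  have gs: "good (sig_fam (\<lambda>p. Pm) (\<lambda>p. Pm))" by (intro good_sig_fam g)
  show "good (\<lambda>p. (z p + (t / 2) *\<^sub>v Pm) + (c / 2) *\<^sub>v sig_fam (\<lambda>p. Pm) (\<lambda>p. Pm) p)"
    by (rule good_closed(2)[OF good_closed(2)[OF g(5) good_closed(3)[OF g(1), of "t / 2"]] good_closed(3)[OF gs, of "c / 2"]])
  show "RR (y_elt l t c p) = (z p + (t / 2) *\<^sub>v Pm) + (c / 2) *\<^sub>v sig_fam (\<lambda>p. Pm) (\<lambda>p. Pm) p" if "p \<in> {1..l}" for p
    using that by (simp add: RR_y_elt sp add.commute del: One_nat_def)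
qed

lemma JJ_tau:
  assumes "a \<in> {1..m + n}" "b \<in> {1..m + n}" "v \<in> TV m n l"
  shows "app (JJ a b) (tau \<xi> v) = (\<Sum>p\<in>{1..l}. tau (app (RR (y_elt l t c p)) \<xi>) (E_at m p a b v))"
proof -
  obtain g where g: "good g" "\<And>p. p \<in> {1..l} \<Longrightarrow> RR (y_elt l t c p) = g p" by (rule y_family) blast
  have "JJ a b = Op g a b" unfolding Op_y_elt[OF assms(1,2), symmetric] by (rule Op_cong) (rule g(2))
  then show ?thesis
    unfolding Op_tau[OF g(1) assms(1,3)] app_EV by (intro trans[OF arg_cong[of _ _ "\<lambda>F. app F (tau \<xi> v)"] trans[OF Op_tau[OF g(1) assms(1,3)]]])
      (auto simp: app_EV g(2) intro!: sum.cong)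
qed

lemma E_at_closed: "v \<in> TV m n l \<Longrightarrow> p \<in> {1..l} \<Longrightarrow> a \<in> {1..m + n} \<Longrightarrow> E_at m p a b v \<in> TV m n l"
  using EV_closed[of v m n l p a b] by (simp add: app_EV)

lemma E_tot_closed: "v \<in> TV m n l \<Longrightarrow> a \<in> {1..m + n} \<Longrightarrow> E_tot m l a b v \<in> TV m n l"
  unfolding E_tot_def by (intro TV_sum E_at_closed)

lemma E_tau:
  assumes "a \<in> {1..m + n}" "v \<in> TV m n l"
  shows "app (E a b) (tau \<xi> v) = tau \<xi> (E_tot m l a b v)"
  unfolding Op_pw Op_tau[OF good_closed(4) assms] tau_Pm app_EV E_tot_def
  by (rule tau_sum_right[symmetric]) (use assms in \<open>auto intro: E_at_closed\<close>)

lemma TV_diff: "v \<in> TV m n l \<Longrightarrow> w \<in> TV m n l \<Longrightarrow> v - w \<in> TV m n l"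
  using TV_add[of v m n l "(-1) *\<^sub>v w"] TV_scale[of w m n l "-1"] by (simp add: scaleC_minus_left scaleC_one)

lemma tau_diff_right: "v \<in> TV m n l \<Longrightarrow> w \<in> TV m n l \<Longrightarrow> tau \<xi> (v - w) = tau \<xi> v - tau \<xi> w"
  using tau_bilinear(3)[of "v - w" w \<xi>] TV_diff by simp

lemma PT_PT: "PT * PT = PT"
  by (rule lin_eqI) (simp add: app_simps(4) app_PT comp_emb[OF cmod_T] comp_closed[OF cmod_T])

lemma PT_emb: "u \<in> carrier TT \<Longrightarrow> app PT (emb TT u) = emb TT u"
  by (simp add: app_PT comp_emb[OF cmod_T])

text \<open>Operators on the tensor product of parity q, expressed through the grading operator.
  Sums, products and commutators inherit this, so the level-one generators are handled through
  \<open>Y_alt\<close>.\<close>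

definition homop :: "nat \<Rightarrow> ('m \<times> tpow \<Rightarrow>\<^sub>0 complex) set vfam lin \<Rightarrow> bool" where
  "homop q F \<longleftrightarrow> PT * F = F \<and> F * PT = F \<and> ParT * F = (-1) ^ q *\<^sub>v (F * ParT)"

lemma homop_closed:
  "homop q F \<Longrightarrow> homop q G \<Longrightarrow> homop q (F + G)" "homop q F \<Longrightarrow> homop q (y *\<^sub>v F)"
  "homop q F \<Longrightarrow> homop q G \<Longrightarrow> homop q (F - G)" "homop q F \<Longrightarrow> homop q (- F)" "homop q 0"
  by (auto simp: homop_def algebra_simps scaleC_simps mult.commute)

lemma homop_cong: "homop q F \<Longrightarrow> even (p + q) \<Longrightarrow> homop p F"
  unfolding homop_def using neg_one_power_eqI by metis

lemma homop_mult: "homop p F \<Longrightarrow> homop q G \<Longrightarrow> homop (p + q) (F * G)"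
proof -
  assume F: "homop p F" and G: "homop q G"
  have "ParT * (F * G) = (ParT * F) * G" by (simp only: mult.assoc)
  also have "\<dots> = (-1) ^ p *\<^sub>v (F * (ParT * G))" using F by (simp only: homop_def mult_scaleC_left mult.assoc)
  also have "\<dots> = (-1) ^ (p + q) *\<^sub>v (F * G * ParT)"
    using G by (simp only: homop_def mult_scaleC_right scaleC_scaleC mult.assoc power_add)
  finally show ?thesis using F G unfolding homop_def by (simp add: mult.assoc) (simp flip: mult.assoc)
qed

lemma homop_sum: "(\<And>x. x \<in> S \<Longrightarrow> homop q (F x)) \<Longrightarrow> homop q (sum F S)"
  by (induction S rule: infinite_finite_induct) (auto intro: homop_closed)

lemma homop_cm: "homop 0 F \<Longrightarrow> homop q G \<Longrightarrow> homop q (cm F G)"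
  unfolding cm_def using homop_mult[of 0 F q G] homop_mult[of q G 0 F] by (auto intro: homop_closed)

lemma homop_Op: "good g \<Longrightarrow> a \<in> {1..m + n} \<Longrightarrow> homop (parity m a + parity m b) (Op g a b)"
  unfolding homop_def by (simp add: Op_PT ParT_Op)

lemma homop_D: "a \<in> {1..m + n} \<Longrightarrow> homop 0 (D a)"
proof -
  assume a: "a \<in> {1..m + n}"
  have 0: "homop 0 (Op g a a)" if "good g" for g
    using homop_Op[OF that a, of a] by (rule homop_cong) simp
  have EE: "homop 0 (E a k * E k a)" if "k \<in> {1..m + n}" for k
  proof -
    have 1: "homop (parity m a + parity m k) (E a k)" by (rule homop_Op[OF good_closed(7) a])
    have 2: "homop (parity m k + parity m a) (E k a)" by (rule homop_Op[OF good_closed(7) that])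
    show ?thesis using homop_mult[OF 1 2] by (rule homop_cong) auto
  qed
  show ?thesis
    unfolding D_def C_def using a
    by (intro homop_closed(1,2) homop_sum 0 good_closed EE) auto
qed

lemma homop_X:
  assumes "i < N"
  shows "homop (np i) (X p i)"
proof -
  have L: "L i \<in> {1..N}" "i + 1 \<in> {1..N}" using assms m2' by (auto simp: L_def)
  have "even (np i + (parity m (L i) + parity m (i + 1)))" "even (np i + (parity m (i + 1) + parity m (L i)))"
    unfolding np_parity[OF assms] by auto
  then show ?thesis
    using homop_cong[OF homop_Op[OF good_closed(7) L(1)]] homop_cong[OF homop_Op[OF good_closed(7) L(2)]]
    by (cases p) (auto simp: e_def f_def intro!: homop_closed(2) simp del: One_nat_def add_Suc_right)
qed

lemma homop_img:
  assumes "g \<in> YG"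
  shows "homop (ygen_parity m g) (img g)"
proof (cases g)
  case (Xy p i r)
  then have i: "i < N" using assms by (auto simp: yangian_gens_def)
  have L: "L i \<in> {1..N}" using i m2' by (auto simp: L_def)
  have "homop (np i) (X1 p i)"
    unfolding X1_def Y_alt(1)[OF i] by (intro homop_closed(1,2) homop_cm homop_D homop_X i L)
  then show ?thesis using homop_X[OF i, of p] by (simp add: Xy img_def np_def split: if_splits)
next
  case (Hy i r)
  then have i: "i < N" using assms by (auto simp: yangian_gens_def)
  have L: "L i \<in> {1..N}" "i + 1 \<in> {1..N}" "1 \<in> {1..N}" using i m2' by (auto simp: L_def)
  have E: "homop 0 (E a a)" if "a \<in> {1..N}" for a
  proof -
    have "homop (parity m a + parity m a) (E a a)" by (rule homop_Op[OF good_closed(7) that])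
    then show ?thesis by (rule homop_cong) simp
  qed
  have h: "homop 0 (h i)" unfolding h_def by (intro homop_closed E L)
  have "homop 0 (if i = 0 then om *\<^sub>v E 1 1 else 0)" using homop_closed(2)[OF E[OF L(3)]] homop_closed(5) by simp
  moreover have "homop 0 (h i * h i)" using homop_mult[OF h h] by simp
  ultimately have "homop 0 (H1 i)"
    unfolding H1_def Ht_def by (intro homop_closed(1-4) h homop_D L)
  then show ?thesis using h by (simp add: Hy img_def)
qed

text \<open>The unit of the free algebra acts as the identity of the ambient product, not as
  \<open>PT\<close>. Invariance of the factor is therefore stated after composing with
  \<open>PT\<close>.\<close>

lemma phi_PT: "a \<in> FA YG \<Longrightarrow> PT * (phi a * PT) = phi a * PT"
proof (induction a rule: FA_induct)
  case (mult a b)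
  have "PT * (phi (a * b) * PT) = PT * (phi a * PT) * (phi b * PT)"
    unfolding falg_hom_simps mult.assoc using mult.IH by (simp only: mult.assoc)
  then show ?case using mult.IH by (simp only: mult.assoc falg_hom_simps)
next
  case (gen g)
  then show ?case using homop_img[OF gen] by (simp add: homop_def falg_hom_simps)
qed (simp_all add: falg_hom_simps distrib_right distrib_left mult_scaleC_left mult_scaleC_right PT_PT)

lemma ParT_phi:
  assumes "a \<in> FA YG" "hg q a"
  shows "ParT * phi a = (-1) ^ q *\<^sub>v (phi a * ParT)"
proof -
  have word: "ParT * prod_list (map img xs) = (-1) ^ (\<Sum>g\<leftarrow>xs. ygen_parity m g) *\<^sub>v (prod_list (map img xs) * ParT)"
    if "set xs \<subseteq> YG" for xs
    using that
  proof (induction xs)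
    case (Cons g xs)
    have "ParT * (img g * prod_list (map img xs)) = (-1) ^ ygen_parity m g *\<^sub>v (img g * (ParT * prod_list (map img xs)))"
      using homop_img[of g] Cons.prems unfolding homop_def by (simp flip: mult.assoc add: mult_scaleC_left)
    also have "\<dots> = (-1) ^ (\<Sum>g\<leftarrow>g # xs. ygen_parity m g) *\<^sub>v (img g * prod_list (map img xs) * ParT)"
      using Cons by (simp add: mult_scaleC_right scaleC_scaleC power_add mult.assoc)
    finally show ?case by simp
  qed (simp add: scaleC_one)
  have "ParT * prod_list (map img (letters w)) = (-1) ^ q *\<^sub>v (prod_list (map img (letters w)) * ParT)"
    if "w \<in> Poly_Mapping.keys a" for w
  proof -
    have "even ((\<Sum>g\<leftarrow>letters w. ygen_parity m g) + q)"
      using assms(2) that unfolding homog_def word_parity_def by (metis even_add even_mod_2_iff)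
    then have sgn: "(-1 :: complex) ^ (\<Sum>g\<leftarrow>letters w. ygen_parity m g) = (-1) ^ q" by (rule neg_one_power_eqI)
    have "set (letters w) \<subseteq> YG" using assms(1) that unfolding FA_def by blast
    from word[OF this] show ?thesis unfolding sgn .
  qed
  then show ?thesis
    unfolding falg_hom_def lext_def sum_distrib_left sum_distrib_right scaleC_sum_right
    by (intro sum.cong refl) (simp add: mult_scaleC_left mult_scaleC_right scaleC_scaleC mult.commute)
qed

sublocale YP: presentation YG "yangian_rels m n c beta"
  by standard (use yangian_rels_FA[OF m2' n2'] FA_closed(4) in blast)

abbreviation "YA \<equiv> yangian m n c beta"
abbreviation "cl \<equiv> yangian_class m n c beta"

lemma cl_eq: "cl = YP.pc" by (simp add: yangian_class_def)

lemma YA_simps: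
  "carrier YA = cl ` FA YG" "\<lbrakk>a \<in> FA YG; b \<in> FA YG\<rbrakk> \<Longrightarrow> cl a \<oplus>\<^bsub>YA\<^esub> cl b = cl (a + b)"
  "\<lbrakk>a \<in> FA YG; b \<in> FA YG\<rbrakk> \<Longrightarrow> cl a \<otimes>\<^bsub>YA\<^esub> cl b = cl (a * b)"
  "a \<in> FA YG \<Longrightarrow> y \<odot>\<^bsub>YA\<^esub> cl a = cl (y *\<^sub>v a)" "\<one>\<^bsub>YA\<^esub> = cl 1"
  by (simp_all add: yangian_def cl_eq YP.PA_carrier YP.PA_simps)

lemma phi_cong: "cl a = cl b \<Longrightarrow> phi a = phi b"
proof -
  assume "cl a = cl b"
  then have "a - b \<in> YP.I" unfolding cl_eq YP.pc_eq coset_eq_iff[OF YP.I_add_closed] .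
  then have "phi (a - b) = 0" using YP.falg_hom_I[of img] phi_rels by blast
  then show ?thesis by (simp add: falg_hom_simps)
qed

text \<open>Restricted to the carriers in both arguments, since uniqueness is claimed among
  extensional functions. By \<open>phi_cong\<close> the chosen representative does not
  matter.\<close>

definition rho :: "ygen falg set \<Rightarrow> ('m \<times> tpow \<Rightarrow>\<^sub>0 complex) set \<Rightarrow> ('m \<times> tpow \<Rightarrow>\<^sub>0 complex) set" where
  "rho = (\<lambda>y\<in>carrier YA. \<lambda>u\<in>carrier TT.
     fam_at (app (phi (SOME a. a \<in> FA YG \<and> y = cl a)) (emb TT u)) TT)"

lemma rho_cl:
  assumes "a \<in> FA YG" "u \<in> carrier TT"
  shows "rho (cl a) u = fam_at (app (phi a) (emb TT u)) TT"
proof -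
  have "\<exists>b. b \<in> FA YG \<and> cl a = cl b" using assms(1) by blast
  from someI_ex[OF this] have "phi (SOME b. b \<in> FA YG \<and> cl a = cl b) = phi a" by (metis phi_cong)
  then show ?thesis using assms by (simp add: rho_def YA_simps)
qed

lemma emb_rho: "a \<in> FA YG \<Longrightarrow> u \<in> carrier TT \<Longrightarrow> emb TT (rho (cl a) u) = app (phi a) (emb TT u)"
proof -
  assume a: "a \<in> FA YG" and u: "u \<in> carrier TT"
  have "app PT (app (phi a) (app PT (emb TT u))) = app (phi a) (app PT (emb TT u))"
    using phi_PT[OF a] by (metis app_simps(4))
  then show ?thesis using u by (simp add: rho_cl[OF a u] PT_emb) (simp add: app_PT)
qed

lemma rho_closed: "a \<in> FA YG \<Longrightarrow> u \<in> carrier TT \<Longrightarrow> rho (cl a) u \<in> carrier TT"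
  by (simp add: rho_cl comp_closed[OF cmod_T])

sublocale T: Module.module complex_ring TT by (rule cmod_T)

lemma left_alg_module_rho: "left_alg_module YA TT rho"
proof (intro left_alg_module.intro cmod_T left_alg_module_axioms.intro)
  note cl = FA_closed(3,5,8) FA_closed(2)[of YG]
  fix a b u v y
  assume u: "u \<in> carrier TT"
  show "rho \<one>\<^bsub>YA\<^esub> u = u"
    using u by (simp add: YA_simps rho_cl cl falg_hom_simps app_simps comp_emb[OF cmod_T])
  assume "a \<in> carrier YA"
  then obtain a' where a: "a' \<in> FA YG" "a = cl a'" by (auto simp: YA_simps)
  show "rho a u \<in> carrier TT" using a u by (simp add: rho_closed)
  show "rho (y \<odot>\<^bsub>YA\<^esub> a) u = y \<odot>\<^bsub>TT\<^esub> rho a u"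
    using a u by (simp add: YA_simps rho_cl cl falg_hom_simps app_simps comp_simps[OF cmod_T])
  show "rho a (u \<oplus>\<^bsub>TT\<^esub> v) = rho a u \<oplus>\<^bsub>TT\<^esub> rho a v" if "v \<in> carrier TT"
    using a u that by (simp add: rho_cl emb_add[OF cmod_T] app_add comp_simps[OF cmod_T])
  assume "b \<in> carrier YA"
  then obtain b' where b: "b' \<in> FA YG" "b = cl b'" by (auto simp: YA_simps)
  show "rho (a \<oplus>\<^bsub>YA\<^esub> b) u = rho a u \<oplus>\<^bsub>TT\<^esub> rho b u"
    using a b u by (simp add: YA_simps rho_cl cl falg_hom_simps app_simps comp_simps[OF cmod_T])
  show "rho (a \<otimes>\<^bsub>YA\<^esub> b) u = rho a (rho b u)"
    using a b u by (simp add: YA_simps rho_cl[of "_ * _"] rho_cl[of a'] rho_closed emb_rho cl falg_hom_simps app_simps)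
qed

abbreviation "Tp \<equiv> tensor_part m n l t c M ract"

lemma Tp_eq: "Tp q = coset tn ` FS (carrier M \<times> tensor_power_part m n l q)"
  by (auto simp: tensor_part_def pair_space_def Q.r_coset_FS)

lemma part_FS: "u \<in> FS (carrier M \<times> tensor_power_part m n l q) \<Longrightarrow> u \<in> FS BB"
  by (auto simp: FS_def tensor_power_part_def)

lemma Tp_sub: "u \<in> Tp q \<Longrightarrow> u \<in> carrier TT" and Tp_parity: "u \<in> Tp q \<Longrightarrow> app ParT (emb TT u) = (-1) ^ q *\<^sub>v emb TT u"
proof -
  assume "u \<in> Tp q"
  then obtain p where p: "u = coset tn p" "p \<in> FS (carrier M \<times> tensor_power_part m n l q)" by (auto simp: Tp_eq)
  then show "u \<in> carrier TT" unfolding TT_eq Q.QS_carrier using part_FS by blast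
  have one: "app ParT (emb TT (tens x v)) = (-1) ^ q *\<^sub>v emb TT (tens x v)"
    if "x \<in> carrier M" "v \<in> tensor_power_part m n l q" for x v
  proof -
    have v: "v \<in> TV m n l" using that by (simp add: tensor_power_part_def)
    show ?thesis
      unfolding tau_emb[OF that(1), symmetric] ParT_tau[OF v] parity_op_part[OF that(2)] by (rule tau_bilinear(4)[OF v])
  qed
  have "app ParT (lext (\<lambda>(x, v). emb TT (tens x v)) p) = (-1) ^ q *\<^sub>v lext (\<lambda>(x, v). emb TT (tens x v)) p"
    unfolding lext_def app_sum app_scale scaleC_sum_right
    by (intro sum.cong refl) (use p in \<open>auto simp: FS_def one scaleC_scaleC mult.commute\<close>)
  then show "app ParT (emb TT u) = (-1) ^ q *\<^sub>v emb TT u"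
    unfolding p(1) emb_coset[OF part_FS[OF p(2)]] .
qed

lemma Tp_decomp:
  assumes "u \<in> carrier TT"
  shows "\<exists>u0\<in>Tp 0. \<exists>u1\<in>Tp 1. u = u0 \<oplus>\<^bsub>TT\<^esub> u1"
proof -
  obtain p where p: "u = coset tn p" "p \<in> FS BB" using assms unfolding TT_eq Q.QS_carrier by auto
  define r where "r q = lext (\<lambda>(x, v). Poly_Mapping.single (x, tensor_proj m l q v) (1 :: complex)) p" for q
  have r: "r q \<in> FS (carrier M \<times> tensor_power_part m n l q)" for q
    unfolding FS_def r_def mem_Collect_eq
  proof (rule keys_lext)
    fix b assume "b \<in> Poly_Mapping.keys p"
    then obtain x v where b: "b = (x, v)" "x \<in> carrier M" "v \<in> TV m n l" using p(2) unfolding FS_def by blast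
    show "Poly_Mapping.keys (case b of (x, v) \<Rightarrow> Poly_Mapping.single (x, tensor_proj m l q v) (1 :: complex))
      \<subseteq> carrier M \<times> tensor_power_part m n l q"
      using b(2) tensor_proj_part[OF b(3)] by (simp add: b(1))
  qed
  have rT: "coset tn (r q) \<in> Tp q" for q using r by (auto simp: Tp_eq)
  have "emb TT u = emb TT (coset tn (r 0)) + emb TT (coset tn (r 1))"
    unfolding p(1) emb_coset[OF p(2)] emb_coset[OF part_FS[OF r]]
    unfolding r_def lext_lext lext_add_fun
  proof (rule lext_cong)
    fix b assume "b \<in> Poly_Mapping.keys p"
    then obtain x v where b: "b = (x, v)" "x \<in> carrier M" "v \<in> TV m n l" using p(2) unfolding FS_def by blast
    have pr: "tensor_proj m l q v \<in> TV m n l" for q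
      using tensor_proj_part[OF b(3)] by (simp add: tensor_power_part_def)
    have "tau (emb M x) v = tau (emb M x) (tensor_proj m l 0 v) + tau (emb M x) (tensor_proj m l 1 v)"
      using tau_bilinear(3)[OF pr pr, of "emb M x" 0 1] by (simp only: tensor_proj_sum)
    then show "(case b of (x, v) \<Rightarrow> emb TT (tens x v))
      = lext (\<lambda>(x, v). emb TT (tens x v)) (case b of (x, v) \<Rightarrow> Poly_Mapping.single (x, tensor_proj m l 0 v) 1)
      + lext (\<lambda>(x, v). emb TT (tens x v)) (case b of (x, v) \<Rightarrow> Poly_Mapping.single (x, tensor_proj m l 1 v) 1)"
      unfolding b(1) by (simp only: prod.case lext_single scaleC_one tau_emb[OF b(2)])
  qed
  then have "emb TT u = emb TT (coset tn (r 0) \<oplus>\<^bsub>TT\<^esub> coset tn (r 1))"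
    by (simp add: emb_add[OF cmod_T] Tp_sub[OF rT])
  then have "u = coset tn (r 0) \<oplus>\<^bsub>TT\<^esub> coset tn (r 1)"
    using emb_inj[OF cmod_T assms] Tp_sub[OF rT] by blast
  then show ?thesis using rT by blast
qed

lemma emb_eq_0: "u \<in> carrier TT \<Longrightarrow> emb TT u = 0 \<Longrightarrow> u = \<zero>\<^bsub>TT\<^esub>"
  using emb_inj[OF cmod_T, of u "\<zero>\<^bsub>TT\<^esub>"] emb_zero[OF cmod_T] by simp

lemma eq_neg_0: "u = - u \<Longrightarrow> u = (0 :: 'x::cvector)"
proof -
  assume "u = - u"
  then have "(2 :: complex) *\<^sub>v u = 0"
    using scaleC_add_left[of 1 1 u] by (simp add: scaleC_one add_eq_0_iff)
  then have "(1 / 2 :: complex) *\<^sub>v (2 :: complex) *\<^sub>v u = 0" by simp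
  then show "u = 0" by (simp add: scaleC_scaleC scaleC_one)
qed

text \<open>The homogeneous parts are the eigenspaces of the grading operator for 1 and -1: if u is
  an eigenvector, its component of the wrong parity equals its own negative. Closure and
  compatibility with the action thus become operator identities.\<close>

lemma Tp_iff:
  assumes "q < 2"
  shows "u \<in> Tp q \<longleftrightarrow> u \<in> carrier TT \<and> app ParT (emb TT u) = (-1) ^ q *\<^sub>v emb TT u"
proof
  assume "u \<in> carrier TT \<and> app ParT (emb TT u) = (-1) ^ q *\<^sub>v emb TT u"
  then have u: "u \<in> carrier TT" and par: "app ParT (emb TT u) = (-1) ^ q *\<^sub>v emb TT u" by auto
  obtain u0 u1 where d: "u0 \<in> Tp 0" "u1 \<in> Tp 1" "u = u0 \<oplus>\<^bsub>TT\<^esub> u1" using Tp_decomp[OF u] by blast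
  have c: "u0 \<in> carrier TT" "u1 \<in> carrier TT" using d Tp_sub by auto
  have e: "emb TT u = emb TT u0 + emb TT u1" using d c by (simp add: emb_add[OF cmod_T])
  have ep: "app ParT (emb TT u) = emb TT u0 - emb TT u1"
    unfolding e app_add Tp_parity[OF d(1)] Tp_parity[OF d(2)] by (simp add: scaleC_one scaleC_minus_left)
  consider "q = 0" | "q = 1" using assms by linarith
  then show "u \<in> Tp q"
  proof cases
    case 1
    have "emb TT u1 = - emb TT u1" using par ep e 1 by (simp add: scaleC_one)
    then have "u1 = \<zero>\<^bsub>TT\<^esub>" by (intro emb_eq_0 c eq_neg_0)
    then show ?thesis using d c 1 by simp
  next
    case 2
    have "emb TT u0 - emb TT u1 = - (emb TT u0 + emb TT u1)"
      using par ep e 2 by (simp add: scaleC_one scaleC_minus_left)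
    then have "emb TT u0 = - emb TT u0" by (simp add: algebra_simps)
    then have "u0 = \<zero>\<^bsub>TT\<^esub>" by (intro emb_eq_0 c eq_neg_0)
    then show ?thesis using d c 2 by simp
  qed
qed (use Tp_sub Tp_parity in blast)

lemma left_supermodule_rho: "left_supermodule YA (yangian_part m n c beta) TT Tp rho"
proof (intro left_supermodule.intro left_alg_module_rho left_supermodule_axioms.intro)
  fix q :: nat assume q: "q < 2"
  show "submodule (Tp q) complex_ring TT"
  proof (rule T.submoduleI)
    show "Tp q \<subseteq> carrier TT" using Tp_sub by blast
  qed (auto simp: Tp_iff[OF q] emb_zero[OF cmod_T] emb_minus[OF cmod_T] emb_add[OF cmod_T] emb_scale[OF cmod_T]
      app_minus app_add app_scale scaleC_simps mult.commute)
next
  fix u assume "u \<in> carrier TT" then show "\<exists>u0\<in>Tp 0. \<exists>u1\<in>Tp 1. u = u0 \<oplus>\<^bsub>TT\<^esub> u1" by (rule Tp_decomp)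
next
  have "u = \<zero>\<^bsub>TT\<^esub>" if "u \<in> Tp 0" "u \<in> Tp 1" for u
  proof (rule emb_eq_0[OF Tp_sub[OF that(1)]], rule eq_neg_0)
    show "emb TT u = - emb TT u"
      using Tp_parity[OF that(1)] Tp_parity[OF that(2)] by (simp add: scaleC_one scaleC_minus_left)
  qed
  moreover have "\<zero>\<^bsub>TT\<^esub> \<in> Tp 0" "\<zero>\<^bsub>TT\<^esub> \<in> Tp 1" by (auto simp: Tp_iff emb_zero[OF cmod_T])
  ultimately show "Tp 0 \<inter> Tp 1 = {\<zero>\<^bsub>TT\<^esub>}" by blast
next
  fix p q a u assume pq: "p < 2" "q < (2 :: nat)" and a: "a \<in> yangian_part m n c beta p" and u: "u \<in> Tp q"
  obtain a' where a': "a = cl a'" "a' \<in> FA YG" "hg p a'"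
    using a by (auto simp: yangian_part_def presented_part_def cl_eq homog_def)
  have uT: "u \<in> carrier TT" using u by (rule Tp_sub)
  have "app ParT (emb TT (rho a u)) = app (ParT * phi a') (emb TT u)"
    by (simp add: a'(1) emb_rho[OF a'(2) uT] app_simps)
  also have "\<dots> = (-1) ^ (p + q) *\<^sub>v app (phi a') (emb TT u)"
    unfolding ParT_phi[OF a'(2,3)] by (simp add: app_simps Tp_parity[OF u] app_scale scaleC_scaleC power_add)
  also have "\<dots> = (-1) ^ ((p + q) mod 2) *\<^sub>v emb TT (rho a u)"
    unfolding a'(1) emb_rho[OF a'(2) uT] by (simp add: neg_one_power_eqI[of "(p + q) mod 2" "p + q"])
  finally show "rho a u \<in> Tp ((p + q) mod 2)"
    using rho_closed[OF a'(2) uT] by (simp add: Tp_iff a'(1))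
qed

end

text \<open>Closure under algebra operations, possibly without unit. It is applied both to
  membership in the free algebra and to the set of elements on which two actions agree.\<close>

definition subalg :: "('g falg \<Rightarrow> bool) \<Rightarrow> bool" where
  "subalg P \<longleftrightarrow> (\<forall>a b. P a \<longrightarrow> P b \<longrightarrow> P (a + b) \<and> P (a * b)) \<and> (\<forall>z a. P a \<longrightarrow> P (z *\<^sub>v a))"

lemma subalg:
  assumes "subalg P"
  shows subalg_add: "P a \<Longrightarrow> P b \<Longrightarrow> P (a + b)" and subalg_mult: "P a \<Longrightarrow> P b \<Longrightarrow> P (a * b)"
    and subalg_scale: "P a \<Longrightarrow> P (z *\<^sub>v a)" and subalg_diff: "P a \<Longrightarrow> P b \<Longrightarrow> P (a - b)"
    and subalg_scomm: "\<lbrakk>P a; P b; homog par p a; homog par q b; p < 2; q < 2\<rbrakk> \<Longrightarrow> P (scomm par a b)"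
proof -
  show add: "P (a + b)" if "P a" "P b" for a b using assms that unfolding subalg_def by blast
  show mult: "P (a * b)" if "P a" "P b" for a b using assms that unfolding subalg_def by blast
  show scale: "P (z *\<^sub>v a)" if "P a" for z a using assms that unfolding subalg_def by blast
  show diff: "P (a - b)" if "P a" "P b" for a b
    using add[OF that(1) scale[OF that(2), of "-1"]] by (simp add: scaleC_minus_left scaleC_one)
  show "P (scomm par a b)" if "P a" "P b" "homog par p a" "homog par q b" "p < 2" "q < 2"
    unfolding scomm_homog[OF that(3-6)] neg_one_mult_falg by (intro diff scale mult that(1,2))
qed

lemma subalg_FA: "subalg (\<lambda>a. a \<in> FA G)"
  unfolding subalg_def by (auto intro: FA_closed)

section \<open>Values of the action on the prescribed elements, and its uniqueness\<close>

context drinfeld_affine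
begin

lemma tens_RR: "h' \<in> HF \<Longrightarrow> x \<in> carrier M \<Longrightarrow>
    emb TT (tens (ract x (dc h')) w) = tau (app (RR h') (emb M x)) w"
  by (simp add: app_RR comp_emb[OF cmod_M] tau_emb R.act_closed dc_carrier)

lemma sum_tens:
  assumes "\<And>k. k \<in> {1..l} \<Longrightarrow> g k \<in> HF" "\<And>k. k \<in> {1..l} \<Longrightarrow> w k \<in> TV m n l" "x \<in> carrier M"
  shows "emb TT (\<Oplus>\<^bsub>TT\<^esub>k\<in>{1..l}. tens (ract x (dc (g k))) (w k))
      = (\<Sum>k\<in>{1..l}. tau (app (RR (g k)) (emb M x)) (w k))"
    and "(\<Oplus>\<^bsub>TT\<^esub>k\<in>{1..l}. tens (ract x (dc (g k))) (w k)) \<in> carrier TT"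
proof -
  have cl: "tens (ract x (dc (g k))) (w k) \<in> carrier TT" if "k \<in> {1..l}" for k
    using assms that by (intro tens_closed R.act_closed dc_carrier) auto
  show "(\<Oplus>\<^bsub>TT\<^esub>k\<in>{1..l}. tens (ract x (dc (g k))) (w k)) \<in> carrier TT"
    by (rule T.M.finsum_closed) (use cl in auto)
  show "emb TT (\<Oplus>\<^bsub>TT\<^esub>k\<in>{1..l}. tens (ract x (dc (g k))) (w k))
      = (\<Sum>k\<in>{1..l}. tau (app (RR (g k)) (emb M x)) (w k))"
    by (subst emb_finsum[OF cmod_T]) (use cl assms in \<open>auto intro!: sum.cong tens_RR\<close>)
qed

lemma rho_formula:
  assumes "a \<in> FA YG" "x \<in> carrier M" "v \<in> TV m n l" "y \<in> carrier TT"
    "app (phi a) (tau (emb M x) v) = emb TT y"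
  shows "rho (cl a) (tens x v) = y"
  using assms by (simp add: rho_cl tens_closed tau_emb comp_emb[OF cmod_T])

text \<open>The quadratic corrections are polynomials in the finite level-zero generators. Stated
  for an arbitrary closed predicate, this serves both well-formedness and the recovery of the
  level-one generators.\<close>

lemma J_closed:
  fixes P :: "ygen falg \<Rightarrow> bool"
  assumes P: "subalg P"
    and X: "\<And>p i. 0 < i \<Longrightarrow> i < N \<Longrightarrow> P (gen (Xy p i 0))" and H: "\<And>i. 0 < i \<Longrightarrow> i < N \<Longrightarrow> P (gen (Hy i 0))"
    and i: "i \<in> {1..m + n - 1}"
  shows "P (vartheta m n i)" "P (varpi_plus m n i)" "P (varpi_minus m n i)"
proof -
  have iN: "0 < i" "i < N" using i m2' by auto
  note add = subalg_add[OF P] and mult = subalg_mult[OF P] and scale = subalg_scale[OF P]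
    and diff = subalg_diff[OF P] and scomm = subalg_scomm[OF P]
  have zero: "P 0" using scale[OF H[OF iN], of 0] by simp
  have sum: "P (sum f S)" if "\<And>k. k \<in> S \<Longrightarrow> P (f k)" for f :: "nat \<Rightarrow> ygen falg" and S
    using that by (induction S rule: infinite_finite_induct) (auto intro: zero add)
  have up: "1 \<le> j \<Longrightarrow> j + 1 + d \<le> N \<Longrightarrow> P (E_up m d j)" for j d
  proof (induction d arbitrary: j)
    case (Suc d)
    have j: "0 < j" "j < N" "1 \<le> j + 1" "j + 1 + 1 + d \<le> N" using Suc.prems by auto
    show ?case
      unfolding E_up.simps
      by (rule scomm[OF X[OF j(1,2)] Suc.IH[OF j(3,4)] hg_gens(1) phi_E_up[OF j(3,4), THEN conjunct2, THEN conjunct1] np_less]) simp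
  qed (auto intro: X)
  have down: "1 \<le> j \<Longrightarrow> j + 1 + d \<le> N \<Longrightarrow> P (E_down m d j)" for j d
  proof (induction d arbitrary: j)
    case (Suc d)
    have j: "0 < j" "j < N" "1 \<le> j + 1" "j + 1 + 1 + d \<le> N" using Suc.prems by auto
    show ?case
      unfolding E_down.simps cscale_eq
      by (rule scomm[OF Suc.IH[OF j(3,4)] scale[OF X[OF j(1,2)]] phi_E_down[OF j(3,4), THEN conjunct2, THEN conjunct1]
            homog_closed(2)[OF hg_gens(1)] _ np_less]) simp
  qed (auto simp: cscale_eq intro!: X scale)
  have unit: "P (E_unit m p q)" if "p \<in> {1..N}" "q \<in> {1..N}" "p \<noteq> q" for p q
    using that up[of p "q - p - 1"] down[of q "p - q - 1"] by (auto simp: E_unit_def)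
  have units: "P (\<Sum>k\<in>S. f k *\<^sub>v (E_unit m a k * E_unit m k b))"
    if "S \<subseteq> {1..N} - {a, b}" "a \<in> {1..N}" "b \<in> {1..N}" for f a b S
    using that by (intro sum scale mult unit) auto
  have ii: "i \<in> {1..N}" "i + 1 \<in> {1..N}" using iN by auto
  have U: "{1..N} - {i} \<subseteq> {1..N} - {i, i}" "{1..N} - {i + 1} \<subseteq> {1..N} - {i + 1, i + 1}"
    "{1..N} - {i, i + 1} \<subseteq> {1..N} - {i, i + 1}" "{1..N} - {i, i + 1} \<subseteq> {1..N} - {i + 1, i}"
    by auto
  note units = units[OF U(1) ii(1,1)] units[OF U(2) ii(2,2)] units[OF U(3) ii] units[OF U(4) ii(2,1)]
  show "P (vartheta m n i)" unfolding vartheta_def cscale_eq by (intro diff add scale units H iN)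
  show "P (varpi_plus m n i)" unfolding varpi_plus_def cscale_eq by (intro diff add scale mult units H X iN)
  show "P (varpi_minus m n i)" unfolding varpi_minus_def cscale_eq by (intro diff add scale mult units H X iN)
qed

lemma J_FA:
  assumes "i \<in> {1..m + n - 1}"
  shows "vartheta m n i \<in> FA YG" "varpi_plus m n i \<in> FA YG" "varpi_minus m n i \<in> FA YG"
    and "J_h m n c i \<in> FA YG" "J_x_plus m n c i \<in> FA YG" "J_x_minus m n c i \<in> FA YG"
proof -
  have i: "i < N" using assms by auto
  show v: "vartheta m n i \<in> FA YG" "varpi_plus m n i \<in> FA YG" "varpi_minus m n i \<in> FA YG"
    by (rule J_closed[of "\<lambda>a. a \<in> FA YG", OF subalg_FA _ _ assms]; simp add: yangian_gen_FA)+
  show "J_h m n c i \<in> FA YG" "J_x_plus m n c i \<in> FA YG" "J_x_minus m n c i \<in> FA YG"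
    unfolding J_h_def J_x_plus_def J_x_minus_def
    by (intro FA_closed(3,7) v H_tilde_FA yangian_gen_FA i; simp)+
qed

lemma rho_values:
  assumes x: "x \<in> carrier M" and v: "v \<in> TV m n l" and i: "i \<in> {1..m + n - 1}"
  shows "rho (cl (gen (Hy i 0))) (tens x v)
      = tens x (s i *\<^sub>c E_tot m l i i v - s (i + 1) *\<^sub>c E_tot m l (i + 1) (i + 1) v)"
    and "rho (cl (gen (Xy Plus i 0))) (tens x v) = tens x (E_tot m l i (i + 1) v)"
    and "rho (cl (gen (Xy Minus i 0))) (tens x v) = s i \<odot>\<^bsub>TT\<^esub> tens x (E_tot m l (i + 1) i v)"
    and "rho (cl (J_h m n c i)) (tens x v) = (\<Oplus>\<^bsub>TT\<^esub>k\<in>{1..l}. tens (ract x (dc (y_elt l t c k)))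
      (s i *\<^sub>c E_at m k i i v - s (i + 1) *\<^sub>c E_at m k (i + 1) (i + 1) v))"
    and "rho (cl (J_x_plus m n c i)) (tens x v)
      = (\<Oplus>\<^bsub>TT\<^esub>k\<in>{1..l}. tens (ract x (dc (y_elt l t c k))) (E_at m k i (i + 1) v))"
    and "rho (cl (J_x_minus m n c i)) (tens x v)
      = s i \<odot>\<^bsub>TT\<^esub> (\<Oplus>\<^bsub>TT\<^esub>k\<in>{1..l}. tens (ract x (dc (y_elt l t c k))) (E_at m k (i + 1) i v))"
proof -
  have iN: "0 < i" "i < N" and ii: "i \<in> {1..m + n}" "i + 1 \<in> {1..m + n}" using i m2' by auto
  note F = rho_formula[OF _ x v] and gFA = yangian_gen_FA[OF iN(2)]
  note ET = E_tot_closed[OF v ii(1)] E_tot_closed[OF v ii(2)]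
  show "rho (cl (gen (Hy i 0))) (tens x v)
      = tens x (s i *\<^sub>c E_tot m l i i v - s (i + 1) *\<^sub>c E_tot m l (i + 1) (i + 1) v)"
    unfolding cscale_eq
    by (rule F[OF gFA(2) tens_closed[OF x]])
      (simp_all add: phi_gen h_def L_simps(3)[OF iN(1)] app_simps E_tau[OF ii(1) v] E_tau[OF ii(2) v] TV_diff TV_scale ET
        tau_diff_right tau_bilinear(4) flip: tau_emb[OF x] del: One_nat_def add_Suc_right)
  show "rho (cl (gen (Xy Plus i 0))) (tens x v) = tens x (E_tot m l i (i + 1) v)"
    by (rule F[OF gFA(1) tens_closed[OF x]])
      (simp_all add: phi_gen e_simps(2,4)[OF iN(1)] E_tau[OF ii(1) v] ET flip: tau_emb[OF x] del: One_nat_def add_Suc_right)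
  show "rho (cl (gen (Xy Minus i 0))) (tens x v) = s i \<odot>\<^bsub>TT\<^esub> tens x (E_tot m l (i + 1) i v)"
    by (rule F[OF gFA(1) T.smult_closed[OF _ tens_closed[OF x]]])
      (simp_all add: phi_gen e_simps(2,4)[OF iN(1)] app_simps emb_scale[OF cmod_T tens_closed[OF x]] E_tau[OF ii(2) v] ET
        flip: tau_emb[OF x] del: One_nat_def add_Suc_right)
  note EA = E_at_closed[OF v _ ii(1)] E_at_closed[OF v _ ii(2)]
  let ?S = "\<lambda>w. \<Oplus>\<^bsub>TT\<^esub>k\<in>{1..l}. tens (ract x (dc (y_elt l t c k))) (w k)"
  have S: "?S w \<in> carrier TT" "emb TT (?S w) = (\<Sum>k\<in>{1..l}. tau (app (RR (y_elt l t c k)) (emb M x)) (w k))"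
    if w: "\<And>k. k \<in> {1..l} \<Longrightarrow> w k \<in> TV m n l" for w
  proof -
    show "?S w \<in> carrier TT" by (rule sum_tens(2)) (erule y_elt_FA, erule w, rule x)
    show "emb TT (?S w) = (\<Sum>k\<in>{1..l}. tau (app (RR (y_elt l t c k)) (emb M x)) (w k))"
      by (rule sum_tens(1)) (erule y_elt_FA, erule w, rule x)
  qed
  show "rho (cl (J_h m n c i)) (tens x v) = (\<Oplus>\<^bsub>TT\<^esub>k\<in>{1..l}. tens (ract x (dc (y_elt l t c k)))
      (s i *\<^sub>c E_at m k i i v - s (i + 1) *\<^sub>c E_at m k (i + 1) (i + 1) v))"
    unfolding cscale_eq
  proof (rule F[OF J_FA(4)[OF i]])
    have w: "s i *\<^sub>v E_at m k i i v - s (i + 1) *\<^sub>v E_at m k (i + 1) (i + 1) v \<in> TV m n l" if "k \<in> {1..l}" for k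
      using that by (intro TV_diff TV_scale EA)
    show "(\<Oplus>\<^bsub>TT\<^esub>k\<in>{1..l}. tens (ract x (dc (y_elt l t c k)))
      (s i *\<^sub>v E_at m k i i v - s (i + 1) *\<^sub>v E_at m k (i + 1) (i + 1) v)) \<in> carrier TT"
      by (rule S(1)) (erule w)
    show "app (phi (J_h m n c i)) (tau (emb M x) v) = emb TT (\<Oplus>\<^bsub>TT\<^esub>k\<in>{1..l}. tens (ract x (dc (y_elt l t c k)))
      (s i *\<^sub>v E_at m k i i v - s (i + 1) *\<^sub>v E_at m k (i + 1) (i + 1) v))"
      unfolding phi_J[OF i] app_simps JJ_tau[OF ii(1,1) v] JJ_tau[OF ii(2,2) v] scaleC_sum_right sum_subtractf[symmetric]
    proof (rule sym, rule trans[OF S(2)], erule w, intro sum.cong refl)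
      fix k assume k: "k \<in> {1..l}"
      show "tau (app (RR (y_elt l t c k)) (emb M x)) (s i *\<^sub>v E_at m k i i v - s (i + 1) *\<^sub>v E_at m k (i + 1) (i + 1) v)
        = s i *\<^sub>v tau (app (RR (y_elt l t c k)) (emb M x)) (E_at m k i i v)
          - s (i + 1) *\<^sub>v tau (app (RR (y_elt l t c k)) (emb M x)) (E_at m k (i + 1) (i + 1) v)"
        by (simp only: tau_diff_right[OF TV_scale[OF EA(1)[OF k]] TV_scale[OF EA(2)[OF k]]] tau_bilinear(4)[OF EA(1)[OF k]]
          tau_bilinear(4)[OF EA(2)[OF k]])
    qed
  qed
  have J: "(\<Oplus>\<^bsub>TT\<^esub>k\<in>{1..l}. tens (ract x (dc (y_elt l t c k))) (E_at m k i (i + 1) v)) \<in> carrier TT"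
    "(\<Oplus>\<^bsub>TT\<^esub>k\<in>{1..l}. tens (ract x (dc (y_elt l t c k))) (E_at m k (i + 1) i v)) \<in> carrier TT"
    by (rule S(1), erule EA)+
  have e: "emb TT (\<Oplus>\<^bsub>TT\<^esub>k\<in>{1..l}. tens (ract x (dc (y_elt l t c k))) (E_at m k i (i + 1) v))
      = app (JJ i (i + 1)) (tau (emb M x) v)"
    "emb TT (\<Oplus>\<^bsub>TT\<^esub>k\<in>{1..l}. tens (ract x (dc (y_elt l t c k))) (E_at m k (i + 1) i v))
      = app (JJ (i + 1) i) (tau (emb M x) v)"
    unfolding JJ_tau[OF ii v] JJ_tau[OF ii(2,1) v] by (rule S(2), erule EA)+
  show "rho (cl (J_x_plus m n c i)) (tens x v)
      = (\<Oplus>\<^bsub>TT\<^esub>k\<in>{1..l}. tens (ract x (dc (y_elt l t c k))) (E_at m k i (i + 1) v))"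
    by (rule F[OF J_FA(5)[OF i] J(1)]) (simp only: e phi_J[OF i])
  have sJ: "s i \<odot>\<^bsub>TT\<^esub> (\<Oplus>\<^bsub>TT\<^esub>k\<in>{1..l}. tens (ract x (dc (y_elt l t c k))) (E_at m k (i + 1) i v)) \<in> carrier TT"
    by (rule T.smult_closed[OF _ J(2)]) simp
  show "rho (cl (J_x_minus m n c i)) (tens x v)
      = s i \<odot>\<^bsub>TT\<^esub> (\<Oplus>\<^bsub>TT\<^esub>k\<in>{1..l}. tens (ract x (dc (y_elt l t c k))) (E_at m k (i + 1) i v))"
    by (rule F[OF J_FA(6)[OF i] sJ]) (simp only: e phi_J[OF i] app_simps emb_scale[OF cmod_T J(2)])
qed

lemma rho_values_0:
  assumes x: "x \<in> carrier M" and v: "v \<in> TV m n l"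
  shows "rho (cl (gen (Xy Plus 0 0))) (tens x v) = (\<Oplus>\<^bsub>TT\<^esub>r\<in>{1..l}. tens (ract x (dc (gen (Xc r)))) (E_at m r (m + n) 1 v))"
    and "rho (cl (gen (Xy Minus 0 0))) (tens x v) = \<ominus>\<^bsub>TT\<^esub> (\<Oplus>\<^bsub>TT\<^esub>r\<in>{1..l}. tens (ract x (dc (x_inv l r))) (E_at m r 1 (m + n) v))"
proof -
  have N: "0 < m + n" using m2' by simp
  note F = rho_formula[OF _ x v] and gFA = yangian_gen_FA[OF N]
  note EA = E_at_closed[OF v _ idx(1)] E_at_closed[OF v _ idx(2)]
  have J: "(\<Oplus>\<^bsub>TT\<^esub>r\<in>{1..l}. tens (ract x (dc (gen (Xc r)))) (E_at m r (m + n) 1 v)) \<in> carrier TT"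
    by (rule sum_tens(2)) (erule gen_X_FA, erule EA, rule x)
  have J': "(\<Oplus>\<^bsub>TT\<^esub>r\<in>{1..l}. tens (ract x (dc (x_inv l r))) (E_at m r 1 (m + n) v)) \<in> carrier TT"
    by (rule sum_tens(2)) (rule x_inv_FA, erule EA, rule x)
  have e: "emb TT (\<Oplus>\<^bsub>TT\<^esub>r\<in>{1..l}. tens (ract x (dc (gen (Xc r)))) (E_at m r (m + n) 1 v))
    = app (X Plus 0) (tau (emb M x) v)"
  proof -
    have X: "X Plus 0 = Op XX (m + n) 1" by (simp add: e_simps(1) Op_pw del: One_nat_def)
    show ?thesis
      unfolding X Op_tau[OF good_closed(5) idx(2) v] XX_def app_EV
      by (rule sum_tens(1)) (erule gen_X_FA, erule EA, rule x)
  qed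
  have e': "emb TT (\<Oplus>\<^bsub>TT\<^esub>r\<in>{1..l}. tens (ract x (dc (x_inv l r))) (E_at m r 1 (m + n) v))
    = - app (X Minus 0) (tau (emb M x) v)"
  proof -
    have X: "X Minus 0 = - Op Xi 1 (m + n)" by (simp add: e_simps(3) Op_pw del: One_nat_def)
    show ?thesis
      unfolding X app_simps minus_minus Op_tau[OF good_closed(6) idx(1) v] Xi_def app_EV
      by (rule sum_tens(1)) (rule x_inv_FA, erule EA, rule x)
  qed
  show "rho (cl (gen (Xy Plus 0 0))) (tens x v)
      = (\<Oplus>\<^bsub>TT\<^esub>r\<in>{1..l}. tens (ract x (dc (gen (Xc r)))) (E_at m r (m + n) 1 v))"
    by (rule F[OF gFA(1) J]) (simp_all only: phi_gen e zero_less_numeral)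
  show "rho (cl (gen (Xy Minus 0 0))) (tens x v)
      = \<ominus>\<^bsub>TT\<^esub> (\<Oplus>\<^bsub>TT\<^esub>r\<in>{1..l}. tens (ract x (dc (x_inv l r))) (E_at m r 1 (m + n) v))"
    by (rule F[OF gFA(1) T.M.a_inv_closed[OF J']])
      (simp_all only: phi_gen e' emb_minus[OF cmod_T J'] minus_minus zero_less_numeral)
qed

lemma tens_scale: "x \<in> carrier M \<Longrightarrow> v \<in> TV m n l \<Longrightarrow> tens (y \<odot>\<^bsub>M\<^esub> x) v = y \<odot>\<^bsub>TT\<^esub> tens x v"
  by (intro emb_inj[OF cmod_T])
    (simp_all add: tens_closed R.smult_closed T.smult_closed emb_scale[OF cmod_T] emb_scale[OF cmod_M] tau_bilinear(2)
      flip: tau_emb)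

text \<open>Scalars are absorbed into the module argument of a pure tensor, so sums of pure tensors
  already exhaust the tensor product.\<close>

lemma T_induct [consumes 1, case_names tens add]:
  assumes "u \<in> carrier TT" and tens: "\<And>x v. x \<in> carrier M \<Longrightarrow> v \<in> TV m n l \<Longrightarrow> Pr (tens x v)"
    and add: "\<And>u w. u \<in> carrier TT \<Longrightarrow> w \<in> carrier TT \<Longrightarrow> Pr u \<Longrightarrow> Pr w \<Longrightarrow> Pr (u \<oplus>\<^bsub>TT\<^esub> w)"
  shows "Pr u"
proof -
  obtain p where p: "u = coset tn p" "p \<in> FS BB" using assms(1) unfolding TT_eq Q.QS_carrier by auto
  let ?S = "\<lambda>K. \<Sum>b\<in>K. Poly_Mapping.lookup p b *\<^sub>v Poly_Mapping.single b 1"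
  have zero: "\<zero>\<^bsub>M\<^esub> \<in> carrier M" by (rule R.M.zero_closed)
  have "tens \<zero>\<^bsub>M\<^esub> 0 = \<zero>\<^bsub>TT\<^esub>"
    by (rule emb_inj[OF cmod_T])
      (simp_all add: tens_closed TV_zero zero emb_zero[OF cmod_T] tau_zero T.M.zero_closed flip: tau_emb[OF zero])
  then have 0: "Pr (coset tn 0)" using tens[OF zero TV_zero] by (simp add: TT_eq Q.QS_zero)
  have "Pr (coset tn (?S K)) \<and> ?S K \<in> FS BB" if "finite K" "K \<subseteq> BB" for K
    using that
  proof (induction K)
    case empty
    then show ?case using 0 by (simp add: FS_closed)
  next
    case (insert b K)
    obtain x v where b: "b = (x, v)" "x \<in> carrier M" "v \<in> TV m n l" using insert.prems by auto
    let ?y = "Poly_Mapping.lookup p b"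
    have IH: "Pr (coset tn (?S K))" "?S K \<in> FS BB" using insert by auto
    have s: "?y *\<^sub>v Poly_Mapping.single b 1 \<in> FS BB" using insert.prems by (auto intro!: FS_closed)
    have 1: "coset tn (?y *\<^sub>v Poly_Mapping.single b 1) = tens (?y \<odot>\<^bsub>M\<^esub> x) v"
      unfolding tens_scale[OF b(2,3)] unfolding tens_eq unfolding TT_eq Q.QS_smult by (simp add: b(1))
    have 2: "coset tn (?S K) \<in> carrier TT" unfolding TT_eq Q.QS_carrier using IH by blast
    have "Pr (coset tn (?y *\<^sub>v Poly_Mapping.single b 1) \<oplus>\<^bsub>TT\<^esub> coset tn (?S K))"
      unfolding 1 using b by (intro add tens tens_closed R.smult_closed IH 2) auto
    then show ?case using insert.hyps s IH(2) by (auto simp: TT_eq Q.QS_add intro: FS_closed)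
  qed
  from this[of "Poly_Mapping.keys p"] show ?thesis
    using p unfolding FS_def poly_mapping_sum_basis[symmetric] by simp
qed

text \<open>The elements on which both actions agree form a subalgebra, and a relation transports
  agreement from its left to its right side. The unprescribed generators follow by subtracting the
  corrections from J and by brackets at node 0.\<close>

lemma action_unique:
  assumes r1: "left_alg_module YA TT r1" and r2: "left_alg_module YA TT r2"
    and ag: "\<And>i a x v. i \<in> {1..m + n - 1} \<Longrightarrow> x \<in> carrier M \<Longrightarrow> v \<in> TV m n l \<Longrightarrow>
      a \<in> {gen (Hy i 0), gen (Xy Plus i 0), gen (Xy Minus i 0), J_h m n c i, J_x_plus m n c i, J_x_minus m n c i,
        gen (Xy Plus 0 0), gen (Xy Minus 0 0)} \<Longrightarrow> r1 (cl a) (tens x v) = r2 (cl a) (tens x v)"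
    and a: "a \<in> FA YG" and u: "u \<in> carrier TT"
  shows "r1 (cl a) u = r2 (cl a) u"
proof -
  interpret r1: left_alg_module YA TT r1 by (rule r1)
  interpret r2: left_alg_module YA TT r2 by (rule r2)
  define Ag where "Ag a \<longleftrightarrow> a \<in> FA YG \<and> (\<forall>u\<in>carrier TT. r1 (cl a) u = r2 (cl a) u)" for a
  have cc: "cl a \<in> carrier YA" if "a \<in> FA YG" for a using that by (simp add: YA_simps)
  have add: "Ag (a + b)" if "Ag a" "Ag b" for a b
    using that by (auto simp: Ag_def FA_closed r1.act_add_left r2.act_add_left cc simp flip: YA_simps(2))
  have scale: "Ag (y *\<^sub>v a)" if "Ag a" for y a
    using that by (auto simp: Ag_def FA_closed r1.act_smult r2.act_smult cc simp flip: YA_simps(4))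
  have mult: "Ag (a * b)" if "Ag a" "Ag b" for a b
    using that by (auto simp: Ag_def FA_closed r1.act_mult r2.act_mult r2.act_closed cc simp flip: YA_simps(3))
  have Ag: "subalg Ag" unfolding subalg_def using add mult scale by blast
  note diff = subalg_diff[OF Ag] and scomm = subalg_scomm[OF Ag]
  have base: "Ag a" if "a \<in> FA YG" "\<And>x v. x \<in> carrier M \<Longrightarrow> v \<in> TV m n l \<Longrightarrow> r1 (cl a) (tens x v) = r2 (cl a) (tens x v)" for a
    unfolding Ag_def
  proof (intro conjI ballI that(1))
    fix u assume "u \<in> carrier TT"
    then show "r1 (cl a) u = r2 (cl a) u"
      by (induction rule: T_induct) (simp_all add: that r1.act_add_right r2.act_add_right cc)
  qed
  have rel: "Ag b" if "(a', b) \<in> yangian_rels m n c beta" "Ag a'" for a' b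
    using that YP.pc_rel[OF that(1)] yangian_rels_FA[OF m2' n2' that(1)] by (simp add: Ag_def cl_eq)
  have N: "0 < m + n" "1 < m + n" and I1: "1 \<in> {1..m + n - 1}" using m2' by auto
  have X0: "Ag (gen (Xy p i 0))" if "i < N" for p i
  proof (cases "i = 0")
    case True
    \<comment> \<open>The agreement hypothesis carries a node i even for the affine generators; node
      1 serves.\<close>
    show ?thesis by (rule base) (use that True I1 ag[OF I1] in \<open>cases p; auto intro: yangian_gen_FA\<close>)+
  next
    case False
    then have i: "i \<in> {1..m + n - 1}" using that by auto
    show ?thesis by (rule base) (use that ag[OF i] in \<open>cases p; auto intro: yangian_gen_FA\<close>)+
  qed
  have H0': "Ag (gen (Hy i 0))" if "0 < i" "i < N" for i
  proof -
    have i: "i \<in> {1..m + n - 1}" using that by auto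
    show ?thesis by (rule base) (use that ag[OF i] in \<open>auto intro: yangian_gen_FA\<close>)
  qed
  have H0: "Ag (gen (Hy i 0))" if "i < N" for i
  proof (cases "i = 0")
    case True
    have "Ag (scomm (ygen_parity m) (gen (Xy Plus 0 0)) (gen (Xy Minus 0 0)))"
      by (rule scomm[OF X0[OF N(1)] X0[OF N(1)] hg_gens(1) hg_gens(1) np_less np_less])
    from rel[OF yangian_rels.XX_00[OF N(1,1)] this] show ?thesis using True by simp
  qed (use that H0' in simp)
  have J: "Ag (vartheta m n i)" "Ag (varpi_plus m n i)" "Ag (varpi_minus m n i)"
    "Ag (J_h m n c i)" "Ag (J_x_plus m n c i)" "Ag (J_x_minus m n c i)" if "i \<in> {1..m + n - 1}" for i
  proof -
    show "Ag (vartheta m n i)" "Ag (varpi_plus m n i)" "Ag (varpi_minus m n i)"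
      by (rule J_closed[of Ag, OF Ag _ _ that]; simp add: X0 H0)+
    show "Ag (J_h m n c i)" "Ag (J_x_plus m n c i)" "Ag (J_x_minus m n c i)"
      by (rule base; use that ag[OF that] in \<open>auto intro: J_FA\<close>)+
  qed
  have Ht: "Ag (H_tilde c i)" if "i \<in> {1..m + n - 1}" for i
  proof -
    have "H_tilde c i = J_h m n c i - c *\<^sub>v vartheta m n i" by (simp add: J_h_def cscale_eq)
    then show ?thesis using diff[OF J(4)[OF that] scale[OF J(1)[OF that]]] by simp
  qed
  have X1': "Ag (gen (Xy p i 1))" if "i \<in> {1..m + n - 1}" for p i
  proof -
    have "gen (Xy Plus i 1) = J_x_plus m n c i - c *\<^sub>v varpi_plus m n i"
      "gen (Xy Minus i 1) = J_x_minus m n c i - c *\<^sub>v varpi_minus m n i"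
      by (simp_all add: J_x_plus_def J_x_minus_def cscale_eq)
    then show ?thesis
      using diff[OF J(5)[OF that] scale[OF J(2)[OF that]]] diff[OF J(6)[OF that] scale[OF J(3)[OF that]]] by (cases p) simp_all
  qed
  have X01: "Ag (gen (Xy p 0 1))" for p
  proof -
    have s: "Ag (scomm (ygen_parity m) (H_tilde c 1) (gen (Xy p 0 0)))"
      by (rule scomm[OF Ht[OF I1] X0[OF N(1)] hg_H_tilde hg_gens(1) _ np_less]) simp
    have g: "generic m n 1 0" using m2' n2' by (auto simp: generic_def)
    from rel[OF yangian_rels.H1X[OF N(2,1) g] s]
    have 1: "Ag ((pm_val p * of_int (cartan m n 1 0)) *\<^sub>v gen (Xy p 0 1))"
      unfolding cscale_eq .
    \<comment> \<open>X_{0,1} is recovered from its multiple because a_{1,0} is invertible; the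
      scalar is its own inverse.\<close>
    have "cartan m n 1 0 = -1" using m2' by (simp add: cartan_def parity_def)
    then have sq: "pm_val p * of_int (cartan m n 1 0) * (pm_val p * of_int (cartan m n 1 0)) = 1" by (cases p) simp_all
    show ?thesis using scale[OF 1, of "pm_val p * of_int (cartan m n 1 0)"]
      unfolding scaleC_scaleC sq scaleC_one .
  qed
  have H1: "Ag (gen (Hy i 1))" if "i < N" for i
  proof (cases "i = 0")
    case True
    have "Ag (scomm (ygen_parity m) (gen (Xy Plus 0 1)) (gen (Xy Minus 0 0)))"
      by (rule scomm[OF X01 X0[OF N(1)] hg_gens(1) hg_gens(1) np_less np_less])
    from rel[OF yangian_rels.XX_10[OF N(1,1)] this] show ?thesis using True by simp
  next
    case False
    then have i: "i \<in> {1..m + n - 1}" using that by auto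
    have "gen (Hy i 1) = H_tilde c i + (c / 2) *\<^sub>v (gen (Hy i 0) * gen (Hy i 0))" by (simp add: H_tilde_def cscale_eq)
    then show ?thesis using add[OF Ht[OF i] scale[OF mult[OF H0[OF that] H0[OF that]]]] by simp
  qed
  have "Ag a" using a
  proof (induction rule: FA_induct)
    case zero
    show ?case using scale[OF H0[OF N(1)], of 0] by simp
  next
    case one
    have "r1 (cl 1) u = u" "r2 (cl 1) u = u" if "u \<in> carrier TT" for u
      using r1.act_one[OF that] r2.act_one[OF that] by (simp_all add: YA_simps)
    then show ?case by (simp add: Ag_def FA_closed)
  next
    case (gen g)
    then consider p i r where "g = Xy p i r" "i < N" "r = 0 \<or> r = 1" | i r where "g = Hy i r" "i < N" "r = 0 \<or> r = 1"
      by (auto simp: yangian_gens_def less_2_cases_iff)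
    then show ?case
    proof cases
      case (1 p i r)
      then show ?thesis using X0 X01 X1'[of i p] by (cases "i = 0") auto
    next
      case (2 i r)
      then show ?thesis using H0 H1 by auto
    qed
  qed (auto intro: add scale mult)
  then show ?thesis using u by (simp add: Ag_def)
qed

lemma rho_PiE: "rho \<in> carrier YA \<rightarrow>\<^sub>E (carrier TT \<rightarrow>\<^sub>E carrier TT)"
  unfolding rho_def by (auto simp: comp_closed[OF cmod_T])

end

theorem theorem5p15:
  fixes m n l :: nat and t c lam beta :: complex
    and M :: "(complex, 'm) module" and ract :: "'m \<Rightarrow> cgen falg set \<Rightarrow> 'm"
  assumes "m \<ge> 2" and "n \<ge> 2" and "m \<noteq> n" and "l \<ge> 1"
    and "c = lam" and "beta + t = (of_nat m - of_nat n) * lam / 2"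
    and "right_alg_module (daha l t c) M ract"
  shows
    "let V = carrier (tensor_power m n l);
         Y = yangian m n lam beta;
         cl = yangian_class m n lam beta;
         T = tensor_space m n l t c M ract;
         tens = tensor m n l t c M ract;
         R = (\<lambda>x b. ract x (daha_class l t c b))
     in \<exists>!\<rho>. \<rho> \<in> carrier Y \<rightarrow>\<^sub>E (carrier T \<rightarrow>\<^sub>E carrier T) \<and>
       left_supermodule Y (yangian_part m n lam beta) T (tensor_part m n l t c M ract) \<rho> \<and>
       (\<forall>x\<in>carrier M. \<forall>v\<in>V.
          (\<forall>i\<in>{1..m + n - 1}.
             \<rho> (cl (gen (Hy i 0))) (tens x v)
               = tens x (psign m i *\<^sub>c E_tot m l i i v - psign m (i + 1) *\<^sub>c E_tot m l (i + 1) (i + 1) v) \<and>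
             \<rho> (cl (gen (Xy Plus i 0))) (tens x v) = tens x (E_tot m l i (i + 1) v) \<and>
             \<rho> (cl (gen (Xy Minus i 0))) (tens x v)
               = psign m i \<odot>\<^bsub>T\<^esub> tens x (E_tot m l (i + 1) i v) \<and>
             \<rho> (cl (J_h m n lam i)) (tens x v)
               = (\<Oplus>\<^bsub>T\<^esub>k\<in>{1..l}. tens (R x (y_elt l t c k))
                   (psign m i *\<^sub>c E_at m k i i v - psign m (i + 1) *\<^sub>c E_at m k (i + 1) (i + 1) v)) \<and>
             \<rho> (cl (J_x_plus m n lam i)) (tens x v)
               = (\<Oplus>\<^bsub>T\<^esub>k\<in>{1..l}. tens (R x (y_elt l t c k)) (E_at m k i (i + 1) v)) \<and>
             \<rho> (cl (J_x_minus m n lam i)) (tens x v)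
               = psign m i \<odot>\<^bsub>T\<^esub>
                   (\<Oplus>\<^bsub>T\<^esub>k\<in>{1..l}. tens (R x (y_elt l t c k)) (E_at m k (i + 1) i v))) \<and>
          \<rho> (cl (gen (Xy Plus 0 0))) (tens x v)
            = (\<Oplus>\<^bsub>T\<^esub>r\<in>{1..l}. tens (R x (gen (Xc r))) (E_at m r (m + n) 1 v)) \<and>
          \<rho> (cl (gen (Xy Minus 0 0))) (tens x v)
            = \<ominus>\<^bsub>T\<^esub> (\<Oplus>\<^bsub>T\<^esub>r\<in>{1..l}. tens (R x (x_inv l r)) (E_at m r 1 (m + n) v)))"
proof -
  have "daha_module l t c M ract" using assms by (simp add: daha_module_def)
  then interpret daha_module l t c M ract .
  interpret drinfeld_affine l t c M ract m n beta
    by unfold_locales (use assms in simp_all)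
  show ?thesis
    unfolding Let_def \<open>c = lam\<close>[symmetric]
  proof (rule ex1I[of _ rho], goal_cases)
    case 1
    show ?case
      by (intro conjI ballI rho_PiE left_supermodule_rho rho_values rho_values_0)
  next
    case (2 \<rho>)
    note PiE = 2[THEN conjunct1] and F = 2[THEN conjunct2, THEN conjunct2]
      and L = left_supermodule.axioms(1)[OF 2[THEN conjunct2, THEN conjunct1]]
    have ag: "\<rho> (cl a) (tens x v) = rho (cl a) (tens x v)"
      if "i \<in> {1..m + n - 1}" "x \<in> carrier M" "v \<in> TV m n l"
        "a \<in> {gen (Hy i 0), gen (Xy Plus i 0), gen (Xy Minus i 0), J_h m n c i, J_x_plus m n c i, J_x_minus m n c i,
        gen (Xy Plus 0 0), gen (Xy Minus 0 0)}" for i a x v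
    proof -
      note G = bspec[OF bspec[OF F that(2)] that(3)]
      note G1 = bspec[OF conjunct1[OF G] that(1)] and G2 = conjunct2[OF G]
      show ?thesis
        using that(4)
        by (elim insertE emptyE) (simp_all only: G1 G2 rho_values[OF that(2,3,1)] rho_values_0[OF that(2,3)])
    qed
    show "\<rho> = rho"
    \<comment> \<open>Both actions are extensional, so comparing them on classes and on vectors of
      the tensor product gives equality as functions.\<close>
    proof (rule PiE_ext[OF PiE rho_PiE])
      fix y assume y: "y \<in> carrier YA"
      then obtain a where a: "a \<in> FA YG" "y = cl a" by (auto simp: YA_simps)
      show "\<rho> y = rho y"
      proof (rule PiE_ext[OF PiE_mem[OF PiE y] PiE_mem[OF rho_PiE y]])
        fix u assume u: "u \<in> carrier TT"
        show "\<rho> y u = rho y u"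
          unfolding a(2) by (rule action_unique[OF L left_alg_module_rho _ a(1) u]) (rule ag)
      qed
    qed
  qed
qed

end
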